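(* Let $R$ be a $GL(m)$-type R-matrix which is a deformation of the flip $P$, and let $\mathcal B_{\rm ad}(\mathcal Q,\mathcal M)$ be the adjoint braided differential algebra: the unital associative algebra generated by the entries of two matrices $Q$ and $M$ subject to $$R_1M_1R_1M_1=M_1R_1M_1R_1,\quad R_1Q_1R_1Q_1=Q_1R_1Q_1R_1,\quad R_1Q_1R_1M_1=M_1R_1Q_1R_1,$$ extended by $a_m(M)^{-1}$ (so that $M$ is invertible), with the action on the unit element $Q\triangleright1=\xi I\,1$, $\xi=\eta^{-1}q^{2m}$, $\eta\in\mathbb K\setminus\{0\}$. Put $\mathsf N=M^{-1}Q$. Then for every $k\ge1$ the elements $\mathrm{Tr}_R(M^k)$ and $\mathrm{Tr}_R(\mathsf N^k)$ are central in the adjoint braided differential algebra. Consequently, for any constants $c_1,\dots,c_m\in\mathbb K$, the quantum orbit $\mathcal M(R)/J_{\{c\}}$ is preserved by the action of $\mathcal Q(R)$, i.e. the ideal $J_{\{c\}}$ of $\mathcal M(R)$ generated by the elements $\mathrm{Tr}_R(M^k)-c_k$, $1\le k\le m$, is invariant under the action of $\mathcal Q(R)$ on $\mathcal M(R)$.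
   Context: $\mathbb K$ is $\mathbb C$ or $\mathbb R$; $V$ is a vector space over $\mathbb K$ of finite dimension $n$ with a fixed basis $x_1,\dots,x_n$; operators are identified with numerical matrices by $R(x_i\otimes x_j)=R_{ij}^{\,rs}x_r\otimes x_s$, and $(AB)_i^{\,j}=\sum_kA_i^{\,k}B_k^{\,j}$. For $X\in\mathrm{End}(V^{\otimes 2})$, $X_i$ denotes $X$ acting in the tensor factors $i,i+1$; for an $n\times n$ matrix $A$ with entries in an algebra, $A_1=A\otimes I\otimes\cdots\otimes I$. The matrices $Q=\|Q_i^{\,j}\|$ and $M=\|M_i^{\,j}\|$ are $n\times n$. R-matrix: an invertible $R\in\mathrm{End}(V^{\otimes 2})$ with $R_1R_2R_1=R_2R_1R_2$. Hecke type: in addition $(R-qI)(R+q^{-1}I)=0$, with $q\in\mathbb K\setminus\{0\}$ generic (either $q=1$ or $q^k\ne1$ for all $k\in\mathbb N$); $k_q=q^{k-1}+q^{k-3}+\dots+q^{1-k}$. The $q$-antisymmetrizers are $A_1(R)=I$, $A_{k+1}(R)=\frac{1}{(k+1)_q}A_k(R)\,(q^kI-k_qR_k)\,A_k(R)\in\mathrm{End}(V^{\otimes(k+1)})$. A Hecke type $R$ is of $GL(m)$-type if $A_m(R)$ is a rank one projector and $A_{m+1}(R)=0$. $R$ is a deformation of the flip $P$, $P(u\otimes v)=v\otimes u$, if $R=R(q)$ is a continuous matrix function of $q$ with $\lim_{q\to1}R(q)=P$ (then $m=n$). A $GL(m)$-type $R$ is skew-invertible: there is $\Psi_R\in\mathrm{End}(V^{\otimes2})$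 with $\mathrm{Tr}_{(2)}R_{12}(\Psi_R)_{23}=P_{13}=\mathrm{Tr}_{(2)}(\Psi_R)_{12}R_{23}$. Put $C=\mathrm{Tr}_{(2)}(\Psi_R)_{12}$. The R-trace of an $n\times n$ matrix $X$ with entries in a vector space is $\mathrm{Tr}_R(X)=\mathrm{Tr}(CX)$. With $M_{\overline1}=M_1$, $M_{\overline{k+1}}=R_kM_{\overline k}R_k^{-1}$, put $a_m(M)=\mathrm{Tr}_{(1\dots m)}\big(C_1\cdots C_m\,M_{\overline 1}M_{\overline2}\cdots M_{\overline m}\,A_m(R)\big)$. By the Cayley-Hamilton identity for $M$, invertibility of $a_m(M)$ guarantees invertibility of $M$. $\mathcal M(R)$ and $\mathcal Q(R)$ are the subalgebras generated by the $M_i^{\,j}$ and by the $Q_i^{\,j}$ respectively (reflection equation algebras). Action of $\mathcal Q(R)$ on $\mathcal M(R)$: let $\chi:\mathcal Q(R)\to\mathbb K$ be the algebra homomorphism with $\chi(Q_i^{\,j})=\xi\delta_i^{\,j}$; for $a\in\mathcal Q(R)$, $b\in\mathcal M(R)$ one uses the third relation to write $ab=\sum_ib_ia_i$ with $b_i\in\mathcal M(R)$, $a_i\in\mathcal Q(R)$, and sets $a\triangleright b=\sum_ib_i\,\chi(a_i)$. *)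

theory Defs
  imports
    "HOL-Analysis.Analysis"
    "HOL-Library.Poly_Mapping"
    "HOL-Library.Function_Algebras"
    "HOL-Algebra.QuotRing"
    "HOL-Algebra.Generated_Rings"
    "HOL-Algebra.Algebraic_Closure_Type"
begin

text \<open>
  The ground field is a type of class \<^class>\<open>real_normed_field\<close>. The norm of such a field is
  multiplicative, so by the Gelfand--Mazur theorem the instances are exactly the real and the
  complex numbers. The index type \<open>'n\<close> labels the fixed basis of \<open>V\<close>, so that
  \<open>dim V = CARD('n)\<close>.

  Matrices act with lower index = row and upper index = column: \<open>A $ (i,j) $ (r,s)\<close> is
  $A_{ij}^{rs}$, and all products of operators are products of these matrices,
  $(AB)_i^j = \sum_k A_i^k B_k^j$.
\<close>

type_synonym ('k, 'n) mat2 = "'k ^ ('n \<times> 'n) ^ ('n \<times> 'n)"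

section \<open>Matrices on tensor powers of \<open>V\<close>\<close>

text \<open>
  A matrix on the \<open>N\<close>-th tensor power has rows and columns labelled by lists of length \<open>N\<close>. It is
  a total function on pairs of lists; all operations below produce functions that vanish on lists
  of a different length. Tensor factors are numbered from 1, list positions from 0.
\<close>

type_synonym ('a, 'n) tmat = "'n list \<Rightarrow> 'n list \<Rightarrow> 'a"

definition tid :: "nat \<Rightarrow> ('a::semiring_1, 'n) tmat" where
  "tid N I J = (if length I = N \<and> I = J then 1 else 0)"

definition tmul :: "nat \<Rightarrow> ('a::semiring_1, 'n::finite) tmat \<Rightarrow> ('a, 'n) tmat \<Rightarrow> ('a, 'n) tmat" where
  "tmul N A B I J = (\<Sum>K | length K = N. A I K * B K J)"

definition tprod :: "nat \<Rightarrow> ('a::semiring_1, 'n::finite) tmat list \<Rightarrow> ('a, 'n) tmat" where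
  "tprod N As = foldr (tmul N) As (tid N)"

definition ttrace :: "nat \<Rightarrow> ('a::semiring_1, 'n::finite) tmat \<Rightarrow> 'a" where
  "ttrace N A = (\<Sum>I | length I = N. A I I)"

text \<open>\<open>on1 N i A\<close> is $A_i$ for an \<open>n \<times> n\<close> matrix and \<open>on2 N i A\<close> is $A_i$ for
  $A \in \mathrm{End}(V^{\otimes 2})$ (acting in the factors \<open>i\<close>, \<open>i + 1\<close>), on the \<open>N\<close>-th tensor
  power.\<close>

definition on1 :: "nat \<Rightarrow> nat \<Rightarrow> ('n \<Rightarrow> 'n \<Rightarrow> 'a::zero) \<Rightarrow> ('a, 'n) tmat" where
  "on1 N i A I J =
     (if length I = N \<and> length J = N \<and> (\<forall>l<N. l \<noteq> i - 1 \<longrightarrow> I ! l = J ! l)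
      then A (I ! (i - 1)) (J ! (i - 1)) else 0)"

definition on2 :: "nat \<Rightarrow> nat \<Rightarrow> ('a::zero, 'n::finite) mat2 \<Rightarrow> ('a, 'n) tmat" where
  "on2 N i A I J =
     (if length I = N \<and> length J = N \<and> (\<forall>l<N. l \<noteq> i - 1 \<and> l \<noteq> i \<longrightarrow> I ! l = J ! l)
      then A $ (I ! (i - 1), I ! i) $ (J ! (i - 1), J ! i) else 0)"

text \<open>The rank is the dimension of the image. The row \<open>A I\<close> is the image of the basis
  vector $x_I$.\<close>

definition trank :: "nat \<Rightarrow> ('k::field, 'n::finite) tmat \<Rightarrow> nat" where
  "trank N A = vector_space.dim (\<lambda>c v. (\<lambda>J. c * v J)) (A ` {I. length I = N})"

section \<open>R-matrices\<close>

definition flip_mat :: "('k::field, 'n::finite) mat2" where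
  "flip_mat = (\<chi> p r. if r = (snd p, fst p) then 1 else 0)"

definition generic :: "'k::field \<Rightarrow> bool" where
  "generic q \<longleftrightarrow> q \<noteq> 0 \<and> (q = 1 \<or> (\<forall>k\<ge>1. q ^ k \<noteq> 1))"

definition qnum :: "'k::field \<Rightarrow> nat \<Rightarrow> 'k" where
  "qnum q k = (\<Sum>i<k. q powi (int k - 1 - 2 * int i))"

definition R_matrix :: "('k::field, 'n::finite) mat2 \<Rightarrow> bool" where
  "R_matrix R \<longleftrightarrow> invertible R \<and>
     tprod 3 [on2 3 1 R, on2 3 2 R, on2 3 1 R] = tprod 3 [on2 3 2 R, on2 3 1 R, on2 3 2 R]"

definition Hecke_type :: "'k::field \<Rightarrow> ('k, 'n::finite) mat2 \<Rightarrow> bool" where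
  "Hecke_type q R \<longleftrightarrow> generic q \<and> R_matrix R \<and> (R - mat q) ** (R + mat (inverse q)) = 0"

text \<open>\<open>antisym q R N k\<close> is $A_k(R)$ acting in the first \<open>k\<close> factors of the \<open>N\<close>-th tensor power.\<close>

primrec antisym :: "'k::field \<Rightarrow> ('k, 'n::finite) mat2 \<Rightarrow> nat \<Rightarrow> nat \<Rightarrow> ('k, 'n) tmat" where
  "antisym q R N 0 = tid N"
| "antisym q R N (Suc k) =
     (if k = 0 then tid N
      else (\<lambda>I J. 1 / qnum q (k + 1) *
              tprod N [antisym q R N k,
                       (\<lambda>I J. q ^ k * tid N I J - qnum q k * on2 N k R I J),
                       antisym q R N k] I J))"

definition GL_type :: "'k::field \<Rightarrow> nat \<Rightarrow> ('k, 'n::finite) mat2 \<Rightarrow> bool" where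
  "GL_type q m R \<longleftrightarrow> Hecke_type q R \<and> m \<ge> 1 \<and>
     tmul m (antisym q R m m) (antisym q R m m) = antisym q R m m \<and>
     trank m (antisym q R m m) = 1 \<and>
     antisym q R (m + 1) (m + 1) = (\<lambda>I J. 0)"

text \<open>\<open>R\<close> is the value at \<open>q\<close> of a continuous family of \<open>GL(m)\<close>-type R-matrices \<open>F p\<close> that tends
  to the flip for \<open>p \<rightarrow> 1\<close>. The family is defined on some set \<open>D\<close> of admissible parameters that
  accumulates at 1 (it need not consist of all generic values: roots of \<open>q\<close> may occur in the
  matrix entries).\<close>

definition flip_deformation ::
    "'k::real_normed_field \<Rightarrow> nat \<Rightarrow> ('k, 'n::finite) mat2 \<Rightarrow> bool" where
  "flip_deformation q m R \<longleftrightarrow>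
     (\<exists>D F. q \<in> D \<and> F q = R \<and> 1 islimpt D \<and> (\<forall>p\<in>D. GL_type p m (F p)) \<and>
            continuous_on D F \<and> (F \<longlongrightarrow> flip_mat) (at 1 within D))"

text \<open>The trace over the middle factor of the third tensor power; the result acts in the factors
  1 and 3.\<close>

definition trace_mid :: "('k::field, 'n::finite) tmat \<Rightarrow> ('k, 'n) mat2" where
  "trace_mid A = (\<chi> p r. \<Sum>a\<in>UNIV. A [fst p, a, snd p] [fst r, a, snd r])"

definition is_skew_inverse :: "('k::field, 'n::finite) mat2 \<Rightarrow> ('k, 'n) mat2 \<Rightarrow> bool" where
  "is_skew_inverse R Psi \<longleftrightarrow>
     trace_mid (tmul 3 (on2 3 1 R) (on2 3 2 Psi)) = flip_mat \<and>
     trace_mid (tmul 3 (on2 3 1 Psi) (on2 3 2 R)) = flip_mat"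

definition skew_inverse :: "('k::field, 'n::finite) mat2 \<Rightarrow> ('k, 'n) mat2" where
  "skew_inverse R = (THE Psi. is_skew_inverse R Psi)"

definition C_mat :: "('k::field, 'n::finite) mat2 \<Rightarrow> 'n \<Rightarrow> 'n \<Rightarrow> 'k" where
  "C_mat R i j = (\<Sum>a\<in>UNIV. skew_inverse R $ (i, a) $ (j, a))"

section \<open>The free algebra on the generators\<close>

text \<open>Words with concatenation, so that finitely supported functions on words are the free
  algebra.\<close>

datatype 'g wrd = Wrd (letters: "'g list")

instantiation wrd :: (type) monoid_add
begin
definition zero_wrd :: "'a wrd" where "0 = Wrd []"
definition plus_wrd :: "'a wrd \<Rightarrow> 'a wrd \<Rightarrow> 'a wrd" where "u + v = Wrd (letters u @ letters v)"
instance by standard (auto simp: zero_wrd_def plus_wrd_def)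
end

text \<open>\<open>AInv\<close> is the generator that becomes the inverse of $a_m(M)$.\<close>

datatype 'n gen = MGen 'n 'n | QGen 'n 'n | AInv

type_synonym ('k, 'n) falg = "'n gen wrd \<Rightarrow>\<^sub>0 'k"

definition fgen :: "'n gen \<Rightarrow> ('k::field, 'n) falg" where
  "fgen g = Poly_Mapping.single (Wrd [g]) 1"

definition fconst :: "'k::field \<Rightarrow> ('k, 'n) falg" where
  "fconst c = Poly_Mapping.single 0 c"

definition fM :: "'n \<Rightarrow> 'n \<Rightarrow> ('k::field, 'n) falg" where
  "fM i j = fgen (MGen i j)"

definition fQ :: "'n \<Rightarrow> 'n \<Rightarrow> ('k::field, 'n) falg" where
  "fQ i j = fgen (QGen i j)"

definition fnum :: "('k::field, 'n) tmat \<Rightarrow> (('k, 'n) falg, 'n) tmat" where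
  "fnum A = (\<lambda>I J. fconst (A I J))"

text \<open>\<open>M_bar R N k\<close> is $M_{\overline{k+1}}$ on the \<open>N\<close>-th tensor power.\<close>

primrec M_bar :: "('k::field, 'n::finite) mat2 \<Rightarrow> nat \<Rightarrow> nat \<Rightarrow> (('k, 'n) falg, 'n) tmat" where
  "M_bar R N 0 = on1 N 1 fM"
| "M_bar R N (Suc k) =
     tprod N [fnum (on2 N (k + 1) R), M_bar R N k, fnum (on2 N (k + 1) (matrix_inv R))]"

definition a_elem :: "'k::field \<Rightarrow> nat \<Rightarrow> ('k, 'n::finite) mat2 \<Rightarrow> ('k, 'n) falg" where
  "a_elem q m R = ttrace m (tprod m
     (map (\<lambda>i. fnum (on1 m i (C_mat R))) [1..<m+1] @ map (M_bar R m) [0..<m] @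
      [fnum (antisym q R m m)]))"

section \<open>The adjoint braided differential algebra\<close>

definition entry_relations :: "(('k::field, 'n) falg, 'n) tmat \<Rightarrow> (('k, 'n) falg, 'n) tmat
    \<Rightarrow> ('k, 'n) falg set" where
  "entry_relations A B = {A I J - B I J | I J. length I = 2 \<and> length J = 2}"

definition ad_relations :: "'k::field \<Rightarrow> nat \<Rightarrow> ('k, 'n::finite) mat2 \<Rightarrow> ('k, 'n) falg set" where
  "ad_relations q m R =
     (let R1 = fnum (on2 2 1 R); M1 = on1 2 1 fM; Q1 = on1 2 1 fQ; a = a_elem q m R in
      entry_relations (tprod 2 [R1, M1, R1, M1]) (tprod 2 [M1, R1, M1, R1]) \<union>
      entry_relations (tprod 2 [R1, Q1, R1, Q1]) (tprod 2 [Q1, R1, Q1, R1]) \<union>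
      entry_relations (tprod 2 [R1, Q1, R1, M1]) (tprod 2 [M1, R1, Q1, R1]) \<union>
      {a * fgen AInv - 1, fgen AInv * a - 1})"

definition ad_ideal :: "'k::field \<Rightarrow> nat \<Rightarrow> ('k, 'n::finite) mat2 \<Rightarrow> ('k, 'n) falg set" where
  "ad_ideal q m R = genideal ring_of_type_algebra (ad_relations q m R)"

definition ad_alg :: "'k::field \<Rightarrow> nat \<Rightarrow> ('k, 'n::finite) mat2 \<Rightarrow> ('k, 'n) falg set ring" where
  "ad_alg q m R = ring_of_type_algebra Quot (ad_ideal q m R)"

definition ad_class :: "'k::field \<Rightarrow> nat \<Rightarrow> ('k, 'n::finite) mat2 \<Rightarrow> ('k, 'n) falg
    \<Rightarrow> ('k, 'n) falg set" where
  "ad_class q m R x = ad_ideal q m R +>\<^bsub>ring_of_type_algebra\<^esub> x"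

definition ad_const :: "'k::field \<Rightarrow> nat \<Rightarrow> ('k, 'n::finite) mat2 \<Rightarrow> 'k \<Rightarrow> ('k, 'n) falg set" where
  "ad_const q m R c = ad_class q m R (fconst c)"

definition ad_M :: "'k::field \<Rightarrow> nat \<Rightarrow> ('k, 'n::finite) mat2 \<Rightarrow> 'n \<Rightarrow> 'n \<Rightarrow> ('k, 'n) falg set" where
  "ad_M q m R i j = ad_class q m R (fM i j)"

definition ad_Q :: "'k::field \<Rightarrow> nat \<Rightarrow> ('k, 'n::finite) mat2 \<Rightarrow> 'n \<Rightarrow> 'n \<Rightarrow> ('k, 'n) falg set" where
  "ad_Q q m R i j = ad_class q m R (fQ i j)"

definition mat_monoid :: "('a, 'b) ring_scheme \<Rightarrow> ('n::finite \<Rightarrow> 'n \<Rightarrow> 'a) monoid" where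
  "mat_monoid S =
     \<lparr>carrier = {A. \<forall>i j. A i j \<in> carrier S},
      mult = (\<lambda>A B i j. \<Oplus>\<^bsub>S\<^esub>k\<in>UNIV. A i k \<otimes>\<^bsub>S\<^esub> B k j),
      one = (\<lambda>i j. if i = j then \<one>\<^bsub>S\<^esub> else \<zero>\<^bsub>S\<^esub>)\<rparr>"

definition ad_N :: "'k::field \<Rightarrow> nat \<Rightarrow> ('k, 'n::finite) mat2 \<Rightarrow> 'n \<Rightarrow> 'n \<Rightarrow> ('k, 'n) falg set" where
  "ad_N q m R = inv\<^bsub>mat_monoid (ad_alg q m R)\<^esub> (ad_M q m R) \<otimes>\<^bsub>mat_monoid (ad_alg q m R)\<^esub> ad_Q q m R"

text \<open>$\mathrm{Tr}_R(A) = \mathrm{Tr}(CA)$ for a matrix \<open>A\<close> over the algebra.\<close>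

definition R_trace :: "'k::field \<Rightarrow> nat \<Rightarrow> ('k, 'n::finite) mat2
    \<Rightarrow> ('n \<Rightarrow> 'n \<Rightarrow> ('k, 'n) falg set) \<Rightarrow> ('k, 'n) falg set" where
  "R_trace q m R A = (\<Oplus>\<^bsub>ad_alg q m R\<^esub>i\<in>UNIV. \<Oplus>\<^bsub>ad_alg q m R\<^esub>j\<in>UNIV.
     ad_const q m R (C_mat R i j) \<otimes>\<^bsub>ad_alg q m R\<^esub> A j i)"

definition central_in :: "('a, 'b) ring_scheme \<Rightarrow> 'a \<Rightarrow> bool" where
  "central_in S z \<longleftrightarrow> z \<in> carrier S \<and> (\<forall>x\<in>carrier S. z \<otimes>\<^bsub>S\<^esub> x = x \<otimes>\<^bsub>S\<^esub> z)"

section \<open>The action of \<open>Q(R)\<close> on \<open>M(R)\<close> and quantum orbits\<close>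

definition M_alg :: "'k::field \<Rightarrow> nat \<Rightarrow> ('k, 'n::finite) mat2 \<Rightarrow> ('k, 'n) falg set set" where
  "M_alg q m R = generate_ring (ad_alg q m R)
     (range (ad_const q m R) \<union> {ad_M q m R i j | i j. True})"

definition Q_alg :: "'k::field \<Rightarrow> nat \<Rightarrow> ('k, 'n::finite) mat2 \<Rightarrow> ('k, 'n) falg set set" where
  "Q_alg q m R = generate_ring (ad_alg q m R)
     (range (ad_const q m R) \<union> {ad_Q q m R i j | i j. True})"

definition is_chi :: "'k::field \<Rightarrow> nat \<Rightarrow> ('k, 'n::finite) mat2 \<Rightarrow> 'k
    \<Rightarrow> (('k, 'n) falg set \<Rightarrow> 'k) \<Rightarrow> bool" where
  "is_chi q m R \<xi> f \<longleftrightarrow>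
     f \<in> ring_hom (ad_alg q m R\<lparr>carrier := Q_alg q m R\<rparr>) ring_of_type_algebra \<and>
     (\<forall>c. f (ad_const q m R c) = c) \<and>
     (\<forall>i j. f (ad_Q q m R i j) = (if i = j then \<xi> else 0))"

text \<open>The values outside \<open>Q_alg\<close>, on which the choice may depend, are not used.\<close>

definition chi :: "'k::field \<Rightarrow> nat \<Rightarrow> ('k, 'n::finite) mat2 \<Rightarrow> 'k \<Rightarrow> ('k, 'n) falg set \<Rightarrow> 'k" where
  "chi q m R \<xi> = (SOME f. is_chi q m R \<xi> f)"

text \<open>\<open>reorders_to q m R \<xi> a b c\<close>: there is an expression $ab = \sum_i b_i a_i$ with
  $\sum_i b_i \chi(a_i) = c$.\<close>

definition reorders_to :: "'k::field \<Rightarrow> nat \<Rightarrow> ('k, 'n::finite) mat2 \<Rightarrow> 'k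
    \<Rightarrow> ('k, 'n) falg set \<Rightarrow> ('k, 'n) falg set \<Rightarrow> ('k, 'n) falg set \<Rightarrow> bool" where
  "reorders_to q m R \<xi> a b c \<longleftrightarrow>
     (\<exists>(N::nat) bs as.
        (\<forall>i<N. bs i \<in> M_alg q m R \<and> as i \<in> Q_alg q m R) \<and>
        a \<otimes>\<^bsub>ad_alg q m R\<^esub> b = (\<Oplus>\<^bsub>ad_alg q m R\<^esub>i\<in>{..<N}. bs i \<otimes>\<^bsub>ad_alg q m R\<^esub> as i) \<and>
        c = (\<Oplus>\<^bsub>ad_alg q m R\<^esub>i\<in>{..<N}.
               bs i \<otimes>\<^bsub>ad_alg q m R\<^esub> ad_const q m R (chi q m R \<xi> (as i))))"

definition Q_act :: "'k::field \<Rightarrow> nat \<Rightarrow> ('k, 'n::finite) mat2 \<Rightarrow> 'k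
    \<Rightarrow> ('k, 'n) falg set \<Rightarrow> ('k, 'n) falg set \<Rightarrow> ('k, 'n) falg set" where
  "Q_act q m R \<xi> a b = (THE c. reorders_to q m R \<xi> a b c)"

definition orbit_ideal :: "'k::field \<Rightarrow> nat \<Rightarrow> ('k, 'n::finite) mat2 \<Rightarrow> (nat \<Rightarrow> 'k)
    \<Rightarrow> ('k, 'n) falg set set" where
  "orbit_ideal q m R c = genideal (ad_alg q m R\<lparr>carrier := M_alg q m R\<rparr>)
     {R_trace q m R (ad_M q m R [^]\<^bsub>mat_monoid (ad_alg q m R)\<^esub> k) \<ominus>\<^bsub>ad_alg q m R\<^esub> ad_const q m R (c k)
      | k. k \<in> {1..m}}"

end

(* The R-trace is invariant under conjugation by R, by the skew invertibility of R. The relation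
   R1 Y1 R1 Z1 = Z1 R1 Y1 R1 says that R1 Y1 R1 commutes with Z1, hence with the powers of Z1, so the
   partial R-trace shows that the entries of Y commute with Tr_R(Z^k). For N = M^{-1} Q the relations
   of M and Q yield relations of the same shape. The inverse of M exists because the rank one
   antisymmetrizer turns the product of the m braided copies of M into the multiplication by a
   central element, a multiple of a_m(M).

   That the action of Q(R) is well defined means that reordering is unambiguous: the character chi
   extends to the operator that maps b a to b chi(a). It is read off the representation in which M
   acts by left multiplication and Q by operators T that satisfy the same exchange relations and
   fix the unit up to the factor xi. The relations among the T hold because their defect is carried
   through the entries of M and Q and vanishes on the unit. Since the generators Tr_R(M^k) - c_k of
   the orbit ideal are central, the action of Q(R) preserves it. *)
theory Submission
  imports Defs
begin

text \<open>Skew invertibility of R has to be extracted from \<open>GL_type\<close>. Its source is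
  the vanishing of the antisymmetrizer of order m + 1: it expresses the product of two neighbouring
  rank one antisymmetrizers by a braid word, so contracting their vectors over m - 1 legs yields
  invertible matrices, and the skew inverse is assembled from these. The same vanishing fixes the
  trace of C and thereby shows that the constant between a_m(M) and the central element is nonzero.

  The algebra is a set of cosets, whereas operators with noncommuting entries need a ring that is a
  type. The quotient is therefore represented faithfully by endomorphisms of the free algebra, by
  means of a linear projection along the ideal of relations.

  No basis of the algebra is at hand for defining the operators T. They are read off from a larger
  representation, on the algebra together with one copy of it for every entry of Q. Pulling a copy
  back into the algebra plays the role of that entry, and skew invertibility dictates how M and Q
  have to act on the copies for the exchange relation to hold.\<close>

no_notation fps_nth (infixl "$" 75)

section \<open>Additive endomorphisms\<close>

text \<open>All operator identities below are equations in types of class \<open>ring_1\<close> of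
  this form. The class \<open>zero_neq_one\<close> on the underlying group is what makes 0 and 1
  different as endomorphisms.\<close>

typedef (overloaded) 'v endo =
  "{f::'v::{ab_group_add,zero_neq_one} \<Rightarrow> 'v. \<forall>x y. f (x + y) = f x + f y}"
  morphisms app Endo
  by (rule exI[of _ id]) auto

setup_lifting type_definition_endo

lemma endo_eqI: "(\<And>x. app f x = app g x) \<Longrightarrow> f = g"
  by (metis app_inject ext)

lemma app_add: "app f (x + y) = app f x + app f y"
  using app[of f] by auto

lemma app_Endo: "(\<And>x y. f (x + y) = f x + f y) \<Longrightarrow> app (Endo f) = f"
  by (rule Endo_inverse) auto

instantiation endo :: ("{ab_group_add,zero_neq_one}") ring_1
begin
lift_definition zero_endo :: "'a endo" is "\<lambda>_. 0" by simp
lift_definition one_endo :: "'a endo" is "\<lambda>x. x" by simp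
lift_definition plus_endo :: "'a endo \<Rightarrow> 'a endo \<Rightarrow> 'a endo" is "\<lambda>f g x. f x + g x"
  by (simp add: algebra_simps)
lift_definition minus_endo :: "'a endo \<Rightarrow> 'a endo \<Rightarrow> 'a endo" is "\<lambda>f g x. f x - g x"
  by (simp add: algebra_simps)
lift_definition uminus_endo :: "'a endo \<Rightarrow> 'a endo" is "\<lambda>f x. - f x"
  by (simp add: algebra_simps)
lift_definition times_endo :: "'a endo \<Rightarrow> 'a endo \<Rightarrow> 'a endo" is "\<lambda>f g x. f (g x)"
  by simp
instance
proof
  show "(0::'a endo) \<noteq> 1"
    by transfer (metis zero_neq_one)
qed (transfer; auto simp: algebra_simps fun_eq_iff)+
end

lemma app_simps [simp]:
  "app 0 x = 0" "app 1 x = x" "app (f + g) x = app f x + app g x"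
  "app (f - g) x = app f x - app g x" "app (- f) x = - app f x" "app (f * g) x = app f (app g x)"
  by (transfer, simp)+

lemma app_zero [simp]: "app f 0 = 0"
  using app_add[of f 0 0] by simp

lemma app_minus: "app f (- x) = - app f x"
  using app_add[of f x "- x"] by (simp add: eq_neg_iff_add_eq_0 add.commute)

lemma app_diff: "app f (x - y) = app f x - app f y"
  using app_add[of f x "- y"] by (simp add: app_minus)

lemma app_sum: "app f (sum g A) = (\<Sum>i\<in>A. app f (g i))"
  by (induction A rule: infinite_finite_induct) (auto simp: app_add)

lemma app_sum_left: "app (sum g A) x = (\<Sum>i\<in>A. app (g i) x)"
  by (induction A rule: infinite_finite_induct) auto

section \<open>The Hecke algebra in an arbitrary ring\<close>

lemma qnum_Suc:
  fixes q :: "'k::field"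
  assumes "q \<noteq> 0"
  shows "qnum q (Suc k) = q ^ k + inverse q * qnum q k"
proof -
  have "qnum q (Suc k) = (\<Sum>i<Suc k. q powi (int k - 2 * int i))"
    by (simp add: qnum_def)
  also have "\<dots> = q powi int k + (\<Sum>i<k. q powi (int k - 2 * int (Suc i)))"
    by (subst sum.lessThan_Suc_shift) simp
  also have "(\<Sum>i<k. q powi (int k - 2 * int (Suc i))) = inverse q * qnum q k"
    unfolding qnum_def sum_distrib_left
  proof (rule sum.cong[OF refl])
    fix i
    have "int k - 2 * int (Suc i) = -1 + (int k - 1 - 2 * int i)" by simp
    also have "q powi \<dots> = inverse q * q powi (int k - 1 - 2 * int i)"
      using assms by (subst power_int_add) auto
    finally show "q powi (int k - 2 * int (Suc i)) = inverse q * q powi (int k - 1 - 2 * int i)" .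
  qed
  finally show ?thesis by simp
qed

lemma qnum_0 [simp]: "qnum q 0 = 0" and qnum_1 [simp]: "qnum q (Suc 0) = 1"
  by (auto simp: qnum_def)

lemma qnum_closed:
  fixes q :: "'k::field"
  assumes "q \<noteq> 0"
  shows "(q - inverse q) * qnum q k = q ^ k - inverse q ^ k"
proof (induction k)
  case (Suc k)
  have "(q - inverse q) * qnum q (Suc k) = (q - inverse q) * q ^ k + inverse q * (q ^ k - inverse q ^ k)"
    using assms by (simp add: qnum_Suc distrib_left Suc.IH[symmetric] mult_ac)
  then show ?case using assms by (simp add: algebra_simps)
qed simp

lemma qnum_at_1: "qnum (1::'k::field) k = of_nat k"
  by (simp add: qnum_def)

text \<open>For q \<noteq> 1 a zero would force q^(2k) = 1 by \<open>qnum_closed\<close>; at q = 1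
  the value is k, nonzero in characteristic 0.\<close>

lemma qnum_nonzero:
  fixes q :: "'k::field_char_0"
  assumes "generic q" "k \<ge> 1"
  shows "qnum q k \<noteq> 0"
proof (cases "q = 1")
  case True
  then show ?thesis using assms by (simp add: qnum_at_1)
next
  case False
  then have q: "q \<noteq> 0" and gen: "\<And>k. k \<ge> 1 \<Longrightarrow> q ^ k \<noteq> 1"
    using assms by (auto simp: generic_def)
  have "q ^ (2 * k) \<noteq> 1" using gen[of "2 * k"] assms(2) by simp
  then have "q ^ k * q ^ k \<noteq> 1" by (simp add: mult_2 power_add)
  then have "q ^ k \<noteq> inverse q ^ k" using q
    by (metis inverse_eq_divide nonzero_eq_divide_eq power_eq_0_iff power_inverse)
  then have "(q - inverse q) * qnum q k \<noteq> 0"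
    unfolding qnum_closed[OF q] by simp
  then show ?thesis by auto
qed

text \<open>With j = m - k this evaluates the factor by which the partial R-trace takes the
  antisymmetrizer of order k + 1 to that of order k, see \<open>t_nonzero\<close>.\<close>

lemma qnum_split:
  fixes q :: "'k::field"
  assumes "q \<noteq> 0"
  shows "q ^ k * qnum q (k + j) - q ^ (k + j) * qnum q k = qnum q j"
proof (induction k)
  case (Suc k)
  have "q ^ Suc k * qnum q (Suc k + j) - q ^ (Suc k + j) * qnum q (Suc k)
     = q ^ Suc k * (q ^ (k + j) + inverse q * qnum q (k + j)) - q ^ (Suc k + j) * (q ^ k + inverse q * qnum q k)"
    using assms by (simp add: qnum_Suc)
  also have "\<dots> = q ^ k * qnum q (k + j) - q ^ (k + j) * qnum q k"
    using assms by (simp add: field_simps power_add)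
  finally show ?case using Suc.IH by simp
qed simp

section \<open>Antisymmetrizers, coset sums and shift words in a ring\<close>

primrec anti :: "('k::field \<Rightarrow> 'e::ring_1) \<Rightarrow> 'k \<Rightarrow> (nat \<Rightarrow> 'e) \<Rightarrow> nat \<Rightarrow> 'e" where
  "anti sc q r 0 = 1"
| "anti sc q r (Suc k) = (if k = 0 then 1 else sc (1 / qnum q (k + 1)) *
     (anti sc q r k * (sc (q ^ k) - sc (qnum q k) * r (k - 1)) * anti sc q r k))"

text \<open>The signed sum 1 - q^{-1} r_{k-1} + q^{-2} r_{k-1} r_{k-2} - ..., whose last word ends
  in r_0: the minimal representatives of the cosets of S_k in S_{k+1}. Up to a factor it completes
  the antisymmetrizer of order k to that of order k + 1; \<open>jm'\<close> does so from the other
  side.\<close>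

primrec jm :: "('k::field \<Rightarrow> 'e::ring_1) \<Rightarrow> 'k \<Rightarrow> (nat \<Rightarrow> 'e) \<Rightarrow> nat \<Rightarrow> 'e" where
  "jm sc q r 0 = 1"
| "jm sc q r (Suc k) = 1 - sc (inverse q) * (r k * jm sc q r k)"

primrec jm' :: "('k::field \<Rightarrow> 'e::ring_1) \<Rightarrow> 'k \<Rightarrow> (nat \<Rightarrow> 'e) \<Rightarrow> nat \<Rightarrow> 'e" where
  "jm' sc q r 0 = 1"
| "jm' sc q r (Suc k) = 1 - sc (inverse q) * (jm' sc q r k * r k)"

primrec down :: "(nat \<Rightarrow> 'e::monoid_mult) \<Rightarrow> nat \<Rightarrow> 'e" where
  "down r 0 = 1"
| "down r (Suc k) = r k * down r k"

primrec up :: "(nat \<Rightarrow> 'e::monoid_mult) \<Rightarrow> nat \<Rightarrow> 'e" where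
  "up r 0 = 1"
| "up r (Suc k) = up r k * r k"

text \<open>Whatever carries the generators r_i to r'_i carries one antisymmetrizer to the other.
  With a shift word for \<open>c\<close> this moves it by one position, with r' = r it gives
  commutation.\<close>

lemma anti_intertwine:
  assumes "\<And>i. i + 1 < k \<Longrightarrow> c * r i = r' i * c" and "\<And>a. c * sc a = sc a * c"
  shows "c * anti sc q r k = anti sc q r' k * c"
  using assms(1)
proof (induction k)
  case (Suc k)
  show ?case
  proof (cases "k = 0")
    case False
    have IH: "c * anti sc q r k = anti sc q r' k * c"
      by (rule Suc.IH) (use Suc.prems in auto)
    have k: "c * r (k - 1) = r' (k - 1) * c"
      by (rule Suc.prems) (use False in auto)
    have mid: "c * (sc (q ^ k) - sc (qnum q k) * r (k - 1)) = (sc (q ^ k) - sc (qnum q k) * r' (k - 1)) * c"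
      (is "c * ?m = ?m' * c")
      by (simp only: right_diff_distrib left_diff_distrib mult.assoc[symmetric] assms(2))
         (simp only: mult.assoc k)
    define w where "w = 1 / qnum q (k + 1)"
    have "c * (sc w * (anti sc q r k * ?m * anti sc q r k))
        = (c * sc w) * anti sc q r k * ?m * anti sc q r k" by (simp only: mult.assoc)
    also have "\<dots> = sc w * (c * anti sc q r k) * ?m * anti sc q r k"
      unfolding assms(2) by (simp only: mult.assoc)
    also have "\<dots> = sc w * anti sc q r' k * (c * ?m) * anti sc q r k"
      unfolding IH by (simp only: mult.assoc)
    also have "\<dots> = sc w * anti sc q r' k * ?m' * (c * anti sc q r k)"
      unfolding mid by (simp only: mult.assoc)
    also have "\<dots> = sc w * (anti sc q r' k * ?m' * anti sc q r' k) * c"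
      unfolding IH by (simp only: mult.assoc)
    finally show ?thesis using False by (simp only: anti.simps w_def if_False)
  qed simp
qed simp

lemma left_inverse_eq_right_inverse:
  assumes "a * x = (1::'e::monoid_mult)" and "x * b = 1"
  shows "a = b"
proof -
  have "a = a * (x * b)" by (simp add: assms)
  also have "\<dots> = b" by (simp add: mult.assoc[symmetric] assms(1))
  finally show ?thesis .
qed

section \<open>Braid group representations and braided copies\<close>

locale braid_rep =
  fixes r ri :: "nat \<Rightarrow> 'e::ring_1"
  assumes r_ri: "r i * ri i = 1" and ri_r: "ri i * r i = 1"
    and braid: "r i * r (Suc i) * r i = r (Suc i) * r i * r (Suc i)"
    and far: "i + 2 \<le> j \<Longrightarrow> r i * r j = r j * r i"
begin

lemma shifted: "braid_rep (\<lambda>i. r (Suc i)) (\<lambda>i. ri (Suc i))"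
proof
  show "r (Suc i) * r (Suc j) = r (Suc j) * r (Suc i)" if "i + 2 \<le> j" for i j
    by (rule far) (use that in simp)
qed (rule r_ri ri_r braid)+

lemma ri_comm: assumes "r i * z = z * r i" shows "ri i * z = z * ri i"
proof -
  have "ri i * z = ri i * (z * r i) * ri i"
    by (simp add: mult.assoc r_ri)
  also have "\<dots> = ri i * r i * z * ri i" by (simp add: assms[symmetric] mult.assoc)
  finally show ?thesis by (simp add: ri_r)
qed

lemma r_cancel: "r i * (ri i * z) = z" "ri i * (r i * z) = z"
  by (simp_all add: mult.assoc[symmetric] r_ri ri_r)

lemma braid_inv: "ri i * ri (Suc i) * r i = r (Suc i) * ri i * ri (Suc i)"
proof -
  have "ri i * ri (Suc i) * r i = ri i * ri (Suc i) * (r i * r (Suc i) * r i) * ri i * ri (Suc i)"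
    by (simp add: mult.assoc r_ri r_cancel)
  also have "\<dots> = ri i * ri (Suc i) * (r (Suc i) * r i * r (Suc i)) * ri i * ri (Suc i)"
    by (simp only: braid)
  finally show ?thesis by (simp add: mult.assoc r_cancel)
qed

lemma inverse_rep: "braid_rep ri r"
proof
  fix i j
  show "ri i * r i = 1" "r i * ri i = 1" by (simp_all add: r_ri ri_r)
  have "ri i * ri (Suc i) * ri i * (r i * r (Suc i) * r i) = 1"
    by (simp add: mult.assoc r_cancel ri_r)
  moreover have "(r (Suc i) * r i * r (Suc i)) * (ri (Suc i) * ri i * ri (Suc i)) = 1"
    by (simp add: mult.assoc r_cancel r_ri)
  ultimately show "ri i * ri (Suc i) * ri i = ri (Suc i) * ri i * ri (Suc i)"
    unfolding braid by (rule left_inverse_eq_right_inverse)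
  show "ri i * ri j = ri j * ri i" if "i + 2 \<le> j"
    using ri_comm[of i "ri j"] ri_comm[of j "r i"] far[OF that] by simp
qed

text \<open>The word r_0 ... r_{k-1} carries one strand across k others, so conjugation by it raises
  the index of a generator.\<close>

lemma up_shift: "i + 1 < k \<Longrightarrow> up r k * r i = r (Suc i) * up r k"
proof (induction k)
  case (Suc k)
  show ?case
  proof (cases "i + 1 < k")
    case True
    have "up r (Suc k) * r i = up r k * r i * r k"
      using far[of i k] True by (simp add: mult.assoc)
    then show ?thesis using Suc.IH True by (simp add: mult.assoc)
  next
    case False
    then have k: "k = Suc i" using Suc.prems by simp
    have comm: "z * r (Suc i) = r (Suc i) * z" if "z = up r i" for z
    proof -
      have "up r j * r (Suc i) = r (Suc i) * up r j" if "j \<le> i" for j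
        using that
      proof (induction j)
        case (Suc j)
        then show ?case using far[of j "Suc i"]
          by (simp add: mult.assoc) (metis mult.assoc Suc_leD)
      qed simp
      then show ?thesis using that by simp
    qed
    have "up r (Suc k) * r i = up r i * (r i * r (Suc i) * r i)"
      by (simp add: k mult.assoc)
    also have "\<dots> = r (Suc i) * up r i * (r i * r (Suc i))"
      by (simp add: braid mult.assoc[symmetric] comm)
    finally show ?thesis by (simp add: k mult.assoc)
  qed
qed simp

lemma up_down_inv: "up r k * down ri k = 1" "down ri k * up r k = 1"
proof (induction k)
  case (Suc k)
  { case 1
    have "up r (Suc k) * down ri (Suc k) = up r k * down ri k" by (simp add: mult.assoc r_cancel)
    then show ?case using Suc by simp }
  { case 2
    have "down ri (Suc k) * up r (Suc k) = ri k * (down ri k * up r k) * r k" by (simp add: mult.assoc)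
    then show ?case using Suc by (simp add: ri_r) }
qed simp_all

text \<open>\<open>down r k\<close> is the inverse of \<open>up ri k\<close>, so this is
  \<open>up_shift\<close> for the inverse braiding.\<close>

lemma down_shift: assumes "i + 1 < k" shows "down r k * r (Suc i) = r i * down r k"
proof -
  interpret inv: braid_rep ri r by (rule inverse_rep)
  note u = inv.up_down_inv[of k]
  have "up ri k * ri i = ri (Suc i) * up ri k" by (rule inv.up_shift[OF assms])
  then have "r (Suc i) * (up ri k * ri i) * r i = up ri k * r i"
    by (simp add: mult.assoc[symmetric] r_ri)
  then have "r (Suc i) * up ri k = up ri k * r i"
    by (simp add: mult.assoc ri_r)
  then have "down r k * (r (Suc i) * up ri k) * down r k = down r k * (up ri k * r i) * down r k"
    by simp
  then have "down r k * r (Suc i) * (up ri k * down r k) = (down r k * up ri k) * r i * down r k"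
    by (simp only: mult.assoc)
  then show ?thesis using u by simp
qed

text \<open>Braided copies $M_{\overline{k+1}}$ of an element acting in the first tensor factor.\<close>

primrec copy :: "'e \<Rightarrow> nat \<Rightarrow> 'e" where
  "copy x 0 = x"
| "copy x (Suc k) = r k * copy x k * ri k"

primrec copies :: "'e \<Rightarrow> nat \<Rightarrow> 'e" where
  "copies x 0 = 1"
| "copies x (Suc k) = copies x k * copy x k"

context
  fixes x :: 'e
  assumes x_far: "\<And>i. i \<ge> 1 \<Longrightarrow> r i * x = x * r i"
begin

lemma copy_above: "i > k \<Longrightarrow> r i * copy x k = copy x k * r i"
proof (induction k)
  case 0 then show ?case using x_far by simp
next
  case (Suc k)
  have a: "r i * r k = r k * r i" using far[of k i] Suc.prems by simp
  have b: "r i * ri k = ri k * r i" using ri_comm[of k "r i"] a by simp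
  have IH: "r i * copy x k = copy x k * r i" using Suc by simp
  have "r i * (r k * copy x k * ri k) = r k * (r i * copy x k) * ri k"
    by (simp add: a mult.assoc[symmetric])
  also have "\<dots> = r k * copy x k * (r i * ri k)" by (simp add: IH mult.assoc)
  finally show ?case by (simp add: b mult.assoc)
qed

text \<open>The decisive case is k = i + 2: the braid relation turns r_i into r_{i+1}, which passes
  the inner copy by \<open>copy_above\<close>, and \<open>braid_inv\<close> turns it back on the
  right.\<close>

lemma copy_below: "Suc i < k \<Longrightarrow> r i * copy x k = copy x k * r i"
proof (induction k)
  case (Suc k)
  show ?case
  proof (cases "Suc i < k")
    case True
    have a: "r i * r k = r k * r i" using far[of i k] True by simp
    have b: "r i * ri k = ri k * r i" using ri_comm[of k "r i"] a by simp
    have IH: "r i * copy x k = copy x k * r i" using Suc True by simp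
    have "r i * (r k * copy x k * ri k) = r k * (r i * copy x k) * ri k"
      by (simp add: a mult.assoc[symmetric])
    also have "\<dots> = r k * copy x k * (r i * ri k)" by (simp add: IH mult.assoc)
    finally show ?thesis by (simp add: b mult.assoc)
  next
    case False
    then have k: "k = Suc i" using Suc.prems by simp
    have c: "r (Suc i) * copy x i = copy x i * r (Suc i)" by (rule copy_above) simp
    have "r i * copy x (Suc k) = (r i * r (Suc i) * r i) * copy x i * ri i * ri (Suc i)"
      by (simp add: k mult.assoc)
    also have "\<dots> = r (Suc i) * r i * (r (Suc i) * copy x i) * ri i * ri (Suc i)"
      unfolding braid by (simp add: mult.assoc)
    also have "\<dots> = r (Suc i) * r i * copy x i * (r (Suc i) * ri i * ri (Suc i))"
      unfolding c by (simp add: mult.assoc)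
    also have "\<dots> = copy x (Suc k) * r i"
      unfolding braid_inv[symmetric] by (simp add: k mult.assoc)
    finally show ?thesis .
  qed
qed simp

text \<open>Among the letters of \<open>up r k\<close> only r_j acts: it turns copy j into copy j +
  1. The later letters commute with the former, the earlier ones with the latter.\<close>

lemma up_copy: "j < k \<Longrightarrow> up r k * copy x j = copy x (Suc j) * up r k"
proof (induction k)
  case (Suc k)
  show ?case
  proof (cases "j < k")
    case True
    have "up r (Suc k) * copy x j = up r k * copy x j * r k"
      using copy_above[of j k] True by (simp add: mult.assoc)
    then show ?thesis using Suc.IH True by (simp add: mult.assoc)
  next
    case False
    then have [simp]: "j = k" using Suc.prems by simp
    have "up r i * copy x (Suc k) = copy x (Suc k) * up r i" if "i \<le> k" for i
      using that
    proof (induction i)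
      case (Suc i)
      have "up r (Suc i) * copy x (Suc k) = up r i * copy x (Suc k) * r i"
        unfolding up.simps mult.assoc using copy_below[of i "Suc k"] Suc.prems by (simp only: Suc_le_eq Suc_less_eq)
      also have "up r i * copy x (Suc k) = copy x (Suc k) * up r i" using Suc by simp
      finally have "up r (Suc i) * copy x (Suc k) = copy x (Suc k) * (up r i * r i)"
        by (simp only: mult.assoc)
      then show ?case by simp
    qed simp
    from this[of k] have a: "up r k * copy x (Suc k) = copy x (Suc k) * up r k" by blast
    have "up r (Suc k) * copy x k = up r k * copy x (Suc k) * r k"
      by (simp add: mult.assoc ri_r)
    then show ?thesis unfolding a by (simp add: mult.assoc)
  qed
qed simp

context
  assumes refl: "r 0 * x * r 0 * x = x * r 0 * x * r 0"
begin

text \<open>Conjugation by r_k r_{k+1} takes r_k to r_{k+1} and copy k to copy k + 1, so the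
  reflection equation is transported from one copy to the next.\<close>

lemma copy_refl: "r k * copy x k * r k * copy x k = copy x k * r k * copy x k * r k"
proof (induction k)
  case 0 show ?case using refl by simp
next
  case (Suc k)
  define w wi where "w = r k * r (Suc k)" and "wi = ri (Suc k) * ri k"
  have wi: "wi * w = 1" by (simp add: w_def wi_def mult.assoc r_cancel ri_r)
  have wr: "w * r k = r (Suc k) * w" by (simp add: w_def braid mult.assoc[symmetric])
  have wx: "w * copy x k = copy x (Suc k) * w"
    using copy_above[of k "Suc k"]
    by (simp add: w_def mult.assoc[symmetric]) (simp add: mult.assoc r_cancel)
  have wr': "w * (r k * z) = r (Suc k) * (w * z)" and wx': "w * (copy x k * z) = copy x (Suc k) * (w * z)" for z
    by (simp_all only: mult.assoc[symmetric] wr wx)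
  have L: "w * (r k * copy x k * r k * copy x k) = (r (Suc k) * copy x (Suc k) * r (Suc k) * copy x (Suc k)) * w"
    by (simp only: mult.assoc wr' wx' wr wx)
  have R: "w * (copy x k * r k * copy x k * r k) = (copy x (Suc k) * r (Suc k) * copy x (Suc k) * r (Suc k)) * w"
    by (simp only: mult.assoc wr' wx' wr wx)
  have ww: "w * wi = 1" by (simp add: w_def wi_def mult.assoc r_cancel r_ri)
  have cancel: "a = b" if "a * w = b * w" for a b
    using arg_cong[OF that, of "\<lambda>z. z * wi"] by (simp add: mult.assoc ww)
  show ?case by (rule cancel) (use L R Suc.IH in simp)
qed

text \<open>Only the adjacent factors with indices i and i + 1 interact with r_i, and for them the
  claim is the reflection equation of copy i.\<close>

lemma copies_commute: "Suc i < k \<Longrightarrow> r i * copies x k = copies x k * r i"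
proof (induction k)
  case (Suc k)
  show ?case
  proof (cases "Suc i < k")
    case True
    then have "r i * copies x (Suc k) = copies x k * (r i * copy x k)"
      using Suc by (simp add: mult.assoc[symmetric])
    also have "\<dots> = copies x (Suc k) * r i" using copy_below[OF True] by (simp add: mult.assoc)
    finally show ?thesis .
  next
    case False
    then have k: "k = Suc i" using Suc.prems by simp
    have "r i * copies x j = copies x j * r i" if "j \<le> i" for j
      using that
    proof (induction j)
      case (Suc j)
      then have "r i * copies x (Suc j) = copies x j * (r i * copy x j)"
        by (simp add: mult.assoc[symmetric])
      also have "\<dots> = copies x (Suc j) * r i" using copy_above[of j i] Suc.prems by (simp add: mult.assoc)
      finally show ?case .
    qed simp
    then have a: "r i * copies x i = copies x i * r i" by simp
    have "r i * copies x (Suc k) = copies x i * (r i * copy x i * r i * copy x i * ri i)"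
      by (simp add: k mult.assoc[symmetric] a)
    also have "r i * copy x i * r i * copy x i * ri i = copy x i * r i * copy x i"
      by (simp add: copy_refl) (simp add: mult.assoc r_ri)
    also have "copies x i * \<dots> = copies x (Suc k) * r i"
      by (simp add: k mult.assoc ri_r)
    finally show ?thesis .
  qed
qed simp

end
end

end

section \<open>Moving an element through the braided copies\<close>

context braid_rep
begin

context
  fixes x y :: 'e and m :: nat
  assumes x_far: "\<And>i. i \<ge> 1 \<Longrightarrow> r i * x = x * r i"
    and y_far: "\<And>i. i \<ge> 1 \<Longrightarrow> r i * y = y * r i"
    and xy: "y * r 0 * x * ri 0 = ri 0 * x * r 0 * y"
begin

text \<open>By \<open>up_copy\<close>, copy k + 1 is copy k conjugated by \<open>up r m\<close>.
  Passing \<open>y\<close> replaces this shift by the one with the inverse braiding,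
  \<open>up ri m\<close>, whose inverse is \<open>down r m\<close>. For k = 0 the letters beyond r_0
  cancel around \<open>x\<close>, and \<open>xy\<close> remains.\<close>

lemma exchange_copy:
  "k < m \<Longrightarrow> y * copy x (Suc k) = up ri m * copy x k * down r m * y"
proof (induction k)
  case 0
  interpret inv: braid_rep ri r by (rule inverse_rep)
  have "up ri (Suc j) * x * down r (Suc j) = ri 0 * x * r 0" for j
  proof (induction j)
    case (Suc j)
    have "ri (Suc j) * x * r (Suc j) = x"
      using x_far[of "Suc j"] by (simp add: mult.assoc[symmetric] ri_comm) (simp add: mult.assoc ri_r)
    then have "up ri (Suc (Suc j)) * x * down r (Suc (Suc j)) = up ri (Suc j) * x * down r (Suc j)"
      unfolding up.simps(2)[of _ "Suc j"] down.simps(2)[of _ "Suc j"] by (metis mult.assoc)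
    then show ?case using Suc by simp
  qed simp
  from this[of "m - 1"] show ?case using 0 xy by (simp add: mult.assoc)
next
  case (Suc k)
  interpret inv: braid_rep ri r by (rule inverse_rep)
  have yi: "y * ri (Suc k) = ri (Suc k) * y" using ri_comm[OF y_far[of "Suc k"]] by simp
  have u: "up ri m * r k = r (Suc k) * up ri m"
  proof -
    have "up ri m * ri k = ri (Suc k) * up ri m" using inv.up_shift Suc.prems by simp
    then have "r (Suc k) * (up ri m * ri k) * r k = r (Suc k) * (ri (Suc k) * up ri m) * r k" by simp
    then show ?thesis by (simp add: mult.assoc ri_r r_cancel)
  qed
  have d: "ri k * down r m = down r m * ri (Suc k)"
  proof -
    have "ri k * (down r m * r (Suc k)) * ri (Suc k) = ri k * (r k * down r m) * ri (Suc k)"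
      using down_shift[of k m] Suc.prems by simp
    then show ?thesis by (simp add: mult.assoc r_ri r_cancel)
  qed
  have u': "r (Suc k) * (up ri m * z) = up ri m * (r k * z)"
    and d': "ri k * (down r m * z) = down r m * (ri (Suc k) * z)" for z
    by (simp_all only: mult.assoc[symmetric] u d)
  have "y * copy x (Suc (Suc k)) = r (Suc k) * (y * copy x (Suc k)) * ri (Suc k)"
    using y_far[of "Suc k"] by (simp only: copy.simps(2)[of _ "Suc k"] mult.assoc[symmetric])
  also have "\<dots> = r (Suc k) * up ri m * copy x k * down r m * (y * ri (Suc k))"
    using Suc by (simp add: mult.assoc)
  also have "\<dots> = up ri m * (r k * copy x k * ri k) * down r m * y"
    unfolding yi by (simp only: mult.assoc u' d')
  finally show ?case by simp
qed

text \<open>The conjugations of consecutive copies telescope because \<open>down r m\<close> and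
  \<open>up ri m\<close> are inverse to each other.\<close>

lemma exchange_copies:
  "k \<le> m \<Longrightarrow> y * (up r m * copies x k) = up ri m * copies x k * down r m * y * up r m"
proof (induction k)
  case 0
  interpret inv: braid_rep ri r by (rule inverse_rep)
  show ?case by (simp add: inv.up_down_inv)
next
  case (Suc k)
  interpret inv: braid_rep ri r by (rule inverse_rep)
  have "y * (up r m * copies x (Suc k)) = y * (up r m * copies x k) * copy x k" by (simp add: mult.assoc)
  also have "\<dots> = up ri m * copies x k * down r m * y * (up r m * copy x k)"
    using Suc by (simp add: mult.assoc)
  also have "up r m * copy x k = copy x (Suc k) * up r m"
    by (rule up_copy[OF x_far]) (use Suc.prems in auto)
  also have "up ri m * copies x k * down r m * y * (copy x (Suc k) * up r m)
     = up ri m * copies x k * down r m * (y * copy x (Suc k)) * up r m" by (simp add: mult.assoc)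
  also have "y * copy x (Suc k) = up ri m * copy x k * down r m * y"
    by (rule exchange_copy) (use Suc.prems in auto)
  also have "up ri m * copies x k * down r m * (up ri m * copy x k * down r m * y) * up r m
    = up ri m * copies x k * (down r m * up ri m) * copy x k * down r m * y * up r m" by (simp add: mult.assoc)
  finally show ?case by (simp add: inv.up_down_inv mult.assoc)
qed

text \<open>If $x_1 x_2 \cdots x_m A = D A$ with \<open>D\<close> commuting with the braid group, then moving \<open>y\<close>
  through the shifted copies of this identity shows that \<open>D\<close> commutes with \<open>y\<close> next to \<open>A'\<close>.\<close>

lemma exchange_det:
  assumes D: "copies x m * A = D * A" and Dr: "\<And>i. D * r i = r i * D"
    and A1: "up r m * A = A' * up r m" and A2: "up ri m * A = A' * up ri m"
    and yA: "y * A' = A' * y"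
  shows "y * D * A' = D * y * A'"
proof -
  interpret inv: braid_rep ri r by (rule inverse_rep)
  have Dri: "D * ri i = ri i * D" for i using ri_comm[of i D] Dr by simp
  have Dup: "up r k * D = D * up r k" for k
    by (induction k) (simp_all add: mult.assoc Dr[symmetric], simp add: mult.assoc[symmetric])
  have Dupi: "up ri k * D = D * up ri k" for k
    by (induction k) (simp_all add: mult.assoc Dri[symmetric], simp add: mult.assoc[symmetric])
  have A': "A' = up r m * A * down ri m"
    unfolding A1 by (simp add: mult.assoc up_down_inv)
  have A'2: "A' = up ri m * A * down r m"
    unfolding A2 by (simp add: mult.assoc inv.up_down_inv)
  have dA': "down r m * A' = A * down r m"
  proof -
    have "down r m * A' = down r m * up ri m * A * down r m" by (subst A'2) (simp add: mult.assoc)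
    then show ?thesis by (simp add: inv.up_down_inv)
  qed
  have "y * D * A' = y * D * up r m * A * down ri m"
    by (subst A') (simp only: mult.assoc)
  also have "\<dots> = y * (up r m * D) * A * down ri m"
    unfolding Dup by (simp only: mult.assoc)
  also have "\<dots> = y * up r m * (D * A) * down ri m" by (simp only: mult.assoc)
  also have "\<dots> = y * (up r m * copies x m) * A * down ri m"
    unfolding D[symmetric] by (simp only: mult.assoc)
  also have "\<dots> = up ri m * copies x m * down r m * y * (up r m * A * down ri m)"
    unfolding exchange_copies[OF order_refl] by (simp only: mult.assoc)
  also have "\<dots> = up ri m * copies x m * down r m * (y * A')"
    unfolding A'[symmetric] by (simp only: mult.assoc)
  also have "\<dots> = up ri m * copies x m * (down r m * A') * y"
    unfolding yA by (simp only: mult.assoc)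
  also have "\<dots> = up ri m * (copies x m * A) * down r m * y"
    unfolding dA' by (simp only: mult.assoc)
  also have "\<dots> = (up ri m * D) * A * down r m * y"
    unfolding D by (simp only: mult.assoc)
  also have "\<dots> = D * (up ri m * A * down r m) * y"
    unfolding Dupi by (simp only: mult.assoc)
  also have "\<dots> = D * (A' * y)"
    unfolding A'2[symmetric] by (simp only: mult.assoc)
  finally show ?thesis unfolding yA[symmetric] by (simp only: mult.assoc)
qed

end
end

text \<open>The scalars enter through a homomorphism \<open>sc\<close> that has to commute with the
  r_i only: in a ring of operators with noncommuting entries the scalars are not central.\<close>

locale hecke_rep = braid_rep r ri
  for r ri :: "nat \<Rightarrow> 'e::ring_1" +
  fixes q :: "'k::field_char_0" and sc :: "'k \<Rightarrow> 'e"
  assumes gen: "generic q"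
    and sc_add: "sc (a + b) = sc a + sc b" and sc_mult: "sc (a * b) = sc a * sc b" and sc_1: "sc 1 = 1"
    and sc_r: "r i * sc a = sc a * r i"
    and hecke: "r i * r i = 1 + sc (q - inverse q) * r i"
begin

lemma q_nz: "q \<noteq> 0" using gen by (simp add: generic_def)

lemma sc_0: "sc 0 = 0" using sc_add[of 0 0] by simp
lemma sc_minus: "sc (- a) = - sc a" using sc_add[of a "- a"] by (simp add: sc_0 eq_neg_iff_add_eq_0 add.commute)
lemma sc_diff: "sc (a - b) = sc a - sc b" using sc_add[of a "- b"] by (simp add: sc_minus)
lemma sc_sc: "sc a * sc b = sc b * sc a" by (simp add: sc_mult[symmetric] mult.commute)
lemma sc_merge: "sc a * (sc b * z) = sc (a * b) * z" by (simp add: sc_mult mult.assoc)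
lemma sc_cancel: assumes "a \<noteq> 0" "sc a * y = sc a * z" shows "y = z"
proof -
  have "sc (1 / a) * (sc a * y) = sc (1 / a) * (sc a * z)" by (simp only: assms(2))
  then show ?thesis using assms(1) by (simp add: sc_merge sc_1)
qed
lemma sc_rl: "r i * (sc a * z) = sc a * (r i * z)" by (simp add: mult.assoc[symmetric] sc_r)

lemma shifted_hecke: "hecke_rep (\<lambda>i. r (Suc i)) (\<lambda>i. ri (Suc i)) q sc"
proof -
  interpret s: braid_rep "\<lambda>i. r (Suc i)" "\<lambda>i. ri (Suc i)" by (rule shifted)
  show ?thesis
    by unfold_locales (auto simp: gen sc_add sc_mult sc_1 sc_r hecke)
qed

abbreviation A where "A \<equiv> anti sc q r"
abbreviation J where "J \<equiv> jm sc q r"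
abbreviation J' where "J' \<equiv> jm' sc q r"

lemma A_comm: "(\<And>i. i + 1 < k \<Longrightarrow> z * r i = r i * z) \<Longrightarrow> (\<And>a. z * sc a = sc a * z) \<Longrightarrow> z * A k = A k * z"
  by (rule anti_intertwine)

lemma sc_A: "A k * sc a = sc a * A k"
  using A_comm[of k "sc a"] by (simp add: sc_r sc_sc)

lemma r_A_comm: "k \<le> i \<Longrightarrow> r i * A k = A k * r i"
  by (rule A_comm) (auto simp: sc_r intro!: far[symmetric])

lemma sc_Al: "A k * (sc a * z) = sc a * (A k * z)"
  by (simp add: mult.assoc[symmetric] sc_A)

lemma J_comm: "(\<And>i. i < k \<Longrightarrow> z * r i = r i * z) \<Longrightarrow> (\<And>a. z * sc a = sc a * z) \<Longrightarrow> z * J k = J k * z"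
proof (induction k)
  case (Suc k)
  have "z * (sc (inverse q) * (r k * J k)) = sc (inverse q) * ((z * r k) * J k)"
    unfolding mult.assoc[symmetric] Suc.prems(2) ..
  also have "\<dots> = sc (inverse q) * (r k * (z * J k))"
    using Suc.prems(1)[of k] by (simp add: mult.assoc)
  finally show ?case using Suc by (simp add: algebra_simps)
qed simp

lemma J'_comm: "(\<And>i. i < k \<Longrightarrow> z * r i = r i * z) \<Longrightarrow> (\<And>a. z * sc a = sc a * z) \<Longrightarrow> z * J' k = J' k * z"
proof (induction k)
  case (Suc k)
  have "z * (sc (inverse q) * (J' k * r k)) = sc (inverse q) * ((z * J' k) * r k)"
    unfolding mult.assoc[symmetric] Suc.prems(2) ..
  also have "\<dots> = sc (inverse q) * (J' k * (z * r k))"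
    using Suc by (simp add: mult.assoc)
  finally show ?case using Suc by (simp add: algebra_simps)
qed simp

text \<open>The normalization in A_k J_k = w_k A_{k+1}. It equals 1 + q^{-2} + ... + q^{-2k}, see
  \<open>al_qnum\<close>.\<close>

abbreviation w :: "nat \<Rightarrow> 'k" where "w k \<equiv> inverse q ^ k * qnum q (Suc k)"

lemma w_nz: "w k \<noteq> 0" using qnum_nonzero[OF gen, of "Suc k"] q_nz by simp

lemma A_Suc: "k \<ge> 1 \<Longrightarrow> sc (qnum q (Suc k)) * A (Suc k) = A k * (sc (q ^ k) - sc (qnum q k) * r (k - 1)) * A k"
  using qnum_nonzero[OF gen, of "Suc k"] by (simp add: sc_merge sc_1)

text \<open>The properties need each other in the induction: A_{k+1} inherits the absorption of all
  but the last generator from A_k, the absorption of the last one is visible only on A_k J_k and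
  J'_k A_k, and idempotence of A_{k+1} follows from absorption.\<close>

lemma A_structure:
  "A k * A k = A k \<and> A k * A (k - 1) = A k \<and> A (k - 1) * A k = A k \<and>
   (\<forall>i. i + 1 < k \<longrightarrow> A k * r i = sc (- inverse q) * A k \<and> r i * A k = sc (- inverse q) * A k) \<and>
   A k * J k = sc (w k) * A (Suc k) \<and> J' k * A k = sc (w k) * A (Suc k)"
proof (induction k)
  case 0
  show ?case by (simp add: sc_1)
next
  case (Suc k)
  note idem = Suc.IH[THEN conjunct1]
  have idem_l: "A k * (A k * z) = A k * z" for z by (simp add: mult.assoc[symmetric] idem)
  note absR = Suc.IH[THEN conjunct2, THEN conjunct2, THEN conjunct2, THEN conjunct1, rule_format, THEN conjunct1]
  note absL = Suc.IH[THEN conjunct2, THEN conjunct2, THEN conjunct2, THEN conjunct1, rule_format, THEN conjunct2]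
  have AJ: "A k * J k = sc (w k) * A (Suc k)" and JA: "J' k * A k = sc (w k) * A (Suc k)"
    using Suc.IH by auto
  have A1: "A (Suc k) * A k = A (Suc k)" and A2: "A k * A (Suc k) = A (Suc k)"
    using idem idem_l by (cases "k = 0"; simp add: mult.assoc sc_Al)+
  have RJ: "r k * J j = J j * r k" if "Suc j \<le> k" for j
    by (rule J_comm) (use that in \<open>auto simp: sc_r intro!: far[symmetric]\<close>)
  have RJ': "r k * J' j = J' j * r k" if "Suc j \<le> k" for j
    by (rule J'_comm) (use that in \<open>auto simp: sc_r intro!: far[symmetric]\<close>)
  have abs: "A (Suc k) * r i = sc (- inverse q) * A (Suc k) \<and> r i * A (Suc k) = sc (- inverse q) * A (Suc k)"
    if "i + 1 < Suc k" for i
  proof (cases "i + 1 < k")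
    case True
    have "A (Suc k) * r i = A (Suc k) * (A k * r i)" by (simp add: A1 mult.assoc[symmetric] del: anti.simps)
    also have "\<dots> = sc (- inverse q) * (A (Suc k) * A k)"
      unfolding absR[OF True] by (simp only: mult.assoc[symmetric] sc_A)
    finally have 1: "A (Suc k) * r i = sc (- inverse q) * A (Suc k)" unfolding A1 .
    have "r i * A (Suc k) = (r i * A k) * A (Suc k)" by (simp add: A2 mult.assoc del: anti.simps)
    also have "\<dots> = sc (- inverse q) * (A k * A (Suc k))"
      unfolding absL[OF True] by (simp only: mult.assoc)
    finally show ?thesis using 1 unfolding A2 by simp
  next
    case False
    then have k: "k = Suc i" using that by simp
    have hR: "z * r i * r i = z + sc (q - inverse q) * (z * r i)" if "\<And>a. z * sc a = sc a * z" for z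
      by (simp only: mult.assoc hecke) (simp add: distrib_left mult.assoc[symmetric] that)
    have hL: "r i * (r i * z) = z + sc (q - inverse q) * (r i * z)" for z
      by (simp only: mult.assoc[symmetric] hecke) (simp add: distrib_right)
    \<comment> \<open>In J_k the terms beyond 1 - q^{-1} r_i begin with r_i r_j, where j = i - 1.
      Multiplied by r_i they yield r_i r_j r_i = r_j r_i r_j next to A_k, and A_k absorbs r_j. On
      the first two terms the Hecke relation suffices. \<open>J'\<close> is treated by mirror
      images.\<close>
    have main: "A k * J k * r i = sc (- inverse q) * (A k * J k) \<and> r i * (J' k * A k) = sc (- inverse q) * (J' k * A k)"
    proof (cases i)
      case 0
      define p where "p = inverse q"
      have pq: "p * (q - p) = 1 - p * p" using q_nz by (simp add: p_def right_diff_distrib)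
      have "sc p * (r 0 * r 0) = sc p + sc (1 - p * p) * r 0"
        unfolding hecke p_def[symmetric] pq[symmetric] by (simp add: distrib_left sc_merge)
      then have e: "sc p * (r 0 * r 0) = sc p + r 0 - sc (p * p) * r 0"
        by (simp add: sc_diff sc_1 left_diff_distrib)
      have k1: "k = Suc 0" using k 0 by simp
      have AJ1: "A k * J k = 1 - sc p * r 0" "J' k * A k = 1 - sc p * r 0" by (simp_all add: k1 p_def)
      show ?thesis unfolding AJ1 0 p_def[symmetric]
        by (simp add: left_diff_distrib right_diff_distrib mult.assoc sc_rl sc_r e sc_minus sc_merge)
    next
      case (Suc j)
      have Jk: "J k = 1 - sc (inverse q) * r i + sc (inverse q * inverse q) * (r i * r j * J j)"
        by (simp add: k Suc right_diff_distrib sc_rl sc_merge mult.assoc)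
      have J'k: "J' k = 1 - sc (inverse q) * r i + sc (inverse q * inverse q) * (J' j * r j * r i)"
        by (simp add: k Suc left_diff_distrib right_diff_distrib sc_merge mult.assoc)
      have rjk: "j + 1 < k" using k Suc by simp
      have c1: "J j * r i = r i * J j" 
        by (rule J_comm[symmetric]) (use Suc in \<open>auto simp: sc_r intro!: far[symmetric]\<close>)
      have c2: "J' j * r i = r i * J' j" 
        by (rule J'_comm[symmetric]) (use Suc in \<open>auto simp: sc_r intro!: far[symmetric]\<close>)
      have t1: "A k * (r i * r j * J j) * r i = sc (- inverse q) * (A k * (r i * r j * J j))"
      proof -
        have "A k * (r i * r j * J j) * r i = A k * (r i * r j * r i) * J j"
          by (simp add: mult.assoc c1)
        also have "r i * r j * r i = r j * r i * r j" using braid[of j] Suc by simp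
        also have "A k * (r j * r i * r j) * J j = (A k * r j) * (r i * r j) * J j"
          by (simp only: mult.assoc)
        finally show ?thesis unfolding absR[OF rjk] by (simp only: mult.assoc)
      qed
      have t2: "r i * ((J' j * r j * r i) * A k) = sc (- inverse q) * ((J' j * r j * r i) * A k)"
      proof -
        have "r i * ((J' j * r j * r i) * A k) = J' j * (r i * r j * r i) * A k"
          by (simp only: mult.assoc[symmetric] c2)
        also have "r i * r j * r i = r j * r i * r j" using braid[of j] Suc by simp
        also have "J' j * (r j * r i * r j) * A k = J' j * (r j * r i) * (r j * A k)"
          by (simp only: mult.assoc)
        also have "\<dots> = sc (- inverse q) * (J' j * (r j * r i) * A k)"
          unfolding absL[OF rjk]
          using J'_comm[of j "sc (- inverse q)"] 
          by (simp only: mult.assoc sc_rl) (simp only: mult.assoc[symmetric] sc_r sc_sc)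
        finally show ?thesis by (simp only: mult.assoc)
      qed
      define p where "p = inverse q"
      define Xe where "Xe = A k * (r i * r j * J j)"
      define Ye where "Ye = (J' j * r j * r i) * A k"
      have AJk: "A k * J k = A k - sc p * (A k * r i) + sc (p * p) * Xe"
        unfolding Jk Xe_def p_def by (simp only: distrib_left right_diff_distrib mult.assoc[symmetric] sc_A) (simp add: mult.assoc)
      have JAk: "J' k * A k = A k - sc p * (r i * A k) + sc (p * p) * Ye"
        unfolding J'k Ye_def p_def by (simp only: distrib_right left_diff_distrib mult.assoc) simp
      have Xe: "Xe * r i = sc (- p) * Xe" using t1 unfolding Xe_def p_def .
      have Ye: "r i * Ye = sc (- p) * Ye" using t2 unfolding Ye_def p_def .
      have pq: "p * (q - p) = 1 - p * p" using q_nz by (simp add: p_def right_diff_distrib)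
      have "A k * J k * r i = A k * r i - sc p * (A k * r i * r i) + sc (p * p) * (Xe * r i)"
        unfolding AJk by (simp only: distrib_right left_diff_distrib mult.assoc)
      also have "\<dots> = A k * r i - sc p * A k - sc (p * (q - p)) * (A k * r i) - sc (p * p) * (sc p * Xe)"
        unfolding hR[OF sc_A] Xe p_def[symmetric] by (simp add: distrib_left sc_merge sc_minus)
      also have "\<dots> = sc (- p) * (A k * J k)"
        unfolding AJk pq by (simp add: distrib_left right_diff_distrib left_diff_distrib sc_minus sc_diff sc_1 sc_merge mult.assoc)
      finally have 1: "A k * J k * r i = sc (- p) * (A k * J k)" .
      have "r i * (J' k * A k) = r i * A k - sc p * (r i * (r i * A k)) + sc (p * p) * (r i * Ye)"
        unfolding JAk by (simp only: distrib_left right_diff_distrib sc_rl)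
      also have "\<dots> = r i * A k - sc p * A k - sc (p * (q - p)) * (r i * A k) - sc (p * p) * (sc p * Ye)"
        unfolding hL Ye p_def[symmetric] by (simp add: distrib_left sc_merge sc_minus)
      also have "\<dots> = sc (- p) * (J' k * A k)"
        unfolding JAk pq by (simp add: distrib_left right_diff_distrib left_diff_distrib sc_minus sc_diff sc_1 sc_merge mult.assoc)
      finally show ?thesis using 1 unfolding p_def by blast
    qed
    show ?thesis
    proof
      have "sc (w k) * (A (Suc k) * r i) = A k * J k * r i"
        unfolding AJ by (simp only: mult.assoc)
      also have "\<dots> = sc (w k) * (sc (- inverse q) * A (Suc k))"
        unfolding main[THEN conjunct1] unfolding AJ by (simp only: mult.assoc[symmetric] sc_sc)
      finally show "A (Suc k) * r i = sc (- inverse q) * A (Suc k)" by (rule sc_cancel[OF w_nz])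
      have "sc (w k) * (r i * A (Suc k)) = r i * (J' k * A k)"
        unfolding JA by (simp only: sc_rl)
      also have "\<dots> = sc (w k) * (sc (- inverse q) * A (Suc k))"
        unfolding main[THEN conjunct2] unfolding JA by (simp only: mult.assoc[symmetric] sc_sc)
      finally show "r i * A (Suc k) = sc (- inverse q) * A (Suc k)" by (rule sc_cancel[OF w_nz])
    qed
  qed
  have idem': "A (Suc k) * A (Suc k) = A (Suc k)"
  proof (cases "k = 0")
    case False
    have Ark: "A (Suc k) * r (k - 1) = sc (- inverse q) * A (Suc k)" using abs[of "k - 1"] False by simp
    have "sc (qnum q (Suc k)) * (A (Suc k) * A (Suc k)) = A (Suc k) * (sc (qnum q (Suc k)) * A (Suc k))"
      by (simp only: mult.assoc[symmetric] sc_A)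
    also have "\<dots> = (A (Suc k) * A k) * (sc (q ^ k) - sc (qnum q k) * r (k - 1)) * A k"
      using A_Suc[of k] False by (simp only: mult.assoc)
    also have "\<dots> = (sc (q ^ k) * A (Suc k) - sc (qnum q k) * (A (Suc k) * r (k - 1))) * A k"
      unfolding A1 by (simp only: right_diff_distrib mult.assoc[symmetric] sc_A)
    also have "\<dots> = (sc (q ^ k + inverse q * qnum q k) * A (Suc k)) * A k"
      unfolding Ark by (simp only: sc_merge) (simp add: sc_add sc_minus distrib_right mult.commute del: anti.simps)
    also have "\<dots> = sc (qnum q (Suc k)) * A (Suc k)"
      using A1 by (simp only: mult.assoc qnum_Suc[OF q_nz])
    finally show ?thesis using sc_cancel[of "qnum q (Suc k)"] qnum_nonzero[OF gen, of "Suc k"] by simp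
  qed simp
  have wA: "q ^ Suc k - qnum q (Suc k) * z = q ^ Suc k * (1 - inverse q * w k * z)" for z
    using q_nz by (simp add: right_diff_distrib field_simps)
  have As: "sc (qnum q (Suc (Suc k))) * A (Suc (Suc k)) = A (Suc k) * (sc (q ^ Suc k) - sc (qnum q (Suc k)) * r k) * A (Suc k)"
    by (rule A_Suc[of "Suc k", unfolded diff_Suc_1]) simp
  have e1: "inverse q ^ Suc k * q ^ Suc k = 1"
    using q_nz by (simp add: power_mult_distrib[symmetric] del: power_Suc)
  have e2: "inverse q ^ Suc k * qnum q (Suc k) = inverse q * w k" by simp
  \<comment> \<open>The recursion of the antisymmetrizer with the power of q divided out, in the
    shape in which it meets the recursion of J.\<close>
  have step: "A (Suc k) - sc (inverse q * w k) * (A (Suc k) * r k * A (Suc k)) = sc (w (Suc k)) * A (Suc (Suc k))"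
  proof -
    have "sc (w (Suc k)) * A (Suc (Suc k)) = sc (inverse q ^ Suc k) * (sc (qnum q (Suc (Suc k))) * A (Suc (Suc k)))"
      by (simp only: sc_merge)
    also have "\<dots> = sc (inverse q ^ Suc k) * (sc (q ^ Suc k) * A (Suc k) - sc (qnum q (Suc k)) * (A (Suc k) * r k * A (Suc k)))"
      unfolding As
      by (simp only: right_diff_distrib left_diff_distrib mult.assoc[symmetric] sc_A diff_Suc_1)
         (simp only: mult.assoc idem')
    also have "\<dots> = A (Suc k) - sc (inverse q * w k) * (A (Suc k) * r k * A (Suc k))"
      by (simp only: right_diff_distrib sc_merge e1 sc_1 mult_1 e2)
    finally show ?thesis by simp
  qed
  have AJ': "A (Suc k) * J (Suc k) = sc (w (Suc k)) * A (Suc (Suc k))"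
  proof -
    have "A (Suc k) * (r k * J k) = (A (Suc k) * A k) * (r k * J k)" unfolding A1 ..
    also have "\<dots> = A (Suc k) * (A k * r k) * J k" by (simp only: mult.assoc)
    also have "\<dots> = A (Suc k) * r k * (A k * J k)"
      unfolding r_A_comm[OF order_refl, symmetric] by (simp only: mult.assoc)
    also have "\<dots> = sc (w k) * (A (Suc k) * r k * A (Suc k))"
      unfolding AJ by (simp only: mult.assoc sc_rl) (simp only: mult.assoc[symmetric] sc_A)
    finally have "A (Suc k) * J (Suc k) = A (Suc k) - sc (inverse q * w k) * (A (Suc k) * r k * A (Suc k))"
      by (simp only: jm.simps right_diff_distrib mult_1_right mult.assoc[symmetric] sc_A)
         (simp only: mult.assoc sc_merge)
    then show ?thesis using step by simp
  qed
  have JA': "J' (Suc k) * A (Suc k) = sc (w (Suc k)) * A (Suc (Suc k))"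
  proof -
    have "J' k * r k * A (Suc k) = J' k * r k * (A k * A (Suc k))" unfolding A2 ..
    also have "\<dots> = J' k * (A k * r k) * A (Suc k)"
      unfolding r_A_comm[OF order_refl, symmetric] by (simp only: mult.assoc)
    also have "\<dots> = sc (w k) * (A (Suc k) * r k * A (Suc k))"
      by (simp only: mult.assoc[symmetric] JA)
    finally have "J' (Suc k) * A (Suc k) = A (Suc k) - sc (inverse q * w k) * (A (Suc k) * r k * A (Suc k))"
      by (simp only: jm'.simps left_diff_distrib mult_1 mult.assoc sc_merge)
    then show ?thesis using step by simp
  qed
  show ?case using idem' A1 A2 abs AJ' JA' by (simp only: diff_Suc_1) blast
qed

lemma A_idem: "A k * A k = A k" using A_structure by blast
lemma A_r: "i + 1 < k \<Longrightarrow> A k * r i = sc (- inverse q) * A k" using A_structure by blast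
lemma r_A: "i + 1 < k \<Longrightarrow> r i * A k = sc (- inverse q) * A k" using A_structure by blast
lemma A_J: "A k * J k = sc (w k) * A (Suc k)" using A_structure by blast
lemma J'_A: "J' k * A k = sc (w k) * A (Suc k)" using A_structure by blast

definition al :: "nat \<Rightarrow> 'k" where "al k = (\<Sum>j<k. (inverse q * inverse q) ^ j)"

lemma al_Suc: "al (Suc k) = 1 + inverse q * inverse q * al k"
  unfolding al_def by (subst sum.lessThan_Suc_shift) (simp add: sum_distrib_left)

lemma al_qnum: "al (Suc k) = w k"
proof (induction k)
  case (Suc k)
  then show ?case
    using q_nz by (simp add: al_Suc[of "Suc k"] qnum_Suc[OF q_nz, of "Suc k"] field_simps power_mult_distrib)
qed (simp add: al_def)

lemma al_nz: "k \<ge> 1 \<Longrightarrow> al k \<noteq> 0"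
  using al_qnum[of "k - 1"] w_nz[of "k - 1"] by simp

text \<open>Every word of J_k except the longest avoids r_0, so \<open>z\<close> absorbs it and
  contributes q^{-2j}; these powers add up to \<open>al k\<close>. The longest word has r_0 next to
  \<open>z\<close> and survives as \<open>down r k\<close>.\<close>

lemma J_absorb:
  assumes "\<And>i. 1 \<le> i \<Longrightarrow> i < k \<Longrightarrow> r i * z = sc (- inverse q) * z"
  shows "J k * z = sc (al k) * z + sc ((- inverse q) ^ k) * (down r k * z)"
  using assms
proof (induction k)
  case 0
  show ?case by (simp add: al_def sc_1 sc_0)
next
  case (Suc k)
  have IH: "J k * z = sc (al k) * z + sc ((- inverse q) ^ k) * (down r k * z)"
    using Suc by simp
  have rk: "sc (al k) * (r k * z) = sc (al k) * (sc (- inverse q) * z)"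
    using Suc.prems[of k] by (cases "k = 0") (simp_all add: al_def sc_0)
  have "J (Suc k) * z = z - sc (inverse q) * (r k * (J k * z))"
    by (simp add: left_diff_distrib mult.assoc)
  also have "\<dots> = z + sc (inverse q * inverse q * al k) * z + sc ((- inverse q) ^ Suc k) * (r k * (down r k * z))"
    unfolding IH by (simp add: distrib_left right_diff_distrib sc_rl rk sc_merge sc_minus mult_ac)
  finally show ?case by (simp add: al_Suc sc_add sc_1 distrib_right mult.assoc)
qed

lemma J'_absorb:
  assumes "k \<ge> 1" "\<And>i. 1 \<le> i \<Longrightarrow> i < k \<Longrightarrow> z * r i = sc (- inverse q) * z" "\<And>a. z * sc a = sc a * z"
  shows "z * J' k = sc (al k) * z + sc ((- inverse q) ^ k) * (z * up r k)"
  using assms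
proof (induction k rule: dec_induct)
  case base
  show ?case using assms(3)[of "inverse q"] by (simp add: al_def sc_1 right_diff_distrib sc_minus mult.assoc[symmetric])
next
  case (step k)
  have IH: "z * J' k = sc (al k) * z + sc ((- inverse q) ^ k) * (z * up r k)"
    using step by simp
  have rk: "z * r k = sc (- inverse q) * z" using step by simp
  have "z * J' (Suc k) = z - sc (inverse q) * ((z * J' k) * r k)"
    using assms(3)[of "inverse q"] by (simp add: right_diff_distrib mult.assoc[symmetric])
  also have "\<dots> = z + sc (inverse q * inverse q * al k) * z + sc ((- inverse q) ^ Suc k) * (z * up r k * r k)"
    unfolding IH by (simp add: distrib_left distrib_right right_diff_distrib left_diff_distrib mult.assoc rk sc_merge sc_minus
        mult.commute[of "al k"] mult.commute[of "(- inverse q) ^ k"])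
  finally show ?case by (simp add: al_Suc sc_add sc_1 distrib_right mult_ac)
qed

section \<open>Consequences of the vanishing of the antisymmetrizer of order m + 1\<close>

context
  fixes m :: nat
  assumes m: "m \<ge> 1" and top: "A (Suc m) = 0"
begin

abbreviation A' where "A' \<equiv> anti sc q (\<lambda>i. r (Suc i)) m"

lemma A_J_zero: "A m * J m = 0" using A_J[of m] top by simp
lemma J'_A_zero: "J' m * A m = 0" using J'_A[of m] top by simp

lemma down_A': "down r m * A' = A m * down r m"
proof -
  have sd: "down r k * sc a = sc a * down r k" for k a
    by (induction k) (simp_all add: mult.assoc sc_rl)
  show ?thesis by (rule anti_intertwine) (auto simp: down_shift sd)
qed

lemma up_A: "up r m * A m = A' * up r m"
proof -
  have su: "up r k * sc a = sc a * up r k" for k a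
    by (induction k) (simp_all add: mult.assoc sc_r, simp add: mult.assoc[symmetric])
  show ?thesis by (rule anti_intertwine) (auto simp: up_shift su)
qed

text \<open>A_m J_m = 0 applied to A'. It is the source of the invertibility statements below: on
  the image of A', the product A_m A' is a nonzero multiple of an invertible braid word. Both
  factors will have rank one and overlap in m - 1 legs.\<close>

lemma top_overlap: "sc (al m) * (A m * A') = sc (- ((- inverse q) ^ m)) * (down r m * A')"
proof -
  interpret s: hecke_rep "\<lambda>i. r (Suc i)" "\<lambda>i. ri (Suc i)" q sc by (rule shifted_hecke)
  have rA: "r i * A' = sc (- inverse q) * A'" if "1 \<le> i" "i < m" for i
    using s.r_A[of "i - 1" m] that by simp
  note down_A'
  then have D: "A m * (down r m * A') = down r m * A'"
    by (simp add: s.A_idem mult.assoc[symmetric]) (metis A_idem mult.assoc)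
  have "0 = A m * (J m * A')" by (simp add: A_J_zero mult.assoc[symmetric])
  also have "\<dots> = sc (al m) * (A m * A') + sc ((- inverse q) ^ m) * (down r m * A')"
    using D by (simp add: J_absorb[OF rA] distrib_left sc_Al)
  finally show ?thesis by (simp add: sc_minus eq_neg_iff_add_eq_0)
qed

lemma top_overlap': "sc (al m) * (A' * A m) = sc (- ((- inverse q) ^ m)) * (A' * up r m)"
proof -
  interpret s: hecke_rep "\<lambda>i. r (Suc i)" "\<lambda>i. ri (Suc i)" q sc by (rule shifted_hecke)
  have Ar: "A' * r i = sc (- inverse q) * A'" if "1 \<le> i" "i < m" for i
    using s.A_r[of "i - 1" m] that by simp
  note up_A
  then have D: "A' * up r m * A m = A' * up r m"
    by (simp only: mult.assoc) (simp only: mult.assoc[symmetric] s.A_idem)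
  have "0 = A' * J' m * A m" by (simp add: J'_A_zero mult.assoc)
  also have "A' * J' m = sc (al m) * A' + sc ((- inverse q) ^ m) * (A' * up r m)"
    by (rule J'_absorb[OF m Ar s.sc_A])
  also have "\<dots> * A m = sc (al m) * (A' * A m) + sc ((- inverse q) ^ m) * (A' * up r m * A m)"
    by (simp only: distrib_right mult.assoc)
  finally show ?thesis unfolding D by (simp add: sc_minus eq_neg_iff_add_eq_0)
qed

end

end

section \<open>Matrices acting on infinite tensors\<close>

lemma finite_length [simp]: "finite {K::'n::finite list. length K = N}"
  using finite_lists_length_eq[of "UNIV::'n set" N] by simp

lemma sum_length_Suc:
  "(\<Sum>K | length K = Suc N. g (K::'n::finite list)) = (\<Sum>a\<in>UNIV. \<Sum>K | length K = N. g (a # K))"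
proof -
  have "{K::'n list. length K = Suc N} = (\<lambda>(a, K). a # K) ` (UNIV \<times> {K. length K = N})"
    by (auto simp: length_Suc_conv image_iff)
  then have "(\<Sum>K | length K = Suc N. g K) = (\<Sum>p\<in>UNIV \<times> {K. length K = N}. g (fst p # snd p))"
    by (simp add: sum.reindex inj_on_def case_prod_unfold)
  then show ?thesis by (simp add: sum.cartesian_product case_prod_unfold)
qed

lemma sum_length_snoc:
  "(\<Sum>K | length K = Suc N. g (K::'n::finite list)) = (\<Sum>K | length K = N. \<Sum>a\<in>UNIV. g (K @ [a]))"
proof -
  have "{K::'n list. length K = Suc N} = (\<lambda>(K, a). K @ [a]) ` ({K. length K = N} \<times> UNIV)"
  proof (intro Set.set_eqI iffI)
    fix K :: "'n list" assume "K \<in> {K. length K = Suc N}"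
    then show "K \<in> (\<lambda>(K, a). K @ [a]) ` ({K. length K = N} \<times> UNIV)"
      by (cases K rule: rev_cases) (auto simp: image_iff)
  qed auto
  then have "(\<Sum>K | length K = Suc N. g K) = (\<Sum>p\<in>{K. length K = N} \<times> UNIV. g (fst p @ [snd p]))"
    by (simp add: sum.reindex inj_on_def case_prod_unfold)
  then show ?thesis by (simp add: sum.cartesian_product case_prod_unfold)
qed

lemma sum_length_0 [simp]: "(\<Sum>K | K = []. g K) = g []"
  by simp

lemma sum_length_1: "(\<Sum>K | length K = Suc 0. g (K::'n::finite list)) = (\<Sum>a\<in>UNIV. g [a])"
  by (simp add: sum_length_Suc)

lemma sum_length_2: "(\<Sum>K | length K = 2. g (K::'n::finite list)) = (\<Sum>a\<in>UNIV. \<Sum>b\<in>UNIV. g [a, b])"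
  by (simp add: numeral_2_eq_2 sum_length_Suc)

lemma sum_delta_mult:
  fixes f :: "'b::finite \<Rightarrow> 'a::semiring_1"
  shows "(\<Sum>a\<in>UNIV. f a * (if a = b then 1 else 0)) = f b"
    "(\<Sum>a\<in>UNIV. f a * (if b = a then 1 else 0)) = f b"
    "(\<Sum>a\<in>UNIV. (if a = b then 1 else 0) * f a) = f b"
    "(\<Sum>a\<in>UNIV. (if b = a then 1 else 0) * f a) = f b"
  by (simp_all add: if_distrib[of "\<lambda>x. _ * x"] if_distrib[of "\<lambda>x. x * _"] cong: if_cong)

text \<open>Tensors are functions of infinite index sequences, of which an operator reads and
  changes a finite segment. Thus antisymmetrizers of all orders and their shifts live in one ring,
  without a fixed number of tensor factors.\<close>

definition seg :: "nat \<Rightarrow> nat \<Rightarrow> (nat \<Rightarrow> 'n) \<Rightarrow> 'n list" where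
  "seg p N s = map (\<lambda>l. s (p + l)) [0..<N]"

definition put :: "nat \<Rightarrow> 'n list \<Rightarrow> (nat \<Rightarrow> 'n) \<Rightarrow> nat \<Rightarrow> 'n" where
  "put p K s = (\<lambda>l. if p \<le> l \<and> l < p + length K then K ! (l - p) else s l)"

lemma length_seg [simp]: "length (seg p N s) = N" by (simp add: seg_def)
lemma seg_nth [simp]: "l < N \<Longrightarrow> seg p N s ! l = s (p + l)" by (simp add: seg_def)
lemma seg_put [simp]: "length K = N \<Longrightarrow> seg p N (put p K s) = K"
  by (auto simp: seg_def put_def intro!: nth_equalityI)
lemma put_put [simp]: "length K = length L \<Longrightarrow> put p K (put p L s) = put p K s"
  by (auto simp: put_def)
lemma put_seg [simp]: "put p (seg p N s) s = s"
  by (auto simp: put_def fun_eq_iff)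
lemma put_disjoint: "p + length K \<le> p' \<Longrightarrow> put p K (put p' L s) = put p' L (put p K s)"
  by (auto simp: put_def fun_eq_iff)
lemma seg_put_disjoint: "p + length K \<le> p' \<Longrightarrow> seg p' N (put p K s) = seg p' N s"
  "p + N \<le> p' \<Longrightarrow> seg p N (put p' K s) = seg p N s"
  by (auto simp: put_def seg_def)
lemma put_Cons: "put p (a # K) s = put (Suc p) K (s(p := a))"
  by (auto simp: put_def fun_eq_iff nth_Cons Suc_diff_Suc[symmetric] split: nat.splits intro!: arg_cong[of _ _ "(!) K"])
lemma put_Nil [simp]: "put p [] s = s" by (auto simp: put_def fun_eq_iff)
lemma put_single: "put p [a] s = s(p := a)" by (simp add: put_Cons)
lemma put_pair: "put p [a, b] s = s(p := a, Suc p := b)" by (simp add: put_Cons)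
lemma seg_0 [simp]: "seg p 0 s = []" by (simp add: seg_def)
lemma seg_Suc: "seg p (Suc N) s = s p # seg (Suc p) N s"
  by (simp add: seg_def upt_conv_Cons map_Suc_upt[symmetric] del: upt_Suc)
lemma seg_snoc: "seg p (Suc N) s = seg p N s @ [s (p + N)]"
  by (simp add: seg_def)

text \<open>Entries multiply functions from the left. This makes \<open>opo\<close> multiplicative
  for matrices over a noncommutative ring (\<open>opo_tmul\<close>), while operators on disjoint
  segments commute only if their entries do (\<open>opo_commute\<close>).\<close>

lift_definition opo :: "nat \<Rightarrow> nat \<Rightarrow> ('a::ring_1, 'n::finite) tmat \<Rightarrow> ((nat \<Rightarrow> 'n) \<Rightarrow> 'a) endo"
  is "\<lambda>p N A f s. \<Sum>K | length K = N. A (seg p N s) K * f (put p K s)"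
  by (auto simp: fun_eq_iff distrib_left sum.distrib)

lemma app_opo: "app (opo p N A) f s = (\<Sum>K | length K = N. A (seg p N s) K * f (put p K s))"
  by (simp add: opo.rep_eq)

lift_definition lmul :: "'a::ring_1 \<Rightarrow> ((nat \<Rightarrow> 'n::finite) \<Rightarrow> 'a) endo" is "\<lambda>d f s. d * f s"
  by (auto simp: fun_eq_iff distrib_left)

lemma app_lmul [simp]: "app (lmul d) f s = d * f s"
  by (simp add: lmul.rep_eq)

lemma op_eqI: "(\<And>f s. app P f s = app Q f s) \<Longrightarrow> P = Q"
  by (rule endo_eqI) auto

lemma lmul_hom: "lmul (a + b) = lmul a + lmul b" "lmul (a * b) = lmul a * lmul b" "lmul 1 = 1" "lmul 0 = 0"
  "lmul (a - b) = lmul a - lmul b" "lmul (- a) = - lmul a"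
  by (rule op_eqI; simp add: algebra_simps)+

lemma opo_cong:
  assumes "\<And>I J. length I = N \<Longrightarrow> length J = N \<Longrightarrow> A I J = B I J"
  shows "opo p N A = opo p N B"
  by (rule op_eqI) (simp add: app_opo assms)

lemma opo_tmul:
  fixes A B :: "('a::ring_1, 'n::finite) tmat"
  shows "opo p N (tmul N A B) = opo p N A * opo p N B"
proof (rule op_eqI)
  fix f :: "(nat \<Rightarrow> 'n) \<Rightarrow> 'a" and s :: "nat \<Rightarrow> 'n"
  have "app (opo p N (tmul N A B)) f s
      = (\<Sum>K | length K = N. \<Sum>L | length L = N. A (seg p N s) L * (B L K * f (put p K s)))"
    by (simp add: app_opo tmul_def sum_distrib_right mult.assoc)
  also have "\<dots> = (\<Sum>L | length L = N. \<Sum>K | length K = N. A (seg p N s) L * (B L K * f (put p K s)))"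
    by (rule sum.swap)
  also have "\<dots> = app (opo p N A * opo p N B) f s"
    by (simp add: app_opo sum_distrib_left)
  finally show "app (opo p N (tmul N A B)) f s = app (opo p N A * opo p N B) f s" .
qed

lemma opo_tid: "opo p N (tid N) = (1 :: ((nat \<Rightarrow> 'n::finite) \<Rightarrow> 'a::ring_1) endo)"
proof (rule op_eqI)
  fix f :: "(nat \<Rightarrow> 'n) \<Rightarrow> 'a" and s :: "nat \<Rightarrow> 'n"
  have "(\<Sum>K | length K = N. tid N (seg p N s) K * f (put p K s))
      = (\<Sum>K | length K = N. if K = seg p N s then f (put p K s) else 0)"
    by (rule sum.cong) (auto simp: tid_def)
  then show "app (opo p N (tid N)) f s = app 1 f s"
    by (simp add: app_opo)
qed

lemma opo_tprod: "opo p N (tprod N As) = foldr (\<lambda>A P. opo p N A * P) As 1"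
  by (induction As) (simp_all add: tprod_def opo_tid opo_tmul)

lemma opo_diff: "opo p N (\<lambda>I J. A I J - B I J) = opo p N A - opo p N B"
  and opo_lmul: "opo p N (\<lambda>I J. d * A I J) = lmul d * opo p N A"
  and opo_0: "opo p N (\<lambda>I J. 0) = 0"
  by (rule op_eqI; simp add: app_opo algebra_simps sum.distrib sum_subtractf sum_distrib_left)+

lemma app_opo_delta:
  assumes "length J = N"
  shows "app (opo p N A) (\<lambda>s. if seg p N s = J then 1 else 0) s = A (seg p N s) J"
proof -
  have "(\<Sum>K | length K = N. A (seg p N s) K * (if seg p N (put p K s) = J then 1 else 0))
      = (\<Sum>K | length K = N. if K = J then A (seg p N s) K else 0)"
    by (rule sum.cong) auto
  then show ?thesis using assms by (simp add: app_opo)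
qed

lemma opo_inj:
  assumes "opo p N A = opo p N B" "length I = N" "length J = N"
  shows "A I J = B I J"
  using app_opo_delta[of J N p A "put p I undefined"] app_opo_delta[of J N p B "put p I undefined"] assms
  by simp

lemma opo_commute:
  fixes A B :: "('a::ring_1, 'n::finite) tmat"
  assumes "p + N \<le> p'" and "\<And>I J K L. A I J * B K L = B K L * A I J"
  shows "opo p N A * opo p' N' B = opo p' N' B * opo p N A"
proof (rule op_eqI)
  fix f :: "(nat \<Rightarrow> 'n) \<Rightarrow> 'a" and s :: "nat \<Rightarrow> 'n"
  have eq: "put p' L (put p K s) = put p K (put p' L s)" if "length K = N" for K L
    using put_disjoint[of p K p' L s] assms(1) that by simp
  have "app (opo p N A * opo p' N' B) f s
    = (\<Sum>K | length K = N. \<Sum>L | length L = N'. A (seg p N s) K * (B (seg p' N' s) L * f (put p' L (put p K s))))"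
    by (simp add: app_opo sum_distrib_left seg_put_disjoint(1) assms(1))
  also have "\<dots> = (\<Sum>L | length L = N'. \<Sum>K | length K = N. A (seg p N s) K * (B (seg p' N' s) L * f (put p' L (put p K s))))"
    by (rule sum.swap)
  also have "\<dots> = (\<Sum>L | length L = N'. \<Sum>K | length K = N. B (seg p' N' s) L * (A (seg p N s) K * f (put p K (put p' L s))))"
    by (intro sum.cong refl) (auto simp: mult.assoc[symmetric] assms(2) eq)
  also have "\<dots> = app (opo p' N' B * opo p N A) f s"
    by (simp add: app_opo sum_distrib_left seg_put_disjoint(2) assms(1))
  finally show "app (opo p N A * opo p' N' B) f s = app (opo p' N' B * opo p N A) f s" .
qed

lemma lmul_opo_commute:
  assumes "\<And>I J. d * A I J = A I J * d"
  shows "lmul d * opo p N A = opo p N A * lmul d"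
  by (rule op_eqI) (simp add: app_opo sum_distrib_left mult.assoc[symmetric] assms)

text \<open>Over a noncommutative ring right multiplication by constants is the linearity that
  survives; it is used to split functions into basis functions with coefficients on the
  right.\<close>

lemma app_opo_right:
  "app (opo p N A) (\<lambda>s. f s * c) s = app (opo p N A) f s * c"
  by (simp add: app_opo sum_distrib_right mult.assoc)

lemma opo_embed:
  fixes A B :: "('a::ring_1, 'n::finite) tmat"
  assumes "j + L \<le> N"
    and "\<And>I J. length I = N \<Longrightarrow> length J = N \<Longrightarrow>
      A I J = (if \<forall>l<N. \<not> (j \<le> l \<and> l < j + L) \<longrightarrow> I ! l = J ! l then B (take L (drop j I)) (take L (drop j J)) else 0)"
  shows "opo p N A = opo (p + j) L B"
proof (rule op_eqI)
  fix f :: "(nat \<Rightarrow> 'n) \<Rightarrow> 'a" and s :: "nat \<Rightarrow> 'n"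
  define I where "I = seg p N s"
  define ins where "ins K = take j I @ K @ drop (j + L) I" for K
  have lI: "length I = N" by (simp add: I_def)
  have I': "take L (drop j I) = seg (p + j) L s"
    using assms(1) by (auto simp: I_def intro!: nth_equalityI simp: add_ac)
  let ?S = "{K. length K = N \<and> (\<forall>l<N. \<not> (j \<le> l \<and> l < j + L) \<longrightarrow> I ! l = K ! l)}"
  have S: "?S = ins ` {K. length K = L}"
  proof (intro Set.set_eqI iffI)
    fix K assume K: "K \<in> ?S"
    have "K = ins (take L (drop j K))"
    proof (rule nth_equalityI)
      show "length K = length (ins (take L (drop j K)))" using K assms(1) lI by (simp add: ins_def)
      fix l assume "l < length K"
      then show "K ! l = ins (take L (drop j K)) ! l"
        using K assms(1) lI by (auto simp: ins_def nth_append)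
    qed
    then show "K \<in> ins ` {K. length K = L}" using K assms(1) by (intro image_eqI) auto
  next
    fix K assume "K \<in> ins ` {K. length K = L}"
    then show "K \<in> ?S" using assms(1) lI by (auto simp: ins_def nth_append)
  qed
  have inj: "inj_on ins {K. length K = L}" by (auto simp: inj_on_def ins_def)
  have tk: "take L (drop j (ins K)) = K" if "length K = L" for K
    using that assms(1) lI by (simp add: ins_def)
  have pt: "put p (ins K) s = put (p + j) K s" if "length K = L" for K
  proof (rule ext)
    fix l
    consider "l < p" | "p \<le> l" "l < p + j" | "p + j \<le> l" "l < p + j + L" | "p + j + L \<le> l" "l < p + N" | "p + N \<le> l"
      by linarith
    then show "put p (ins K) s l = put (p + j) K s l"
      using that assms(1) lI
      by cases (auto simp: put_def ins_def nth_append I_def)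
  qed
  have "app (opo p N A) f s = (\<Sum>K\<in>?S. A I K * f (put p K s))"
    unfolding app_opo I_def[symmetric]
    by (rule sum.mono_neutral_right) (auto simp: assms(2) lI)
  also have "\<dots> = (\<Sum>K | length K = L. A I (ins K) * f (put p (ins K) s))"
    unfolding S by (rule sum.reindex[OF inj, unfolded o_def])
  also have "\<dots> = (\<Sum>K | length K = L. B (seg (p + j) L s) K * f (put (p + j) K s))"
  proof (rule sum.cong[OF refl])
    fix K :: "'n list" assume K: "K \<in> {K. length K = L}"
    then have "ins K \<in> ?S" unfolding S by blast
    then show "A I (ins K) * f (put p (ins K) s) = B (seg (p + j) L s) K * f (put (p + j) K s)"
      using K by (simp add: assms(2) lI tk pt I')
  qed
  finally show "app (opo p N A) f s = app (opo (p + j) L B) f s" by (simp add: app_opo)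
qed

definition op1 :: "nat \<Rightarrow> ('n::finite \<Rightarrow> 'n \<Rightarrow> 'a::ring_1) \<Rightarrow> ((nat \<Rightarrow> 'n) \<Rightarrow> 'a) endo" where
  "op1 p Z = opo p 1 (\<lambda>I J. Z (I ! 0) (J ! 0))"

definition op2 :: "nat \<Rightarrow> ('n::finite \<Rightarrow> 'n \<Rightarrow> 'n \<Rightarrow> 'n \<Rightarrow> 'a::ring_1) \<Rightarrow> ((nat \<Rightarrow> 'n) \<Rightarrow> 'a) endo" where
  "op2 p B = opo p 2 (\<lambda>I J. B (I ! 0) (I ! 1) (J ! 0) (J ! 1))"

lemma app_op1: "app (op1 p Z) f s = (\<Sum>a\<in>UNIV. Z (s p) a * f (s(p := a)))"
  by (simp add: op1_def app_opo sum_length_1 put_single)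

lemma app_op2: "app (op2 p B) f s = (\<Sum>a\<in>UNIV. \<Sum>b\<in>UNIV. B (s p) (s (Suc p)) a b * f (s(p := a, Suc p := b)))"
  by (simp add: op2_def app_opo sum_length_2 put_pair)

lemma op1_mult: "op1 p Z * op1 p Y = op1 p (\<lambda>i j. \<Sum>k\<in>UNIV. Z i k * Y k j)"
  unfolding op1_def opo_tmul[symmetric]
  by (rule opo_cong) (simp add: tmul_def sum_length_1)

lemma op1_one: "op1 p (\<lambda>i j. if i = j then 1 else 0) = 1"
  by (rule op_eqI) (simp add: app_op1 if_distrib[of "\<lambda>x. x * _"] cong: if_cong)

lemma op2_mult: "op2 p Z * op2 p Y = op2 p (\<lambda>i j k l. \<Sum>a\<in>UNIV. \<Sum>b\<in>UNIV. Z i j a b * Y a b k l)"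
  unfolding op2_def opo_tmul[symmetric]
  by (rule opo_cong) (simp add: tmul_def sum_length_2)

lemma op2_one: "op2 p (\<lambda>i j k l. if i = k \<and> j = l then 1 else 0)
    = (1 :: ((nat \<Rightarrow> 'n::finite) \<Rightarrow> 'a::ring_1) endo)"
proof (rule op_eqI)
  fix f :: "(nat \<Rightarrow> 'n) \<Rightarrow> 'a" and s :: "nat \<Rightarrow> 'n"
  have "app (op2 p (\<lambda>i j k l. if i = k \<and> j = l then 1 else 0)) f s
      = (\<Sum>a\<in>UNIV. \<Sum>b\<in>UNIV. if s p = a then if s (Suc p) = b then f (s(p := a, Suc p := b)) else 0 else 0)"
    unfolding app_op2 by (intro sum.cong refl) auto
  also have "\<dots> = (\<Sum>a\<in>UNIV. if s p = a then f (s(p := a)) else 0)"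
    by (intro sum.cong refl) (auto simp: fun_upd_twist intro!: arg_cong[of _ _ f])
  finally show "app (op2 p (\<lambda>i j k l. if i = k \<and> j = l then 1 else 0)) f s = app 1 f s" by simp
qed

lemma opo_on1:
  assumes "1 \<le> i" "i \<le> N"
  shows "opo p N (on1 N i Z) = op1 (p + i - 1) Z"
proof -
  have "opo p N (on1 N i Z) = opo (p + (i - 1)) 1 (\<lambda>I J. Z (I ! 0) (J ! 0))"
    using assms by (intro opo_embed) (auto simp: on1_def)
  then show ?thesis using assms by (simp add: op1_def)
qed

lemma opo_on2:
  fixes B :: "('b::zero, 'n::finite) mat2" and h :: "'b \<Rightarrow> 'a::ring_1"
  assumes "1 \<le> i" "i < N" "h 0 = 0"
  shows "opo p N (\<lambda>I J. h (on2 N i B I J)) = op2 (p + i - 1) (\<lambda>a b c d. h (B $ (a, b) $ (c, d)))"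
proof -
  have "opo p N (\<lambda>I J. h (on2 N i B I J)) = opo (p + (i - 1)) 2 (\<lambda>I J. h (B $ (I ! 0, I ! 1) $ (J ! 0, J ! 1)))"
  proof (rule opo_embed)
    fix I J :: "'n list" assume IJ: "length I = N" "length J = N"
    have e: "(\<forall>l<N. l \<noteq> i - 1 \<and> l \<noteq> i \<longrightarrow> I ! l = J ! l) \<longleftrightarrow>
          (\<forall>l<N. \<not> (i - 1 \<le> l \<and> l < i - 1 + 2) \<longrightarrow> I ! l = J ! l)"
      using assms by (intro all_cong) auto
    show "h (on2 N i B I J) = (if \<forall>l<N. \<not> (i - 1 \<le> l \<and> l < i - 1 + 2) \<longrightarrow> I ! l = J ! l
        then h (B $ (take 2 (drop (i - 1) I) ! 0, take 2 (drop (i - 1) I) ! 1) $ (take 2 (drop (i - 1) J) ! 0, take 2 (drop (i - 1) J) ! 1)) else 0)"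
      unfolding e[symmetric] using assms IJ by (auto simp: on2_def)
  qed (use assms in auto)
  then show ?thesis using assms by (simp add: op2_def)
qed

section \<open>The R-matrix acting on infinite tensors\<close>

lemma matrix_inv_both:
  fixes R :: "'k::field^'n^'n"
  assumes "invertible R" shows "R ** matrix_inv R = mat 1" "matrix_inv R ** R = mat 1"
  using assms unfolding invertible_def matrix_inv_def by (metis (mono_tags, lifting) someI_ex)+

locale scalars =
  fixes \<kappa> :: "'k::field_char_0 \<Rightarrow> 'a::ring_1"
  assumes \<kappa>_add: "\<kappa> (a + b) = \<kappa> a + \<kappa> b" and \<kappa>_mult: "\<kappa> (a * b) = \<kappa> a * \<kappa> b" and \<kappa>_1: "\<kappa> 1 = 1"
begin

lemma \<kappa>_0: "\<kappa> 0 = 0" using \<kappa>_add[of 0 0] by simp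
lemma \<kappa>_minus: "\<kappa> (- a) = - \<kappa> a" using \<kappa>_add[of a "- a"] by (simp add: \<kappa>_0 eq_neg_iff_add_eq_0 add.commute)
lemma \<kappa>_diff: "\<kappa> (a - b) = \<kappa> a - \<kappa> b" using \<kappa>_add[of a "- b"] by (simp add: \<kappa>_minus)
lemma \<kappa>_sum: "\<kappa> (sum f S) = (\<Sum>i\<in>S. \<kappa> (f i))"
  by (induction S rule: infinite_finite_induct) (auto simp: \<kappa>_add \<kappa>_0)
lemma \<kappa>_comm: "\<kappa> a * \<kappa> b = \<kappa> b * \<kappa> a" by (simp add: \<kappa>_mult[symmetric] mult.commute)
definition num2 :: "nat \<Rightarrow> ('k, 'n::finite) mat2 \<Rightarrow> ((nat \<Rightarrow> 'n) \<Rightarrow> 'a) endo" where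
  "num2 p B = op2 p (\<lambda>a b c d. \<kappa> (B $ (a, b) $ (c, d)))"

definition num :: "nat \<Rightarrow> nat \<Rightarrow> ('k, 'n::finite) tmat \<Rightarrow> ((nat \<Rightarrow> 'n) \<Rightarrow> 'a) endo" where
  "num p N A = opo p N (\<lambda>I J. \<kappa> (A I J))"

abbreviation sc :: "'k \<Rightarrow> ((nat \<Rightarrow> 'n::finite) \<Rightarrow> 'a) endo" where "sc c \<equiv> lmul (\<kappa> c)"

lemma num_tmul: "num p N (tmul N A B) = num p N A * num p N B"
  unfolding num_def opo_tmul[symmetric] tmul_def \<kappa>_sum \<kappa>_mult ..

lemma num_tid: "num p N (tid N) = 1"
  unfolding num_def opo_tid[symmetric, of p N] by (rule opo_cong) (simp add: tid_def \<kappa>_0 \<kappa>_1)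

lemma num_tprod: "num p N (tprod N As) = foldr (\<lambda>A P. num p N A * P) As 1"
  by (induction As) (simp_all add: tprod_def num_tid num_tmul)

lemma num_on2: "1 \<le> i \<Longrightarrow> i < N \<Longrightarrow> num p N (on2 N i B) = num2 (p + i - 1) B"
  unfolding num_def num2_def by (rule opo_on2) (auto simp: \<kappa>_0)

lemma num_diff: "num p N (\<lambda>I J. A I J - B I J) = num p N A - num p N B"
  and num_scale: "num p N (\<lambda>I J. c * A I J) = sc c * num p N A"
  unfolding num_def \<kappa>_diff \<kappa>_mult by (rule opo_diff opo_lmul)+

lemma num2_mult: "num2 p A * num2 p B = num2 p (A ** B)"
proof -
  have "(A ** B) $ (i, j) $ (k, l) = (\<Sum>a\<in>UNIV. \<Sum>b\<in>UNIV. A $ (i, j) $ (a, b) * B $ (a, b) $ (k, l))" for i j k l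
    unfolding matrix_matrix_mult_def
    by (simp add: sum.cartesian_product UNIV_Times_UNIV[symmetric] case_prod_unfold del: UNIV_Times_UNIV)
  then show ?thesis unfolding num2_def op2_mult by (simp add: \<kappa>_sum \<kappa>_mult)
qed

lemma num2_one: "num2 p (mat 1) = 1"
  unfolding num2_def op2_one[symmetric, of p] by (rule arg_cong[of _ _ "op2 p"]) (auto simp: mat_def fun_eq_iff \<kappa>_0 \<kappa>_1)

lemma num2_add: "num2 p (A + B) = num2 p A + num2 p B"
  by (rule op_eqI) (simp add: num2_def app_op2 \<kappa>_add distrib_right sum.distrib)

lemma num2_scale: "num2 p (\<chi> i j. c * A $ i $ j) = sc c * num2 p A"
  by (rule op_eqI) (simp add: num2_def app_op2 \<kappa>_mult sum_distrib_left mult.assoc)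

end

text \<open>The same numerical R acts over every ring that receives the scalars. Taking the field
  itself yields the numerical facts, other rings serve the generators of the algebra.\<close>

locale GL = scalars \<kappa> for \<kappa> :: "'k::field_char_0 \<Rightarrow> 'a::ring_1" +
  fixes R :: "('k, 'n::finite) mat2" and q :: 'k and m :: nat
  assumes GL: "GL_type q m R"
begin

definition r :: "nat \<Rightarrow> ((nat \<Rightarrow> 'n) \<Rightarrow> 'a) endo" where "r i = num2 i R"
definition ri :: "nat \<Rightarrow> ((nat \<Rightarrow> 'n) \<Rightarrow> 'a) endo" where "ri i = num2 i (matrix_inv R)"

lemma Hecke: "Hecke_type q R" and m1: "m \<ge> 1" and generic: "generic q"
  and R_mat: "R_matrix R" and R_inv: "invertible R"
  using GL by (auto simp: GL_type_def Hecke_type_def R_matrix_def)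

lemma Hecke_square: "R ** R = mat 1 + (\<chi> i j. (q - inverse q) * R $ i $ j)"
proof -
  have q: "q \<noteq> 0" using generic by (simp add: generic_def)
  have m: "mat a ** Z = (\<chi> i j. a * Z $ i $ j)" "Z ** mat a = (\<chi> i j. a * Z $ i $ j)" for a :: 'k and Z :: "('k, 'n) mat2"
    unfolding matrix_matrix_mult_def mat_def
    by (auto simp: vec_eq_iff if_distrib[of "\<lambda>x. x * _"] if_distrib[of "\<lambda>x. _ * x"] mult.commute cong: if_cong)
  have sub: "(D - E) ** F = D ** F - E ** F" for D E F :: "('k, 'n) mat2"
    by (simp add: matrix_matrix_mult_def vec_eq_iff left_diff_distrib sum_subtractf)
  have "(R - mat q) ** (R + mat (inverse q)) = 0"
    using Hecke by (simp add: Hecke_type_def)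
  then have "R ** R + R ** mat (inverse q) - mat q ** R - mat q ** mat (inverse q) = 0"
    by (simp add: matrix_add_ldistrib sub algebra_simps)
  moreover have "mat q ** mat (inverse q) = (mat 1 :: ('k, 'n) mat2)"
    using q unfolding m by (auto simp: vec_eq_iff mat_def)
  ultimately show ?thesis
    unfolding m by (auto simp: vec_eq_iff algebra_simps)
qed

sublocale hecke_rep r ri q sc
proof
  fix i j :: nat and a b :: 'k
  show "r i * ri i = 1" "ri i * r i = 1"
    unfolding r_def ri_def num2_mult matrix_inv_both[OF R_inv] by (rule num2_one)+
  have "num i 3 (tprod 3 [on2 3 1 R, on2 3 2 R, on2 3 1 R]) = num i 3 (tprod 3 [on2 3 2 R, on2 3 1 R, on2 3 2 R])"
    using R_mat by (simp add: R_matrix_def)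
  then show "r i * r (Suc i) * r i = r (Suc i) * r i * r (Suc i)"
    unfolding num_tprod by (simp add: num_on2 r_def mult.assoc)
  show "r i * r j = r j * r i" if "i + 2 \<le> j"
    unfolding r_def num2_def op2_def by (rule opo_commute) (use that \<kappa>_comm in auto)
  show "generic q" by (rule generic)
  show "sc (a + b) = sc a + sc b" "sc (a * b) = sc a * sc b" "sc 1 = 1"
    by (simp_all add: \<kappa>_add \<kappa>_mult \<kappa>_1 lmul_hom)
  show "r i * sc a = sc a * r i"
    unfolding r_def num2_def op2_def by (rule lmul_opo_commute[symmetric]) (simp add: \<kappa>_comm)
  show "r i * r i = 1 + sc (q - inverse q) * r i"
    unfolding r_def num2_mult Hecke_square num2_add num2_one num2_scale ..
qed

lemma num_antisym:
  "k \<le> N \<Longrightarrow> num p N (antisym q R N k) = anti sc q (\<lambda>i. r (p + i)) k"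
proof (induction k)
  case (Suc k)
  show ?case
  proof (cases "k = 0")
    case False
    have "num p N (on2 N k R) = r (p + (k - 1))"
      using False Suc.prems by (subst num_on2) (auto simp: r_def)
    moreover have "num p N (antisym q R N k) = anti sc q (\<lambda>i. r (p + i)) k"
      using Suc by simp
    ultimately show ?thesis using False
      by (simp only: antisym.simps anti.simps if_False num_scale num_tprod foldr.simps o_apply
          num_diff num_tid id_apply mult_1_right mult.assoc)
  qed (simp add: num_tid)
qed (simp add: num_tid)

lemma A_top: "A (Suc m) = 0"
proof -
  have "A (Suc m) = num 0 (Suc m) (antisym q R (Suc m) (Suc m))" 
    by (subst num_antisym) simp_all
  also have "antisym q R (Suc m) (Suc m) = (\<lambda>I J. 0)" using GL by (simp only: GL_type_def Suc_eq_plus1)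
  finally show ?thesis by (simp add: num_def opo_0 \<kappa>_0)
qed

end

section \<open>Numerical consequences of the \<open>GL(m)\<close>-type condition\<close>

lemma sum_fun_apply: "(\<Sum>i\<in>S. F i) x = (\<Sum>i\<in>S. F i x)"
  by (induction S rule: infinite_finite_induct) auto

lemma trank_1_factor:
  fixes A :: "('k::field, 'n::finite) tmat"
  assumes "trank N A = 1"
  obtains u v I0 J0 where "\<And>I J. length I = N \<Longrightarrow> A I J = u I * v J" "length I0 = N" "A I0 J0 \<noteq> 0"
proof -
  interpret vs: vector_space "\<lambda>(c::'k) (w::'n list \<Rightarrow> 'k) J. c * w J"
    by unfold_locales (auto simp: fun_eq_iff algebra_simps)
  let ?V = "A ` {I. length I = N}"
  obtain B where B: "B \<subseteq> ?V" "vs.independent B" "?V \<subseteq> vs.span B" "card B = vs.dim ?V"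
    using vs.basis_exists by blast
  have "card B = 1" using B(4) assms by (simp add: trank_def)
  then obtain w where w: "B = {w}" by (auto simp: card_1_singleton_iff)
  have "w \<noteq> 0" using B(2) w vs.dependent_zero[of B] by auto
  then obtain J0 where J0: "w J0 \<noteq> 0" by (auto simp: fun_eq_iff)
  obtain I0 where I0: "length I0 = N" "A I0 = w" using B(1) w by auto
  have "\<exists>c. \<forall>J. A I J = c * w J" if "length I = N" for I
  proof -
    have "A I \<in> vs.span {w}" using B(3) w that by auto
    then show ?thesis unfolding vs.span_singleton by auto
  qed
  then obtain u where "\<And>I J. length I = N \<Longrightarrow> A I J = u I * w J" by metis
  then show ?thesis using that I0 J0 by blast
qed

lemma matrix_left_right:
  fixes F G :: "'n::finite \<Rightarrow> 'n \<Rightarrow> 'k::field"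
  assumes "\<And>a b. (\<Sum>c\<in>UNIV. F a c * G c b) = (if a = b then 1 else 0)"
  shows "(\<Sum>c\<in>UNIV. G a c * F c b) = (if a = b then 1 else 0)"
proof -
  have "(\<chi> i j. F i j) ** (\<chi> i j. G i j) = mat 1"
    by (simp add: matrix_matrix_mult_def mat_def assms vec_eq_iff)
  then have "(\<chi> i j. G i j) ** (\<chi> i j. F i j) = mat 1"
    by (simp add: matrix_left_right_inverse)
  then have "((\<chi> i j. G i j) ** (\<chi> i j. F i j)) $ a $ b = mat 1 $ a $ b" by simp
  then show ?thesis by (simp add: matrix_matrix_mult_def mat_def)
qed

text \<open>The rank one projector as a product of u and v; the normalization \<open>vu\<close>
  expresses its idempotence.\<close>

locale numGL = GL "\<lambda>x. x" R q m for R :: "('k::field_char_0, 'n::finite) mat2" and q :: 'k and m :: nat +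
  fixes u v :: "'n list \<Rightarrow> 'k"
  assumes uv: "\<And>I J. length I = m \<Longrightarrow> length J = m \<Longrightarrow> antisym q R m m I J = u I * v J"
    and vu: "(\<Sum>J | length J = m. v J * u J) = 1"
begin

lemma app_A: "app (A m) f s = u (seg 0 m s) * (\<Sum>K | length K = m. v K * f (put 0 K s))"
proof -
  have "A m = num 0 m (antisym q R m m)" by (subst num_antisym) simp_all
  then show ?thesis by (simp add: num_def app_opo uv sum_distrib_left mult.assoc)
qed

lemma app_A': "app (anti sc q (\<lambda>i. r (Suc i)) m) f s = u (seg (Suc 0) m s) * (\<Sum>K | length K = m. v K * f (put (Suc 0) K s))"
proof -
  have "anti sc q (\<lambda>i. r (Suc i)) m = num (Suc 0) m (antisym q R m m)" by (subst num_antisym) simp_all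
  then show ?thesis by (simp add: num_def app_opo uv sum_distrib_left mult.assoc)
qed

lemma u_nonzero: "\<exists>L. length L = m \<and> u L \<noteq> 0"
proof (rule ccontr)
  assume "\<not> ?thesis"
  then have "(\<Sum>J | length J = m. v J * u J) = (\<Sum>J\<in>{J. length J = m}. 0)" by (auto intro!: sum.neutral)
  then show False using vu by simp
qed

lemma sum_m:
  "(\<Sum>K | length K = m. g (K::'n list)) = (\<Sum>a\<in>UNIV. \<Sum>K | length K = m - 1. g (a # K))"
  "(\<Sum>K | length K = m. g (K::'n list)) = (\<Sum>K | length K = m - 1. \<Sum>a\<in>UNIV. g (K @ [a]))"
  using sum_length_Suc[of g "m - 1"] sum_length_snoc[of g "m - 1"] m1 by simp_all

text \<open>Contractions of v with u over m - 1 legs. In \<open>Gm\<close> and \<open>Gm'\<close>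
  the two are displaced by one leg, as in the products of A_m and its shift; in \<open>Hm\<close>
  and \<open>Hm'\<close> they are aligned, so these are partial traces of the projector.\<close>

definition Gm :: "'n \<Rightarrow> 'n \<Rightarrow> 'k" where "Gm a b = (\<Sum>J | length J = m - 1. v (b # J) * u (J @ [a]))"
definition Gm' :: "'n \<Rightarrow> 'n \<Rightarrow> 'k" where "Gm' a b = (\<Sum>J | length J = m - 1. u (a # J) * v (J @ [b]))"
definition Hm :: "'n \<Rightarrow> 'n \<Rightarrow> 'k" where "Hm y x = (\<Sum>J | length J = m - 1. v (J @ [x]) * u (J @ [y]))"
definition Hm' :: "'n \<Rightarrow> 'n \<Rightarrow> 'k" where "Hm' c i = (\<Sum>J | length J = m - 1. v (i # J) * u (c # J))"

lemma right_linear: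
  "app (r i) (\<lambda>s. f s * c) = (\<lambda>s. app (r i) f s * c)"
  "app (ri i) (\<lambda>s. f s * c) = (\<lambda>s. app (ri i) f s * c)"
  by (rule ext; simp add: r_def ri_def num2_def op2_def app_opo_right)+

lemma right_linear_up: "app (up ri k) (\<lambda>s. f s * c) = (\<lambda>s. app (up ri k) f s * c)"
  by (induction k arbitrary: f) (simp_all add: right_linear)

lemma seg_put_shift: "length K = m \<Longrightarrow> seg 0 m (put (Suc 0) K s) = s 0 # butlast K"
  using m1 by (intro nth_equalityI) (auto simp: put_def nth_Cons nth_butlast split: nat.split)

lemma seg_put_shift': "length K = m \<Longrightarrow> seg (Suc 0) m (put 0 K s) = tl K @ [s m]"
  using m1 by (cases K) (auto intro!: nth_equalityI simp: put_def nth_append nth_Cons less_Suc_eq_le split: nat.split)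

lemma put_at: "length K = N \<Longrightarrow> put 0 K s N = s N" by (simp add: put_def)
lemma put_at_0: "put (Suc 0) K s 0 = s 0" by (simp add: put_def)
lemma put_hd: "length K = m \<Longrightarrow> put 0 K s 0 = hd K" using m1 by (cases K) (auto simp: put_def)
lemma put_0_Cons: "put 0 (a # K) s 0 = a" by (simp add: put_def)

definition vec1 :: "'n \<Rightarrow> (nat \<Rightarrow> 'n) \<Rightarrow> 'k" where
  "vec1 b = (\<lambda>s. if s 0 = b then u (seg (Suc 0) m s) else 0)"

lemma A'_vec1: "app (anti sc q (\<lambda>i. r (Suc i)) m) (vec1 b) = vec1 b"
  by (rule ext) (simp add: app_A' vec1_def put_at_0 vu)

text \<open>\<open>vec1 b\<close> is e_b \<otimes> u, fixed by A', and A_m maps it to the sum of the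
  (u \<otimes> e_c) times \<open>Gm c b\<close>. By \<open>top_overlap\<close> this image is a
  multiple of \<open>down r m\<close> applied to e_b \<otimes> u, so \<open>up ri m\<close> recovers
  e_b \<otimes> u from it. Contracting u with v gives the inverse matrix; \<open>k\<close> is the
  ratio of the two scalars in \<open>top_overlap\<close>.\<close>

lemma Gm_inverse: "\<exists>F. \<forall>a b. (\<Sum>c\<in>UNIV. F a c * Gm c b) = (if a = b then 1 else 0)"
proof -
  define e where "e c = (\<lambda>s. if s m = c then u (seg 0 m s) else 0)" for c
  define k where "k = al m / (- ((- inverse q) ^ m))"
  define F where "F a c = (\<Sum>J | length J = m. v J * (k * app (up ri m) (e c) (put 0 (a # J) undefined)))" for a c
  interpret inv: braid_rep ri r by (rule inverse_rep)
  have Af: "app (A m) (vec1 b) = (\<Sum>c\<in>UNIV. (\<lambda>s. e c s * Gm c b))" for b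
  proof (rule ext)
    fix s
    have "app (A m) (vec1 b) s = u (seg 0 m s) * (\<Sum>K | length K = m. v K * vec1 b (put 0 K s))"
      by (rule app_A)
    also have "(\<Sum>K | length K = m. v K * vec1 b (put 0 K s)) = (\<Sum>K | length K = m. if hd K = b then v K * u (tl K @ [s m]) else 0)"
      by (intro sum.cong refl) (auto simp: vec1_def seg_put_shift' put_hd)
    also have "\<dots> = Gm (s m) b"
      by (simp add: sum_m(1) Gm_def)
         (subst sum.swap, simp)
    finally show "app (A m) (vec1 b) s = (\<Sum>c\<in>UNIV. (\<lambda>s. e c s * Gm c b)) s"
      by (simp add: e_def sum_fun_apply if_distrib[of "\<lambda>x. x * _"] cong: if_cong)
  qed
  have qp: "(- inverse q) ^ m \<noteq> 0" using q_nz by simp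
  have f: "vec1 b s = k * app (up ri m) (app (A m) (vec1 b)) s" for b s
  proof -
    have "app (sc (al m) * (A m * anti sc q (\<lambda>i. r (Suc i)) m)) (vec1 b)
        = app (sc (- ((- inverse q) ^ m)) * (down r m * anti sc q (\<lambda>i. r (Suc i)) m)) (vec1 b)"
      by (simp only: top_overlap[OF m1 A_top])
    then have "app (lmul (al m)) (app (A m) (vec1 b)) = app (lmul (- ((- inverse q) ^ m))) (app (down r m) (vec1 b))"
      by (simp add: A'_vec1)
    then have "al m * app (A m) (vec1 b) s = - ((- inverse q) ^ m) * app (down r m) (vec1 b) s" for s
      by (metis app_lmul)
    then have "app (down r m) (vec1 b) = (\<lambda>s. app (A m) (vec1 b) s * k)"
      using qp by (auto simp: k_def field_simps fun_eq_iff)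
    then have "app (up ri m) (app (down r m) (vec1 b)) s = app (up ri m) (app (A m) (vec1 b)) s * k"
      by (simp add: right_linear_up)
    moreover have "app (up ri m) (app (down r m) (vec1 b)) = vec1 b"
      using inv.up_down_inv(1)[of m] by (metis app_simps(2) app_simps(6))
    ultimately show ?thesis by simp
  qed
  have "(\<Sum>c\<in>UNIV. F a c * Gm c b) = (if a = b then 1 else 0)" for a b
  proof -
    have "(\<Sum>c\<in>UNIV. F a c * Gm c b) = (\<Sum>J | length J = m. v J * vec1 b (put 0 (a # J) undefined))"
      unfolding F_def f[of b] Af app_sum right_linear_up sum_fun_apply
      by (simp add: sum_distrib_left sum_distrib_right mult.assoc) (rule sum.swap)
    also have "\<dots> = (\<Sum>J | length J = m. if a = b then v J * u J else 0)"
      by (intro sum.cong refl) (auto simp: vec1_def put_Cons put_at_0)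
    finally show ?thesis using vu by simp
  qed
  then show ?thesis by blast
qed

lemma Gm'_inverse: "\<exists>F. \<forall>a b. (\<Sum>c\<in>UNIV. Gm' a c * F c b) = (if a = b then 1 else 0)"
proof -
  define k where "k = al m / (- ((- inverse q) ^ m))"
  \<comment> \<open>Chosen so that \<open>up r m\<close> in \<open>top_overlap'\<close> returns
    \<open>vec1 b\<close>, which A' fixes.\<close>
  define h where "h b = app (down ri m) (vec1 b)" for b
  define hv where "hv c b = (\<Sum>J | length J = m. v J * h b (put 0 (J @ [c]) undefined))" for c b
  define F where "F c b = k * hv c b" for c b
  have qp: "(- inverse q) ^ m \<noteq> 0" using q_nz by simp
  let ?A' = "anti sc q (\<lambda>i. r (Suc i)) m"
  have eq: "k * app ?A' (app (A m) (h b)) s = vec1 b s" for b s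
  proof -
    have "app (sc (al m) * (?A' * A m)) (h b) = app (sc (- ((- inverse q) ^ m)) * (?A' * up r m)) (h b)"
      by (simp only: top_overlap'[OF m1 A_top])
    moreover have "app (up r m) (h b) = vec1 b"
      unfolding h_def using up_down_inv(1)[of m] by (metis app_simps(2) app_simps(6))
    ultimately have "app (lmul (al m)) (app ?A' (app (A m) (h b))) = app (lmul (- ((- inverse q) ^ m))) (vec1 b)"
      by (simp add: A'_vec1)
    then have "al m * app ?A' (app (A m) (h b)) s = - ((- inverse q) ^ m) * vec1 b s"
      by (metis app_lmul)
    then show ?thesis using qp by (simp add: k_def field_simps)
  qed
  obtain L where L: "length L = m" "u L \<noteq> 0" using u_nonzero by blast
  have "(\<Sum>c\<in>UNIV. Gm' a c * F c b) = (if a = b then 1 else 0)" for a b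
  proof -
    define s where "s = put 0 (a # L) undefined"
    have s0: "s 0 = a" by (simp add: s_def put_0_Cons)
    have sL: "seg (Suc 0) m s = L" by (simp add: s_def put_Cons L)
    have pp: "put 0 J (put (Suc 0) (K @ [c]) s) = put 0 (J @ [c]) undefined"
      if "length J = m" "length K = m - 1" for J K c
      using that m1 L by (auto simp: put_def s_def fun_eq_iff nth_append nth_Cons split: nat.splits)
    have "app ?A' (app (A m) (h b)) s = u L * (\<Sum>K | length K = m. v K * (u (a # butlast K) *
         (\<Sum>J | length J = m. v J * h b (put 0 J (put (Suc 0) K s)))))"
      by (simp add: app_A' app_A sL seg_put_shift s0)
    also have "\<dots> = u L * (\<Sum>K | length K = m - 1. \<Sum>c\<in>UNIV. v (K @ [c]) * (u (a # K) * hv c b))"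
      by (simp add: hv_def sum_m(2)[of "\<lambda>K. v K * (u (a # butlast K) * _ K)"] pp)
    also have "k * \<dots> = u L * (\<Sum>c\<in>UNIV. Gm' a c * F c b)"
      unfolding Gm'_def F_def
      by (subst sum.swap) (simp add: sum_distrib_left sum_distrib_right mult_ac)
    finally have "vec1 b s = u L * (\<Sum>c\<in>UNIV. Gm' a c * F c b)" unfolding eq .
    then show ?thesis using L by (auto simp: vec1_def s0 sL split: if_splits)
  qed
  then show ?thesis by blast
qed

text \<open>The vanishing of A_{m+1} in its recursive form, A_m (q^m - [m] r_{m-1}) A_m = 0,
  evaluated on u \<otimes> e_b.\<close>

lemma H_trace: "qnum q m * (\<Sum>x\<in>UNIV. \<Sum>y\<in>UNIV. R $ (x, a) $ (y, b) * Hm y x) = (if a = b then q ^ m else 0)"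
proof -
  define e where "e = (\<lambda>s. if s m = b then u (seg 0 m s) else 0)"
  have Ae: "app (A m) e = e"
    by (rule ext) (simp add: app_A e_def put_at vu)
  have "A m * (sc (q ^ m) - sc (qnum q m) * r (m - 1)) * A m = 0"
    using A_Suc[OF m1] A_top by simp
  then have "app (A m * (sc (q ^ m) - sc (qnum q m) * r (m - 1)) * A m) e = 0" by (simp only: app_simps)
  then have "app (A m) (app (sc (q ^ m)) e) = app (A m) (app (sc (qnum q m)) (app (r (m - 1)) e))"
    by (simp add: Ae app_diff)
  moreover have "app (A m) (app (lmul c) f) s = c * app (A m) f s" for c f s
    by (simp add: app_A sum_distrib_left mult_ac)
  ultimately have eq: "q ^ m * e s = qnum q m * app (A m) (app (r (m - 1)) e) s" for s
    by (metis Ae)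
  obtain L where L: "length L = m" "u L \<noteq> 0" using u_nonzero by blast
  define s where "s = put 0 (L @ [a]) undefined"
  have sm: "s m = a" using L by (simp add: s_def put_def nth_append)
  have sL: "seg 0 m s = L" using L by (intro nth_equalityI) (auto simp: s_def put_def nth_append)
  have r: "app (r (m - 1)) e t = (\<Sum>y\<in>UNIV. R $ (t (m - 1), t m) $ (y, b) * u (seg 0 m (t(m - 1 := y))))" for t
  proof -
    have "seg 0 m (t(m - Suc 0 := y, m := d)) = seg 0 m (t(m - 1 := y))" for y d
      using m1 by (intro nth_equalityI) auto
    then show ?thesis using m1
      by (simp add: r_def num2_def app_op2 e_def if_distrib[of "\<lambda>x. _ * x"] cong: if_cong)
  qed
  have "app (A m) (app (r (m - 1)) e) s = u L * (\<Sum>K | length K = m - 1. \<Sum>x\<in>UNIV. v (K @ [x]) *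
      (\<Sum>y\<in>UNIV. R $ (x, a) $ (y, b) * u (K @ [y])))"
  proof -
    have "put 0 (K @ [x]) s (m - 1) = x" "put 0 (K @ [x]) s m = a"
       "seg 0 m ((put 0 (K @ [x]) s)(m - 1 := y)) = K @ [y]"
      if "length K = m - 1" for K x y
      using that m1 sm by (auto simp: put_def nth_append intro!: nth_equalityI)
    then show ?thesis unfolding app_A sL sum_m(2) r by simp
  qed
  also have "\<dots> = u L * (\<Sum>x\<in>UNIV. \<Sum>y\<in>UNIV. R $ (x, a) $ (y, b) * Hm y x)"
  proof -
    have "(\<Sum>K | length K = m - 1. \<Sum>x\<in>UNIV. v (K @ [x]) * (\<Sum>y\<in>UNIV. R $ (x, a) $ (y, b) * u (K @ [y])))
       = (\<Sum>x\<in>UNIV. \<Sum>K | length K = m - 1. \<Sum>y\<in>UNIV. R $ (x, a) $ (y, b) * (v (K @ [x]) * u (K @ [y])))"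
      by (subst sum.swap) (simp add: sum_distrib_left mult_ac)
    also have "\<dots> = (\<Sum>x\<in>UNIV. \<Sum>y\<in>UNIV. \<Sum>K | length K = m - 1. R $ (x, a) $ (y, b) * (v (K @ [x]) * u (K @ [y])))"
      by (intro sum.cong refl sum.swap)
    finally show ?thesis by (simp add: Hm_def sum_distrib_left)
  qed
  finally have "q ^ m * e s = u L * (qnum q m * (\<Sum>x\<in>UNIV. \<Sum>y\<in>UNIV. R $ (x, a) $ (y, b) * Hm y x))"
    using eq[of s] by simp
  moreover have "e s = u L * (if a = b then 1 else 0)" by (simp add: e_def sm sL)
  ultimately show ?thesis using L by (simp split: if_splits)
qed

text \<open>Applying $A_m J_m = 0$ to a tensor that contracts the legs $2, \dots, m$ with \<open>u\<close>.\<close>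

lemma Y_relation:
  "\<exists>Y. \<forall>a b. (if a = b then Hm' c i else 0) - inverse q * al (m - 1) * (\<Sum>x\<in>UNIV. \<Sum>y\<in>UNIV. R $ (x, a) $ (y, b) * Y x y)
     = al m * (Gm a i * Gm' c b)"
proof -
  define f where "f b = (\<lambda>s. if s 0 = i \<and> s m = b then u (c # seg (Suc 0) (m - 1) s) else 0)" for b
  define U where "U = (\<lambda>s::nat \<Rightarrow> 'n. u (seg 0 m s))"
  have AU: "app (A m) U = U" by (rule ext) (simp add: app_A U_def vu)
  have rU: "app (r j) U s = - inverse q * U s" if "j + 1 < m" for j s
  proof -
    have "app (r j) U = app (r j * A m) U" by (simp add: AU)
    also have "\<dots> = app (lmul (- inverse q)) U" unfolding r_A[OF that] by (simp add: AU)
    finally show ?thesis by simp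
  qed
  \<comment> \<open>Between the first and the last leg \<open>f b\<close> is a slice of u, so r_j
    acts on it as it acts on u, which absorbs it.\<close>
  have rf: "app (r j) (f b) s = - inverse q * f b s" if j: "1 \<le> j" "j < m - 1" for j b s
  proof -
    have fU: "f b t = (if t 0 = i \<and> t m = b then U (t(0 := c)) else 0)" for t
      using m1 by (auto simp: f_def U_def seg_def upt_conv_Cons map_Suc_upt[symmetric] simp del: upt_Suc
          intro!: arg_cong[of _ _ u])
         (cases m, auto simp: upt_conv_Cons map_Suc_upt[symmetric] simp del: upt_Suc)
    have ne: "m \<noteq> j" "m \<noteq> Suc j" "j \<noteq> 0" "j > 0" using j by auto
    have "app (r j) (f b) s = (if s 0 = i \<and> s m = b then app (r j) U (s(0 := c)) else 0)"
      using ne by (auto simp: r_def num2_def app_op2 fU fun_upd_twist intro!: sum.cong)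
    then show ?thesis using rU[of j] j by (simp add: fU)
  qed
  \<comment> \<open>\<open>J_absorb\<close> speaks about ring elements. The tensor
    \<open>f b\<close> is therefore turned into an operator of rank one, whose value at the constant
    function 1 is \<open>f b\<close>.\<close>
  define z where "z b = Endo (\<lambda>g s. f b s * g (\<lambda>_. undefined))" for b
  have z: "app (z b) g = (\<lambda>s. f b s * g (\<lambda>_. undefined))" for b g
    unfolding z_def by (subst app_Endo) (auto simp: distrib_left fun_eq_iff)
  have "J (m - 1) * z b = sc (al (m - 1)) * z b + sc ((- inverse q) ^ (m - 1)) * (down r (m - 1) * z b)" for b
  proof (rule J_absorb)
    fix j assume "1 \<le> j" "j < m - 1"
    then show "r j * z b = sc (- inverse q) * z b"
      by (intro op_eqI) (simp add: z right_linear rf)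
  qed
  then have "app (J (m - 1) * z b) 1 = app (sc (al (m - 1)) * z b + sc ((- inverse q) ^ (m - 1)) * (down r (m - 1) * z b)) 1" for b
    by simp
  then have Jf: "app (J (m - 1)) (f b) = app (lmul (al (m - 1))) (f b) + app (lmul ((- inverse q) ^ (m - 1))) (app (down r (m - 1)) (f b))" for b
    by (simp add: z)
  have lin: "app (A m) (app (lmul k) g) s = k * app (A m) g s" "app (r j) (app (lmul k) g) = app (lmul k) (app (r j) g)" for k g s j
    by (simp_all add: app_A sum_distrib_left mult_ac fun_eq_iff r_def num2_def app_op2)
  let ?A' = "anti sc q (\<lambda>i. r (Suc i)) m"
  have main: "app (A m) (f b) s - inverse q * al (m - 1) * app (A m) (app (r (m - 1)) (f b)) s = al m * app (A m) (app ?A' (f b)) s" for b s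
  proof -
    have Jm: "J m = 1 - sc (inverse q) * (r (m - 1) * J (m - 1))" using m1 by (cases m) simp_all
    have dm: "down r m = r (m - 1) * down r (m - 1)" using m1 by (cases m) simp_all
    have pm: "inverse q * (- inverse q) ^ (m - 1) = - ((- inverse q) ^ m)" using m1 by (cases m) simp_all
    have "0 = app (A m * J m) (f b) s" by (simp only: A_J_zero[OF m1 A_top]) simp
    also have "\<dots> = app (A m) (f b) s - inverse q * al (m - 1) * app (A m) (app (r (m - 1)) (f b)) s
       - inverse q * (- inverse q) ^ (m - 1) * app (A m) (app (down r m) (f b)) s"
      by (simp only: Jm app_simps Jf app_diff app_add lin dm) (simp add: lin app_add algebra_simps)
    finally have 1: "app (A m) (f b) s - inverse q * al (m - 1) * app (A m) (app (r (m - 1)) (f b)) s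
       = - ((- inverse q) ^ m) * app (A m) (app (down r m) (f b)) s" unfolding pm by (simp add: eq_neg_iff_add_eq_0)
    have "app (A m * down r m) (f b) = app (down r m * ?A') (f b)"
      by (simp only: down_A'[OF m1 A_top])
    moreover have "app (sc (al m) * (A m * ?A')) (f b) s = app (sc (- ((- inverse q) ^ m)) * (down r m * ?A')) (f b) s"
      by (simp only: top_overlap[OF m1 A_top])
    ultimately show ?thesis using 1 by simp
  qed
  obtain L where L: "length L = m" "u L \<noteq> 0" using u_nonzero by blast
  \<comment> \<open>For m = 1 the truncated m - 2 does no harm: the coefficient
    \<open>al (m - 1)\<close> of the term with \<open>Y\<close> is then 0.\<close>
  define Y where "Y x y = (\<Sum>K | length K = m - 2. v (i # K @ [x]) * u (c # K @ [y]))" for x y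
  have "(if a = b then Hm' c i else 0) - inverse q * al (m - 1) * (\<Sum>x\<in>UNIV. \<Sum>y\<in>UNIV. R $ (x, a) $ (y, b) * Y x y)
     = al m * (Gm a i * Gm' c b)" for a b
  proof -
    define s where "s = put 0 (L @ [a]) undefined"
    have sm: "s m = a" using L by (simp add: s_def put_def nth_append)
    have sL: "seg 0 m s = L" using L by (intro nth_equalityI) (auto simp: s_def put_def nth_append)
    have 1: "app (A m) (f b) s = u L * (if a = b then Hm' c i else 0)"
    proof -
      have t: "f b (put 0 (d # K) s) = (if d = i \<and> a = b then u (c # K) else 0)" if "length K = m - 1" for d K
      proof -
        have "put 0 (d # K) s m = a" "put 0 (d # K) s 0 = d" "seg (Suc 0) (m - Suc 0) (put 0 (d # K) s) = K"
          subgoal using put_at[of "d # K" m s] that m1 sm by simp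
          subgoal by (rule put_0_Cons)
          subgoal using that by (simp add: put_Cons)
          done
        then show ?thesis by (auto simp: f_def)
      qed
      have "(\<Sum>K | length K = m. v K * f b (put 0 K s)) = (\<Sum>d\<in>UNIV. \<Sum>K | length K = m - 1. if d = i then (if a = b then v (d # K) * u (c # K) else 0) else 0)"
        unfolding sum_m(1) by (intro sum.cong refl) (auto simp: t)
      also have "\<dots> = (if a = b then Hm' c i else 0)"
        by (subst sum.swap) (simp add: Hm'_def)
      finally show ?thesis by (simp add: app_A sL)
    qed
    have 2: "app (A m) (app ?A' (f b)) s = u L * (Gm a i * Gm' c b)"
    proof -
      have "app ?A' (f b) t = (if t 0 = i then u (seg (Suc 0) m t) * Gm' c b else 0)" for t
      proof -
        have t: "f b (put (Suc 0) (K @ [d]) t) = (if d = b then if t 0 = i then u (c # K) else 0 else 0)" if "length K = m - 1" for d K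
        proof -
          have "seg (Suc 0) (m - Suc 0) (put (Suc 0) (K @ [d]) t) = K"
            using that by (intro nth_equalityI) (auto simp: put_def nth_append)
          then show ?thesis using that m1 by (auto simp: f_def put_def nth_append)
        qed
        have "(\<Sum>K | length K = m. v K * f b (put (Suc 0) K t)) = (\<Sum>K | length K = m - 1. \<Sum>d\<in>UNIV. if d = b then (if t 0 = i then v (K @ [d]) * u (c # K) else 0) else 0)"
          unfolding sum_m(2) by (intro sum.cong refl) (auto simp: t)
        also have "\<dots> = (if t 0 = i then Gm' c b else 0)" by (simp add: Gm'_def mult.commute)
        finally show ?thesis by (simp add: app_A')
      qed
      moreover have "(if put 0 (d # K) s 0 = i then u (seg (Suc 0) m (put 0 (d # K) s)) * g else 0) = (if d = i then u (K @ [a]) * g else 0)" if "length K = m - 1" for d K g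
        using that m1 seg_put_shift'[of "d # K" s] by (auto simp: put_0_Cons sm)
      ultimately have "app (A m) (app ?A' (f b)) s = u L * (\<Sum>d\<in>UNIV. \<Sum>K | length K = m - 1. v (d # K) * (if d = i then u (K @ [a]) * Gm' c b else 0))"
        unfolding app_A sL sum_m(1) by simp
      also have "\<dots> = u L * (\<Sum>K | length K = m - 1. \<Sum>d\<in>UNIV. if d = i then v (d # K) * (u (K @ [a]) * Gm' c b) else 0)"
        by (subst sum.swap) (simp add: if_distrib[of "\<lambda>x. _ * x"] cong: if_cong)
      finally show ?thesis by (simp add: Gm_def sum_distrib_right mult.assoc)
    qed
    have 3: "al (m - 1) * app (A m) (app (r (m - 1)) (f b)) s = al (m - 1) * (u L * (\<Sum>x\<in>UNIV. \<Sum>y\<in>UNIV. R $ (x, a) $ (y, b) * Y x y))"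
    proof (cases "m = 1")
      case True then show ?thesis by (simp add: al_def)
    next
      case False
      then obtain m' where m': "m = Suc (Suc m')" using m1 by (metis One_nat_def Suc_le_D not0_implies_Suc)
      have rf: "app (r (m - 1)) (f b) t = (\<Sum>y\<in>UNIV. R $ (t (m - 1), t m) $ (y, b) * (if t 0 = i then u (c # seg (Suc 0) m' t @ [y]) else 0))" for t
      proof -
        have "seg (Suc 0) (Suc m') (t(Suc m' := y, Suc (Suc m') := d)) = seg (Suc 0) m' t @ [y]" for y d
          by (intro nth_equalityI) (auto simp: nth_append)
        then show ?thesis
          by (simp add: r_def num2_def app_op2 f_def m' if_distrib[of "\<lambda>x. _ * x"] if_if_eq_conj[symmetric] cong: if_cong)
             (auto intro!: sum.cong)
      qed
      have p: "put 0 (d # K @ [x]) s (m - 1) = x" "put 0 (d # K @ [x]) s m = a" "put 0 (d # K @ [x]) s 0 = d"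
          "seg (Suc 0) m' (put 0 (d # K @ [x]) s) = K" if "length K = m'" for d K x
        using that sm by (auto simp: put_def nth_append m' intro!: nth_equalityI)
      have split: "(\<Sum>K | length K = m. F K) = (\<Sum>d\<in>UNIV. \<Sum>K | length K = m'. \<Sum>x\<in>UNIV. F (d # K @ [x]))"
        for F :: "'n list \<Rightarrow> 'k"
        by (simp add: m' sum_length_Suc[of _ "Suc m'"] sum_length_snoc[of _ m'])
      have "(\<Sum>K | length K = m. v K * app (r (m - 1)) (f b) (put 0 K s))
        = (\<Sum>d\<in>UNIV. \<Sum>K | length K = m'. \<Sum>x\<in>UNIV. v (d # K @ [x]) * (\<Sum>y\<in>UNIV. R $ (x, a) $ (y, b) * (if d = i then u (c # K @ [y]) else 0)))"
        unfolding split rf by (intro sum.cong refl) (simp only: p mem_Collect_eq)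
      also have "\<dots> = (\<Sum>K | length K = m'. \<Sum>x\<in>UNIV. \<Sum>d\<in>UNIV. if d = i then v (d # K @ [x]) * (\<Sum>y\<in>UNIV. R $ (x, a) $ (y, b) * u (c # K @ [y])) else 0)"
        by (subst sum.swap, rule sum.cong[OF refl], subst sum.swap) (auto intro!: sum.cong)
      also have "\<dots> = (\<Sum>K | length K = m'. \<Sum>x\<in>UNIV. \<Sum>y\<in>UNIV. R $ (x, a) $ (y, b) * (v (i # K @ [x]) * u (c # K @ [y])))"
        by (simp add: sum_distrib_left mult_ac)
      also have "\<dots> = (\<Sum>x\<in>UNIV. \<Sum>y\<in>UNIV. \<Sum>K | length K = m'. R $ (x, a) $ (y, b) * (v (i # K @ [x]) * u (c # K @ [y])))"
        by (subst sum.swap, rule sum.cong[OF refl], rule sum.swap)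
      finally have fin: "(\<Sum>K | length K = m. v K * app (r (m - 1)) (f b) (put 0 K s)) = \<dots>" .
      show ?thesis unfolding app_A sL fin Y_def by (simp add: m' sum_distrib_left)
    qed
    have "u L * ((if a = b then Hm' c i else 0) - inverse q * al (m - 1) * (\<Sum>x\<in>UNIV. \<Sum>y\<in>UNIV. R $ (x, a) $ (y, b) * Y x y))
        = app (A m) (f b) s - inverse q * (al (m - 1) * app (A m) (app (r (m - 1)) (f b)) s)"
      unfolding 1 3 by (simp only: right_diff_distrib mult_ac)
    also have "\<dots> = u L * (al m * (Gm a i * Gm' c b))"
      using main[of b s] unfolding 2 by (simp add: mult_ac)
    finally show ?thesis using L(2) by simp
  qed
  then show ?thesis by blast
qed

text \<open>A one-sided inverse for the contraction with R over its first leg.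
  \<open>Y_relation\<close> and \<open>H_trace\<close> solve the equation for right hand sides of
  the form \<open>Gm a i * Gm' c b\<close>; since both matrices are invertible, these span all right
  hand sides.\<close>

lemma Psi_hat:
  "\<exists>P. \<forall>a b j k. (\<Sum>x\<in>UNIV. \<Sum>y\<in>UNIV. R $ (x, a) $ (y, b) * P x y j k) = (if a = j \<and> k = b then 1 else 0)"
proof -
  obtain F where F: "\<And>a b. (\<Sum>c\<in>UNIV. F a c * Gm c b) = (if a = b then 1 else 0)" using Gm_inverse by blast
  obtain F' where F': "\<And>a b. (\<Sum>c\<in>UNIV. Gm' a c * F' c b) = (if a = b then 1 else 0)" using Gm'_inverse by blast
  have GF: "(\<Sum>c\<in>UNIV. Gm a c * F c b) = (if a = b then 1 else 0)" for a b by (rule matrix_left_right[OF F])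
  have FG: "(\<Sum>c\<in>UNIV. F' a c * Gm' c b) = (if a = b then 1 else 0)" for a b by (rule matrix_left_right[OF F'])
  define Y where "Y c i = (SOME Y. \<forall>a b. (if a = b then Hm' c i else 0) - inverse q * al (m - 1) * (\<Sum>x\<in>UNIV. \<Sum>y\<in>UNIV. R $ (x, a) $ (y, b) * Y x y)
     = al m * (Gm a i * Gm' c b))" for c i
  have Y: "(if a = b then Hm' c i else 0) - inverse q * al (m - 1) * (\<Sum>x\<in>UNIV. \<Sum>y\<in>UNIV. R $ (x, a) $ (y, b) * Y c i x y)
     = al m * (Gm a i * Gm' c b)" for c i a b
    using someI_ex[OF Y_relation[of c i]] unfolding Y_def by blast
  have am: "al m \<noteq> 0" using al_nz[OF m1] .
  have qm: "q ^ m \<noteq> 0" using q_nz by simp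
  \<comment> \<open>\<open>Y_relation\<close> solved for the product of \<open>Gm\<close> and
    \<open>Gm'\<close>: the diagonal term with \<open>Hm'\<close> is itself a contraction with R, by
    \<open>H_trace\<close>.\<close>
  define W where "W c i x y = (Hm' c i * (qnum q m / q ^ m * Hm y x) - inverse q * al (m - 1) * Y c i x y) / al m" for c i x y
  have W: "(\<Sum>x\<in>UNIV. \<Sum>y\<in>UNIV. R $ (x, a) $ (y, b) * W c i x y) = Gm a i * Gm' c b" for a b c i
  proof -
    have H: "qnum q m / q ^ m * (\<Sum>x\<in>UNIV. \<Sum>y\<in>UNIV. R $ (x, a) $ (y, b) * Hm y x) = (if a = b then 1 else 0)"
      using H_trace[of a b] qm by (simp add: field_simps split: if_splits)
    have "al m * (\<Sum>x\<in>UNIV. \<Sum>y\<in>UNIV. R $ (x, a) $ (y, b) * W c i x y)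
      = (\<Sum>x\<in>UNIV. \<Sum>y\<in>UNIV. Hm' c i * (qnum q m / q ^ m) * (R $ (x, a) $ (y, b) * Hm y x) - inverse q * al (m - 1) * (R $ (x, a) $ (y, b) * Y c i x y))"
      unfolding sum_distrib_left using am by (intro sum.cong refl) (simp add: W_def field_simps)
    also have "\<dots> = Hm' c i * (qnum q m / q ^ m * (\<Sum>x\<in>UNIV. \<Sum>y\<in>UNIV. R $ (x, a) $ (y, b) * Hm y x))
        - inverse q * al (m - 1) * (\<Sum>x\<in>UNIV. \<Sum>y\<in>UNIV. R $ (x, a) $ (y, b) * Y c i x y)"
      by (simp only: sum_subtractf sum_distrib_left mult.assoc)
    also have "\<dots> = al m * (Gm a i * Gm' c b)"
      unfolding H Y[symmetric] by simp
    finally show ?thesis using am by simp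
  qed
  define P where "P x y j k = (\<Sum>i\<in>UNIV. \<Sum>c\<in>UNIV. F' k c * (F i j * W c i x y))" for x y j k
  have "(\<Sum>x\<in>UNIV. \<Sum>y\<in>UNIV. R $ (x, a) $ (y, b) * P x y j k) = (if a = j \<and> k = b then 1 else 0)" for a b j k
  proof -
    have "(\<Sum>x\<in>UNIV. \<Sum>y\<in>UNIV. R $ (x, a) $ (y, b) * P x y j k)
        = (\<Sum>x\<in>UNIV. \<Sum>y\<in>UNIV. \<Sum>i\<in>UNIV. \<Sum>c\<in>UNIV. F' k c * (F i j * (R $ (x, a) $ (y, b) * W c i x y)))"
      unfolding P_def by (simp add: sum_distrib_left mult_ac)
    also have "\<dots> = (\<Sum>x\<in>UNIV. \<Sum>i\<in>UNIV. \<Sum>c\<in>UNIV. \<Sum>y\<in>UNIV. F' k c * (F i j * (R $ (x, a) $ (y, b) * W c i x y)))"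
      by (rule sum.cong[OF refl], subst sum.swap, rule sum.cong[OF refl], rule sum.swap)
    also have "\<dots> = (\<Sum>i\<in>UNIV. \<Sum>c\<in>UNIV. \<Sum>x\<in>UNIV. \<Sum>y\<in>UNIV. F' k c * (F i j * (R $ (x, a) $ (y, b) * W c i x y)))"
      by (subst sum.swap, rule sum.cong[OF refl], rule sum.swap)
    also have "\<dots> = (\<Sum>i\<in>UNIV. \<Sum>c\<in>UNIV. F' k c * (F i j * (Gm a i * Gm' c b)))"
      by (simp only: sum_distrib_left[symmetric] W)
    also have "\<dots> = (\<Sum>i\<in>UNIV. Gm a i * F i j) * (\<Sum>c\<in>UNIV. F' k c * Gm' c b)"
      unfolding sum_product by (simp add: mult_ac)
    finally show ?thesis unfolding GF FG by auto
  qed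
  then show ?thesis by blast
qed

end

lemma numGL_exists:
  fixes R :: "('k::field_char_0, 'n::finite) mat2"
  assumes "GL_type q m R"
  obtains u v where "numGL R q m u v"
proof -
  interpret GL "\<lambda>x. x" R q m by unfold_locales (auto simp: assms)
  obtain u v I0 J0 where uv: "\<And>I J. length I = m \<Longrightarrow> antisym q R m m I J = u I * v J"
    and I0: "length I0 = m" "antisym q R m m I0 J0 \<noteq> 0"
    using trank_1_factor[of m "antisym q R m m"] assms unfolding GL_type_def by blast
  have "tmul m (antisym q R m m) (antisym q R m m) = antisym q R m m" using assms by (simp add: GL_type_def)
  then have "antisym q R m m I0 J0 = (\<Sum>K | length K = m. antisym q R m m I0 K * antisym q R m m K J0)"
    by (simp add: tmul_def fun_eq_iff)
  also have "\<dots> = u I0 * v J0 * (\<Sum>K | length K = m. v K * u K)"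
    by (simp add: uv I0 sum_distrib_left mult_ac)
  finally have "(\<Sum>K | length K = m. v K * u K) = 1" using uv[OF I0(1), of J0] I0(2) by simp
  then have "numGL R q m u v" using uv by unfold_locales
  then show ?thesis by (rule that)
qed


lemma sum_if_const: "(\<Sum>y\<in>S. if P then g y else 0) = (if P then \<Sum>y\<in>S. g y else (0::'a::comm_monoid_add))"
  by simp

lemma mult_if_delta:
  "x * (if P then y else 0) = (if P then x * y else (0::'a::mult_zero))"
  "(if P then y else 0) * x = (if P then y * x else 0)"
  by auto

lemma sum_swap_pairs:
  fixes f :: "'b::finite \<Rightarrow> 'b \<Rightarrow> 'c::finite \<Rightarrow> 'c \<Rightarrow> 'a::comm_monoid_add"
  shows "(\<Sum>a\<in>UNIV. \<Sum>b\<in>UNIV. \<Sum>c\<in>UNIV. \<Sum>d\<in>UNIV. f a b c d) = (\<Sum>c\<in>UNIV. \<Sum>d\<in>UNIV. \<Sum>a\<in>UNIV. \<Sum>b\<in>UNIV. f a b c d)"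
proof -
  have "(\<Sum>a\<in>UNIV. \<Sum>b\<in>UNIV. \<Sum>c\<in>UNIV. \<Sum>d\<in>UNIV. f a b c d) = (\<Sum>a\<in>UNIV. \<Sum>c\<in>UNIV. \<Sum>b\<in>UNIV. \<Sum>d\<in>UNIV. f a b c d)"
    by (intro sum.cong[OF refl] sum.swap)
  also have "\<dots> = (\<Sum>c\<in>UNIV. \<Sum>a\<in>UNIV. \<Sum>b\<in>UNIV. \<Sum>d\<in>UNIV. f a b c d)"
    by (rule sum.swap)
  also have "\<dots> = (\<Sum>c\<in>UNIV. \<Sum>a\<in>UNIV. \<Sum>d\<in>UNIV. \<Sum>b\<in>UNIV. f a b c d)"
    by (intro sum.cong[OF refl] sum.swap)
  also have "\<dots> = (\<Sum>c\<in>UNIV. \<Sum>d\<in>UNIV. \<Sum>a\<in>UNIV. \<Sum>b\<in>UNIV. f a b c d)"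
    by (intro sum.cong[OF refl] sum.swap)
  finally show ?thesis .
qed

lemma sum_delta_pair:
  fixes g :: "'b::finite \<Rightarrow> 'b \<Rightarrow> 'a::semiring_1"
  shows "(\<Sum>a\<in>UNIV. \<Sum>b\<in>UNIV. (if b = y \<and> x = a then 1 else 0) * g a b) = g x y"
    "(\<Sum>a\<in>UNIV. \<Sum>b\<in>UNIV. (if a = x \<and> b = y then 1 else 0) * g a b) = g x y"
proof -
  have "(\<Sum>a\<in>UNIV. \<Sum>b\<in>UNIV. (if b = y \<and> x = a then 1 else 0) * g a b) = (\<Sum>a\<in>UNIV. \<Sum>b\<in>UNIV. if x = a then if b = y then g a b else 0 else 0)"
    "(\<Sum>a\<in>UNIV. \<Sum>b\<in>UNIV. (if a = x \<and> b = y then 1 else 0) * g a b) = (\<Sum>a\<in>UNIV. \<Sum>b\<in>UNIV. if a = x then if b = y then g a b else 0 else 0)"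
    by (intro sum.cong refl; auto)+
  then show "(\<Sum>a\<in>UNIV. \<Sum>b\<in>UNIV. (if b = y \<and> x = a then 1 else 0) * g a b) = g x y"
    "(\<Sum>a\<in>UNIV. \<Sum>b\<in>UNIV. (if a = x \<and> b = y then 1 else 0) * g a b) = g x y"
    by (simp_all add: sum_if_const)
qed

section \<open>The skew inverse and the R-trace\<close>

lemma trace_mid_on2:
  fixes A B :: "('k::field, 'n::finite) mat2"
  shows "trace_mid (tmul 3 (on2 3 1 A) (on2 3 2 B)) $ (i, j) $ (k, l)
     = (\<Sum>a\<in>UNIV. \<Sum>b\<in>UNIV. A $ (i, a) $ (k, b) * B $ (b, j) $ (a, l))"
proof -
  have 1: "on2 3 1 A [i, a, j] [x, y, z] = (if z = j then A $ (i, a) $ (x, y) else 0)" for i a j x y z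
    by (auto simp: on2_def numeral_3_eq_3 All_less_Suc)
  have 2: "on2 3 2 B [x, y, z] [k, a, l] = (if x = k then B $ (y, z) $ (a, l) else 0)" for x y z k a l
    by (auto simp: on2_def numeral_3_eq_3 numeral_2_eq_2 All_less_Suc)
  have "tmul 3 (on2 3 1 A) (on2 3 2 B) [i, a, j] [k, a, l]
      = (\<Sum>x\<in>UNIV. \<Sum>y\<in>UNIV. \<Sum>z\<in>UNIV. on2 3 1 A [i, a, j] [x, y, z] * on2 3 2 B [x, y, z] [k, a, l])" for a
    unfolding tmul_def by (simp only: numeral_3_eq_3 sum_length_Suc) simp
  also have "(\<Sum>x\<in>UNIV. \<Sum>y\<in>UNIV. \<Sum>z\<in>UNIV. on2 3 1 A [i, a, j] [x, y, z] * on2 3 2 B [x, y, z] [k, a, l])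
     = (\<Sum>b\<in>UNIV. A $ (i, a) $ (k, b) * B $ (b, j) $ (a, l))" for a
    unfolding 1 2 by (simp add: mult_if_delta sum_if_const)
  finally show ?thesis by (simp add: trace_mid_def)
qed

lemma is_skew_inverse_iff:
  fixes R Psi :: "('k::field, 'n::finite) mat2"
  shows "is_skew_inverse R Psi \<longleftrightarrow>
    (\<forall>i j k l. (\<Sum>a\<in>UNIV. \<Sum>b\<in>UNIV. R $ (i, a) $ (k, b) * Psi $ (b, j) $ (a, l)) = (if k = j \<and> i = l then 1 else 0)) \<and>
    (\<forall>i j k l. (\<Sum>a\<in>UNIV. \<Sum>b\<in>UNIV. Psi $ (i, a) $ (k, b) * R $ (b, j) $ (a, l)) = (if k = j \<and> i = l then 1 else 0))"
  unfolding is_skew_inverse_def vec_eq_iff split_paired_all split_paired_All trace_mid_on2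
  by (auto simp: flip_mat_def)

text \<open>With regrouped indices the two conditions say that square matrices of size n^2, one made
  from Psi and one from R, are inverse to each other. A one-sided inverse, given by
  \<open>Psi_hat\<close>, is thus two-sided and unique.\<close>

lemma skew_inverse_exists:
  fixes R :: "('k::field_char_0, 'n::finite) mat2"
  assumes "GL_type q m R"
  shows "\<exists>!Psi. is_skew_inverse R Psi"
proof -
  obtain u v where "numGL R q m u v" using numGL_exists[OF assms] .
  then interpret numGL R q m u v .
  obtain P where P: "\<And>a b j k. (\<Sum>x\<in>UNIV. \<Sum>y\<in>UNIV. R $ (x, a) $ (y, b) * P x y j k) = (if a = j \<and> k = b then 1 else 0)"
    using Psi_hat by blast
  define Psi :: "('k, 'n) mat2" where "Psi = (\<chi> p p'. P (snd p') (snd p) (fst p') (fst p))"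
  have two: "(\<Sum>a\<in>UNIV. \<Sum>b\<in>UNIV. Psi $ (i, a) $ (k, b) * R $ (b, j) $ (a, l)) = (if k = j \<and> i = l then 1 else 0)" for i j k l
  proof -
    have "(\<Sum>a\<in>UNIV. \<Sum>b\<in>UNIV. Psi $ (i, a) $ (k, b) * R $ (b, j) $ (a, l)) = (\<Sum>x\<in>UNIV. \<Sum>y\<in>UNIV. R $ (x, j) $ (y, l) * P x y k i)"
      unfolding Psi_def by (subst sum.swap) (simp add: mult.commute)
    then show ?thesis unfolding P by auto
  qed
  define F where "F Ps = (\<lambda>(i, k) (a, b). Ps $ (i, a) $ (k, b))" for Ps :: "('k, 'n) mat2"
  define G where "G = (\<lambda>(a, b) (l, j). R $ (b, j) $ (a, l))"
  have pairs: "(\<Sum>c\<in>UNIV. H c) = (\<Sum>a\<in>UNIV. \<Sum>b\<in>UNIV. H (a, b))" for H :: "'n \<times> 'n \<Rightarrow> 'k"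
    by (simp add: sum.cartesian_product UNIV_Times_UNIV[symmetric] del: UNIV_Times_UNIV)
  have FG_iff: "(\<forall>p s. (\<Sum>c\<in>UNIV. F Ps p c * G c s) = (if p = s then 1 else 0)) \<longleftrightarrow>
      (\<forall>i j k l. (\<Sum>a\<in>UNIV. \<Sum>b\<in>UNIV. Ps $ (i, a) $ (k, b) * R $ (b, j) $ (a, l)) = (if k = j \<and> i = l then 1 else 0))" for Ps
    unfolding split_paired_All pairs by (auto simp: F_def G_def conj_commute)
  have GF_iff: "(\<forall>p s. (\<Sum>c\<in>UNIV. G p c * F Ps c s) = (if p = s then 1 else 0)) \<longleftrightarrow>
      (\<forall>i j k l. (\<Sum>a\<in>UNIV. \<Sum>b\<in>UNIV. R $ (i, a) $ (k, b) * Ps $ (b, j) $ (a, l)) = (if k = j \<and> i = l then 1 else 0))" for Ps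
  proof -
    have "(\<Sum>x\<in>UNIV. \<Sum>y\<in>UNIV. G (k, i) (x, y) * F Ps (x, y) (j, l)) = (\<Sum>a\<in>UNIV. \<Sum>b\<in>UNIV. R $ (i, a) $ (k, b) * Ps $ (b, j) $ (a, l))" for i j k l
      unfolding F_def G_def by (subst sum.swap) simp
    then show ?thesis unfolding split_paired_All pairs by (auto simp: conj_commute)
  qed
  have FG: "(\<Sum>c\<in>UNIV. F Psi p c * G c s) = (if p = s then 1 else 0)" for p s
    using FG_iff[of Psi] two by blast
  have GF: "(\<Sum>c\<in>UNIV. G p c * F Psi c s) = (if p = s then 1 else 0)" for p s
    by (rule matrix_left_right[OF FG])
  show ?thesis
  proof (rule ex1I)
    show "is_skew_inverse R Psi"
      unfolding is_skew_inverse_iff using two GF GF_iff[of Psi] by blast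
    fix Ps assume "is_skew_inverse R Ps"
    then have Ps: "(\<Sum>c\<in>UNIV. G p c * F Ps c s) = (if p = s then 1 else 0)" for p s
      unfolding is_skew_inverse_iff using GF_iff[of Ps] by blast
    have "F Psi p s = F Ps p s" for p s
    proof -
      have "F Psi p s = (\<Sum>c\<in>UNIV. F Psi p c * (\<Sum>d\<in>UNIV. G c d * F Ps d s))"
        unfolding Ps by (simp add: sum_delta_mult)
      also have "\<dots> = (\<Sum>d\<in>UNIV. (\<Sum>c\<in>UNIV. F Psi p c * G c d) * F Ps d s)"
        by (simp add: sum_distrib_left sum_distrib_right mult.assoc) (rule sum.swap)
      also have "\<dots> = F Ps p s" unfolding FG by (simp add: sum_delta_mult)
      finally show ?thesis .
    qed
    then have "F Ps (i, k) (a, b) = F Psi (i, k) (a, b)" for i k a b by simp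
    then show "Ps = Psi" unfolding vec_eq_iff split_paired_All F_def by simp
  qed
qed

context GL
begin

abbreviation Psi where "Psi \<equiv> skew_inverse R"
abbreviation C where "C \<equiv> C_mat R"

lemma skew: "is_skew_inverse R Psi"
  unfolding skew_inverse_def by (rule theI'[OF skew_inverse_exists[OF GL]])

lemma R_Psi: "(\<Sum>a\<in>UNIV. \<Sum>b\<in>UNIV. R $ (i, a) $ (k, b) * Psi $ (b, j) $ (a, l)) = (if k = j \<and> i = l then 1 else 0)"
  and Psi_R: "(\<Sum>a\<in>UNIV. \<Sum>b\<in>UNIV. Psi $ (i, a) $ (k, b) * R $ (b, j) $ (a, l)) = (if k = j \<and> i = l then 1 else 0)"
  using skew unfolding is_skew_inverse_iff by blast+

text \<open>The device for removing an R from an identity: the contraction with R over one leg is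
  inverted by Psi. The unknown may have values in a noncommutative ring.\<close>

lemma solve_R:
  assumes "\<And>j c. (\<Sum>a\<in>UNIV. \<Sum>b\<in>UNIV. \<kappa> (R $ (a, j) $ (b, c)) * g a b) = h j c"
  shows "g x y = (\<Sum>j\<in>UNIV. \<Sum>c\<in>UNIV. \<kappa> (Psi $ (c, y) $ (j, x)) * h j c)"
proof -
  have "(\<Sum>j\<in>UNIV. \<Sum>c\<in>UNIV. \<kappa> (Psi $ (c, y) $ (j, x)) * h j c)
     = (\<Sum>j\<in>UNIV. \<Sum>c\<in>UNIV. \<Sum>a\<in>UNIV. \<Sum>b\<in>UNIV. \<kappa> (R $ (a, j) $ (b, c) * Psi $ (c, y) $ (j, x)) * g a b)"
    unfolding assms[symmetric]
    by (simp add: sum_distrib_left \<kappa>_mult[symmetric] mult.assoc[symmetric] mult.commute[of "Psi $ _ $ _"])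
  also have "\<dots> = (\<Sum>a\<in>UNIV. \<Sum>b\<in>UNIV. \<Sum>j\<in>UNIV. \<Sum>c\<in>UNIV. \<kappa> (R $ (a, j) $ (b, c) * Psi $ (c, y) $ (j, x)) * g a b)"
    by (rule sum_swap_pairs)
  also have "\<dots> = (\<Sum>a\<in>UNIV. \<Sum>b\<in>UNIV. (if b = y \<and> a = x then 1 else 0) * g a b)"
    by (simp only: sum_distrib_right[symmetric] \<kappa>_sum[symmetric] R_Psi) (simp add: \<kappa>_0 \<kappa>_1 if_distrib[of \<kappa>] cong: if_cong)
  finally show ?thesis by (simp add: eq_commute[of _ x] sum_delta_pair)
qed

text \<open>The defining relation of Psi, with its last leg traced out: Tr_(2) R_12 C_2 = I.\<close>

lemma trace_R: "(\<Sum>a\<in>UNIV. \<Sum>b\<in>UNIV. R $ (i, a) $ (k, b) * C b a) = (if i = k then 1 else 0)"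
proof -
  have "(\<Sum>a\<in>UNIV. \<Sum>b\<in>UNIV. R $ (i, a) $ (k, b) * C b a)
     = (\<Sum>a\<in>UNIV. \<Sum>b\<in>UNIV. \<Sum>j\<in>UNIV. R $ (i, a) $ (k, b) * Psi $ (b, j) $ (a, j))"
    by (simp add: C_mat_def sum_distrib_left)
  also have "\<dots> = (\<Sum>a\<in>UNIV. \<Sum>j\<in>UNIV. \<Sum>b\<in>UNIV. R $ (i, a) $ (k, b) * Psi $ (b, j) $ (a, j))"
    by (rule sum.cong[OF refl], rule sum.swap)
  also have "\<dots> = (\<Sum>j\<in>UNIV. \<Sum>a\<in>UNIV. \<Sum>b\<in>UNIV. R $ (i, a) $ (k, b) * Psi $ (b, j) $ (a, j))"
    by (rule sum.swap)
  also have "\<dots> = (\<Sum>j\<in>UNIV. if k = j \<and> i = j then 1 else 0)" unfolding R_Psi ..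
  also have "\<dots> = (\<Sum>j\<in>UNIV. if j = k then (if i = k then 1 else 0) else 0)"
    by (intro sum.cong) auto
  finally show ?thesis by simp
qed

end

text \<open>The Yang--Baxter equation gives $\mathrm{Tr}_{(3)} S_{23} R_{12} S'_{23} C_3 = I$ for
  $\{S, S'\} = \{R, R^{-1}\}$; then $R_{12}$ is removed with the skew inverse.\<close>

locale GLid = GL "\<lambda>x. x" R q m for R :: "('k::field_char_0, 'n::finite) mat2" and q :: 'k and m :: nat
begin

lemma trace_strip:
  fixes S S' :: "('k, 'n) mat2"
  assumes S: "S ** S' = mat 1"
    and B: "num2 1 S' * num2 0 R * num2 1 S = num2 0 S * num2 1 R * num2 0 S'"
  shows "(\<Sum>a\<in>UNIV. \<Sum>b\<in>UNIV. \<Sum>c\<in>UNIV. S' $ (j, a) $ (p, c) * S $ (z, c) $ (l, b) * C b a) = (if j = l then C z p else 0)"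
proof -
  define Q where "Q p z = (\<Sum>a\<in>UNIV. \<Sum>b\<in>UNIV. \<Sum>c\<in>UNIV. S' $ (j, a) $ (p, c) * S $ (z, c) $ (l, b) * C b a)" for p z
  have entry: "(\<Sum>x\<in>UNIV. \<Sum>y\<in>UNIV. S' $ (j, a) $ (x, y) * (\<Sum>x'\<in>UNIV. \<Sum>y'\<in>UNIV. R $ (i, x) $ (x', y') *
        (\<Sum>x''\<in>UNIV. \<Sum>y''\<in>UNIV. S $ (y', y) $ (x'', y'') * F x' x'' y'')))
    = (\<Sum>x\<in>UNIV. \<Sum>y\<in>UNIV. S $ (i, j) $ (x, y) * (\<Sum>x'\<in>UNIV. \<Sum>y'\<in>UNIV. R $ (y, a) $ (x', y') *
        (\<Sum>x''\<in>UNIV. \<Sum>y''\<in>UNIV. S' $ (x, x') $ (x'', y'') * F x'' y'' y')))" for i a and F :: "'n \<Rightarrow> 'n \<Rightarrow> 'n \<Rightarrow> 'k"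
  proof -
    define f where "f = (\<lambda>s::nat \<Rightarrow> 'n. F (s 0) (s 1) (s 2))"
    define s where "s = (\<lambda>n::nat. if n = 0 then i else if n = 1 then j else a)"
    have "app (num2 1 S' * num2 0 R * num2 1 S) f s = app (num2 0 S * num2 1 R * num2 0 S') f s"
      by (simp only: B)
    then show ?thesis
      by (simp add: num2_def app_op2 f_def s_def numeral_2_eq_2)
  qed
  have "(\<Sum>p\<in>UNIV. \<Sum>z\<in>UNIV. R $ (i, p) $ (k, z) * Q p z) = (if i = k \<and> j = l then 1 else 0)" for i k
  proof -
    \<comment> \<open>Basis indices k, l in the first two legs and the weight C in the third, so
      that the sum of \<open>entry\<close> over \<open>a\<close> is the third partial trace of both
      sides of \<open>B\<close>.\<close>
    define F where "F a = (\<lambda>x' x'' y''. if x' = k then if x'' = l then C y'' a else 0 else 0)" for a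
    have 1: "(\<Sum>p\<in>UNIV. \<Sum>z\<in>UNIV. R $ (i, p) $ (k, z) * Q p z) = (\<Sum>a\<in>UNIV. \<Sum>x\<in>UNIV. \<Sum>y\<in>UNIV. S' $ (j, a) $ (x, y) * (\<Sum>x'\<in>UNIV. \<Sum>y'\<in>UNIV. R $ (i, x) $ (x', y') *
        (\<Sum>x''\<in>UNIV. \<Sum>y''\<in>UNIV. S $ (y', y) $ (x'', y'') * F a x' x'' y'')))"
    proof -
      have "(\<Sum>p\<in>UNIV. \<Sum>z\<in>UNIV. R $ (i, p) $ (k, z) * Q p z)
        = (\<Sum>p\<in>UNIV. \<Sum>z\<in>UNIV. \<Sum>a\<in>UNIV. \<Sum>b\<in>UNIV. \<Sum>c\<in>UNIV. R $ (i, p) $ (k, z) * (S' $ (j, a) $ (p, c) * S $ (z, c) $ (l, b) * C b a))"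
        by (simp add: Q_def sum_distrib_left)
      also have "\<dots> = (\<Sum>a\<in>UNIV. \<Sum>b\<in>UNIV. \<Sum>p\<in>UNIV. \<Sum>z\<in>UNIV. \<Sum>c\<in>UNIV. R $ (i, p) $ (k, z) * (S' $ (j, a) $ (p, c) * S $ (z, c) $ (l, b) * C b a))"
        by (rule sum_swap_pairs)
      also have "\<dots> = (\<Sum>a\<in>UNIV. \<Sum>p\<in>UNIV. \<Sum>b\<in>UNIV. \<Sum>c\<in>UNIV. \<Sum>z\<in>UNIV. R $ (i, p) $ (k, z) * (S' $ (j, a) $ (p, c) * S $ (z, c) $ (l, b) * C b a))"
        by (rule sum.cong[OF refl], subst sum.swap, rule sum.cong[OF refl], rule sum.cong[OF refl], rule sum.swap)
      also have "\<dots> = (\<Sum>a\<in>UNIV. \<Sum>p\<in>UNIV. \<Sum>c\<in>UNIV. \<Sum>z\<in>UNIV. \<Sum>b\<in>UNIV. R $ (i, p) $ (k, z) * (S' $ (j, a) $ (p, c) * S $ (z, c) $ (l, b) * C b a))"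
        by (rule sum.cong[OF refl], rule sum.cong[OF refl], subst sum.swap, rule sum.cong[OF refl], rule sum.swap)
      finally show ?thesis
        by (simp add: F_def mult_if_delta sum_if_const sum_distrib_left mult_ac)
    qed
    have 2: "(\<Sum>a\<in>UNIV. \<Sum>x\<in>UNIV. \<Sum>y\<in>UNIV. S $ (i, j) $ (x, y) * (\<Sum>x'\<in>UNIV. \<Sum>y'\<in>UNIV. R $ (y, a) $ (x', y') *
        (\<Sum>x''\<in>UNIV. \<Sum>y''\<in>UNIV. S' $ (x, x') $ (x'', y'') * F a x'' y'' y')))
      = (\<Sum>x\<in>UNIV. \<Sum>y\<in>UNIV. S $ (i, j) $ (x, y) * S' $ (x, y) $ (k, l))"
    proof -
      have "(\<Sum>a\<in>UNIV. \<Sum>x\<in>UNIV. \<Sum>y\<in>UNIV. S $ (i, j) $ (x, y) * (\<Sum>x'\<in>UNIV. \<Sum>y'\<in>UNIV. R $ (y, a) $ (x', y') *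
        (\<Sum>x''\<in>UNIV. \<Sum>y''\<in>UNIV. S' $ (x, x') $ (x'', y'') * F a x'' y'' y')))
       = (\<Sum>a\<in>UNIV. \<Sum>x\<in>UNIV. \<Sum>y\<in>UNIV. \<Sum>x'\<in>UNIV. \<Sum>y'\<in>UNIV. S $ (i, j) $ (x, y) * S' $ (x, x') $ (k, l) * (R $ (y, a) $ (x', y') * C y' a))"
        by (simp add: F_def mult_if_delta sum_if_const sum_distrib_left mult_ac)
      also have "\<dots> = (\<Sum>x\<in>UNIV. \<Sum>y\<in>UNIV. \<Sum>a\<in>UNIV. \<Sum>x'\<in>UNIV. \<Sum>y'\<in>UNIV. S $ (i, j) $ (x, y) * S' $ (x, x') $ (k, l) * (R $ (y, a) $ (x', y') * C y' a))"
        by (subst sum.swap, rule sum.cong[OF refl], rule sum.swap)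
      also have "\<dots> = (\<Sum>x\<in>UNIV. \<Sum>y\<in>UNIV. \<Sum>x'\<in>UNIV. S $ (i, j) $ (x, y) * S' $ (x, x') $ (k, l) * (\<Sum>a\<in>UNIV. \<Sum>y'\<in>UNIV. R $ (y, a) $ (x', y') * C y' a))"
        unfolding sum_distrib_left by (rule sum.cong[OF refl], rule sum.cong[OF refl], rule sum.swap)
      finally show ?thesis unfolding trace_R by (simp add: mult_if_delta)
    qed
    have 3: "(\<Sum>x\<in>UNIV. \<Sum>y\<in>UNIV. S $ (i, j) $ (x, y) * S' $ (x, y) $ (k, l)) = (S ** S') $ (i, j) $ (k, l)"
      unfolding matrix_matrix_mult_def
      by (simp add: sum.cartesian_product UNIV_Times_UNIV[symmetric] case_prod_unfold del: UNIV_Times_UNIV)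
    show ?thesis unfolding 1 entry 2 3 S by (simp add: mat_def)
  qed
  then have e: "(\<Sum>p\<in>UNIV. \<Sum>z\<in>UNIV. R $ (i, p) $ (k, z) * Q p z) = (if i = k then (if j = l then 1 else 0) else 0)" for i k by auto
  \<comment> \<open>Now \<open>Psi_R\<close> removes the R in front of \<open>Q\<close>; what
    remains is the partial trace of Psi that defines C.\<close>
  have "Q p z = (\<Sum>k\<in>UNIV. \<Sum>i\<in>UNIV. Psi $ (z, k) $ (p, i) * (\<Sum>p'\<in>UNIV. \<Sum>z'\<in>UNIV. R $ (i, p') $ (k, z') * Q p' z'))"
  proof -
    have "(\<Sum>k\<in>UNIV. \<Sum>i\<in>UNIV. Psi $ (z, k) $ (p, i) * (\<Sum>p'\<in>UNIV. \<Sum>z'\<in>UNIV. R $ (i, p') $ (k, z') * Q p' z'))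
      = (\<Sum>k\<in>UNIV. \<Sum>i\<in>UNIV. \<Sum>p'\<in>UNIV. \<Sum>z'\<in>UNIV. Psi $ (z, k) $ (p, i) * R $ (i, p') $ (k, z') * Q p' z')"
      by (simp add: sum_distrib_left mult.assoc)
    also have "\<dots> = (\<Sum>p'\<in>UNIV. \<Sum>z'\<in>UNIV. \<Sum>k\<in>UNIV. \<Sum>i\<in>UNIV. Psi $ (z, k) $ (p, i) * R $ (i, p') $ (k, z') * Q p' z')"
      by (rule sum_swap_pairs)
    also have "\<dots> = (\<Sum>p'\<in>UNIV. \<Sum>z'\<in>UNIV. (if p = p' \<and> z = z' then 1 else 0) * Q p' z')"
      by (simp only: sum_distrib_right[symmetric] Psi_R)
    also have "\<dots> = Q p z"
      using sum_delta_pair(2)[of p z Q] by (simp add: eq_commute[of p] eq_commute[of z])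
    finally show ?thesis by simp
  qed
  also have "\<dots> = (if j = l then C z p else 0)"
    unfolding e C_mat_def by (simp add: mult_if_delta sum_if_const)
  finally show ?thesis unfolding Q_def .
qed

lemma trace_conj:
  "(\<Sum>a\<in>UNIV. \<Sum>b\<in>UNIV. \<Sum>c\<in>UNIV. matrix_inv R $ (j, a) $ (p, c) * R $ (z, c) $ (l, b) * C b a) = (if j = l then C z p else 0)"
  "(\<Sum>a\<in>UNIV. \<Sum>b\<in>UNIV. \<Sum>c\<in>UNIV. R $ (j, a) $ (p, c) * matrix_inv R $ (z, c) $ (l, b) * C b a) = (if j = l then C z p else 0)"
proof -
  have b: "r 0 * (r 1 * r 0) = r 1 * (r 0 * r 1)" using braid[of 0] by (simp add: mult.assoc)
  have "ri 1 * r 0 * r 1 = r 0 * r 1 * ri 0"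
  proof -
    have "ri 1 * (r 0 * (r 1 * r 0)) * ri 0 = ri 1 * (r 1 * (r 0 * r 1)) * ri 0" unfolding b ..
    then show ?thesis by (simp add: mult.assoc r_ri r_cancel)
  qed
  then show "(\<Sum>a\<in>UNIV. \<Sum>b\<in>UNIV. \<Sum>c\<in>UNIV. matrix_inv R $ (j, a) $ (p, c) * R $ (z, c) $ (l, b) * C b a) = (if j = l then C z p else 0)"
    by (intro trace_strip) (simp_all add: matrix_inv_both[OF R_inv] r_def ri_def)
  have "r 1 * r 0 * ri 1 = ri 0 * r 1 * r 0"
  proof -
    have "ri 0 * (r 0 * (r 1 * r 0)) * ri 1 = ri 0 * (r 1 * (r 0 * r 1)) * ri 1" unfolding b ..
    then show ?thesis by (simp add: mult.assoc r_ri r_cancel)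
  qed
  then show "(\<Sum>a\<in>UNIV. \<Sum>b\<in>UNIV. \<Sum>c\<in>UNIV. R $ (j, a) $ (p, c) * matrix_inv R $ (z, c) $ (l, b) * C b a) = (if j = l then C z p else 0)"
    by (intro trace_strip) (simp_all add: matrix_inv_both[OF R_inv] r_def ri_def)
qed

section \<open>R-traces of the antisymmetrizers\<close>

abbreviation An where "An k \<equiv> antisym q R k k"
definition trC where "trC = (\<Sum>a\<in>UNIV. C a a)"

lemma put_snoc: "length K = N \<Longrightarrow> put 0 (K @ [a]) s = (put 0 K s)(N := a)"
  by (auto simp: put_def fun_eq_iff nth_append)

lemma seg_upd_above: "N \<le> l \<Longrightarrow> seg 0 N (s(l := a)) = seg 0 N s"
  by (auto simp: seg_def)

lemma app_An: "app (A k) f s = (\<Sum>K | length K = k. An k (seg 0 k s) K * f (put 0 K s))"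
proof -
  have "A k = num 0 k (An k)" by (subst num_antisym) simp_all
  then show ?thesis by (simp add: num_def app_opo)
qed

lemma An_entry:
  fixes I J :: "'n list"
  shows "length I = k \<Longrightarrow> length J = k \<Longrightarrow> An k I J = app (A k) (\<lambda>s. if seg 0 k s = J then 1 else 0) (put 0 I s)"
proof -
  assume "length I = k" "length J = k"
  moreover have "A k = num 0 k (An k)" by (subst num_antisym) simp_all
  ultimately show ?thesis by (simp add: num_def app_opo_delta)
qed

text \<open>In A_k (q^k - [k] r_{k-1}) A_k the last leg meets only the middle factor. Its scalar
  part contributes the trace of C, its r_{k-1} contributes 1 by \<open>trace_R\<close>, and A_k A_k
  = A_k remains.\<close>

lemma partial_trace_A:
  fixes I J :: "'n list"
  assumes k: "k \<ge> 1" and IJ: "length I = k" "length J = k"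
  shows "(\<Sum>a\<in>UNIV. \<Sum>b\<in>UNIV. C b a * An (Suc k) (I @ [a]) (J @ [b])) = (q ^ k * trC - qnum q k) / qnum q (Suc k) * An k I J"
proof -
  have nz: "qnum q (Suc k) \<noteq> 0" by (rule qnum_nonzero[OF generic]) simp
  define f where "f b = (\<lambda>s. if seg 0 (Suc k) s = J @ [b] then 1 else (0::'k))" for b
  define s where "s a = put 0 (I @ [a]) (undefined :: nat \<Rightarrow> 'n)" for a
  have s: "seg 0 k (s a) = I" "s a k = a" for a
    using IJ by (simp_all add: s_def put_snoc seg_upd_above)
  have f: "f b t = (if t k = b then if seg 0 k t = J then 1 else 0 else 0)" for b t
    using IJ by (auto simp: f_def seg_snoc)
  have pk: "put 0 K t k = t k" if "length K = k" for K t using that by (simp add: put_def)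
  have Af: "app (A k) (f b) t = (if t k = b then An k (seg 0 k t) J else 0)" for b t
  proof -
    have "app (A k) (f b) t = (\<Sum>K | length K = k. if K = J then (if t k = b then An k (seg 0 k t) J else 0) else 0)"
      unfolding app_An using pk by (intro sum.cong refl) (auto simp: f)
    then show ?thesis using IJ by simp
  qed
  have rAf: "app (r (k - 1)) (app (A k) (f b)) t = (\<Sum>x\<in>UNIV. R $ (t (k - 1), t k) $ (x, b) * An k (seg 0 k (t(k - 1 := x))) J)" for b t
  proof -
    have "seg 0 k (t(k - Suc 0 := y, k := d)) = seg 0 k (t(k - 1 := y))" for y d
      by (simp add: seg_upd_above)
    then show ?thesis using k
      by (simp add: r_def num2_def app_op2 Af mult_if_delta)
  qed
  have ArAf: "app (A k) (app (r (k - 1)) (app (A k) (f b))) (s a)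
     = (\<Sum>K | length K = k - 1. \<Sum>y\<in>UNIV. An k I (K @ [y]) * (\<Sum>x\<in>UNIV. R $ (y, a) $ (x, b) * An k (K @ [x]) J))" for a b
  proof -
    have p: "put 0 (K @ [y]) (s a) (k - 1) = y" "put 0 (K @ [y]) (s a) k = a"
       "seg 0 k ((put 0 (K @ [y]) (s a))(k - 1 := x)) = K @ [x]" if "length K = k - 1" for K y x
      using that k s[of a] by (auto simp: put_def nth_append intro!: nth_equalityI)
    have split: "(\<Sum>K | length K = k. g K) = (\<Sum>K | length K = k - 1. \<Sum>y\<in>UNIV. g (K @ [y]))" for g :: "'n list \<Rightarrow> 'k"
      using sum_length_snoc[of g "k - 1"] k by simp
    show ?thesis unfolding app_An[of k "app (r (k - 1)) _"] split rAf s
      by (intro sum.cong refl) (simp only: p mem_Collect_eq)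
  qed
  have idem: "(\<Sum>K | length K = k. An k I K * An k K J) = An k I J"
  proof -
    have "num 0 k (tmul k (An k) (An k)) = num 0 k (An k)"
      unfolding num_tmul by (simp add: num_antisym A_idem)
    then have "tmul k (An k) (An k) I J = An k I J"
      unfolding num_def by (rule opo_inj) (rule IJ)+
    then show ?thesis by (simp only: tmul_def)
  qed
  have "(\<Sum>a\<in>UNIV. \<Sum>b\<in>UNIV. C b a * app (A k) (app (r (k - 1)) (app (A k) (f b))) (s a)) = An k I J"
  proof -
    have "(\<Sum>a\<in>UNIV. \<Sum>b\<in>UNIV. C b a * app (A k) (app (r (k - 1)) (app (A k) (f b))) (s a))
      = (\<Sum>a\<in>UNIV. \<Sum>b\<in>UNIV. \<Sum>K | length K = k - 1. \<Sum>y\<in>UNIV. \<Sum>x\<in>UNIV. An k I (K @ [y]) * An k (K @ [x]) J * (R $ (y, a) $ (x, b) * C b a))"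
      unfolding ArAf by (simp add: sum_distrib_left mult_ac)
    also have "\<dots> = (\<Sum>K | length K = k - 1. \<Sum>a\<in>UNIV. \<Sum>b\<in>UNIV. \<Sum>y\<in>UNIV. \<Sum>x\<in>UNIV. An k I (K @ [y]) * An k (K @ [x]) J * (R $ (y, a) $ (x, b) * C b a))"
      by (rule trans[OF sum.cong[OF refl sum.swap] sum.swap])
    also have "\<dots> = (\<Sum>K | length K = k - 1. \<Sum>y\<in>UNIV. \<Sum>x\<in>UNIV. \<Sum>a\<in>UNIV. \<Sum>b\<in>UNIV. An k I (K @ [y]) * An k (K @ [x]) J * (R $ (y, a) $ (x, b) * C b a))"
      by (rule sum.cong[OF refl], rule sum_swap_pairs)
    also have "\<dots> = (\<Sum>K | length K = k - 1. \<Sum>y\<in>UNIV. An k I (K @ [y]) * An k (K @ [y]) J)"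
      by (simp only: sum_distrib_left[symmetric] trace_R) (simp add: mult_if_delta)
    also have "\<dots> = (\<Sum>K | length K = k. An k I K * An k K J)"
      using sum_length_snoc[of "\<lambda>K. An k I K * An k K J" "k - 1"] k by simp
    finally show ?thesis unfolding idem .
  qed
  moreover have "(\<Sum>a\<in>UNIV. \<Sum>b\<in>UNIV. C b a * app (A k) (f b) (s a)) = trC * An k I J"
    unfolding Af s by (simp add: mult_if_delta trC_def sum_distrib_right)
  moreover have "qnum q (Suc k) * An (Suc k) (I @ [a]) (J @ [b]) = q ^ k * app (A k) (f b) (s a)
      - qnum q k * app (A k) (app (r (k - 1)) (app (A k) (f b))) (s a)" for a b
  proof -
    have lin: "app (A k) (app (lmul c) g) t = c * app (A k) g t" for c g t
      by (simp add: app_An sum_distrib_left mult_ac)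
    have AA: "app (A k) (app (A k) g) = app (A k) g" for g using A_idem[of k] by (metis app_simps(6))
    have "An (Suc k) (I @ [a]) (J @ [b]) = app (A (Suc k)) (f b) (s a)"
      unfolding f_def s_def by (rule An_entry) (simp_all add: IJ)
    then have "qnum q (Suc k) * An (Suc k) (I @ [a]) (J @ [b]) = app (sc (qnum q (Suc k)) * A (Suc k)) (f b) (s a)"
      by (simp only: app_simps app_lmul)
    also have "\<dots> = q ^ k * app (A k) (f b) (s a) - qnum q k * app (A k) (app (r (k - 1)) (app (A k) (f b))) (s a)"
      unfolding A_Suc[OF k] by (simp only: app_simps app_diff minus_apply lin AA)
    finally show ?thesis .
  qed
  ultimately have "qnum q (Suc k) * (\<Sum>a\<in>UNIV. \<Sum>b\<in>UNIV. C b a * An (Suc k) (I @ [a]) (J @ [b]))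
     = q ^ k * (trC * An k I J) - qnum q k * An k I J"
    by (simp only: sum_distrib_left mult.left_commute[of "qnum q (Suc k)"])
       (simp add: right_diff_distrib sum_subtractf sum_distrib_left[symmetric] mult.left_commute)
  then show ?thesis using nz by (simp add: field_simps)
qed

text \<open>The partial R-trace of A_{m+1} = 0 is a multiple of A_m, which is nonzero; hence the
  multiple vanishes.\<close>

lemma trC_value: "q ^ m * trC = qnum q m"
proof -
  obtain u v where "numGL R q m u v" using numGL_exists[OF GL] .
  then interpret u: numGL R q m u v .
  obtain L where L: "length L = m" "u L \<noteq> 0" using u.u_nonzero by blast
  have "\<exists>J. length J = m \<and> v J \<noteq> 0"
  proof (rule ccontr)
    assume "\<not> ?thesis"
    then have "(\<Sum>J | length J = m. v J * u J) = 0" by (intro sum.neutral) auto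
    then show False using u.vu by simp
  qed
  then obtain J where J: "length J = m" "v J \<noteq> 0" by blast
  have "An (Suc m) = (\<lambda>I J. 0)" using GL by (simp only: GL_type_def Suc_eq_plus1)
  then have "(q ^ m * trC - qnum q m) / qnum q (Suc m) * An m L J = 0"
    using partial_trace_A[OF m1 L(1) J(1)] by simp
  moreover have "An m L J \<noteq> 0" using u.uv[OF L(1) J(1)] L J by simp
  ultimately show ?thesis using qnum_nonzero[OF generic, of "Suc m"] by auto
qed

abbreviation CC where "CC k \<equiv> tprod k (map (\<lambda>i. on1 k i C) [1..<k + 1])"

text \<open>The R-trace of A_k over all its legs. For k = m it is the factor between a_m(M) and the
  quantum determinant.\<close>

definition t :: "nat \<Rightarrow> 'k" where
  "t k = (\<Sum>I | length I = k. \<Sum>K | length K = k. CC k I K * An k K I)"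

lemma foldr_mult_append: "foldr (\<lambda>A P. f A * P) xs (y::'z::monoid_mult) = foldr (\<lambda>A P. f A * P) xs 1 * y"
  by (induction xs) (simp_all add: mult.assoc)

lemma CC_snoc:
  fixes I J :: "'n list"
  assumes "length I = k" "length J = k"
  shows "CC (Suc k) (I @ [a]) (J @ [b]) = CC k I J * C a b"
proof -
  have prod: "opo 0 N (CC k') = foldr (\<lambda>A P. A * P) (map (\<lambda>i. op1 (i - 1) C) [1..<k' + 1]) 1" if "N = k'" for k' N
    unfolding that opo_tprod foldr_map o_def by (rule foldr_cong) (auto simp: opo_on1)
  define E :: "('k, 'n) tmat" where "E I J = CC k (butlast I) (butlast J) * C (last I) (last J)" for I J
  have "opo 0 (Suc k) (CC (Suc k)) = foldr (\<lambda>A P. A * P) (map (\<lambda>i. op1 (i - 1) C) [1..<k + 1]) 1 * op1 k C"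
    using prod[of "Suc k" "Suc k"] foldr_mult_append[of "\<lambda>x. x" _ "op1 k C"] by simp
  also have "\<dots> = opo 0 k (CC k) * op1 k C" using prod[of k k] by simp
  also have "\<dots> = opo 0 (Suc k) E"
  proof (rule op_eqI)
    fix f and s :: "nat \<Rightarrow> 'n"
    have pk: "put 0 K s k = s k" if "length K = k" for K using that by (simp add: put_def)
    show "app (opo 0 k (CC k) * op1 k C) f s = app (opo 0 (Suc k) E) f s"
      by (simp add: app_opo app_op1 sum_length_snoc E_def seg_snoc put_snoc pk sum_distrib_left mult.assoc)
  qed
  finally have "CC (Suc k) (I @ [a]) (J @ [b]) = E (I @ [a]) (J @ [b])"
    by (rule opo_inj) (simp_all add: assms)
  then show ?thesis by (simp add: E_def)
qed

text \<open>By \<open>partial_trace_A\<close>, \<open>trC_value\<close> and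
  \<open>qnum_split\<close> the quotient of consecutive values is q^{-m} [m-k] / [k+1], nonzero for
  k < m.\<close>

lemma t_nonzero: "t m \<noteq> 0"
proof -
  have "t k \<noteq> 0" if "1 \<le> k" "k \<le> m" for k
    using that
  proof (induction k rule: dec_induct)
    case base
    have c: "CC (Suc 0) [a] [b] = C a b" for a b
      using CC_snoc[of "[]" 0 "[]" a b] by (simp add: tprod_def tid_def)
    have "t (Suc 0) = trC"
      unfolding t_def trC_def sum_length_1 c by (simp add: tid_def mult_if_delta)
    then show ?case using trC_value qnum_nonzero[OF generic m1] by auto
  next
    case (step k)
    define fac where "fac = (q ^ k * trC - qnum q k) / qnum q (Suc k)"
    have "t (Suc k) = (\<Sum>I | length I = k. \<Sum>a\<in>UNIV. \<Sum>K | length K = k. \<Sum>b\<in>UNIV. CC k I K * (C a b * An (Suc k) (K @ [b]) (I @ [a])))"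
      unfolding t_def sum_length_snoc by (intro sum.cong refl) (simp only: CC_snoc mem_Collect_eq mult.assoc)
    also have "\<dots> = (\<Sum>I | length I = k. \<Sum>K | length K = k. \<Sum>b\<in>UNIV. \<Sum>a\<in>UNIV. CC k I K * (C a b * An (Suc k) (K @ [b]) (I @ [a])))"
      by (rule sum.cong[OF refl], subst sum.swap, rule sum.cong[OF refl], rule sum.swap)
    also have "\<dots> = (\<Sum>I | length I = k. \<Sum>K | length K = k. CC k I K * (fac * An k K I))"
      unfolding sum_distrib_left[symmetric] fac_def
      by (intro sum.cong refl arg_cong2[of _ _ _ _ "(*)"] partial_trace_A step.hyps) auto
    also have "\<dots> = fac * t k"
      unfolding t_def by (simp add: sum_distrib_left mult_ac)
    finally have tk: "t (Suc k) = fac * t k" .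
    have "q ^ m * (q ^ k * trC - qnum q k) = q ^ k * qnum q m - q ^ m * qnum q k"
      using trC_value by (simp add: right_diff_distrib mult.left_commute)
    also have "\<dots> = qnum q (m - k)" using qnum_split[OF q_nz, of k "m - k"] step.prems by simp
    finally have "q ^ k * trC - qnum q k \<noteq> 0"
      using qnum_nonzero[OF generic, of "m - k"] step.prems by auto
    then show ?case using step qnum_nonzero[OF generic, of "Suc k"] by (simp add: tk fac_def)
  qed
  then show ?thesis using m1 by blast
qed

end


lemma app_opo_right_fun: "app (opo p N A) (\<lambda>s. f s * c) = (\<lambda>s. app (opo p N A) f s * c)"
  by (rule ext) (rule app_opo_right)

section \<open>Homomorphisms out of the free algebra\<close>

lemma single_letters:
  "Poly_Mapping.single (Wrd ws) c = fconst c * prod_list (map fgen ws)"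
proof (induction ws)
  case Nil
  then show ?case by (simp add: fconst_def zero_wrd_def)
next
  case (Cons g ws)
  have "Poly_Mapping.single (Wrd (g # ws)) c = fgen g * Poly_Mapping.single (Wrd ws) c"
    by (simp add: fgen_def mult_single plus_wrd_def)
  also have "fgen g * (fconst c * z) = fconst c * (fgen g * z)" for z
    by (simp add: fgen_def fconst_def mult_single mult.assoc[symmetric])
  then have "fgen g * Poly_Mapping.single (Wrd ws) c = fconst c * (fgen g * prod_list (map fgen ws))"
    by (simp add: Cons.IH)
  finally show ?case by simp
qed

lemma update_eq_add:
  assumes "a \<notin> Poly_Mapping.keys f"
  shows "Poly_Mapping.update a b f = f + Poly_Mapping.single a b"
proof (rule poly_mapping_eqI)
  fix k
  have "Poly_Mapping.lookup f a = 0" using assms by (simp add: in_keys_iff)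
  then show "Poly_Mapping.lookup (Poly_Mapping.update a b f) k = Poly_Mapping.lookup (f + Poly_Mapping.single a b) k"
    by (auto simp: lookup_add lookup_single lookup_update when_def)
qed

lemma falg_induct [case_names const gen add mult]:
  assumes "\<And>c. P (fconst c)" "\<And>g. P (fgen g)" "\<And>x y. P x \<Longrightarrow> P y \<Longrightarrow> P (x + y)" "\<And>x y. P x \<Longrightarrow> P y \<Longrightarrow> P (x * y)"
  shows "P (x :: ('k::field, 'n) falg)"
proof (induction x rule: update_induct)
  case const
  show ?case using assms(1)[of 0] by (simp add: fconst_def)
next
  case (update f a b)
  have "P (prod_list (map fgen ws))" for ws
  proof (induction ws)
    case Nil show ?case using assms(1)[of 1] by (simp add: fconst_def)
  qed (simp add: assms)
  then have "P (Poly_Mapping.single a b)" using single_letters[of "letters a" b] assms by simp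
  moreover note update_eq_add[OF update(1)]
  ultimately show ?case using update assms(3) by simp
qed

definition ev :: "('k::field \<Rightarrow> 'a::ring_1) \<Rightarrow> ('n gen \<Rightarrow> 'a) \<Rightarrow> ('k, 'n) falg \<Rightarrow> 'a" where
  "ev \<kappa> g x = (\<Sum>w\<in>Poly_Mapping.keys x. \<kappa> (Poly_Mapping.lookup x w) * prod_list (map g (letters w)))"

locale falg_hom = scalars \<kappa> for \<kappa> :: "'k::field_char_0 \<Rightarrow> 'a::ring_1" +
  fixes g :: "'n::finite gen \<Rightarrow> 'a"
  assumes \<kappa>_g: "\<kappa> c * g z = g z * \<kappa> c"
begin

abbreviation e where "e \<equiv> ev \<kappa> g"

lemma ev_single: "e (Poly_Mapping.single w c) = \<kappa> c * prod_list (map g (letters w))"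
  by (simp add: ev_def \<kappa>_0)

lemma ev_add: "e (x + y) = e x + e y"
  unfolding ev_def by (rule setsum_keys_plus_distrib) (simp_all add: \<kappa>_0 \<kappa>_add distrib_right)

lemma ev_0: "e 0 = 0" by (simp add: ev_def)

lemma ev_const: "e (fconst c) = \<kappa> c" by (simp add: fconst_def ev_single zero_wrd_def)
lemma ev_gen: "e (fgen z) = g z" by (simp add: fgen_def ev_single \<kappa>_1)
lemma ev_1: "e 1 = 1" using ev_const[of 1] by (simp add: fconst_def \<kappa>_1)

lemma ev_gen_mult: "e (fgen z * y) = g z * e y"
proof (induction y rule: update_induct)
  case const show ?case by (simp add: ev_0)
next
  case (update f a b)
  note update_eq_add[OF update(1)]
  moreover have "e (fgen z * Poly_Mapping.single a b) = g z * e (Poly_Mapping.single a b)"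
    by (simp add: fgen_def mult_single ev_single plus_wrd_def mult.assoc[symmetric] \<kappa>_g)
  ultimately show ?case using update by (simp add: distrib_left ev_add)
qed

lemma ev_const_mult: "e (fconst c * y) = \<kappa> c * e y"
proof (induction y rule: update_induct)
  case const show ?case by (simp add: ev_0)
next
  case (update f a b)
  note update_eq_add[OF update(1)]
  moreover have "e (fconst c * Poly_Mapping.single a b) = \<kappa> c * e (Poly_Mapping.single a b)"
    by (simp add: fconst_def mult_single ev_single \<kappa>_mult mult.assoc)
  ultimately show ?case using update by (simp add: distrib_left ev_add)
qed

lemma ev_mult: "e (x * y) = e x * e y"
proof (induction x arbitrary: y rule: falg_induct)
  case (const c) show ?case by (simp add: ev_const_mult ev_const)
next
  case (gen z) show ?case by (simp add: ev_gen_mult ev_gen)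
next
  case (add x y') then show ?case by (simp add: distrib_right ev_add)
next
  case (mult x y') then show ?case by (simp add: mult.assoc)
qed

lemma ev_minus: "e (- x) = - e x" using ev_add[of x "- x"] by (simp add: ev_0 eq_neg_iff_add_eq_0 add.commute)
lemma ev_diff: "e (x - y) = e x - e y" using ev_add[of x "- y"] by (simp add: ev_minus)
lemma ev_sum: "e (sum f S) = (\<Sum>i\<in>S. e (f i))"
  by (induction S rule: infinite_finite_induct) (auto simp: ev_add ev_0)

lemma \<kappa>_e: "\<kappa> c * e x = e x * \<kappa> c"
proof (induction x rule: falg_induct)
  case (const c') then show ?case by (simp add: ev_const \<kappa>_comm)
next
  case (gen z) then show ?case by (simp add: ev_gen \<kappa>_g)
next
  case (add x y) then show ?case by (simp add: ev_add distrib_left distrib_right)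
next
  case (mult x y) then show ?case by (metis ev_mult mult.assoc)
qed

definition evo :: "nat \<Rightarrow> nat \<Rightarrow> (('k, 'n) falg, 'n) tmat \<Rightarrow> ((nat \<Rightarrow> 'n) \<Rightarrow> 'a) endo" where
  "evo p N A = opo p N (\<lambda>I J. e (A I J))"

lemma evo_tmul: "evo p N (tmul N A B) = evo p N A * evo p N B"
  unfolding evo_def opo_tmul[symmetric] tmul_def ev_sum ev_mult ..

lemma evo_tid: "evo p N (tid N) = 1"
  unfolding evo_def opo_tid[symmetric, of p N] by (rule opo_cong) (simp add: tid_def ev_0 ev_1)

lemma evo_tprod: "evo p N (tprod N As) = foldr (\<lambda>A P. evo p N A * P) As 1"
  by (induction As) (simp_all add: tprod_def evo_tid evo_tmul)

lemma evo_fnum: "evo p N (fnum B) = num p N B"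
  by (simp add: evo_def num_def fnum_def ev_const)

lemma evo_on1: "1 \<le> i \<Longrightarrow> i \<le> N \<Longrightarrow> evo p N (on1 N i Z) = op1 (p + i - 1) (\<lambda>a b. e (Z a b))"
  unfolding evo_def opo_on1[symmetric] by (rule opo_cong) (auto simp: on1_def ev_0)

end

section \<open>Solutions of the reflection equation\<close>

context GL
begin

definition RTr :: "('n \<Rightarrow> 'n \<Rightarrow> 'a) \<Rightarrow> 'a" where
  "RTr Z = (\<Sum>i\<in>UNIV. \<Sum>j\<in>UNIV. \<kappa> (C i j) * Z j i)"

text \<open>The entry (i, k) of the partial R-trace of \<open>P\<close> over the second leg. The
  value \<open>a\<close> at the later positions of the test sequence is immaterial for operators on
  the first two legs.\<close>

definition ptr :: "((nat \<Rightarrow> 'n) \<Rightarrow> 'a) endo \<Rightarrow> 'n \<Rightarrow> 'n \<Rightarrow> 'a" where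
  "ptr P i k = (\<Sum>a\<in>UNIV. \<Sum>b\<in>UNIV. \<kappa> (C b a) *
     app P (\<lambda>s. if s 0 = k then if s 1 = b then 1 else 0 else 0) (\<lambda>n. if n = 0 then i else a))"

text \<open>The scalars are collected in front of the entries of \<open>Z\<close>, with which they
  commute; then the numerical identity \<open>trace_conj\<close> applies.\<close>

lemma ptr_conj:
  assumes \<kappa>Z: "\<And>c i j. \<kappa> c * Z i j = Z i j * \<kappa> c"
    and SS: "(S, S') = (R, matrix_inv R) \<or> (S, S') = (matrix_inv R, R)"
  shows "ptr (num2 0 S' * op1 0 Z * num2 0 S) i k = (if i = k then RTr Z else 0)"
proof -
  interpret n: GLid R q m by unfold_locales (auto simp: GL)
  have tr: "(\<Sum>a\<in>UNIV. \<Sum>b\<in>UNIV. \<Sum>c\<in>UNIV. S' $ (i, a) $ (p, c) * S $ (z, c) $ (k, b) * C b a) = (if i = k then C z p else 0)" for p z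
    using SS n.trace_conj[of i p z k] by auto
  have "ptr (num2 0 S' * op1 0 Z * num2 0 S) i k
     = (\<Sum>a\<in>UNIV. \<Sum>b\<in>UNIV. \<kappa> (C b a) * (\<Sum>p\<in>UNIV. \<Sum>c\<in>UNIV. \<kappa> (S' $ (i, a) $ (p, c)) * (\<Sum>z\<in>UNIV. Z p z * \<kappa> (S $ (z, c) $ (k, b)))))"
    unfolding ptr_def by (simp add: num2_def app_op1 app_op2 mult_if_delta sum_if_const)
  also have "\<dots> = (\<Sum>a\<in>UNIV. \<Sum>b\<in>UNIV. \<Sum>p\<in>UNIV. \<Sum>c\<in>UNIV. \<Sum>z\<in>UNIV. \<kappa> (S' $ (i, a) $ (p, c) * S $ (z, c) $ (k, b) * C b a) * Z p z)"
  proof -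
    have "\<kappa> x * (\<kappa> y * (Z p z * \<kappa> v)) = \<kappa> (y * v * x) * Z p z" for x y v p z
    proof -
      have "y * v * x = x * (y * v)" by (rule mult.commute)
      then show ?thesis by (simp only: \<kappa>_mult \<kappa>Z[symmetric] mult.assoc)
    qed
    then show ?thesis by (simp add: sum_distrib_left)
  qed
  also have "\<dots> = (\<Sum>p\<in>UNIV. \<Sum>c\<in>UNIV. \<Sum>a\<in>UNIV. \<Sum>b\<in>UNIV. \<Sum>z\<in>UNIV. \<kappa> (S' $ (i, a) $ (p, c) * S $ (z, c) $ (k, b) * C b a) * Z p z)"
    by (rule sum_swap_pairs)
  also have "\<dots> = (\<Sum>p\<in>UNIV. \<Sum>c\<in>UNIV. \<Sum>z\<in>UNIV. \<Sum>a\<in>UNIV. \<Sum>b\<in>UNIV. \<kappa> (S' $ (i, a) $ (p, c) * S $ (z, c) $ (k, b) * C b a) * Z p z)"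
    by (rule sum.cong[OF refl], rule sum.cong[OF refl], rule trans[OF sum.cong[OF refl sum.swap] sum.swap])
  also have "\<dots> = (\<Sum>p\<in>UNIV. \<Sum>z\<in>UNIV. \<Sum>a\<in>UNIV. \<Sum>b\<in>UNIV. \<Sum>c\<in>UNIV. \<kappa> (S' $ (i, a) $ (p, c) * S $ (z, c) $ (k, b) * C b a) * Z p z)"
    by (rule sum.cong[OF refl], rule trans[OF sum.swap], rule sum.cong[OF refl], rule trans[OF sum.swap], rule sum.cong[OF refl], rule sum.swap)
  also have "\<dots> = (\<Sum>p\<in>UNIV. \<Sum>z\<in>UNIV. \<kappa> (if i = k then C z p else 0) * Z p z)"
    by (simp only: tr[symmetric] \<kappa>_sum sum_distrib_right)
  also have "\<dots> = (if i = k then RTr Z else 0)"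
    unfolding RTr_def by (simp add: \<kappa>_0) (rule impI, rule sum.swap)
  finally show ?thesis .
qed

lemma ptr_left:
  assumes \<kappa>Y: "\<And>c i j. \<kappa> c * Y i j = Y i j * \<kappa> c"
  shows "ptr (op1 0 Y * P) i k = (\<Sum>l\<in>UNIV. Y i l * ptr P l k)"
proof -
  have e: "(\<lambda>n. if n = 0 then i else a)(0 := l) = (\<lambda>n::nat. if n = 0 then l else a)" for i l a :: 'n by auto
  have "\<kappa> c * (Y i l * z) = Y i l * (\<kappa> c * z)" for c l z by (simp add: mult.assoc[symmetric] \<kappa>Y)
  then have "ptr (op1 0 Y * P) i k = (\<Sum>a\<in>UNIV. \<Sum>b\<in>UNIV. \<Sum>l\<in>UNIV. Y i l * (\<kappa> (C b a) *
     app P (\<lambda>s. if s 0 = k then if s 1 = b then 1 else 0 else 0) (\<lambda>n. if n = 0 then l else a)))"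
    unfolding ptr_def by (simp add: app_op1 e sum_distrib_left)
  also have "\<dots> = (\<Sum>l\<in>UNIV. \<Sum>a\<in>UNIV. \<Sum>b\<in>UNIV. Y i l * (\<kappa> (C b a) *
     app P (\<lambda>s. if s 0 = k then if s 1 = b then 1 else 0 else 0) (\<lambda>n. if n = 0 then l else a)))"
    by (rule trans[OF sum.cong[OF refl sum.swap] sum.swap])
  finally show ?thesis by (simp add: ptr_def sum_distrib_left)
qed

lemma ptr_right:
  assumes P: "\<And>f c s. app P (\<lambda>s. f s * c) s = app P f s * c"
  shows "ptr (P * op1 0 Y) i k = (\<Sum>l\<in>UNIV. ptr P i l * Y l k)"
proof -
  have e: "app (op1 0 Y) (\<lambda>s. if s 0 = k then if s 1 = b then 1 else 0 else 0)
      = (\<Sum>l\<in>UNIV. (\<lambda>s. (if s 0 = l then if s 1 = b then 1 else 0 else 0) * Y l k))" for b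
    by (rule ext) (simp add: app_op1 sum_fun_apply mult_if_delta sum_if_const)
  have "ptr (P * op1 0 Y) i k = (\<Sum>a\<in>UNIV. \<Sum>b\<in>UNIV. \<Sum>l\<in>UNIV. \<kappa> (C b a) *
     app P (\<lambda>s. if s 0 = l then if s 1 = b then 1 else 0 else 0) (\<lambda>n. if n = 0 then i else a) * Y l k)"
    unfolding ptr_def app_simps e app_sum sum_fun_apply P by (simp add: sum_distrib_left mult.assoc)
  also have "\<dots> = (\<Sum>l\<in>UNIV. \<Sum>a\<in>UNIV. \<Sum>b\<in>UNIV. \<kappa> (C b a) *
     app P (\<lambda>s. if s 0 = l then if s 1 = b then 1 else 0 else 0) (\<lambda>n. if n = 0 then i else a) * Y l k)"
    by (rule trans[OF sum.cong[OF refl sum.swap] sum.swap])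
  finally show ?thesis by (simp add: ptr_def sum_distrib_right)
qed

text \<open>\<open>Y\<close> acts in the first leg only and leaves the partial trace on either side.
  The conjugations on the two sides are kept independent: the exchange relation needs opposite ones,
  the pair of N and M equal ones.\<close>

lemma RTr_commutes:
  assumes \<kappa>Z: "\<And>c i j. \<kappa> c * Z i j = Z i j * \<kappa> c" and \<kappa>Y: "\<And>c i j. \<kappa> c * Y i j = Y i j * \<kappa> c"
    and SS: "(S, S') = (R, matrix_inv R) \<or> (S, S') = (matrix_inv R, R)"
    and TT: "(T, T') = (R, matrix_inv R) \<or> (T, T') = (matrix_inv R, R)"
    and eq: "num2 0 S' * op1 0 Z * num2 0 S * op1 0 Y = op1 0 Y * (num2 0 T' * op1 0 Z * num2 0 T)"
  shows "RTr Z * Y i k = Y i k * RTr Z"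
proof -
  have "ptr (num2 0 S' * op1 0 Z * num2 0 S * op1 0 Y) i k = (\<Sum>l\<in>UNIV. ptr (num2 0 S' * op1 0 Z * num2 0 S) i l * Y l k)"
    by (rule ptr_right) (simp add: num2_def op1_def op2_def app_opo_right_fun)
  also have "\<dots> = RTr Z * Y i k"
    unfolding ptr_conj[OF \<kappa>Z SS] by (simp add: mult_if_delta)
  finally have "RTr Z * Y i k = ptr (op1 0 Y * (num2 0 T' * op1 0 Z * num2 0 T)) i k" by (simp only: eq)
  also have "\<dots> = Y i k * RTr Z"
    unfolding ptr_left[OF \<kappa>Y] ptr_conj[OF \<kappa>Z TT] by (simp add: mult_if_delta)
  finally show ?thesis .
qed

primrec mpow :: "('n \<Rightarrow> 'n \<Rightarrow> 'a) \<Rightarrow> nat \<Rightarrow> 'n \<Rightarrow> 'n \<Rightarrow> 'a" where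
  "mpow Z 0 = (\<lambda>i j. if i = j then 1 else 0)"
| "mpow Z (Suc k) = (\<lambda>i j. \<Sum>l\<in>UNIV. mpow Z k i l * Z l j)"

lemma op1_mpow: "op1 p (mpow Z k) = op1 p Z ^ k"
  by (induction k) (simp_all add: op1_one op1_mult[symmetric] power_commutes)

lemma \<kappa>_mpow:
  assumes "\<And>c i j. \<kappa> c * Z i j = Z i j * \<kappa> c"
  shows "\<kappa> c * mpow Z k i j = mpow Z k i j * \<kappa> c"
proof (induction k arbitrary: i j)
  case (Suc k)
  then show ?case
    by (simp add: sum_distrib_left sum_distrib_right mult.assoc[symmetric])
       (simp add: mult.assoc assms)
qed simp

lemma op1_far: "\<lbrakk>\<And>c i j. \<kappa> c * Z i j = Z i j * \<kappa> c; i \<ge> 1\<rbrakk> \<Longrightarrow> r i * op1 0 Z = op1 0 Z * r i"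
  unfolding r_def num2_def op1_def op2_def by (rule opo_commute[symmetric]) auto

text \<open>\<open>exch Y Z\<close> is the relation $R_1 Y_1 R_1 Z_1 = Z_1 R_1 Y_1 R_1$.\<close>

definition exch :: "('n \<Rightarrow> 'n \<Rightarrow> 'a) \<Rightarrow> ('n \<Rightarrow> 'n \<Rightarrow> 'a) \<Rightarrow> bool" where
  "exch Y Z \<longleftrightarrow> r 0 * op1 0 Y * r 0 * op1 0 Z = op1 0 Z * r 0 * op1 0 Y * r 0"

lemma exch_mpow: "exch Y Z \<Longrightarrow> exch Y (mpow Z k)"
proof (induction k)
  case 0 show ?case by (simp add: exch_def op1_one mult.assoc)
next
  case (Suc k)
  let ?p = "r 0 * op1 0 Y * r 0"
  have 1: "?p * op1 0 Z = op1 0 Z * ?p" and 2: "?p * op1 0 Z ^ k = op1 0 Z ^ k * ?p"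
    using Suc by (simp_all add: exch_def op1_mpow mult.assoc)
  have "?p * (op1 0 Z ^ k * op1 0 Z) = op1 0 Z ^ k * (?p * op1 0 Z)"
    by (simp only: mult.assoc[symmetric] 2)
  also have "\<dots> = (op1 0 Z ^ k * op1 0 Z) * ?p" unfolding 1 by (simp only: mult.assoc)
  finally show ?case unfolding exch_def op1_mpow power_Suc2 by (simp only: mult.assoc)
qed

lemma RTr_mpow_commutes:
  assumes \<kappa>Z: "\<And>c i j. \<kappa> c * Z i j = Z i j * \<kappa> c" and \<kappa>Y: "\<And>c i j. \<kappa> c * Y i j = Y i j * \<kappa> c"
    and ex: "exch Y Z"
  shows "RTr (mpow Z k) * Y i j = Y i j * RTr (mpow Z k)"
proof (rule RTr_commutes[OF \<kappa>_mpow[OF \<kappa>Z] \<kappa>Y])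
  let ?z = "op1 0 (mpow Z k)" and ?y = "op1 0 Y"
  have e: "r 0 * (?y * (r 0 * ?z)) = ?z * (r 0 * (?y * r 0))"
    using exch_mpow[OF ex, of k] by (simp add: exch_def mult.assoc)
  have "ri 0 * (?z * (r 0 * (?y * r 0))) * ri 0 = ri 0 * (r 0 * (?y * (r 0 * ?z))) * ri 0" by (simp only: e)
  then have "ri 0 * ?z * r 0 * ?y = ?y * (r 0 * ?z * ri 0)"
    by (simp add: mult.assoc r_ri r_cancel)
  then show "num2 0 (matrix_inv R) * ?z * num2 0 R * ?y = ?y * (num2 0 R * ?z * num2 0 (matrix_inv R))"
    by (simp add: r_def ri_def)
qed auto

context
  fixes M Q N :: "'n \<Rightarrow> 'n \<Rightarrow> 'a" and Mi :: "'n \<Rightarrow> 'n \<Rightarrow> 'a"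
  assumes MM: "exch M M" and QM: "exch Q M" and QQ: "exch Q Q"
    and MiM: "\<And>i j. (\<Sum>k\<in>UNIV. Mi i k * M k j) = (if i = j then 1 else 0)"
    and Q: "\<And>i j. Q i j = (\<Sum>k\<in>UNIV. M i k * N k j)"
begin

lemma inv_op: "op1 0 Mi * op1 0 M = 1"
  by (simp add: op1_mult MiM op1_one)

lemma M_cancel: assumes "op1 0 M * y = op1 0 M * z" shows "y = z"
proof -
  have "op1 0 Mi * (op1 0 M * y) = op1 0 Mi * (op1 0 M * z)" by (simp only: assms)
  then show ?thesis by (simp only: mult.assoc[symmetric] inv_op mult_1)
qed

lemma r_cancel': assumes "r i * y = r i * z" shows "y = z"
proof -
  have "ri i * (r i * y) = ri i * (r i * z)" by (simp only: assms)
  then show ?thesis by (simp only: r_cancel)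
qed

lemma Q_op: "op1 0 Q = op1 0 M * op1 0 N"
proof -
  have "Q = (\<lambda>i j. \<Sum>k\<in>UNIV. M i k * N k j)" using Q by (intro ext) simp
  then show ?thesis by (simp add: op1_mult)
qed

lemma M_refl: "op1 0 M * (r 0 * op1 0 M) = r 0 * (op1 0 M * (r 0 * (op1 0 M * ri 0)))"
proof -
  have "r 0 * (op1 0 M * (r 0 * op1 0 M)) = op1 0 M * (r 0 * (op1 0 M * r 0))"
    using MM by (simp add: exch_def mult.assoc)
  then have "op1 0 M * (r 0 * (op1 0 M * r 0)) * ri 0 = r 0 * (op1 0 M * (r 0 * op1 0 M)) * ri 0" by simp
  then show ?thesis by (simp add: mult.assoc r_ri)
qed

text \<open>In the relation for Q = M N the reflection equation of M exposes a common left factor,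
  which cancels. The result says that N_1 commutes with R_1 M_1 R_1^{-1}.\<close>

lemma N_M: "op1 0 N * (r 0 * op1 0 M) = r 0 * (op1 0 M * (ri 0 * (op1 0 N * r 0)))"
proof -
  let ?M = "op1 0 M" and ?N = "op1 0 N"
  have "r 0 * (?M * (?N * (r 0 * ?M))) = (?M * (r 0 * ?M)) * (?N * r 0)"
    using QM by (simp add: exch_def Q_op mult.assoc)
  also have "\<dots> = r 0 * (?M * (r 0 * (?M * (ri 0 * (?N * r 0)))))"
    unfolding M_refl by (simp add: mult.assoc)
  finally have "r 0 * (?M * (?N * (r 0 * ?M))) = r 0 * (?M * (r 0 * (?M * (ri 0 * (?N * r 0)))))" .
  then show ?thesis by (rule M_cancel[OF r_cancel'])
qed

text \<open>In the reflection equation of Q = M N all M are moved to the left by \<open>N_M\<close>.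
  The reflection equation of M makes the prefixes equal, and they cancel.\<close>

lemma N_N: "exch N N"
proof -
  let ?M = "op1 0 M" and ?N = "op1 0 N"
  have NM: "?N * (r 0 * (?M * z)) = r 0 * (?M * (ri 0 * (?N * (r 0 * z))))" for z
    using N_M by (simp add: mult.assoc[symmetric])
  have MM': "?M * (r 0 * (?M * z)) = r 0 * (?M * (r 0 * (?M * (ri 0 * z))))" for z
    using arg_cong[OF M_refl, of "\<lambda>y. y * z"] by (simp only: mult.assoc)
  have "r 0 * (?M * (?N * (r 0 * (?M * ?N)))) = ?M * (?N * (r 0 * (?M * (?N * r 0))))"
    using QQ by (simp add: exch_def Q_op mult.assoc)
  then have "r 0 * (?M * (r 0 * (?M * (ri 0 * (?N * (r 0 * ?N)))))) = ?M * (r 0 * (?M * (ri 0 * (?N * (r 0 * (?N * r 0))))))"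
    unfolding NM .
  then have "?M * (r 0 * (?M * (?N * (r 0 * ?N)))) = ?M * (r 0 * (?M * (ri 0 * (?N * (r 0 * (?N * r 0))))))"
    unfolding MM'[symmetric] .
  then have "?N * (r 0 * ?N) = ri 0 * (?N * (r 0 * (?N * r 0)))"
    by (rule M_cancel[OF r_cancel'[OF M_cancel]])
  then have "r 0 * (?N * (r 0 * ?N)) = r 0 * (ri 0 * (?N * (r 0 * (?N * r 0))))" by simp
  then show ?thesis by (simp add: exch_def mult.assoc r_cancel)
qed

text \<open>The powers of N_1 commute with R_1 M_1 R_1^{-1} as well; conjugating by R_1 gives the
  shape of \<open>RTr_commutes\<close> with the same conjugation on both sides.\<close>

lemma RTr_N_M:
  assumes \<kappa>N: "\<And>c i j. \<kappa> c * N i j = N i j * \<kappa> c" and \<kappa>M: "\<And>c i j. \<kappa> c * M i j = M i j * \<kappa> c"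
  shows "RTr (mpow N k) * M i j = M i j * RTr (mpow N k)"
proof (rule RTr_commutes[OF \<kappa>_mpow[OF \<kappa>N] \<kappa>M])
  let ?M = "op1 0 M" and ?N = "op1 0 N"
  let ?p = "r 0 * ?M * ri 0"
  have 1: "?N * ?p = ?p * ?N"
  proof -
    have "?N * (r 0 * ?M) * ri 0 = r 0 * (?M * (ri 0 * (?N * r 0))) * ri 0" unfolding N_M ..
    then show ?thesis by (simp add: mult.assoc r_ri)
  qed
  have 2: "?N ^ k * ?p = ?p * ?N ^ k"
    by (rule power_commuting_commutes[OF 1])
  have "ri 0 * (?N ^ k * ?p) * r 0 = ri 0 * (?p * ?N ^ k) * r 0" unfolding 2 ..
  then have "ri 0 * ?N ^ k * r 0 * ?M = ?M * (ri 0 * ?N ^ k * r 0)"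
    by (simp add: mult.assoc r_cancel ri_r)
  then show "num2 0 (matrix_inv R) * op1 0 (mpow N k) * num2 0 R * ?M = ?M * (num2 0 (matrix_inv R) * op1 0 (mpow N k) * num2 0 R)"
    by (simp add: op1_mpow r_def ri_def)
qed auto

end

end

section \<open>The quantum determinant\<close>

context braid_rep
begin

lemma up_ri_shift: assumes "i + 1 < k" shows "up ri k * r i = r (Suc i) * up ri k"
proof -
  interpret inv: braid_rep ri r by (rule inverse_rep)
  have "up ri k * ri i = ri (Suc i) * up ri k" using inv.up_shift assms by simp
  then have "r (Suc i) * (up ri k * ri i) * r i = r (Suc i) * (ri (Suc i) * up ri k) * r i" by simp
  then show ?thesis by (simp add: mult.assoc ri_r r_cancel)
qed

lemma copy_conj: "copy x k = down r k * x * up ri k"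
  by (induction k) (simp_all add: mult.assoc)

text \<open>The copies after the first one. Splitting off \<open>x\<close> on the left prepares the
  right inverse of M.\<close>

primrec tail_copies :: "'e \<Rightarrow> nat \<Rightarrow> 'e" where
  "tail_copies x 0 = 1"
| "tail_copies x (Suc k) = tail_copies x k * copy x (Suc k)"

lemma copies_tail: "copies x (Suc k) = x * tail_copies x k"
  by (induction k) (simp_all add: mult.assoc)

end

locale RE = GL \<kappa> R q m for \<kappa> :: "'k::field_char_0 \<Rightarrow> 'a::ring_1" and R :: "('k, 'n::finite) mat2" and q m +
  fixes M :: "'n \<Rightarrow> 'n \<Rightarrow> 'a" and u v :: "'n list \<Rightarrow> 'k"
  assumes \<kappa>M: "\<And>c i j. \<kappa> c * M i j = M i j * \<kappa> c" and MM: "exch M M" and uv: "numGL R q m u v"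
begin

sublocale n: numGL R q m u v by (rule uv)

abbreviation x where "x \<equiv> op1 0 M"

lemma app_A_uv: "app (A m) f s = \<kappa> (u (seg 0 m s)) * (\<Sum>K | length K = m. \<kappa> (v K) * f (put 0 K s))"
proof -
  have "A m = num 0 m (antisym q R m m)" by (subst num_antisym) simp_all
  then show ?thesis by (simp add: num_def app_opo n.uv sum_distrib_left mult.assoc \<kappa>_mult)
qed

lemma app_A'_uv: "app (anti sc q (\<lambda>i. r (Suc i)) m) f s = \<kappa> (u (seg (Suc 0) m s)) * (\<Sum>K | length K = m. \<kappa> (v K) * f (put (Suc 0) K s))"
proof -
  have "anti sc q (\<lambda>i. r (Suc i)) m = num (Suc 0) m (antisym q R m m)" by (subst num_antisym) simp_all
  then show ?thesis by (simp add: num_def app_opo n.uv sum_distrib_left mult.assoc \<kappa>_mult)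
qed

lemma vu_\<kappa>: "(\<Sum>K | length K = m. \<kappa> (v K) * \<kappa> (u K)) = 1"
  by (simp only: \<kappa>_mult[symmetric] \<kappa>_sum[symmetric] n.vu \<kappa>_1)

text \<open>Operators on the first N legs whose matrix entries commute with the scalars, so that the
  coefficients of u and v can be moved past them.\<close>

definition loc :: "nat \<Rightarrow> ((nat \<Rightarrow> 'n) \<Rightarrow> 'a) endo \<Rightarrow> bool" where
  "loc N P \<longleftrightarrow> (\<exists>T. P = opo 0 N T \<and> (\<forall>c I L. \<kappa> c * T I L = T I L * \<kappa> c))"

lemma loc_mult: "loc N P \<Longrightarrow> loc N P' \<Longrightarrow> loc N (P * P')"
proof -
  assume "loc N P" "loc N P'"
  then obtain T T' where T: "P = opo 0 N T" "\<And>c I L. \<kappa> c * T I L = T I L * \<kappa> c"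
    and T': "P' = opo 0 N T'" "\<And>c I L. \<kappa> c * T' I L = T' I L * \<kappa> c" unfolding loc_def by blast
  have "\<kappa> c * tmul N T T' I L = tmul N T T' I L * \<kappa> c" for c I L
    by (simp add: tmul_def sum_distrib_left sum_distrib_right mult.assoc[symmetric] T(2))
       (simp add: mult.assoc T'(2))
  then show ?thesis unfolding loc_def T(1) T'(1) opo_tmul[symmetric] by blast
qed

lemma loc_num2: "Suc i < N \<Longrightarrow> loc N (num2 i B)"
proof -
  assume "Suc i < N"
  then have "num2 i B = num 0 N (on2 N (Suc i) B)" by (subst num_on2) auto
  then show ?thesis unfolding loc_def num_def using \<kappa>_comm by blast
qed

lemma loc_r: "Suc i < N \<Longrightarrow> loc N (r i)" "Suc i < N \<Longrightarrow> loc N (ri i)"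
  by (simp_all add: r_def ri_def loc_num2)

lemma loc_x: "loc m x"
proof -
  have "x = opo 0 m (on1 m 1 M)" using m1 by (subst opo_on1) auto
  moreover have "\<kappa> c * on1 m 1 M I L = on1 m 1 M I L * \<kappa> c" for c I L by (simp add: on1_def \<kappa>M)
  ultimately show ?thesis unfolding loc_def by blast
qed

lemma loc_1: "loc m 1"
  unfolding loc_def by (rule exI[of _ "tid m"]) (simp add: opo_tid tid_def)

lemma loc_copies: "k \<le> m \<Longrightarrow> loc m (copies x k)"
proof (induction k)
  case (Suc k)
  have "loc m (copy x j)" if "j < m" for j
    using that
  proof (induction j)
    case (Suc j)
    then show ?case by (simp add: loc_r loc_mult)
  qed (simp add: loc_x)
  then show ?case using Suc by (simp add: loc_mult)
qed (simp add: loc_1)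

lemma x_far: "i \<ge> 1 \<Longrightarrow> r i * x = x * r i"
  by (rule op1_far[OF \<kappa>M])

lemma x_refl: "r 0 * x * r 0 * x = x * r 0 * x * r 0"
  using MM by (simp add: exch_def)

lemma sc_x: "x * sc c = sc c * x"
  unfolding op1_def by (rule lmul_opo_commute[symmetric]) (simp add: \<kappa>M)

lemma sc_ri: "ri i * sc c = sc c * ri i"
  by (rule ri_comm) (rule sc_r)

lemma sc_copy: "copy x k * sc c = sc c * copy x k"
proof (induction k)
  case (Suc k)
  have "copy x (Suc k) * sc c = r k * (copy x k * sc c) * ri k" by (simp add: mult.assoc sc_ri)
  then show ?case unfolding Suc by (simp add: mult.assoc[symmetric] sc_r)
qed (simp add: sc_x)

lemma sc_copies: "copies x k * sc c = sc c * copies x k"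
proof (induction k)
  case (Suc k)
  have "copies x (Suc k) * sc c = copies x k * sc c * copy x k" by (simp add: mult.assoc sc_copy)
  then show ?case unfolding Suc by (simp add: mult.assoc)
qed simp

lemma copies_A: "copies x m * A m = A m * copies x m"
proof (rule A_comm)
  show "copies x m * r i = r i * copies x m" if "i + 1 < m" for i
    using copies_commute[OF x_far x_refl, of i m] that by simp
qed (rule sc_copies)

definition Tm where "Tm = (SOME T. copies x m = opo 0 m T \<and> (\<forall>c I L. \<kappa> c * T I L = T I L * \<kappa> c))"

lemma Tm: "copies x m = opo 0 m Tm" "\<kappa> c * Tm I L = Tm I L * \<kappa> c"
  using someI_ex[OF loc_copies[OF order_refl, unfolded loc_def]] unfolding Tm_def[symmetric] by blast+

text \<open>The quantum determinant: the matrix of the product of all m copies, contracted with v on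
  the left and u on the right.\<close>

definition qdet :: 'a where
  "qdet = (\<Sum>I | length I = m. \<Sum>L | length L = m. \<kappa> (v I) * Tm I L * \<kappa> (u L))"

lemma \<kappa>_qdet: "\<kappa> c * qdet = qdet * \<kappa> c"
proof -
  have "\<kappa> c * (\<kappa> a * Tm I L * \<kappa> b) = \<kappa> a * Tm I L * \<kappa> b * \<kappa> c" for a b I L
  proof -
    have "\<kappa> c * (\<kappa> a * Tm I L * \<kappa> b) = (\<kappa> a * \<kappa> c) * Tm I L * \<kappa> b"
      unfolding \<kappa>_comm[of a c] by (simp only: mult.assoc)
    also have "\<dots> = \<kappa> a * (Tm I L * \<kappa> c) * \<kappa> b" unfolding Tm(2)[symmetric] by (simp only: mult.assoc)
    also have "\<dots> = \<kappa> a * Tm I L * (\<kappa> b * \<kappa> c)" unfolding \<kappa>_comm[of b c] by (simp only: mult.assoc)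
    finally show ?thesis by (simp only: mult.assoc)
  qed
  then show ?thesis by (simp add: qdet_def sum_distrib_left sum_distrib_right)
qed

text \<open>The product of the copies commutes with the rank one projector A_m and therefore acts on
  its image by a single ring element.\<close>

lemma copies_qdet: "copies x m * A m = lmul qdet * A m"
proof (rule op_eqI)
  fix f :: "(nat \<Rightarrow> 'n) \<Rightarrow> 'a" and s
  define \<phi> where "\<phi> = (\<Sum>K | length K = m. \<kappa> (v K) * f (put 0 K s))"
  have Af: "app (A m) f s = \<kappa> (u (seg 0 m s)) * \<phi>" by (simp add: app_A_uv \<phi>_def)
  have "copies x m * A m = A m * copies x m * A m"
    by (simp only: copies_A[symmetric] mult.assoc A_idem)
  then have "app (copies x m * A m) f s = app (A m) (app (copies x m) (app (A m) f)) s" by simp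
  also have "\<dots> = \<kappa> (u (seg 0 m s)) * (\<Sum>K | length K = m. \<kappa> (v K) * (\<Sum>L | length L = m. Tm K L * (\<kappa> (u L) * \<phi>)))"
    by (simp add: app_A_uv[of "app (copies x m) _"] Tm(1) app_opo app_A_uv \<phi>_def cong: sum.cong_simp)
  also have "\<dots> = \<kappa> (u (seg 0 m s)) * (qdet * \<phi>)"
    by (simp add: qdet_def sum_distrib_left sum_distrib_right mult.assoc)
  also have "\<dots> = qdet * app (A m) f s"
    unfolding Af by (simp only: mult.assoc[symmetric] \<kappa>_qdet)
  finally show "app (copies x m * A m) f s = app (lmul qdet * A m) f s" by simp
qed

lemma qdet_r: "lmul qdet * r i = r i * lmul qdet"
  unfolding r_def num2_def op2_def by (rule lmul_opo_commute) (simp add: \<kappa>_qdet)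

lemma \<kappa>_unit: assumes "c \<noteq> 0" "y * \<kappa> c = z * \<kappa> c" shows "y = z"
proof -
  have "y * \<kappa> c * \<kappa> (1 / c) = z * \<kappa> c * \<kappa> (1 / c)" by (simp only: assms(2))
  then show ?thesis using assms(1) by (simp add: mult.assoc \<kappa>_mult[symmetric] \<kappa>_1)
qed

text \<open>\<open>exchange_det\<close> gives commutation next to A'. Evaluated on e_j \<otimes> u,
  which A' fixes, it yields the entry (i, j) of Y times a nonzero coefficient of u.\<close>

lemma qdet_commutes:
  assumes \<kappa>Y: "\<And>c i j. \<kappa> c * Y i j = Y i j * \<kappa> c" and ex: "exch Y M"
  shows "Y i j * qdet = qdet * Y i j"
proof -
  let ?y = "op1 0 Y" and ?A' = "anti sc q (\<lambda>i. r (Suc i)) m"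
  have y_far: "r i * ?y = ?y * r i" if "i \<ge> 1" for i by (rule op1_far[OF \<kappa>Y that])
  have xy: "?y * r 0 * x * ri 0 = ri 0 * x * r 0 * ?y"
  proof -
    have e: "r 0 * (?y * (r 0 * x)) = x * (r 0 * (?y * r 0))" using ex by (simp add: exch_def mult.assoc)
    have "ri 0 * (r 0 * (?y * (r 0 * x))) * ri 0 = ri 0 * (x * (r 0 * (?y * r 0))) * ri 0" unfolding e ..
    then show ?thesis by (simp add: mult.assoc r_cancel r_ri)
  qed
  have sc_up: "up ri k * sc a = sc a * up ri k" for k a
    by (induction k) (simp_all add: mult.assoc sc_ri, simp add: mult.assoc[symmetric])
  have eq: "?y * lmul qdet * ?A' = lmul qdet * ?y * ?A'"
  proof (rule exchange_det[OF x_far y_far xy copies_qdet qdet_r up_A[OF m1 A_top]])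
    show "up ri m * A m = ?A' * up ri m"
      by (rule anti_intertwine) (auto simp: up_ri_shift sc_up)
    show "?y * ?A' = ?A' * ?y"
    proof (rule anti_intertwine)
      show "?y * sc a = sc a * ?y" for a
        unfolding op1_def by (rule lmul_opo_commute[symmetric]) (simp add: \<kappa>Y)
    qed (simp add: y_far)
  qed auto
  define f where "f = (\<lambda>s::nat \<Rightarrow> 'n. if s 0 = j then \<kappa> (u (seg (Suc 0) m s)) else 0)"
  have p0: "put (Suc 0) K s 0 = s 0" for K s by (simp add: put_def)
  have f: "app ?A' f = f"
    by (rule ext) (simp add: app_A'_uv f_def p0 vu_\<kappa>)
  obtain L where L: "length L = m" "u L \<noteq> 0" using n.u_nonzero by blast
  define s where "s = put 0 (i # L) (undefined :: nat \<Rightarrow> 'n)"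
  have s: "s 0 = i" "seg (Suc 0) m s = L" using L by (auto simp: s_def put_Cons) (simp add: put_def)?
  have seg: "seg (Suc 0) m (s(0 := a)) = seg (Suc 0) m s" for a s by (auto simp: seg_def)
  have "app (?y * lmul qdet) (app ?A' f) s = app (lmul qdet * ?y) (app ?A' f) s"
    using arg_cong[OF eq, of "\<lambda>P. app P f s"] by (simp only: app_simps)
  then have "Y i j * (qdet * \<kappa> (u L)) = qdet * (Y i j * \<kappa> (u L))"
    unfolding f by (simp add: app_op1 s f_def seg mult_if_delta)
  then show ?thesis using \<kappa>_unit[OF L(2)] by (simp add: mult.assoc[symmetric])
qed

text \<open>Invertibility of \<open>Gm'\<close> makes u, read as a matrix with its first index
  against the others, invertible from the right.\<close>

lemma u_contract: "\<exists>y. \<forall>i j. (\<Sum>K | length K = m - 1. u (i # K) * y j K) = (if i = j then 1 else 0)"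
proof -
  obtain F where F: "\<And>a b. (\<Sum>c\<in>UNIV. n.Gm' a c * F c b) = (if a = b then 1 else 0)" using n.Gm'_inverse by blast
  have "(\<Sum>K | length K = m - 1. u (i # K) * (\<Sum>c\<in>UNIV. v (K @ [c]) * F c j)) = (if i = j then 1 else 0)" for i j
    unfolding F[symmetric] n.Gm'_def by (simp add: sum_distrib_left sum_distrib_right mult.assoc) (rule sum.swap)
  then show ?thesis by (intro exI[of _ "\<lambda>j K. \<Sum>c\<in>UNIV. v (K @ [c]) * F c j"] allI)
qed

lemma v_contract: "\<exists>y. \<forall>i j. (\<Sum>K | length K = m - 1. y i K * v (j # K)) = (if i = j then 1 else 0)"
proof -
  obtain F where F: "\<And>a b. (\<Sum>c\<in>UNIV. F a c * n.Gm c b) = (if a = b then 1 else 0)" using n.Gm_inverse by blast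
  have "(\<Sum>K | length K = m - 1. (\<Sum>c\<in>UNIV. F i c * u (K @ [c])) * v (j # K)) = (if i = j then 1 else 0)" for i j
    unfolding F[symmetric] n.Gm_def by (simp add: sum_distrib_left sum_distrib_right mult_ac) (rule sum.swap)
  then show ?thesis by (intro exI[of _ "\<lambda>i K. \<Sum>c\<in>UNIV. F i c * u (K @ [c])"] allI)
qed

text \<open>Applied to u, \<open>copies_qdet\<close> says that M_1 times the product of the other
  copies multiplies u by \<open>qdet\<close>. The legs 2, ..., m are then contracted with
  \<open>y\<close>.\<close>

lemma right_inverse:
  assumes y: "\<And>i j. (\<Sum>K | length K = m - 1. u (i # K) * y j K) = (if i = j then 1 else 0)"
    and T: "tail_copies x (m - 1) = opo 0 m T"
  shows "(\<Sum>a\<in>UNIV. M i a * (\<Sum>K | length K = m - 1. \<Sum>L | length L = m. T (a # K) L * \<kappa> (u L) * \<kappa> (y j K))) = (if i = j then qdet else 0)"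
proof -
  define U where "U = (\<lambda>s::nat \<Rightarrow> 'n. \<kappa> (u (seg 0 m s)))"
  have AU: "app (A m) U = U" by (rule ext) (simp add: app_A_uv U_def vu_\<kappa>)
  have c: "copies x m = x * tail_copies x (m - 1)" using m1 copies_tail[of x "m - 1"] by simp
  have "app (x * tail_copies x (m - 1) * A m) U = app (lmul qdet * A m) U"
    unfolding c[symmetric] copies_qdet ..
  then have "app x (app (opo 0 m T) U) = app (lmul qdet) U" by (simp only: app_simps AU T)
  then have eq: "app x (app (opo 0 m T) U) s = qdet * U s" for s by simp
  have row: "(\<Sum>a\<in>UNIV. M i a * (\<Sum>L | length L = m. T (a # K) L * \<kappa> (u L))) = qdet * \<kappa> (u (i # K))" if K: "length K = m - 1" for i K
  proof -
    define s where "s = put 0 (i # K) (undefined :: nat \<Rightarrow> 'n)"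
    have s0: "s 0 = i" by (simp add: s_def put_def)
    have sa: "s(0 := a) = put 0 (a # K) undefined" for a
      by (auto simp: s_def put_def fun_eq_iff)
    have sg: "seg 0 m (s(0 := a)) = a # K" for a unfolding sa using K m1 by simp
    have "seg 0 m s = i # K" using sg[of i] s0 by (simp add: fun_upd_idem)
    then show ?thesis using eq[of s] by (simp add: app_op1 app_opo s0 sg U_def cong: sum.cong_simp)
  qed
  have "(\<Sum>a\<in>UNIV. M i a * (\<Sum>K | length K = m - 1. \<Sum>L | length L = m. T (a # K) L * \<kappa> (u L) * \<kappa> (y j K)))
     = (\<Sum>K | length K = m - 1. (\<Sum>a\<in>UNIV. M i a * (\<Sum>L | length L = m. T (a # K) L * \<kappa> (u L))) * \<kappa> (y j K))"
    by (simp add: sum_distrib_left sum_distrib_right mult.assoc) (rule sum.swap)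
  also have "\<dots> = (\<Sum>K | length K = m - 1. qdet * (\<kappa> (u (i # K)) * \<kappa> (y j K)))"
    by (intro sum.cong refl) (simp add: row mult.assoc)
  also have "\<dots> = qdet * \<kappa> (if i = j then 1 else 0)"
    by (simp only: sum_distrib_left[symmetric] \<kappa>_mult[symmetric] \<kappa>_sum[symmetric] y)
  finally show ?thesis by (simp add: \<kappa>_0 \<kappa>_1)
qed

lemma down_A: "A k * down r j = sc ((- inverse q) ^ j) * A k" if "j < k"
  using that
proof (induction j)
  case (Suc j)
  have "A k * down r (Suc j) = sc (- inverse q) * (A k * down r j)"
    using A_r[of j k] Suc.prems by (simp add: mult.assoc[symmetric])
  then show ?case using Suc by (simp add: sc_merge mult.assoc)
qed (simp add: sc_1)

text \<open>\<open>copy_conj\<close> brings M_1 to the right end of the product of copies, up to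
  braid words; the word left over on the determinant side is absorbed by A_m. One row of
  \<open>P\<close> contracted with \<open>y\<close> is the left inverse; \<open>c\<close> collects
  the scalar of the absorbed word and a nonzero coefficient of u.\<close>

lemma left_inverse:
  "\<exists>Z c. c \<noteq> 0 \<and> (\<forall>i j. (\<Sum>a\<in>UNIV. Z i a * M a j) = (if i = j then qdet * \<kappa> c else 0))"
proof -
  obtain y where y: "\<And>i j. (\<Sum>K | length K = m - 1. y i K * v (j # K)) = (if i = j then 1 else 0)"
    using v_contract by blast
  interpret inv: braid_rep ri r by (rule inverse_rep)
  define P where "P = A m * copies x (m - 1) * down r (m - 1)"
  have cm: "copies x m = copies x (m - 1) * (down r (m - 1) * x * up ri (m - 1))"
    using m1 copy_conj[of x "m - 1"] by (cases m) simp_all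
  have "P * x = A m * copies x m * down r (m - 1)"
    unfolding P_def cm by (simp add: mult.assoc inv.up_down_inv)
  also have "\<dots> = lmul qdet * (A m * down r (m - 1))"
    unfolding copies_A[symmetric] copies_qdet by (simp only: mult.assoc)
  also have "\<dots> = lmul qdet * (sc ((- inverse q) ^ (m - 1)) * A m)"
    using down_A[of "m - 1" m] m1 by simp
  finally have Px: "P * x = lmul qdet * (sc ((- inverse q) ^ (m - 1)) * A m)" .
  have Pr: "app P (\<lambda>s. f s * c) s = app P f s * c" for f c s
  proof -
    have rr: "app (r i) (\<lambda>s. f s * c) = (\<lambda>s. app (r i) f s * c)" for i f
      by (simp add: r_def num2_def op2_def app_opo_right_fun)
    obtain T where "copies x (m - 1) = opo 0 m T" using loc_copies[of "m - 1"] unfolding loc_def by auto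
    moreover have "app (down r k) (\<lambda>s. f s * c) = (\<lambda>s. app (down r k) f s * c)" for k
      by (induction k) (simp_all add: rr)
    moreover have "A m = num 0 m (antisym q R m m)" by (subst num_antisym) simp_all
    ultimately show ?thesis unfolding P_def by (simp add: num_def app_opo_right_fun)
  qed
  obtain L where L: "length L = m" "u L \<noteq> 0" using n.u_nonzero by blast
  define s where "s = put 0 L (undefined :: nat \<Rightarrow> 'n)"
  have s: "seg 0 m s = L" using L by (simp add: s_def)
  define \<delta> where "\<delta> a K = (\<lambda>s::nat \<Rightarrow> 'n. if s 0 = a then if seg (Suc 0) (m - 1) s = K then 1 else (0::'a) else 0)" for a K
  define Z where "Z i a = (\<Sum>K | length K = m - 1. \<kappa> (y i K) * app P (\<delta> a K) s)" for i a
  have x\<delta>: "app x (\<delta> j K) = (\<Sum>a\<in>UNIV. (\<lambda>s. \<delta> a K s * M a j))" for j K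
  proof -
    have seg: "seg (Suc 0) (m - 1) (t(0 := a)) = seg (Suc 0) (m - 1) t" for a t by (auto simp: seg_def)
    show ?thesis by (rule ext) (simp add: app_op1 \<delta>_def seg[simplified] sum_fun_apply mult_if_delta)
  qed
  have A\<delta>: "app (A m) (\<delta> j K) s = \<kappa> (u L * v (j # K))" if "length K = m - 1" for j K
  proof -
    have "\<delta> j K (put 0 I s) = (if I = j # K then 1 else 0)" if I: "length I = m" for I
    proof -
      obtain a I' where I': "I = a # I'" "length I' = m - 1" using I m1 by (cases I) auto
      have "put 0 I s 0 = a" "seg (Suc 0) (m - 1) (put 0 I s) = I'"
        using I' by (simp_all add: put_Cons) (simp add: put_def)
      then show ?thesis unfolding \<delta>_def I' by auto
    qed
    then have "(\<Sum>I | length I = m. \<kappa> (v I) * \<delta> j K (put 0 I s)) = (\<Sum>I | length I = m. if I = j # K then \<kappa> (v I) else 0)"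
      by (intro sum.cong refl) auto
    also have "\<dots> = \<kappa> (v (j # K))" using that m1 by simp
    finally show ?thesis by (simp add: app_A_uv s \<kappa>_mult)
  qed
  define c where "c = (- inverse q) ^ (m - 1) * u L"
  have row: "(\<Sum>a\<in>UNIV. app P (\<delta> a K) s * M a j) = qdet * \<kappa> (c * v (j # K))" if K: "length K = m - 1" for j K
  proof -
    have "(\<Sum>a\<in>UNIV. app P (\<delta> a K) s * M a j) = app (P * x) (\<delta> j K) s"
      by (simp add: x\<delta> app_sum sum_fun_apply Pr)
    also have "\<dots> = qdet * (\<kappa> ((- inverse q) ^ (m - 1)) * \<kappa> (u L * v (j # K)))"
      unfolding Px by (simp only: app_simps app_lmul A\<delta>[OF K])
    finally show ?thesis by (simp add: c_def \<kappa>_mult mult.assoc)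
  qed
  have "(\<Sum>a\<in>UNIV. Z i a * M a j) = (if i = j then qdet * \<kappa> c else 0)" for i j
  proof -
    have "(\<Sum>a\<in>UNIV. Z i a * M a j) = (\<Sum>K | length K = m - 1. \<kappa> (y i K) * (\<Sum>a\<in>UNIV. app P (\<delta> a K) s * M a j))"
      unfolding Z_def by (simp add: sum_distrib_left sum_distrib_right mult.assoc) (rule sum.swap)
    also have "\<dots> = (\<Sum>K | length K = m - 1. qdet * (\<kappa> c * \<kappa> (y i K * v (j # K))))"
    proof (intro sum.cong refl)
      fix K :: "'n list" assume "K \<in> {K. length K = m - 1}"
      then have "\<kappa> (y i K) * (\<Sum>a\<in>UNIV. app P (\<delta> a K) s * M a j) = \<kappa> (y i K) * qdet * \<kappa> (c * v (j # K))"
        by (simp add: row mult.assoc)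
      also have "\<dots> = qdet * (\<kappa> (y i K) * \<kappa> (c * v (j # K)))" by (simp add: \<kappa>_qdet mult.assoc)
      also have "\<dots> = qdet * (\<kappa> c * \<kappa> (y i K * v (j # K)))" by (simp add: \<kappa>_mult[symmetric] mult_ac)
      finally show "\<kappa> (y i K) * (\<Sum>a\<in>UNIV. app P (\<delta> a K) s * M a j) = qdet * (\<kappa> c * \<kappa> (y i K * v (j # K)))" .
    qed
    also have "\<dots> = qdet * (\<kappa> c * \<kappa> (if i = j then 1 else 0))"
      by (simp only: sum_distrib_left[symmetric] \<kappa>_sum[symmetric] y)
    finally show ?thesis by (simp add: \<kappa>_0 \<kappa>_1)
  qed
  moreover have "c \<noteq> 0" using L q_nz by (simp add: c_def)
  ultimately show ?thesis by blast
qed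

end


section \<open>The relations of the braided differential algebra\<close>

lemma foldr_mult_append': "foldr (\<lambda>A P. f A * P) xs (y::'z::monoid_mult) = foldr (\<lambda>A P. f A * P) xs 1 * y"
  by (induction xs) (simp_all add: mult.assoc)

locale GL_hom = GL \<kappa> R q m + falg_hom \<kappa> g
  for \<kappa> :: "'k::field_char_0 \<Rightarrow> 'a::ring_1" and R :: "('k, 'n::finite) mat2" and q m and g :: "'n gen \<Rightarrow> 'a"
begin

abbreviation gM where "gM \<equiv> \<lambda>i j. g (MGen i j)"
abbreviation gQ where "gQ \<equiv> \<lambda>i j. g (QGen i j)"

lemma evo_relation:
  "evo 0 2 (tprod 2 [fnum (on2 2 1 R), on1 2 1 Y, fnum (on2 2 1 R), on1 2 1 Z])
     = r 0 * op1 0 (\<lambda>i j. e (Y i j)) * r 0 * op1 0 (\<lambda>i j. e (Z i j))"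
  "evo 0 2 (tprod 2 [on1 2 1 Z, fnum (on2 2 1 R), on1 2 1 Y, fnum (on2 2 1 R)])
     = op1 0 (\<lambda>i j. e (Z i j)) * r 0 * op1 0 (\<lambda>i j. e (Y i j)) * r 0"
  by (simp_all add: evo_tprod evo_fnum evo_on1 num_on2 r_def mult.assoc)

lemma exch_iff:
  "exch (\<lambda>i j. e (Y i j)) (\<lambda>i j. e (Z i j)) \<longleftrightarrow>
   (\<forall>y\<in>entry_relations (tprod 2 [fnum (on2 2 1 R), on1 2 1 Y, fnum (on2 2 1 R), on1 2 1 Z])
       (tprod 2 [on1 2 1 Z, fnum (on2 2 1 R), on1 2 1 Y, fnum (on2 2 1 R)]). e y = 0)"
proof -
  let ?L = "tprod 2 [fnum (on2 2 1 R), on1 2 1 Y, fnum (on2 2 1 R), on1 2 1 Z]"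
  let ?R = "tprod 2 [on1 2 1 Z, fnum (on2 2 1 R), on1 2 1 Y, fnum (on2 2 1 R)]"
  have "exch (\<lambda>i j. e (Y i j)) (\<lambda>i j. e (Z i j)) \<longleftrightarrow> evo 0 2 ?L = evo 0 2 ?R"
    unfolding evo_relation exch_def ..
  also have "\<dots> \<longleftrightarrow> (\<forall>I I'. length I = 2 \<longrightarrow> length I' = 2 \<longrightarrow> e (?L I I') = e (?R I I'))"
    unfolding evo_def using opo_inj[of 0 2 "\<lambda>I J. e (?L I J)" "\<lambda>I J. e (?R I J)"]
      opo_cong[of 2 "\<lambda>I J. e (?L I J)" "\<lambda>I J. e (?R I J)" 0] by blast
  also have "\<dots> \<longleftrightarrow> (\<forall>y\<in>entry_relations ?L ?R. e y = 0)"
  proof -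
    have "e y = e z \<longleftrightarrow> e (y - z) = 0" for y z by (simp add: ev_diff)
    then show ?thesis unfolding entry_relations_def by blast
  qed
  finally show ?thesis .
qed

text \<open>The checklist for a homomorphism to factor through the algebra. It serves the character
  \<epsilon>, the regular representation \<rho>, the enlarged one \<Phi> and the representation
  \<Theta> with the operators T.\<close>

lemma kills_relations_iff:
  "(\<forall>y\<in>ad_relations q m R. e y = 0) \<longleftrightarrow> exch gM gM \<and> exch gQ gQ \<and> exch gQ gM \<and>
     e (a_elem q m R) * g AInv = 1 \<and> g AInv * e (a_elem q m R) = 1"
proof -
  have M: "gM = (\<lambda>i j. e (fM i j))" and Q: "gQ = (\<lambda>i j. e (fQ i j))"
    by (simp_all add: fM_def fQ_def ev_gen)
  show ?thesis
    unfolding M Q exch_iff ad_relations_def Let_def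
    by (simp only: ball_Un) (simp add: ev_diff ev_mult ev_gen ev_1 ball_Un conj_ac)
qed

lemma evo_M_bar: "k < N \<Longrightarrow> evo 0 N (M_bar R N k) = copy (op1 0 gM) k"
proof (induction k)
  case 0
  then show ?case by (simp add: evo_on1 fM_def ev_gen)
next
  case (Suc k)
  then show ?case by (simp add: evo_tprod evo_fnum num_on2 r_def[symmetric] ri_def[symmetric] mult.assoc)
qed

lemma evo_M_bars: "k \<le> N \<Longrightarrow> foldr (\<lambda>A P. evo 0 N A * P) (map (M_bar R N) [0..<k]) 1 = copies (op1 0 gM) k"
proof (induction k)
  case (Suc k)
  have "foldr (\<lambda>A P. evo 0 N A * P) (map (M_bar R N) [0..<Suc k]) 1
      = foldr (\<lambda>A P. evo 0 N A * P) (map (M_bar R N) [0..<k]) 1 * evo 0 N (M_bar R N k)"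
    using foldr_mult_append'[of "evo 0 N" "map (M_bar R N) [0..<k]" "evo 0 N (M_bar R N k)"] by simp
  then show ?case using Suc by (simp add: evo_M_bar del: M_bar.simps)
qed simp

lemma evo_M_tail: "k < N \<Longrightarrow> evo 0 N (tprod N (map (M_bar R N) [1..<Suc k])) = tail_copies (op1 0 gM) k"
  unfolding evo_tprod
proof (induction k)
  case (Suc k)
  have "foldr (\<lambda>A P. evo 0 N A * P) (map (M_bar R N) [1..<Suc (Suc k)]) 1
      = foldr (\<lambda>A P. evo 0 N A * P) (map (M_bar R N) [1..<Suc k]) 1 * evo 0 N (M_bar R N (Suc k))"
    using foldr_mult_append'[of "evo 0 N" "map (M_bar R N) [1..<Suc k]" "evo 0 N (M_bar R N (Suc k))"]
    by (simp del: M_bar.simps)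
  then show ?case using Suc by (simp add: evo_M_bar del: M_bar.simps)
qed simp

end

locale RE_hom = GL_hom \<kappa> R q m g
  for \<kappa> :: "'k::field_char_0 \<Rightarrow> 'a::ring_1" and R :: "('k, 'n::finite) mat2" and q m and g :: "'n gen \<Rightarrow> 'a" +
  fixes u v :: "'n list \<Rightarrow> 'k"
  assumes gMM: "exch gM gM" and uv': "numGL R q m u v"
begin

sublocale RE \<kappa> R q m gM u v
  by (rule RE.intro[OF GL_axioms], rule RE_axioms.intro) (auto simp: \<kappa>_g gMM uv')

abbreviation tq :: 'k where "tq \<equiv> GLid.t R q m"

lemma GLid: "GLid R q m" by unfold_locales (auto simp: GL)

text \<open>By \<open>copies_qdet\<close> the determinant leaves the trace, past the numerical
  matrices C, and the R-trace of A_m is left.\<close>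

lemma ev_a_elem: "e (a_elem q m R) = qdet * \<kappa> tq"
proof -
  interpret i: GLid R q m by (rule GLid)
  let ?L = "map (\<lambda>i. fnum (on1 m i C)) [1..<m+1] @ map (M_bar R m) [0..<m] @ [fnum (antisym q R m m)]"
  let ?CC = "tprod m (map (\<lambda>i. on1 m i C) [1..<m+1])"
  have "evo 0 m (tprod m ?L) = num 0 m ?CC * (copies (op1 0 gM) m * A m)"
  proof -
    have "evo 0 m (tprod m ?L) = foldr (\<lambda>A P. evo 0 m A * P) (map (\<lambda>i. fnum (on1 m i C)) [1..<m+1]) 1 *
       (foldr (\<lambda>A P. evo 0 m A * P) (map (M_bar R m) [0..<m]) 1 * evo 0 m (fnum (antisym q R m m)))"
      unfolding evo_tprod foldr_append
      by (subst foldr_mult_append', subst foldr_mult_append'[of _ "map (M_bar R m) [0..<m]"]) simp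
    also have "foldr (\<lambda>A P. evo 0 m A * P) (map (\<lambda>i. fnum (on1 m i C)) [1..<m+1]) 1 = num 0 m ?CC"
      unfolding num_tprod foldr_map o_def evo_fnum ..
    finally show ?thesis by (simp add: evo_M_bars evo_fnum num_antisym)
  qed
  also have "\<dots> = lmul qdet * (num 0 m ?CC * A m)"
  proof -
    have "num 0 m ?CC * lmul qdet = lmul qdet * num 0 m ?CC"
      unfolding num_def by (rule lmul_opo_commute[symmetric]) (simp add: \<kappa>_qdet)
    then show ?thesis unfolding copies_qdet by (simp only: mult.assoc[symmetric])
  qed
  also have "A m = num 0 m (antisym q R m m)" by (simp add: num_antisym)
  also have "lmul qdet * (num 0 m ?CC * num 0 m (antisym q R m m)) = opo 0 m (\<lambda>I J. qdet * \<kappa> (tmul m ?CC (antisym q R m m) I J))"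
    by (simp only: num_tmul[symmetric]) (simp only: num_def opo_lmul)
  finally have "e (tprod m ?L I I') = qdet * \<kappa> (tmul m ?CC (antisym q R m m) I I')" if "length I = m" "length I' = m" for I I'
    unfolding evo_def by (rule opo_inj) (rule that)+
  then have "e (a_elem q m R) = (\<Sum>I | length I = m. qdet * \<kappa> (tmul m ?CC (antisym q R m m) I I))"
    unfolding a_elem_def ttrace_def ev_sum by (intro sum.cong refl) simp
  also have "\<dots> = qdet * \<kappa> (i.t m)"
    by (simp add: i.t_def tmul_def sum_distrib_left[symmetric] \<kappa>_sum[symmetric])
  finally show ?thesis .
qed

lemma tq_nz: "tq \<noteq> 0" using GLid.t_nonzero[OF GLid] .

end


section \<open>The exchange relation in coordinates\<close>

context GL
begin

definition locs :: "((nat \<Rightarrow> 'n) \<Rightarrow> 'a) endo \<Rightarrow> bool" where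
  "locs P \<longleftrightarrow> (\<exists>T. P = opo 0 2 T)"

lemma locs_mult: "locs P \<Longrightarrow> locs P' \<Longrightarrow> locs (P * P')"
  unfolding locs_def by (auto simp: opo_tmul[symmetric])

lemma locs_diff: "locs P \<Longrightarrow> locs P' \<Longrightarrow> locs (P - P')"
  unfolding locs_def by (auto simp: opo_diff[symmetric])

lemma locs_r: "locs (r 0)" "locs (ri 0)"
  unfolding locs_def r_def ri_def num2_def op2_def by blast+

lemma locs_op1: "locs (op1 0 Z)"
proof -
  have "op1 0 Z = opo 0 2 (on1 2 1 Z)" by (subst opo_on1) auto
  then show ?thesis unfolding locs_def by blast
qed

definition ent2 :: "((nat \<Rightarrow> 'n) \<Rightarrow> 'a) endo \<Rightarrow> 'n \<Rightarrow> 'n \<Rightarrow> 'n \<Rightarrow> 'n \<Rightarrow> 'a" where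
  "ent2 P i j k c = app P (\<lambda>s. if s 0 = k then if s 1 = c then 1 else 0 else 0) (\<lambda>n. if n = 0 then i else j)"

lemma ent2_opo: "ent2 (opo 0 2 T) i j k c = T [i, j] [k, c]"
proof -
  have "(\<lambda>s. if s 0 = k then if s 1 = c then 1 else 0 else 0) = (\<lambda>s. if seg 0 2 s = [k, c] then 1 else (0::'a))"
    by (auto simp: fun_eq_iff numeral_2_eq_2 seg_Suc)
  moreover have "seg 0 2 (\<lambda>n. if n = 0 then i else j) = [i, j]"
    by (simp add: numeral_2_eq_2 seg_Suc)
  ultimately show ?thesis unfolding ent2_def by (simp add: app_opo_delta)
qed

lemma locs_eqI:
  assumes "locs P" "locs P'" "\<And>i j k c. ent2 P i j k c = ent2 P' i j k c"
  shows "P = P'"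
proof -
  obtain T T' where T: "P = opo 0 2 T" "P' = opo 0 2 T'" using assms unfolding locs_def by blast
  have "T [i, j] [k, c] = T' [i, j] [k, c]" for i j k c
    using assms(3)[of i j k c] unfolding T ent2_opo .
  then show ?thesis unfolding T
    by (intro opo_cong) (auto simp: numeral_2_eq_2 length_Suc_conv)
qed

text \<open>Coordinates are needed where the relation is transported along a map of the entries, or
  from operators acting on a vector to the components of the result.\<close>

lemma exch_formula:
  "exch Y Z \<longleftrightarrow> (\<forall>i j k c.
     (\<Sum>a\<in>UNIV. \<Sum>b\<in>UNIV. \<kappa> (R $ (i, j) $ (a, b)) * (\<Sum>l\<in>UNIV. Y a l * (\<Sum>d\<in>UNIV. \<kappa> (R $ (l, b) $ (d, c)) * Z d k)))
     = (\<Sum>l\<in>UNIV. Z i l * (\<Sum>a\<in>UNIV. \<Sum>b\<in>UNIV. \<kappa> (R $ (l, j) $ (a, b)) * (\<Sum>d\<in>UNIV. Y a d * \<kappa> (R $ (d, b) $ (k, c))))))"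
proof -
  have 1: "ent2 (r 0 * op1 0 Y * r 0 * op1 0 Z) i j k c
     = (\<Sum>a\<in>UNIV. \<Sum>b\<in>UNIV. \<kappa> (R $ (i, j) $ (a, b)) * (\<Sum>l\<in>UNIV. Y a l * (\<Sum>d\<in>UNIV. \<kappa> (R $ (l, b) $ (d, c)) * Z d k)))" for i j k c
    by (simp add: ent2_def r_def num2_def app_op1 app_op2 mult_if_delta sum_if_const)
  have 2: "ent2 (op1 0 Z * r 0 * op1 0 Y * r 0) i j k c
     = (\<Sum>l\<in>UNIV. Z i l * (\<Sum>a\<in>UNIV. \<Sum>b\<in>UNIV. \<kappa> (R $ (l, j) $ (a, b)) * (\<Sum>d\<in>UNIV. Y a d * \<kappa> (R $ (d, b) $ (k, c)))))" for i j k c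
    by (simp add: ent2_def r_def num2_def app_op1 app_op2 mult_if_delta sum_if_const)
  have l: "locs (r 0 * op1 0 Y * r 0 * op1 0 Z)" "locs (op1 0 Z * r 0 * op1 0 Y * r 0)"
    by (intro locs_mult locs_r locs_op1)+
  show ?thesis unfolding exch_def 1[symmetric] 2[symmetric] by (auto intro!: locs_eqI[OF l])
qed

definition swapped :: "('n \<Rightarrow> 'n \<Rightarrow> 'a) \<Rightarrow> ('n \<Rightarrow> 'n \<Rightarrow> 'a) \<Rightarrow> 'n \<Rightarrow> 'n \<Rightarrow> 'n \<Rightarrow> 'n \<Rightarrow> 'a" where
  "swapped Y Z i j k c = (\<Sum>a\<in>UNIV. \<Sum>b\<in>UNIV. \<kappa> (matrix_inv R $ (i, j) $ (a, b)) * (\<Sum>l\<in>UNIV. Z a l *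
     (\<Sum>d\<in>UNIV. \<Sum>d'\<in>UNIV. \<kappa> (R $ (l, b) $ (d, d')) * (\<Sum>t\<in>UNIV. Y d t * \<kappa> (R $ (t, d') $ (k, c))))))"

lemma ent2_swapped: "ent2 (ri 0 * op1 0 Z * r 0 * op1 0 Y * r 0) i j k c = swapped Y Z i j k c"
  by (simp add: ent2_def swapped_def r_def ri_def num2_def app_op1 app_op2 mult_if_delta sum_if_const)

lemma ent2_product: "ent2 (op1 0 Y * r 0 * op1 0 Z) i j k c = (\<Sum>a\<in>UNIV. \<Sum>b\<in>UNIV. Y i a * (\<kappa> (R $ (a, j) $ (b, c)) * Z b k))"
  by (simp add: ent2_def r_def num2_def app_op1 app_op2 mult_if_delta sum_if_const sum_distrib_left)

lemma exch_iff_swapped: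
  "exch Y Z \<longleftrightarrow> (\<forall>i j k c. (\<Sum>a\<in>UNIV. \<Sum>b\<in>UNIV. Y i a * (\<kappa> (R $ (a, j) $ (b, c)) * Z b k)) = swapped Y Z i j k c)"
proof -
  have l: "locs (op1 0 Y * r 0 * op1 0 Z)" "locs (ri 0 * op1 0 Z * r 0 * op1 0 Y * r 0)"
    by (intro locs_mult locs_r locs_op1)+
  have "exch Y Z \<longleftrightarrow> op1 0 Y * r 0 * op1 0 Z = ri 0 * op1 0 Z * r 0 * op1 0 Y * r 0"
  proof
    assume "exch Y Z"
    then have "ri 0 * (r 0 * op1 0 Y * r 0 * op1 0 Z) = ri 0 * (op1 0 Z * r 0 * op1 0 Y * r 0)" by (simp add: exch_def)
    then show "op1 0 Y * r 0 * op1 0 Z = ri 0 * op1 0 Z * r 0 * op1 0 Y * r 0" by (simp add: mult.assoc r_cancel)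
  next
    assume "op1 0 Y * r 0 * op1 0 Z = ri 0 * op1 0 Z * r 0 * op1 0 Y * r 0"
    then have "r 0 * (op1 0 Y * r 0 * op1 0 Z) = r 0 * (ri 0 * op1 0 Z * r 0 * op1 0 Y * r 0)" by simp
    then show "exch Y Z" by (simp add: exch_def mult.assoc r_cancel)
  qed
  then show ?thesis unfolding ent2_swapped[symmetric] ent2_product[symmetric] by (auto intro!: locs_eqI[OF l])
qed

text \<open>In Y_1 R_1 Z_1 = R_1^{-1} Z_1 R_1 Y_1 R_1 the R between Y and Z is removed by Psi. Every
  single product of entries is thus reordered.\<close>

lemma exch_solved:
  assumes "exch Y Z" and \<kappa>Y: "\<And>c i j. \<kappa> c * Y i j = Y i j * \<kappa> c"
  shows "Y i x * Z y k = (\<Sum>j\<in>UNIV. \<Sum>c\<in>UNIV. \<kappa> (Psi $ (c, y) $ (j, x)) * swapped Y Z i j k c)"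
proof (rule solve_R[where g = "\<lambda>x y. Y i x * Z y k"])
  fix j c
  have "\<kappa> e * (Y i a * z) = Y i a * (\<kappa> e * z)" for e a z by (simp only: mult.assoc[symmetric] \<kappa>Y)
  then show "(\<Sum>a\<in>UNIV. \<Sum>b\<in>UNIV. \<kappa> (R $ (a, j) $ (b, c)) * (Y i a * Z b k)) = swapped Y Z i j k c"
    using assms(1) unfolding exch_iff_swapped by simp
qed

end

text \<open>\<open>\<phi>\<close> may fail to preserve 1; it is applied to \<open>lift0\<close>.
  Compatibility with the scalars on both sides takes the place of unitality.\<close>

lemma exch_hom:
  assumes "GL \<kappa> R q m" "GL \<kappa>' R q m"
    and add: "\<And>y z. \<phi> (y + z) = \<phi> y + \<phi> z"
    and mult: "\<And>y z. \<phi> (y * z) = \<phi> y * \<phi> z"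
    and l: "\<And>c y. \<phi> (\<kappa> c * y) = \<kappa>' c * \<phi> y" and r: "\<And>c y. \<phi> (y * \<kappa> c) = \<phi> y * \<kappa>' c"
    and ex: "GL.exch \<kappa> R Y Z"
  shows "GL.exch \<kappa>' R (\<lambda>i j. \<phi> (Y i j)) (\<lambda>i j. \<phi> (Z i j))"
proof -
  interpret g: GL \<kappa> R q m by fact
  interpret h: GL \<kappa>' R q m by fact
  have "\<phi> 0 = 0" using add[of 0 0] by simp
  then have sum: "\<phi> (sum F S) = (\<Sum>i\<in>S. \<phi> (F i))" for F and S :: "'z set"
    by (induction S rule: infinite_finite_induct) (simp_all add: add)
  show ?thesis
    unfolding h.exch_formula
  proof (intro allI)
    fix i j k c
    show "(\<Sum>a\<in>UNIV. \<Sum>b\<in>UNIV. \<kappa>' (R $ (i, j) $ (a, b)) * (\<Sum>l\<in>UNIV. \<phi> (Y a l) * (\<Sum>d\<in>UNIV. \<kappa>' (R $ (l, b) $ (d, c)) * \<phi> (Z d k))))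
     = (\<Sum>l\<in>UNIV. \<phi> (Z i l) * (\<Sum>a\<in>UNIV. \<Sum>b\<in>UNIV. \<kappa>' (R $ (l, j) $ (a, b)) * (\<Sum>d\<in>UNIV. \<phi> (Y a d) * \<kappa>' (R $ (d, b) $ (k, c)))))"
      using ex[unfolded g.exch_formula, rule_format, of i j c k, THEN arg_cong[of _ _ \<phi>]] by (simp only: sum l r
          mult[of "Y a b" "sum F UNIV" for a b F] mult[of "Z a b" "sum F UNIV" for a b F])
  qed
qed

section \<open>Extending a matrix to the bimodule spanned by the \<open>Q\<close>'s\<close>

text \<open>The ring \<open>'g\<close> acts on a direct sum of a module (the image of the idempotent \<open>p\<close>) and
  copies of it indexed by the entries of a matrix; \<open>Qh i j\<close> and \<open>emb i j\<close> are the matrix units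
  from and to the copy with index \<open>(i, j)\<close>. For a matrix \<open>Z\<close> over the first summand, \<open>hat Z\<close> is the
  block diagonal extension of \<open>Z\<close> for which \<open>exch Qh (hat Z)\<close> holds.\<close>

locale hat = GL \<kappa> R q m
  for \<kappa> :: "'k::field_char_0 \<Rightarrow> 'g::ring_1" and R :: "('k, 'n::finite) mat2" and q m +
  fixes p :: 'g and Qh emb :: "'n \<Rightarrow> 'n \<Rightarrow> 'g"
  assumes \<kappa>p: "\<kappa> c * p = p * \<kappa> c" and \<kappa>Q: "\<kappa> c * Qh i j = Qh i j * \<kappa> c" and \<kappa>emb: "\<kappa> c * emb i j = emb i j * \<kappa> c"
    and pp: "p * p = p" and Q_emb: "Qh i j * emb k l = (if k = i then if l = j then p else 0 else 0)"
    and pQ: "p * Qh i j = Qh i j" and Qp: "Qh i j * p = 0" and p_emb: "p * emb i j = 0" and emb_p: "emb i j * p = emb i j"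
    and complete: "p + (\<Sum>i\<in>UNIV. \<Sum>j\<in>UNIV. emb i j * Qh i j) = 1"
begin

definition hat :: "('n \<Rightarrow> 'n \<Rightarrow> 'g) \<Rightarrow> 'n \<Rightarrow> 'n \<Rightarrow> 'g" where
  "hat Z y k = Z y k + (\<Sum>i\<in>UNIV. \<Sum>x\<in>UNIV. emb i x *
     (\<Sum>j\<in>UNIV. \<Sum>c\<in>UNIV. \<kappa> (Psi $ (c, y) $ (j, x)) * swapped Qh Z i j k c))"

lemma lr: "lmul p * r i = r i * lmul p" "lmul p * ri i = ri i * lmul p"
  unfolding r_def ri_def num2_def op2_def by (rule lmul_opo_commute, simp add: \<kappa>p)+

lemma p_op1: "lmul p * op1 0 Z = op1 0 (\<lambda>i j. p * Z i j)"
  by (rule op_eqI) (simp add: app_op1 sum_distrib_left mult.assoc)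

lemma op1_p: "op1 0 Z * lmul p = op1 0 (\<lambda>i j. Z i j * p)"
  by (rule op_eqI) (simp add: app_op1 mult.assoc)

context
  fixes Z :: "'n \<Rightarrow> 'n \<Rightarrow> 'g"
  assumes pZ: "\<And>i j. p * Z i j = Z i j" and Zp: "\<And>i j. Z i j * p = Z i j" and \<kappa>Z: "\<And>c i j. \<kappa> c * Z i j = Z i j * \<kappa> c"
begin

lemma pZ': "p * (Z i j * z) = Z i j * z" by (simp only: mult.assoc[symmetric] pZ)
lemma p\<kappa>': "p * (\<kappa> c * z) = \<kappa> c * (p * z)" by (simp only: mult.assoc[symmetric] \<kappa>p)

lemma p_swapped: "p * swapped Qh Z i j k c = swapped Qh Z i j k c"
  unfolding swapped_def by (simp add: sum_distrib_left p\<kappa>' pZ' mult.assoc)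

lemma swapped_p: "swapped Qh Z i j k c * p = 0"
proof -
  have "Qh d t * (\<kappa> e * p) = 0" for d t e unfolding \<kappa>p by (simp only: mult.assoc[symmetric] Qp) simp
  then show ?thesis unfolding swapped_def by (simp add: sum_distrib_right mult.assoc)
qed

lemma \<kappa>_swapped: "\<kappa> e * swapped Qh Z i j k c = swapped Qh Z i j k c * \<kappa> e"
proof -
  have 1: "\<kappa> e * (\<kappa> a * z) = \<kappa> a * (\<kappa> e * z)" for a z by (simp only: mult.assoc[symmetric] \<kappa>_comm)
  have 2: "\<kappa> e * (Z a b * z) = Z a b * (\<kappa> e * z)" for a b z by (simp only: mult.assoc[symmetric] \<kappa>Z)
  have 3: "\<kappa> e * (Qh a b * \<kappa> f) = Qh a b * (\<kappa> f * \<kappa> e)" for a b f by (simp only: mult.assoc[symmetric] \<kappa>Q) (simp only: mult.assoc \<kappa>_comm)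
  show ?thesis unfolding swapped_def
    by (simp add: sum_distrib_left sum_distrib_right mult.assoc 1 2 3)
qed

lemma p_hat: "p * hat Z y k = Z y k"
  unfolding hat_def by (simp add: distrib_left sum_distrib_left pZ mult.assoc[symmetric] p_emb)

lemma hat_p: "hat Z y k * p = Z y k"
  unfolding hat_def by (simp add: distrib_right sum_distrib_right Zp mult.assoc swapped_p)

lemma \<kappa>_hat: "\<kappa> e * hat Z y k = hat Z y k * \<kappa> e"
proof -
  have 1: "\<kappa> e * (emb a b * z) = emb a b * (\<kappa> e * z)" for a b z by (simp only: mult.assoc[symmetric] \<kappa>emb)
  have 2: "\<kappa> e * (\<kappa> f * swapped Qh Z i j k c) = \<kappa> f * (swapped Qh Z i j k c * \<kappa> e)" for f i j k c
    by (simp only: \<kappa>_swapped[symmetric] mult.assoc[symmetric] \<kappa>_comm[of e f])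
  show ?thesis unfolding hat_def
    by (simp add: distrib_left distrib_right sum_distrib_left sum_distrib_right mult.assoc 1 2 \<kappa>Z)
qed

lemma Q_hat: "Qh i x * hat Z y k = (\<Sum>j\<in>UNIV. \<Sum>c\<in>UNIV. \<kappa> (Psi $ (c, y) $ (j, x)) * swapped Qh Z i j k c)"
proof -
  have "Qh i x * (p * Z y k) = 0" by (simp only: mult.assoc[symmetric] Qp mult_zero_left)
  then have "Qh i x * Z y k = 0" by (simp only: pZ)
  moreover have "Qh i x * (emb a b * z) = (if a = i then if b = x then p * z else 0 else 0)" for a b z
    by (simp only: mult.assoc[symmetric] Q_emb) simp
  moreover have "p * (\<Sum>j\<in>UNIV. \<Sum>c\<in>UNIV. \<kappa> (Psi $ (c, y) $ (j, x)) * swapped Qh Z i j k c)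
     = (\<Sum>j\<in>UNIV. \<Sum>c\<in>UNIV. \<kappa> (Psi $ (c, y) $ (j, x)) * swapped Qh Z i j k c)"
    by (simp add: sum_distrib_left p\<kappa>' p_swapped)
  ultimately show ?thesis
    unfolding hat_def by (simp add: distrib_left sum_distrib_left[of "Qh i x"] sum_if_const)
qed

lemma op1_hat_Q: "op1 0 (hat Z) * r 0 * op1 0 Qh = op1 0 Z * r 0 * op1 0 Qh"
proof -
  have Q: "op1 0 Qh = lmul p * op1 0 Qh" by (simp add: p_op1 pQ)
  have "op1 0 (hat Z) * r 0 * op1 0 Qh = op1 0 (hat Z) * (r 0 * lmul p) * op1 0 Qh"
    by (subst Q) (simp only: mult.assoc)
  also have "\<dots> = (op1 0 (hat Z) * lmul p) * r 0 * op1 0 Qh" by (simp only: lr[symmetric] mult.assoc)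
  also have "\<dots> = op1 0 Z * r 0 * op1 0 Qh" by (simp add: op1_p hat_p)
  finally show ?thesis .
qed

text \<open>On the copies \<open>hat Z\<close> is defined as the reordered product of
  \<open>Qh\<close> and \<open>Z\<close>, as in \<open>exch_solved\<close>; contracting with R
  undoes Psi.\<close>

lemma exch_Q_hat: "exch Qh (hat Z)"
proof -
  have "(\<Sum>a\<in>UNIV. \<Sum>b\<in>UNIV. Qh i a * (\<kappa> (R $ (a, j) $ (b, c)) * hat Z b k)) = swapped Qh Z i j k c" for i j k c
  proof -
    have "Qh i a * (\<kappa> e * hat Z b k) = \<kappa> e * (Qh i a * hat Z b k)" for e a b by (simp only: mult.assoc[symmetric] \<kappa>Q)
    then have "(\<Sum>a\<in>UNIV. \<Sum>b\<in>UNIV. Qh i a * (\<kappa> (R $ (a, j) $ (b, c)) * hat Z b k))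
      = (\<Sum>a\<in>UNIV. \<Sum>b\<in>UNIV. \<Sum>j'\<in>UNIV. \<Sum>c'\<in>UNIV. \<kappa> (Psi $ (c', b) $ (j', a) * R $ (a, j) $ (b, c)) * swapped Qh Z i j' k c')"
      by (simp add: Q_hat sum_distrib_left \<kappa>_mult \<kappa>_comm[of "Psi $ _ $ _"] mult.assoc)
    also have "\<dots> = (\<Sum>j'\<in>UNIV. \<Sum>c'\<in>UNIV. \<Sum>a\<in>UNIV. \<Sum>b\<in>UNIV. \<kappa> (Psi $ (c', b) $ (j', a) * R $ (a, j) $ (b, c)) * swapped Qh Z i j' k c')"
      by (rule sum_swap_pairs)
    also have "\<dots> = (\<Sum>j'\<in>UNIV. \<Sum>c'\<in>UNIV. \<kappa> (\<Sum>a\<in>UNIV. \<Sum>b\<in>UNIV. Psi $ (c', b) $ (j', a) * R $ (a, j) $ (b, c)) * swapped Qh Z i j' k c')"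
      by (simp only: \<kappa>_sum sum_distrib_right)
    also have "\<dots> = (\<Sum>j'\<in>UNIV. \<Sum>c'\<in>UNIV. (if j' = j \<and> c' = c then 1 else 0) * swapped Qh Z i j' k c')"
    proof -
      have "(\<Sum>a\<in>UNIV. \<Sum>b\<in>UNIV. Psi $ (c', b) $ (j', a) * R $ (a, j) $ (b, c)) = (if j' = j \<and> c' = c then 1 else 0)" for j' c'
        by (subst sum.swap) (rule Psi_R)
      then show ?thesis by (simp add: \<kappa>_0 \<kappa>_1 if_distrib[of \<kappa>] cong: if_cong)
    qed
    finally show ?thesis by (simp only: sum_delta_pair)
  qed
  \<comment> \<open>In \<open>swapped\<close> the matrix stands to the left of \<open>Qh\<close>,
    whose image lies in the first summand, where \<open>hat Z\<close> is \<open>Z\<close>.\<close>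
  moreover have "swapped Qh (hat Z) i j k c = swapped Qh Z i j k c" for i j k c
  proof -
    have "ri 0 * op1 0 (hat Z) * r 0 * op1 0 Qh * r 0 = ri 0 * (op1 0 (hat Z) * r 0 * op1 0 Qh) * r 0" by (simp only: mult.assoc)
    also have "\<dots> = ri 0 * op1 0 Z * r 0 * op1 0 Qh * r 0" unfolding op1_hat_Q by (simp only: mult.assoc)
    finally show ?thesis unfolding ent2_swapped[symmetric] by simp
  qed
  ultimately show ?thesis unfolding exch_iff_swapped by simp
qed

lemma Q_moves: "op1 0 Qh * (r 0 * op1 0 (hat Z) * ri 0) = (ri 0 * op1 0 (hat Z) * r 0) * op1 0 Qh"
proof -
  have e: "r 0 * (op1 0 Qh * (r 0 * op1 0 (hat Z))) = op1 0 (hat Z) * (r 0 * (op1 0 Qh * r 0))"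
    using exch_Q_hat by (simp add: exch_def mult.assoc)
  have "ri 0 * (r 0 * (op1 0 Qh * (r 0 * op1 0 (hat Z)))) * ri 0 = ri 0 * (op1 0 (hat Z) * (r 0 * (op1 0 Qh * r 0))) * ri 0"
    unfolding e ..
  then show ?thesis by (simp add: mult.assoc r_cancel r_ri)
qed

end

text \<open>The defect \<open>D\<close> of the relation is block diagonal with zero first block: p D
  = D p = 0. Moving \<open>Qh\<close> through r_0 r_1 D puts D to the left of \<open>Qh\<close> = p
  \<open>Qh\<close>, where it vanishes. Skew invertibility strips r_0 r_1 from \<open>Qh\<close> r_0
  r_1 D = 0, so the entries of D vanish on the copies as well.\<close>

lemma exch_hat:
  assumes pY: "\<And>i j. p * Y i j = Y i j" and Yp: "\<And>i j. Y i j * p = Y i j" and \<kappa>Y: "\<And>c i j. \<kappa> c * Y i j = Y i j * \<kappa> c"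
    and pZ: "\<And>i j. p * Z i j = Z i j" and Zp: "\<And>i j. Z i j * p = Z i j" and \<kappa>Z: "\<And>c i j. \<kappa> c * Z i j = Z i j * \<kappa> c"
    and ex: "exch Y Z"
  shows "exch (hat Y) (hat Z)"
proof -
  let ?y = "op1 0 (hat Y)" and ?z = "op1 0 (hat Z)" and ?Q = "op1 0 Qh"
  interpret inv: braid_rep ri r by (rule inverse_rep)
  define D where "D = r 0 * ?y * r 0 * ?z - ?z * r 0 * ?y * r 0"
  have zp: "?z * lmul p = op1 0 Z" "lmul p * ?z = op1 0 Z"
    by (simp_all add: op1_p p_op1 hat_p[OF pZ Zp \<kappa>Z] p_hat[OF pZ Zp \<kappa>Z])
  have yp: "?y * lmul p = op1 0 Y" "lmul p * ?y = op1 0 Y"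
    by (simp_all add: op1_p p_op1 hat_p[OF pY Yp \<kappa>Y] p_hat[OF pY Yp \<kappa>Y])
  have Zp': "op1 0 Z * lmul p = op1 0 Z" "lmul p * op1 0 Z = op1 0 Z" by (simp_all add: op1_p p_op1 Zp pZ)
  have Yp': "op1 0 Y * lmul p = op1 0 Y" "lmul p * op1 0 Y = op1 0 Y" by (simp_all add: op1_p p_op1 Yp pY)
  have assoc: "lmul p * (?y * w) = op1 0 Y * w" "lmul p * (?z * w) = op1 0 Z * w" "lmul p * (r i * w) = r i * (lmul p * w)" for w i
    by (simp_all only: mult.assoc[symmetric] yp zp lr)
  have pD: "lmul p * D = 0"
  proof -
    have a1: "op1 0 Y * (r 0 * ?z) = op1 0 Y * (r 0 * op1 0 Z)"
    proof -
      have "op1 0 Y * (r 0 * ?z) = (op1 0 Y * lmul p) * (r 0 * ?z)" unfolding Yp' ..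
      then show ?thesis by (simp only: mult.assoc assoc zp)
    qed
    have a2: "op1 0 Z * (r 0 * (?y * r 0)) = op1 0 Z * (r 0 * (op1 0 Y * r 0))"
    proof -
      have "op1 0 Z * (r 0 * (?y * r 0)) = (op1 0 Z * lmul p) * (r 0 * (?y * r 0))" unfolding Zp' ..
      then show ?thesis by (simp only: mult.assoc assoc)
    qed
    have "lmul p * D = r 0 * (op1 0 Y * (r 0 * ?z)) - op1 0 Z * (r 0 * (?y * r 0))"
      unfolding D_def by (simp only: right_diff_distrib mult.assoc assoc)
    also have "\<dots> = 0" unfolding a1 a2 using ex by (simp add: exch_def mult.assoc)
    finally show ?thesis .
  qed
  have Dp: "D * lmul p = 0"
  proof -
    have pr: "w * r i * lmul p = w * lmul p * r i" for w i by (simp only: mult.assoc lr)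
    have a1: "?y * r 0 * op1 0 Z = op1 0 Y * r 0 * op1 0 Z"
    proof -
      have "?y * r 0 * op1 0 Z = ?y * r 0 * lmul p * op1 0 Z" by (simp only: mult.assoc Zp')
      then show ?thesis by (simp only: pr yp)
    qed
    have a2: "?z * r 0 * op1 0 Y = op1 0 Z * r 0 * op1 0 Y"
    proof -
      have "?z * r 0 * op1 0 Y = ?z * r 0 * lmul p * op1 0 Y" by (simp only: mult.assoc Yp')
      then show ?thesis by (simp only: pr zp)
    qed
    have "D * lmul p = r 0 * (?y * r 0 * (?z * lmul p)) - (?z * r 0 * (?y * lmul p)) * r 0"
      unfolding D_def by (simp only: left_diff_distrib pr) (simp only: mult.assoc)
    also have "\<dots> = r 0 * (?y * r 0 * op1 0 Z) - (?z * r 0 * op1 0 Y) * r 0"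
      unfolding zp yp ..
    also have "\<dots> = 0" unfolding a1 a2 using ex by (simp add: exch_def mult.assoc)
    finally show ?thesis .
  qed
  have far1: "r 1 * ?y = ?y * r 1" "r 1 * ?z = ?z * r 1" "r 1 * ?Q = ?Q * r 1"
    by (rule op1_far; simp add: \<kappa>_hat[OF pY Yp \<kappa>Y] \<kappa>_hat[OF pZ Zp \<kappa>Z] \<kappa>Q)+
  have far1': "ri 1 * ?y = ?y * ri 1" "ri 1 * ?z = ?z * ri 1"
    using far1 by (simp_all add: ri_comm)
  \<comment> \<open>\<open>c\<close> conjugates \<open>z\<close> in the first leg to its braided
    copy in the second, \<open>c'\<close> does the same with the inverse braiding. Passing
    \<open>Qh\<close> exchanges the two, by \<open>Q_moves\<close>; this is recorded for every
    factor of \<open>D\<close> in the form of \<open>Qc\<close>.\<close>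
  define c c' where "c = r 0 * r 1" and "c' = ri 0 * ri 1"
  define ci ci' where "ci = ri 1 * ri 0" and "ci' = r 1 * r 0"
  have inv: "c * ci = 1" "ci * c = 1" "c' * ci' = 1" "ci' * c' = 1"
    by (simp_all add: c_def ci_def c'_def ci'_def mult.assoc r_cancel r_ri ri_r)
  have cr: "c * r 0 = r 1 * c" using braid[of 0] by (simp add: c_def mult.assoc)
  have c'r: "c' * r 0 = r 1 * c'" using braid_inv[of 0] by (simp add: c'_def mult.assoc)
  have cz: "c * z = (r 0 * z * ri 0) * c" if "r 1 * z = z * r 1" for z
    using that by (simp add: c_def mult.assoc r_cancel)
  have c'z: "c' * z = (ri 0 * z * r 0) * c'" if "ri 1 * z = z * ri 1" for z
    using that by (simp add: c'_def mult.assoc r_cancel)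
  have Qr: "?Q * r 1 = r 1 * ?Q" using far1 by simp
  have Qc: "?Q * (c * w) = c' * w' * ci' * ?Q * c"
    if "?Q * (r 0 * w * ri 0) = (ri 0 * w' * r 0) * ?Q" "r 1 * w = w * r 1" "ri 1 * w' = w' * ri 1" for w w'
  proof -
    have "?Q * (c * w) = (ri 0 * w' * r 0) * ?Q * c" unfolding cz[OF that(2)] using that(1) by (simp only: mult.assoc[symmetric])
    also have "ri 0 * w' * r 0 = c' * w' * ci'"
      unfolding c'z[OF that(3)] by (simp add: mult.assoc inv)
    finally show ?thesis .
  qed
  have Qcy: "?Q * (c * ?y) = c' * ?y * ci' * ?Q * c" by (rule Qc[OF Q_moves[OF pY Yp \<kappa>Y] far1(1) far1'(1)])
  have Qcz: "?Q * (c * ?z) = c' * ?z * ci' * ?Q * c" by (rule Qc[OF Q_moves[OF pZ Zp \<kappa>Z] far1(2) far1'(2)])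
  have Qcr: "?Q * (c * r 0) = c' * r 0 * ci' * ?Q * c"
  proof -
    have "?Q * (c * r 0) = r 1 * ?Q * c" unfolding cr by (simp only: mult.assoc[symmetric] Qr)
    also have "r 1 = c' * r 0 * ci'" unfolding c'r using inv by (simp add: mult.assoc)
    finally show ?thesis .
  qed
  have comp: "?Q * (c * (w * z)) = c' * (w' * z') * ci' * ?Q * c"
    if "?Q * (c * w) = c' * w' * ci' * ?Q * c" "?Q * (c * z) = c' * z' * ci' * ?Q * c" for w w' z z'
  proof -
    have "?Q * (c * (w * z)) = (?Q * (c * w)) * z" by (simp only: mult.assoc)
    also have "\<dots> = c' * w' * ci' * (?Q * (c * z))" unfolding that(1) by (simp only: mult.assoc)
    also have "\<dots> = c' * w' * (ci' * c') * z' * ci' * ?Q * c" unfolding that(2) by (simp only: mult.assoc)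
    finally show ?thesis by (simp add: inv mult.assoc)
  qed
  have "?Q * (c * D) = c' * D * ci' * ?Q * c"
    unfolding D_def right_diff_distrib left_diff_distrib mult.assoc
    using comp[OF Qcr comp[OF Qcy comp[OF Qcr Qcz]]] comp[OF Qcz comp[OF Qcr comp[OF Qcy Qcr]]]
    by (simp only: mult.assoc)
  also have "\<dots> = 0"
  proof -
    have "D * ci' * ?Q = D * ci' * (lmul p * ?Q)" by (simp add: p_op1 pQ)
    also have "\<dots> = D * (ci' * lmul p) * ?Q" by (simp only: mult.assoc)
    also have "ci' * lmul p = lmul p * ci'" by (simp only: ci'_def mult.assoc assoc(3) lr)
    also have "D * (lmul p * ci') * ?Q = (D * lmul p) * ci' * ?Q" by (simp only: mult.assoc)
    finally show ?thesis unfolding Dp by (simp add: mult.assoc)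
  qed
  finally have QcD: "?Q * (c * D) = 0" .
  have locD: "locs D" unfolding D_def by (intro locs_diff locs_mult locs_r locs_op1)
  have "D = 0"
  proof (rule locs_eqI[OF locD])
    show "locs 0" unfolding locs_def by (rule exI[of _ "\<lambda>_ _. 0"]) (simp add: opo_0)
    fix x y k l
    define g where "g b b' = ent2 D b b' k l" for b b'
    \<comment> \<open>The operator \<open>c\<close> reaches the third leg, so the test function
      fixes a third index that \<open>D\<close> does not touch.\<close>
    have gapp: "app D (\<lambda>s. if s 0 = k then if s 1 = l then if s 2 = l' then 1 else 0 else 0 else 0) s = (if s 2 = l' then g (s 0) (s 1) else 0)" for s l'
    proof -
      obtain T where T: "D = opo 0 2 T" using locD unfolding locs_def by blast
      have seg2: "seg 0 2 s = [s 0, s (Suc 0)]" by (simp add: numeral_2_eq_2 seg_Suc)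
      have "app D (\<lambda>s. if s 0 = k then if s 1 = l then if s 2 = l' then 1 else 0 else 0 else 0) s
         = (\<Sum>a\<in>UNIV. \<Sum>b\<in>UNIV. T [s 0, s (Suc 0)] [a, b] * (if a = k then if b = l then if s 2 = l' then 1 else 0 else 0 else 0))"
        unfolding T app_opo seg2 sum_length_2 put_pair by (simp cong: if_cong)
      also have "\<dots> = (if s 2 = l' then T [s 0, s (Suc 0)] [k, l] else 0)"
        by (simp add: mult_if_delta sum_if_const)
      finally show ?thesis by (simp add: g_def T ent2_opo)
    qed
    have Q0: "(\<Sum>s\<in>UNIV. \<Sum>b'\<in>UNIV. \<kappa> (R $ (s, y') $ (b', l')) * (\<Sum>a\<in>UNIV. \<Sum>b\<in>UNIV. \<kappa> (R $ (a, j') $ (b, s)) * (Qh i' a * g b b'))) = 0" for i' j' y' l'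
    proof -
      define s0 where "s0 = (\<lambda>n::nat. if n = 0 then i' else if n = 1 then j' else y')"
      have "app (?Q * (c * D)) (\<lambda>s. if s 0 = k then if s 1 = l then if s 2 = l' then 1 else 0 else 0 else 0) s0 = 0"
        unfolding QcD by simp
      then have e: "(\<Sum>a\<in>UNIV. Qh i' a * (\<Sum>b\<in>UNIV. \<Sum>s\<in>UNIV. \<kappa> (R $ (a, j') $ (b, s)) * (\<Sum>b'\<in>UNIV. \<kappa> (R $ (s, y') $ (b', l')) * g b b'))) = 0"
        by (simp add: gapp c_def r_def num2_def app_op1 app_op2 s0_def numeral_2_eq_2 mult_if_delta sum_if_const)
      have m1: "Qh i' a * (\<kappa> d * (\<kappa> d' * z)) = \<kappa> d' * (\<kappa> d * (Qh i' a * z))" for a d d' z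
      proof -
        have "Qh i' a * (\<kappa> d * (\<kappa> d' * z)) = (Qh i' a * \<kappa> d) * \<kappa> d' * z" by (simp only: mult.assoc)
        also have "\<dots> = \<kappa> d * (Qh i' a * \<kappa> d') * z" unfolding \<kappa>Q[of d, symmetric] by (simp only: mult.assoc)
        also have "\<dots> = (\<kappa> d * \<kappa> d') * (Qh i' a * z)" unfolding \<kappa>Q[of d', symmetric] by (simp only: mult.assoc)
        also have "\<dots> = \<kappa> d' * (\<kappa> d * (Qh i' a * z))" unfolding \<kappa>_comm[of d d'] by (simp only: mult.assoc)
        finally show ?thesis .
      qed
      have "(\<Sum>s\<in>UNIV. \<Sum>b'\<in>UNIV. \<kappa> (R $ (s, y') $ (b', l')) * (\<Sum>a\<in>UNIV. \<Sum>b\<in>UNIV. \<kappa> (R $ (a, j') $ (b, s)) * (Qh i' a * g b b')))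
        = (\<Sum>s\<in>UNIV. \<Sum>b'\<in>UNIV. \<Sum>a\<in>UNIV. \<Sum>b\<in>UNIV. Qh i' a * (\<kappa> (R $ (a, j') $ (b, s)) * (\<kappa> (R $ (s, y') $ (b', l')) * g b b')))"
        by (simp add: sum_distrib_left m1)
      also have "\<dots> = (\<Sum>a\<in>UNIV. \<Sum>b\<in>UNIV. \<Sum>s\<in>UNIV. \<Sum>b'\<in>UNIV. Qh i' a * (\<kappa> (R $ (a, j') $ (b, s)) * (\<kappa> (R $ (s, y') $ (b', l')) * g b b')))"
        by (rule sum_swap_pairs)
      also have "\<dots> = 0" using e by (simp add: sum_distrib_left)
      finally show ?thesis .
    qed
    \<comment> \<open>The two R coming from \<open>c\<close> are removed one after the
      other.\<close>
    have Q1: "(\<Sum>a\<in>UNIV. \<Sum>b\<in>UNIV. \<kappa> (R $ (a, j') $ (b, s)) * (Qh i' a * g b b')) = 0" for i' j' s b'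
      using solve_R[of "\<lambda>s b'. \<Sum>a\<in>UNIV. \<Sum>b\<in>UNIV. \<kappa> (R $ (a, j') $ (b, s)) * (Qh i' a * g b b')" "\<lambda>_ _. 0" s b', OF Q0] by simp
    have Q2: "Qh i' a * g b b' = 0" for i' a b b'
      using solve_R[of "\<lambda>a b. Qh i' a * g b b'" "\<lambda>_ _. 0" a b, OF Q1] by simp
    have "p * g x y = ent2 (lmul p * D) x y k l" by (simp add: g_def ent2_def)
    then have pg: "p * g x y = 0" by (simp add: pD ent2_def)
    have "g x y = (p + (\<Sum>i\<in>UNIV. \<Sum>j\<in>UNIV. emb i j * Qh i j)) * g x y" unfolding complete by simp
    also have "\<dots> = 0" by (simp add: distrib_right sum_distrib_right mult.assoc Q2 pg)
    finally show "ent2 D x y k l = ent2 0 x y k l" by (simp add: g_def ent2_def)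
  qed
  then show ?thesis by (simp add: D_def exch_def)
qed

end


section \<open>The ideal of relations\<close>

lemma ring_of_type_ring: "ring (ring_of_type_algebra :: 'a::ring_1 ring)"
proof -
  have "\<exists>y. y + x = 0" for x :: 'a by (rule exI[of _ "- x"]) simp
  then show ?thesis
    unfolding ring_of_type_algebra_def
    by unfold_locales (auto simp: algebra_simps Units_def add_eq_0_iff)
qed

lemma ad_ideal_ideal: "ideal (ad_ideal q m R) ring_of_type_algebra"
  unfolding ad_ideal_def
  by (rule ring.genideal_ideal[OF ring_of_type_ring]) (simp add: ring_of_type_algebra_def)

lemma ring_of_type_simps [simp]:
  "carrier ring_of_type_algebra = UNIV" "x \<otimes>\<^bsub>ring_of_type_algebra\<^esub> y = x * y"
  "x \<oplus>\<^bsub>ring_of_type_algebra\<^esub> y = x + y" "\<zero>\<^bsub>ring_of_type_algebra\<^esub> = 0" "\<one>\<^bsub>ring_of_type_algebra\<^esub> = 1"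
  by (simp_all add: ring_of_type_algebra_def)

lemma ad_ideal_closed:
  "0 \<in> ad_ideal q m R" "x \<in> ad_ideal q m R \<Longrightarrow> y \<in> ad_ideal q m R \<Longrightarrow> x + y \<in> ad_ideal q m R"
  "x \<in> ad_ideal q m R \<Longrightarrow> z * x \<in> ad_ideal q m R" "x \<in> ad_ideal q m R \<Longrightarrow> x * z \<in> ad_ideal q m R"
  "x \<in> ad_ideal q m R \<Longrightarrow> - x \<in> ad_ideal q m R" "x \<in> ad_ideal q m R \<Longrightarrow> y \<in> ad_ideal q m R \<Longrightarrow> x - y \<in> ad_ideal q m R"
proof -
  interpret i: ideal "ad_ideal q m R" ring_of_type_algebra by (rule ad_ideal_ideal)
  show z: "0 \<in> ad_ideal q m R" and a: "x \<in> ad_ideal q m R \<Longrightarrow> y \<in> ad_ideal q m R \<Longrightarrow> x + y \<in> ad_ideal q m R"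
    and l: "x \<in> ad_ideal q m R \<Longrightarrow> z * x \<in> ad_ideal q m R" and "x \<in> ad_ideal q m R \<Longrightarrow> x * z \<in> ad_ideal q m R" for x y z
    using additive_subgroup.zero_closed[OF i.additive_subgroup_axioms] additive_subgroup.a_closed[OF i.additive_subgroup_axioms, of x y]
      i.I_l_closed[of x z] i.I_r_closed[of x z] by simp_all
  show n: "x \<in> ad_ideal q m R \<Longrightarrow> - x \<in> ad_ideal q m R" for x using l[of x "- 1"] by simp
  show "x \<in> ad_ideal q m R \<Longrightarrow> y \<in> ad_ideal q m R \<Longrightarrow> x - y \<in> ad_ideal q m R" for x y using a[of x "- y"] n[of y] by simp
qed

lemma relations_in_ideal: "ad_relations q m R \<subseteq> ad_ideal q m R"
  unfolding ad_ideal_def by (rule ring.genideal_self[OF ring_of_type_ring]) simp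

lemma (in falg_hom) kills_ideal:
  assumes "\<forall>y\<in>ad_relations q m R. e y = 0" "x \<in> ad_ideal q m R"
  shows "e x = 0"
proof -
  have "ideal {x. e x = 0} ring_of_type_algebra"
  proof (rule idealI[OF ring_of_type_ring])
    show "subgroup {x. e x = 0} (add_monoid ring_of_type_algebra)"
    proof (rule group.subgroupI)
      interpret ring "ring_of_type_algebra :: (('k, 'n) falg) ring" by (rule ring_of_type_ring)
      show "Group.group (add_monoid (ring_of_type_algebra :: (('k, 'n) falg) ring))" by (rule add.is_group)
      show "{x. e x = 0} \<noteq> {}" using ev_0 by blast
      fix a assume a: "a \<in> {x. e x = 0}"
      have "\<ominus>\<^bsub>ring_of_type_algebra\<^esub> a = - a" 
        using minus_equality[of "- a" a] by simp
      then show "inv\<^bsub>add_monoid ring_of_type_algebra\<^esub> a \<in> {x. e x = 0}"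
        using a by (simp add: a_inv_def ev_minus)
    qed (auto simp: ev_add)
  qed (auto simp: ev_mult)
  then have "ad_ideal q m R \<subseteq> {x. e x = 0}"
    unfolding ad_ideal_def using assms(1) by (intro ring.genideal_minimal[OF ring_of_type_ring]) auto
  then show ?thesis using assms(2) by blast
qed

lemma fconst_simps:
  "fconst (a + b) = fconst a + fconst b" "fconst (a * b) = fconst a * fconst b" "fconst 1 = 1" "fconst 0 = 0"
  by (simp_all add: fconst_def single_add mult_single)

lemma fconst_comm: "fconst c * x = x * fconst c" for x :: "('k::field, 'n) falg"
proof (induction x rule: falg_induct)
  case (const c') then show ?case by (simp add: fconst_simps(2)[symmetric] mult.commute)
next
  case (gen g) then show ?case by (simp add: fconst_def fgen_def mult_single)
next
  case (add x y) then show ?case by (simp add: algebra_simps)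
next
  case (mult x y)
  have "fconst c * (x * y) = (x * fconst c) * y" unfolding mult(1)[symmetric] by (simp only: mult.assoc)
  also have "\<dots> = x * (y * fconst c)" unfolding mult(2)[symmetric] by (simp only: mult.assoc)
  finally show ?case by (simp only: mult.assoc)
qed

lemma fconst_left: "x * (fconst c * y) = fconst c * (x * y)" for x :: "('k::field, 'n) falg"
proof -
  have "x * (fconst c * y) = (x * fconst c) * y" by (rule mult.assoc[symmetric])
  also have "x * fconst c = fconst c * x" by (rule fconst_comm[symmetric])
  finally show ?thesis by (simp only: mult.assoc)
qed

text \<open>A basis of the ideal is extended to the free algebra and its members are sent to 0. The
  image of \<open>\<pi>\<close> is a linear copy of the quotient inside a type.\<close>

lemma ideal_projection:
  obtains \<pi> :: "('k::field, 'n::finite) falg \<Rightarrow> ('k, 'n) falg"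
  where "\<And>x y. \<pi> (x + y) = \<pi> x + \<pi> y" "\<And>c x. \<pi> (fconst c * x) = fconst c * \<pi> x"
    "\<And>x. x \<in> ad_ideal q m R \<Longrightarrow> \<pi> x = 0" "\<And>x. x - \<pi> x \<in> ad_ideal q m R"
proof -
  interpret vs: vector_space "\<lambda>(c::'k) (x::('k, 'n) falg). fconst c * x"
    by unfold_locales (simp_all add: algebra_simps fconst_simps)
  interpret vp: vector_space_pair "\<lambda>(c::'k) (x::('k, 'n) falg). fconst c * x" "\<lambda>(c::'k) (x::('k, 'n) falg). fconst c * x"
    by unfold_locales
  let ?I = "ad_ideal q m R"
  have sub: "vs.subspace ?I" by (auto simp: vs.subspace_def ad_ideal_closed)
  obtain B where B: "B \<subseteq> ?I" "vs.independent B" "?I \<subseteq> vs.span B" by (rule vs.basis_exists[of ?I])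
  define B' where "B' = vs.extend_basis B"
  have B': "B \<subseteq> B'" "vs.independent B'" "vs.span B' = UNIV"
    unfolding B'_def using vs.extend_basis_superset[OF B(2)] vs.independent_extend_basis[OF B(2)] vs.span_extend_basis[OF B(2)] by auto
  obtain \<pi> where \<pi>: "Vector_Spaces.linear (\<lambda>c x. fconst c * x) (\<lambda>c x. fconst c * x) \<pi>" "\<And>b. b \<in> B' \<Longrightarrow> \<pi> b = (if b \<in> B then 0 else b)"
    using vp.linear_independent_extend[OF B'(2), of "\<lambda>b. if b \<in> B then 0 else b"] by blast
  interpret l: Vector_Spaces.linear "\<lambda>(c::'k) (x::('k, 'n) falg). fconst c * x" "\<lambda>(c::'k) (x::('k, 'n) falg). fconst c * x" \<pi> by (rule \<pi>(1))
  have "\<pi> x = 0" if "x \<in> ?I" for x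
  proof -
    have "x \<in> vs.span B" using that B by blast
    then show ?thesis
    proof (induction rule: vs.span_induct_alt)
      case base show ?case by (rule l.zero)
    next
      case (step c x y)
      then show ?case using \<pi>(2)[of x] B'(1) by (auto simp: l.add l.scale)
    qed
  qed
  moreover have "x - \<pi> x \<in> ?I" for x
  proof -
    have "x \<in> vs.span B'" using B' by simp
    then show ?thesis
    proof (induction rule: vs.span_induct_alt)
      case base show ?case by (simp add: l.zero ad_ideal_closed)
    next
      case (step c x y)
      have "x - \<pi> x \<in> ?I" using \<pi>(2)[OF step(1)] B(1) by (auto simp: ad_ideal_closed)
      then have "fconst c * (x - \<pi> x) + (y - \<pi> y) \<in> ?I" using step by (intro ad_ideal_closed(2,3))
      then show ?case by (simp add: l.add l.scale algebra_simps)
    qed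
  qed
  ultimately show ?thesis using that l.add l.scale by blast
qed

section \<open>The regular representation\<close>

lemma GLI: "scalars \<kappa> \<Longrightarrow> GL_type q m R \<Longrightarrow> GL \<kappa> R q m"
  by (rule GL.intro) (auto simp: GL_axioms_def)

locale bda =
  fixes R :: "('k::field_char_0, 'n::finite) mat2" and q \<xi> :: 'k and m :: nat
  assumes GLt: "GL_type q m R"
begin

definition uv where "uv = (SOME p. numGL R q m (fst p) (snd p))"
abbreviation u where "u \<equiv> fst uv"
abbreviation v where "v \<equiv> snd uv"

lemma numuv: "numGL R q m u v"
proof -
  obtain u v where "numGL R q m u v" using numGL_exists[OF GLt] .
  then have "\<exists>p. numGL R q m (fst p) (snd p)" by auto
  then show ?thesis unfolding uv_def by (rule someI_ex)
qed

abbreviation I where "I \<equiv> ad_ideal q m R"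

abbreviation tc :: 'k where "tc \<equiv> GLid.t R q m"

text \<open>The relations hold for M = I and Q = \<xi> I. At this point a_m(M) is \<open>tc\<close>,
  which dictates the value of \<open>AInv\<close>.\<close>

primrec chg :: "'n gen \<Rightarrow> 'k" where
  "chg (MGen i j) = (if i = j then 1 else 0)"
| "chg (QGen i j) = (if i = j then \<xi> else 0)"
| "chg AInv = 1 / tc"

abbreviation \<epsilon> where "\<epsilon> \<equiv> ev (\<lambda>c. c) chg"

sublocale id: scalars "\<lambda>c::'k. c" by unfold_locales auto

sublocale eps: falg_hom "\<lambda>c::'k. c" chg by unfold_locales (simp add: mult.commute)

lemma GL_id: "GL (\<lambda>c::'k. c) R q m" by (rule GLI[OF id.scalars_axioms GLt])

text \<open>All braided copies of the identity matrix are the identity, so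
  \<open>copies_qdet\<close> forces the determinant to be 1. In particular 1 does not lie in the
  ideal, and \<epsilon> supplies the character \<chi> of Q(R).\<close>

lemma eps_kills: "x \<in> I \<Longrightarrow> \<epsilon> x = 0"
proof (rule eps.kills_ideal)
  interpret GL_hom "\<lambda>c::'k. c" R q m chg by (rule GL_hom.intro[OF GL_id eps.falg_hom_axioms])
  have oM: "op1 0 gM = 1" by (simp add: op1_one)
  have oQ: "op1 0 gQ = lmul \<xi>"
    by (rule op_eqI) (simp add: app_op1 mult_if_delta)
  have c: "lmul \<xi> * r 0 = r 0 * lmul \<xi>"
    unfolding r_def id.num2_def op2_def by (rule lmul_opo_commute) (simp add: mult.commute)
  have exs: "exch gM gM" "exch gQ gQ" "exch gQ gM"
    unfolding exch_def oM oQ by (simp_all add: c mult.assoc) (simp only: mult.assoc[symmetric] c)?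
  interpret RE_hom "\<lambda>c::'k. c" R q m chg u v
    by (rule RE_hom.intro[OF GL_hom_axioms], rule RE_hom_axioms.intro[OF exs(1) numuv])
  have "copies (op1 0 gM) k = 1" for k
  proof (induction k)
    case (Suc k)
    have "copy (op1 0 gM) j = 1" for j
      by (induction j) (simp_all add: op1_one r_ri)
    then show ?case using Suc by simp
  qed simp
  from copies_qdet[unfolded this[of m] mult_1_left] have "A m = lmul qdet * A m" .
  then have "app (A m) f s = app (lmul qdet * A m) f s" for f s by (rule arg_cong[where f = "\<lambda>P. app P f s"])
  then have "app (A m) f s = qdet * app (A m) f s" for f s unfolding app_simps app_lmul .
  moreover have "\<exists>f s. app (A m) f s \<noteq> 0"
  proof -
    interpret n: numGL R q m u v by (rule numuv)
    obtain L where L: "length L = m" "u L \<noteq> 0" using n.u_nonzero by blast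
    have "app (A m) (\<lambda>s. u (seg 0 m s)) (put 0 L undefined) = u L"
      using L by (simp add: app_A_uv n.vu)
    then show ?thesis using L by metis
  qed
  ultimately have "qdet = 1" by (metis mult_cancel_right1)
  then have "\<epsilon> (a_elem q m R) = tq" using ev_a_elem by simp
  then show "\<forall>y\<in>ad_relations q m R. \<epsilon> y = 0"
    unfolding kills_relations_iff using exs tq_nz by simp
qed

definition \<pi> :: "('k, 'n) falg \<Rightarrow> ('k, 'n) falg" where
  "\<pi> = (SOME \<pi>. (\<forall>x y. \<pi> (x + y) = \<pi> x + \<pi> y) \<and> (\<forall>c x. \<pi> (fconst c * x) = fconst c * \<pi> x) \<and>
      (\<forall>x. x \<in> I \<longrightarrow> \<pi> x = 0) \<and> (\<forall>x. x - \<pi> x \<in> I))"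

lemma \<pi>: "\<pi> (x + y) = \<pi> x + \<pi> y" "\<pi> (fconst c * x) = fconst c * \<pi> x" "x \<in> I \<Longrightarrow> \<pi> x = 0" "x - \<pi> x \<in> I"
proof -
  have "\<exists>\<pi>. (\<forall>x y. \<pi> (x + y) = \<pi> x + \<pi> y) \<and> (\<forall>c x. \<pi> (fconst c * x) = fconst c * \<pi> x) \<and>
      (\<forall>x. x \<in> I \<longrightarrow> \<pi> x = 0) \<and> (\<forall>x. x - \<pi> x \<in> I)"
    using ideal_projection[of q m R] by metis
  from someI_ex[OF this] show "\<pi> (x + y) = \<pi> x + \<pi> y" "\<pi> (fconst c * x) = fconst c * \<pi> x" "x \<in> I \<Longrightarrow> \<pi> x = 0" "x - \<pi> x \<in> I"
    unfolding \<pi>_def[symmetric] by blast+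
qed

lemma \<pi>_diff: "\<pi> (x - y) = \<pi> x - \<pi> y"
  using \<pi>(1)[of "x - y" y] by (simp add: algebra_simps)

lemma \<pi>_eq: "x - y \<in> I \<Longrightarrow> \<pi> x = \<pi> y" using \<pi>(3)[of "x - y"] by (simp add: \<pi>_diff)
lemma \<pi>_\<pi>: "\<pi> (\<pi> x) = \<pi> x" using \<pi>_eq[OF \<pi>(4)[of x]] by simp

lift_definition \<kappa>S :: "'k \<Rightarrow> ('k, 'n) falg endo" is "\<lambda>c x. fconst c * x"
  by (simp add: distrib_left)

lemma app_\<kappa>S: "app (\<kappa>S c) x = fconst c * x" by (simp add: \<kappa>S.rep_eq)

sublocale S: scalars \<kappa>S
  by unfold_locales (rule endo_eqI, simp add: app_\<kappa>S fconst_simps distrib_right mult.assoc)+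

text \<open>Left multiplication on a complement of the ideal. On the ideal it is the character \<open>\<epsilon>\<close> instead of
  zero, so that \<open>rep\<close> is unital on the whole free algebra.\<close>

definition rep :: "('k, 'n) falg \<Rightarrow> ('k, 'n) falg endo" where
  "rep x = Endo (\<lambda>y. \<pi> (x * \<pi> y) + fconst (\<epsilon> x) * (y - \<pi> y))"

lemma app_rep: "app (rep x) y = \<pi> (x * \<pi> y) + fconst (\<epsilon> x) * (y - \<pi> y)"
  unfolding rep_def by (subst app_Endo) (simp_all add: \<pi>(1) distrib_left algebra_simps)

lemma \<kappa>S_app: "(\<And>y. app P (fconst c * y) = fconst c * app P y) \<Longrightarrow> \<kappa>S c * P = P * \<kappa>S c"
  by (rule endo_eqI) (simp add: app_\<kappa>S)

lemma \<kappa>S_rep: "\<kappa>S c * rep x = rep x * \<kappa>S c"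
proof (rule \<kappa>S_app)
  fix y
  have "app (rep x) (fconst c * y) = \<pi> (x * (fconst c * \<pi> y)) + fconst (\<epsilon> x) * (fconst c * (y - \<pi> y))"
    by (simp add: app_rep \<pi>(2) right_diff_distrib)
  also have "\<dots> = fconst c * app (rep x) y"
    unfolding fconst_left[of x] fconst_left[of "fconst (\<epsilon> x)"] by (simp only: app_rep \<pi>(2) distrib_left)
  finally show "app (rep x) (fconst c * y) = fconst c * app (rep x) y" .
qed

sublocale rho: falg_hom \<kappa>S "\<lambda>z. rep (fgen z)"
  by unfold_locales (rule \<kappa>S_rep)

abbreviation \<rho> where "\<rho> \<equiv> ev \<kappa>S (\<lambda>z. rep (fgen z))"

text \<open>Multiplicativity holds on both summands: on the image of \<open>\<pi>\<close> because I
  is an ideal, on its complement because \<epsilon> is a character.\<close>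

lemma rho_rep: "\<rho> x = rep x"
proof (induction x rule: falg_induct)
  case (const c)
  show ?case
    by (rule endo_eqI) (simp add: rho.ev_const app_\<kappa>S app_rep eps.ev_const \<pi>(2) \<pi>_\<pi> algebra_simps)
next
  case (gen g) show ?case by (simp add: rho.ev_gen)
next
  case (add x y)
  then show ?case by (intro endo_eqI) (simp add: rho.ev_add app_rep eps.ev_add \<pi>(1) fconst_simps algebra_simps)
next
  case (mult x y)
  show ?case
  proof (rule endo_eqI)
    fix z
    have 1: "\<pi> (app (rep y) z) = \<pi> (y * \<pi> z)"
      using \<pi>(3)[OF \<pi>(4)[of z]] by (simp add: app_rep \<pi>(1,2) \<pi>_\<pi> \<pi>_diff)
    have 2: "\<pi> (x * \<pi> (y * \<pi> z)) = \<pi> (x * (y * \<pi> z))"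
    proof (rule \<pi>_eq)
      have "x * (y * \<pi> z - \<pi> (y * \<pi> z)) \<in> I" by (intro ad_ideal_closed \<pi>(4))
      then have "- (x * (y * \<pi> z - \<pi> (y * \<pi> z))) \<in> I" by (rule ad_ideal_closed)
      then show "x * \<pi> (y * \<pi> z) - x * (y * \<pi> z) \<in> I" by (simp add: algebra_simps)
    qed
    have 3: "app (rep y) z - \<pi> (y * \<pi> z) = fconst (\<epsilon> y) * (z - \<pi> z)" by (simp add: app_rep)
    have "app (\<rho> (x * y)) z = \<pi> (x * \<pi> (app (rep y) z)) + fconst (\<epsilon> x) * (app (rep y) z - \<pi> (app (rep y) z))"
      by (simp add: rho.ev_mult mult app_rep[of x])
    also have "\<dots> = app (rep (x * y)) z"
      unfolding 1 2 3 by (simp add: app_rep[of "x * y"] eps.ev_mult fconst_simps mult.assoc)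
    finally show "app (\<rho> (x * y)) z = app (rep (x * y)) z" .
  qed
qed

lemma rho_mod: "app (\<rho> x) y - x * y \<in> I"
proof -
  have "app (\<rho> x) y - x * y = - (x * \<pi> y - \<pi> (x * \<pi> y)) + (fconst (\<epsilon> x) * (y - \<pi> y) - x * (y - \<pi> y))"
    by (simp add: rho_rep app_rep algebra_simps)
  also have "\<dots> \<in> I" by (intro ad_ideal_closed \<pi>(4))
  finally show ?thesis .
qed

text \<open>Congruence modulo the ideal becomes equality of elements of a ring type, so all the
  operator results apply to the quotient.\<close>

lemma rho_0_iff: "\<rho> x = 0 \<longleftrightarrow> x \<in> I"
proof
  assume "\<rho> x = 0"
  then show "x \<in> I" using rho_mod[of x 1] ad_ideal_closed(5)[of "- x"] by simp
next
  assume x: "x \<in> I"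
  then have "\<pi> (x * \<pi> y) = 0" for y by (intro \<pi>(3) ad_ideal_closed)
  then show "\<rho> x = 0" unfolding rho_rep using eps_kills[OF x] by (intro endo_eqI) (simp add: app_rep fconst_simps)
qed

lemma rho_eq_iff: "\<rho> x = \<rho> y \<longleftrightarrow> x - y \<in> I"
  using rho_0_iff[of "x - y"] by (simp add: rho.ev_diff)

lemma GL_S: "GL \<kappa>S R q m" by (rule GLI[OF S.scalars_axioms GLt])

abbreviation exS where "exS \<equiv> GL.exch \<kappa>S R"
abbreviation MS where "MS \<equiv> \<lambda>i j. rep (fgen (MGen i j))"
abbreviation QS where "QS \<equiv> \<lambda>i j. rep (fgen (QGen i j))"

lemma rho_GL_hom: "GL_hom \<kappa>S R q m (\<lambda>z. rep (fgen z))"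
  by (rule GL_hom.intro[OF GL_S rho.falg_hom_axioms])

lemma rho_relations: "exS MS MS" "exS QS QS" "exS QS MS"
  "\<rho> (a_elem q m R) * rep (fgen AInv) = 1" "rep (fgen AInv) * \<rho> (a_elem q m R) = 1"
proof -
  have "\<forall>y\<in>ad_relations q m R. \<rho> y = 0" using relations_in_ideal rho_0_iff by blast
  then show "exS MS MS" "exS QS QS" "exS QS MS"
    "\<rho> (a_elem q m R) * rep (fgen AInv) = 1" "rep (fgen AInv) * \<rho> (a_elem q m R) = 1"
    using GL_hom.kills_relations_iff[OF rho_GL_hom] by blast+
qed

lemma rho_RE_hom: "RE_hom \<kappa>S R q m (\<lambda>z. rep (fgen z)) u v"
  by (rule RE_hom.intro[OF rho_GL_hom], rule RE_hom_axioms.intro[OF rho_relations(1) numuv])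

end


section \<open>Moving \<open>Q\<close> through the algebra\<close>

text \<open>\<open>None\<close> is the index of the algebra itself, \<open>Some (i, j)\<close> that of a copy of it that belongs to the
  entry $Q_i^j$.\<close>

type_synonym ('x, 'y) sumspace = "('y \<times> 'y) option \<Rightarrow> ('x, 'y) falg"

context bda
begin

definition amp :: "('k, 'n) falg endo \<Rightarrow> ('k, 'n) sumspace endo" where
  "amp s = Endo (\<lambda>f x. app s (f x))"
definition pr0 :: "('k, 'n) sumspace endo" where
  "pr0 = Endo (\<lambda>f x. if x = None then f None else 0)"
definition Qh :: "'n \<Rightarrow> 'n \<Rightarrow> ('k, 'n) sumspace endo" where
  "Qh i j = Endo (\<lambda>f x. if x = None then f (Some (i, j)) else 0)"
definition emb :: "'n \<Rightarrow> 'n \<Rightarrow> ('k, 'n) sumspace endo" where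
  "emb i j = Endo (\<lambda>f x. if x = Some (i, j) then f None else 0)"

lemma app_amp: "app (amp s) f x = app s (f x)"
  unfolding amp_def by (subst app_Endo) (auto simp: fun_eq_iff app_add)
lemma app_pr0: "app pr0 f x = (if x = None then f None else 0)"
  unfolding pr0_def by (subst app_Endo) (auto simp: fun_eq_iff)
lemma app_Qh: "app (Qh i j) f x = (if x = None then f (Some (i, j)) else 0)"
  unfolding Qh_def by (subst app_Endo) (auto simp: fun_eq_iff)
lemma app_emb: "app (emb i j) f x = (if x = Some (i, j) then f None else 0)"
  unfolding emb_def by (subst app_Endo) (auto simp: fun_eq_iff)

lemma sum_eqI: "(\<And>f x. app P f x = app P' f x) \<Longrightarrow> P = P'" for P P' :: "('k, 'n) sumspace endo"
  by (rule endo_eqI) auto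

lemma amp_hom: "amp (s + s') = amp s + amp s'" "amp (s * s') = amp s * amp s'" "amp 1 = 1"
  by (rule sum_eqI; simp add: app_amp)+

definition \<kappa>G :: "'k \<Rightarrow> ('k, 'n) sumspace endo" where "\<kappa>G c = amp (\<kappa>S c)"

sublocale G: scalars \<kappa>G
  by unfold_locales (simp_all add: \<kappa>G_def S.\<kappa>_add S.\<kappa>_mult S.\<kappa>_1 amp_hom)

lemma GL_G: "GL \<kappa>G R q m" by (rule GLI[OF G.scalars_axioms GLt])

sublocale h: hat \<kappa>G R q m pr0 Qh emb
proof (rule hat.intro[OF GL_G], rule hat_axioms.intro)
  fix c i j k l
  show "\<kappa>G c * pr0 = pr0 * \<kappa>G c" "\<kappa>G c * Qh i j = Qh i j * \<kappa>G c" "\<kappa>G c * emb i j = emb i j * \<kappa>G c"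
    "pr0 * pr0 = pr0" "Qh i j * emb k l = (if k = i then if l = j then pr0 else 0 else 0)"
    "pr0 * Qh i j = Qh i j" "Qh i j * pr0 = 0" "pr0 * emb i j = 0" "emb i j * pr0 = emb i j"
    by (rule sum_eqI; auto simp: \<kappa>G_def app_amp app_pr0 app_Qh app_emb)+
  have "(\<Sum>i\<in>UNIV. \<Sum>j\<in>UNIV. if x = Some (i, j) then f (Some (i, j)) else 0) = (if x = None then 0 else f x)"
    for f :: "('k, 'n) sumspace" and x
  proof (cases x)
    case (Some y)
    obtain a b where y: "y = (a, b)" by (cases y)
    have "(\<Sum>i\<in>UNIV. \<Sum>j\<in>UNIV. if x = Some (i, j) then f (Some (i, j)) else 0)
        = (\<Sum>i\<in>UNIV. \<Sum>j\<in>UNIV. if i = a then if j = b then f (Some (i, j)) else 0 else 0)"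
      by (intro sum.cong refl) (auto simp: Some y)
    then show ?thesis by (simp add: sum_if_const Some y)
  qed simp
  then show "pr0 + (\<Sum>i\<in>UNIV. \<Sum>j\<in>UNIV. emb i j * Qh i j) = 1"
    by (intro sum_eqI) (simp add: app_sum_left sum_fun_apply app_pr0 app_emb app_Qh cong: if_cong)
qed

abbreviation exG where "exG \<equiv> GL.exch \<kappa>G R"

text \<open>Not unital: 1 becomes the projection \<open>pr0\<close> onto the algebra itself.\<close>

definition lift0 :: "('k, 'n) falg endo \<Rightarrow> ('k, 'n) sumspace endo" where "lift0 s = pr0 * amp s"

lemma app_lift0: "app (lift0 s) f x = (if x = None then app s (f None) else 0)"
  by (simp add: lift0_def app_pr0 app_amp)

lemma lift0_props: "pr0 * lift0 s = lift0 s" "lift0 s * pr0 = lift0 s" "lift0 (s + s') = lift0 s + lift0 s'"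
  "lift0 (s * s') = lift0 s * lift0 s'" "lift0 (\<kappa>S c * s) = \<kappa>G c * lift0 s" "lift0 (s * \<kappa>S c) = lift0 s * \<kappa>G c"
  by (rule sum_eqI; simp add: app_lift0 app_pr0 \<kappa>G_def app_amp)+

definition hatS :: "('n \<Rightarrow> 'n \<Rightarrow> ('k, 'n) falg endo) \<Rightarrow> 'n \<Rightarrow> 'n \<Rightarrow> ('k, 'n) sumspace endo" where
  "hatS Z = h.hat (\<lambda>i j. lift0 (Z i j))"

lemma \<kappa>_lift0: "\<kappa>S c * s = s * \<kappa>S c \<Longrightarrow> \<kappa>G c * lift0 s = lift0 s * \<kappa>G c"
  by (metis lift0_props(5,6))

lemma hatS_props:
  assumes "\<And>c i j. \<kappa>S c * Z i j = Z i j * \<kappa>S c"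
  shows "pr0 * hatS Z y k = lift0 (Z y k)" "hatS Z y k * pr0 = lift0 (Z y k)"
    "\<kappa>G c * hatS Z y k = hatS Z y k * \<kappa>G c" "exG Qh (hatS Z)"
proof -
  note a = lift0_props(1) lift0_props(2) \<kappa>_lift0[OF assms]
  show "pr0 * hatS Z y k = lift0 (Z y k)" "hatS Z y k * pr0 = lift0 (Z y k)"
    "\<kappa>G c * hatS Z y k = hatS Z y k * \<kappa>G c" "exG Qh (hatS Z)"
    unfolding hatS_def
    by (rule h.p_hat h.hat_p h.\<kappa>_hat h.exch_Q_hat; (rule a)?)+
qed

lemma exch_hatS:
  assumes "\<And>c i j. \<kappa>S c * Y i j = Y i j * \<kappa>S c" "\<And>c i j. \<kappa>S c * Z i j = Z i j * \<kappa>S c" "exS Y Z"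
  shows "exG (hatS Y) (hatS Z)"
  unfolding hatS_def
proof (rule h.exch_hat)
  show "exG (\<lambda>i j. lift0 (Y i j)) (\<lambda>i j. lift0 (Z i j))"
    by (rule exch_hom[OF GL_S GL_G _ _ _ _ assms(3)]) (rule lift0_props)+
qed (simp_all add: lift0_props \<kappa>_lift0 assms)

text \<open>\<open>AInv\<close> acts diagonally without a hat, because the element that it inverts
  does so by \<open>Phi_a\<close>.\<close>

primrec gG :: "'n gen \<Rightarrow> ('k, 'n) sumspace endo" where
  "gG (MGen i j) = hatS MS i j"
| "gG (QGen i j) = hatS QS i j"
| "gG AInv = amp (rep (fgen AInv))"

sublocale Phi: falg_hom \<kappa>G gG
proof unfold_locales
  fix c z
  show "\<kappa>G c * gG z = gG z * \<kappa>G c"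
  proof (cases z)
    case AInv
    then show ?thesis by (simp add: \<kappa>G_def amp_hom(2)[symmetric] \<kappa>S_rep)
  qed (simp_all add: hatS_props(3)[OF \<kappa>S_rep])
qed

abbreviation \<Phi> where "\<Phi> \<equiv> ev \<kappa>G gG"

lemma Phi_block: "pr0 * \<Phi> x = lift0 (\<rho> x) \<and> \<Phi> x * pr0 = lift0 (\<rho> x)"
proof (induction x rule: falg_induct)
  case (const c)
  show ?case
    by (simp add: Phi.ev_const rho.ev_const h.\<kappa>p) (rule sum_eqI, simp add: app_pr0 \<kappa>G_def app_amp app_lift0)
next
  case (gen z)
  show ?case
  proof (cases z)
    case AInv
    show ?thesis unfolding AInv
      by (simp add: Phi.ev_gen rho.ev_gen) (intro conjI; rule sum_eqI; simp add: app_pr0 app_amp app_lift0)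
  qed (simp_all add: Phi.ev_gen rho.ev_gen hatS_props(1,2)[OF \<kappa>S_rep])
next
  case (add x y) then show ?case by (simp add: Phi.ev_add rho.ev_add distrib_left distrib_right lift0_props)
next
  case (mult x y)
  have "pr0 * (\<Phi> x * \<Phi> y) = lift0 (\<rho> x) * \<Phi> y" using mult by (simp add: mult.assoc[symmetric])
  also have "\<dots> = lift0 (\<rho> x) * (pr0 * \<Phi> y)" by (simp only: mult.assoc[symmetric] lift0_props(2))
  finally have 1: "pr0 * (\<Phi> x * \<Phi> y) = lift0 (\<rho> x * \<rho> y)" using mult by (simp add: lift0_props)
  have "\<Phi> x * \<Phi> y * pr0 = \<Phi> x * lift0 (\<rho> y)" using mult by (simp add: mult.assoc)
  also have "\<dots> = (\<Phi> x * pr0) * lift0 (\<rho> y)" by (simp only: mult.assoc lift0_props(1))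
  finally show ?case using 1 mult by (simp add: Phi.ev_mult rho.ev_mult lift0_props)
qed

lemma Phi_GL_hom: "GL_hom \<kappa>G R q m gG"
  by (rule GL_hom.intro[OF GL_G Phi.falg_hom_axioms])

text \<open>\<open>Qh\<close> and \<open>hatS MS\<close> satisfy the exchange relation, so
  \<open>Qh i j\<close> commutes with the determinant. Hence a_m(M) acts on each copy as on the
  algebra itself.\<close>

lemma Phi_a: "\<Phi> (a_elem q m R) = amp (\<rho> (a_elem q m R))"
proof -
  let ?a = "a_elem q m R"
  have MM: "exG (\<lambda>i j. gG (MGen i j)) (\<lambda>i j. gG (MGen i j))"
    using exch_hatS[OF \<kappa>S_rep \<kappa>S_rep rho_relations(1)] by simp
  interpret RE_hom \<kappa>G R q m gG u v
    by (rule RE_hom.intro[OF Phi_GL_hom], rule RE_hom_axioms.intro[OF MM numuv])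
  have QM: "exG Qh (\<lambda>i j. gG (MGen i j))" using hatS_props(4)[of MS] \<kappa>S_rep by simp
  have c: "Qh i j * qdet = qdet * Qh i j" for i j
    by (rule qdet_commutes[OF h.\<kappa>Q QM])
  then have comm: "Qh i j * \<Phi> ?a = \<Phi> ?a * Qh i j" for i j
    unfolding ev_a_elem by (simp only: mult.assoc[symmetric] c) (simp only: mult.assoc h.\<kappa>Q)
  show ?thesis
  proof (rule sum_eqI)
    fix f x
    have N: "app (\<Phi> ?a) f None = app (\<rho> ?a) (f None)" for f
    proof -
      have "app (\<Phi> ?a) f None = app (pr0 * \<Phi> ?a) f None" by (simp add: app_pr0)
      then show ?thesis using Phi_block[of ?a] by (simp add: app_lift0)
    qed
    show "app (\<Phi> ?a) f x = app (amp (\<rho> ?a)) f x"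
    proof (cases x)
      case None then show ?thesis by (simp add: N app_amp)
    next
      case (Some y)
      obtain i j where y: "y = (i, j)" by (cases y)
      have "app (\<Phi> ?a) f x = app (Qh i j * \<Phi> ?a) f None" by (simp add: Some y app_Qh)
      also have "\<dots> = app (\<rho> ?a) (app (Qh i j) f None)" unfolding comm by (simp add: N)
      finally show ?thesis by (simp add: Some y app_Qh app_amp)
    qed
  qed
qed

lemma Phi_kills: "x \<in> I \<Longrightarrow> \<Phi> x = 0"
proof (rule Phi.kills_ideal)
  have "exG (\<lambda>i j. gG (MGen i j)) (\<lambda>i j. gG (MGen i j))" "exG (\<lambda>i j. gG (QGen i j)) (\<lambda>i j. gG (QGen i j))"
    "exG (\<lambda>i j. gG (QGen i j)) (\<lambda>i j. gG (MGen i j))"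
    using exch_hatS[OF \<kappa>S_rep \<kappa>S_rep rho_relations(1)] exch_hatS[OF \<kappa>S_rep \<kappa>S_rep rho_relations(2)]
      exch_hatS[OF \<kappa>S_rep \<kappa>S_rep rho_relations(3)] by simp_all
  moreover have "\<Phi> (a_elem q m R) * gG AInv = 1" "gG AInv * \<Phi> (a_elem q m R) = 1"
    unfolding Phi_a by (simp_all add: amp_hom(2)[symmetric] rho_relations(4,5) amp_hom(3))
  ultimately show "\<forall>y\<in>ad_relations q m R. \<Phi> y = 0"
    unfolding GL_hom.kills_relations_iff[OF Phi_GL_hom] by blast
qed

text \<open>\<open>\<Phi> y\<close> moves the entries of \<open>Q\<close> through \<open>y\<close>; then they are evaluated by $Q_i^j \mapsto \xi \delta_i^j$.\<close>

definition vec :: "('k, 'n) sumspace" where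
  "vec x = (case x of None \<Rightarrow> 1 | Some (i, j) \<Rightarrow> if i = j then fconst \<xi> else 0)"

definition T :: "'n \<Rightarrow> 'n \<Rightarrow> ('k, 'n) falg endo" where
  "T i j = Endo (\<lambda>y. app (\<Phi> y) vec (Some (i, j)))"

lemma app_T: "app (T i j) y = app (\<Phi> y) vec (Some (i, j))"
  unfolding T_def by (subst app_Endo) (simp_all add: Phi.ev_add)

lemma T_mod: "x - y \<in> I \<Longrightarrow> app (T i j) x = app (T i j) y"
  using Phi_kills[of "x - y"] by (simp add: app_T Phi.ev_diff)

lemma T_rho: "app (T i j) (app (\<rho> x) y) = app (\<Phi> x) (app (\<Phi> y) vec) (Some (i, j))"
  using T_mod[OF rho_mod[of x y]] by (simp add: app_T Phi.ev_mult)

lemma \<kappa>S_T: "\<kappa>S c * T i j = T i j * \<kappa>S c"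
  by (rule \<kappa>S_app) (simp add: app_T Phi.ev_mult Phi.ev_const \<kappa>G_def app_amp app_\<kappa>S)

text \<open>\<open>T i j\<close> applied to y is what \<open>Qh i j\<close> extracts from the vector
  \<open>app (\<Phi> y) vec\<close>. The relation between \<open>Qh\<close> and
  \<open>hatS Z\<close>, evaluated on this vector, becomes the one between \<open>T\<close> and
  \<open>Z\<close>.\<close>

lemma exch_T:
  assumes Z: "\<And>i j. Z i j = \<rho> (z i j)" and \<Phi>z: "\<And>i j. \<Phi> (z i j) = hatS Z i j"
  shows "exS T Z"
proof -
  interpret g: GL \<kappa>S R q m by (rule GL_S)
  have \<kappa>Z: "\<kappa>S c * Z i j = Z i j * \<kappa>S c" for c i j unfolding Z by (rule rho.\<kappa>_e)
  have "exG Qh (hatS Z)" by (rule hatS_props(4)[OF \<kappa>Z])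
  note ex = this[unfolded h.exch_formula, rule_format]
  show ?thesis
    unfolding g.exch_formula
  proof (intro allI endo_eqI)
    fix i j k c y
    define f where "f = app (\<Phi> y) vec"
    have zT: "app (T a l) (app (Z d k) y) = app (hatS Z d k) f (Some (a, l))" for a l d k
      unfolding Z T_rho \<Phi>z[unfolded Z] f_def by (simp add: \<Phi>z)
    have Tl: "app (T a l) (fconst d * x) = fconst d * app (T a l) x" for a l d x
      using arg_cong[OF \<kappa>S_T[of d a l], of "\<lambda>P. app P x"] by (simp add: app_\<kappa>S)
    have N: "app (hatS Z a b) f' None = app (Z a b) (f' None)" for a b f'
    proof -
      have "app (hatS Z a b) f' None = app (pr0 * hatS Z a b) f' None" by (simp add: app_pr0)
      then show ?thesis unfolding hatS_props(1)[OF \<kappa>Z] by (simp add: app_lift0)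
    qed
    note e = ex[of i j c k, THEN arg_cong[of _ _ "\<lambda>P. app P f None"]]
    have L: "app (\<Sum>a\<in>UNIV. \<Sum>b\<in>UNIV. \<kappa>S (R $ (i, j) $ (a, b)) * (\<Sum>l\<in>UNIV. T a l * (\<Sum>d\<in>UNIV. \<kappa>S (R $ (l, b) $ (d, c)) * Z d k))) y
      = app (\<Sum>a\<in>UNIV. \<Sum>b\<in>UNIV. \<kappa>G (R $ (i, j) $ (a, b)) * (\<Sum>l\<in>UNIV. Qh a l * (\<Sum>d\<in>UNIV. \<kappa>G (R $ (l, b) $ (d, c)) * hatS Z d k))) f None"
      by (simp add: app_sum_left app_sum sum_fun_apply \<kappa>G_def app_amp app_\<kappa>S app_Qh Tl zT)
    have Rr: "app (\<Sum>l\<in>UNIV. Z i l * (\<Sum>a\<in>UNIV. \<Sum>b\<in>UNIV. \<kappa>S (R $ (l, j) $ (a, b)) * (\<Sum>d\<in>UNIV. T a d * \<kappa>S (R $ (d, b) $ (k, c))))) y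
      = app (\<Sum>l\<in>UNIV. hatS Z i l * (\<Sum>a\<in>UNIV. \<Sum>b\<in>UNIV. \<kappa>G (R $ (l, j) $ (a, b)) * (\<Sum>d\<in>UNIV. Qh a d * \<kappa>G (R $ (d, b) $ (k, c))))) f None"
      by (simp add: app_sum_left app_sum sum_fun_apply \<kappa>G_def app_amp app_\<kappa>S app_Qh Tl N app_T[of _ _ y] f_def[symmetric])
    show "app (\<Sum>a\<in>UNIV. \<Sum>b\<in>UNIV. \<kappa>S (R $ (i, j) $ (a, b)) * (\<Sum>l\<in>UNIV. T a l * (\<Sum>d\<in>UNIV. \<kappa>S (R $ (l, b) $ (d, c)) * Z d k))) y
      = app (\<Sum>l\<in>UNIV. Z i l * (\<Sum>a\<in>UNIV. \<Sum>b\<in>UNIV. \<kappa>S (R $ (l, j) $ (a, b)) * (\<Sum>d\<in>UNIV. T a d * \<kappa>S (R $ (d, b) $ (k, c))))) y"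
      unfolding L Rr by (rule e)
  qed
qed

lemma T_M: "exS T MS" and T_Q: "exS T QS"
  by (rule exch_T[where z = "\<lambda>i j. fgen (MGen i j)"] exch_T[where z = "\<lambda>i j. fgen (QGen i j)"];
      simp add: rho.ev_gen Phi.ev_gen)+

lemma T_AInv: "app (T i j) (app (rep (fgen AInv)) y) = app (rep (fgen AInv)) (app (T i j) y)"
  using T_rho[of i j "fgen AInv" y] by (simp add: rho.ev_gen Phi.ev_gen app_amp app_T)

lemma T_1: "app (T i j) (fconst c) = fconst c * (if i = j then fconst \<xi> else 0)"
  by (simp add: app_T Phi.ev_const \<kappa>G_def app_amp app_\<kappa>S vec_def)

end


section \<open>The defect of the reflection equation\<close>

context GL
begin

definition refl_defect :: "('n \<Rightarrow> 'n \<Rightarrow> 'a) \<Rightarrow> ((nat \<Rightarrow> 'n) \<Rightarrow> 'a) endo" where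
  "refl_defect Y = r 0 * op1 0 Y * r 0 * op1 0 Y - op1 0 Y * r 0 * op1 0 Y * r 0"

lemma exch_iff_refl_defect: "exch Y Y \<longleftrightarrow> refl_defect Y = 0"
  by (simp add: exch_def refl_defect_def)

lemma locs_refl_defect: "locs (refl_defect Y)"
  unfolding refl_defect_def by (intro locs_diff locs_mult locs_r locs_op1)

text \<open>\<open>Y\<close> passes the braided copy of \<open>Z\<close> by the exchange relation
  \<open>e\<close>, and the braid words that arise are the same for both terms of the defect.
  \<open>L\<close> and \<open>Rr\<close> carry this out for the two terms.\<close>

lemma refl_defect_copy:
  fixes Y Z
  defines "t \<equiv> op1 0 Y" and "z \<equiv> op1 0 Z"
  assumes ex: "exch Y Z" and \<kappa>Y: "\<And>c i j. \<kappa> c * Y i j = Y i j * \<kappa> c" and \<kappa>Z: "\<And>c i j. \<kappa> c * Z i j = Z i j * \<kappa> c"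
  shows "refl_defect Y * (r 1 * (r 0 * z)) = ri 1 * (ri 0 * (z * (r 0 * (r 1 * (refl_defect Y * (r 1 * r 0))))))"
proof -
  have far: "t * (r 1 * w) = r 1 * (t * w)" "t * (ri 1 * w) = ri 1 * (t * w)" "r 1 * (z * w) = z * (r 1 * w)" for w
  proof -
    have a: "r 1 * t = t * r 1" "r 1 * z = z * r 1"
      unfolding t_def z_def by (rule op1_far; simp add: \<kappa>Y \<kappa>Z)+
    show 1: "t * (r 1 * w) = r 1 * (t * w)" "r 1 * (z * w) = z * (r 1 * w)" for w
      by (simp_all only: a mult.assoc[symmetric])
    have "ri 1 * (t * w) = ri 1 * (t * (r 1 * (ri 1 * w)))" by (simp only: r_cancel)
    also have "\<dots> = ri 1 * (r 1 * (t * (ri 1 * w)))" by (simp only: 1)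
    also have "\<dots> = t * (ri 1 * w)" by (simp only: r_cancel)
    finally show "t * (ri 1 * w) = ri 1 * (t * w)" ..
  qed
  have e: "t * (r 0 * (z * w)) = ri 0 * (z * (r 0 * (t * (r 0 * w))))" for w
  proof -
    have "r 0 * (t * (r 0 * (z * w))) = z * (r 0 * (t * (r 0 * w)))"
      using arg_cong[OF ex[unfolded exch_def], of "\<lambda>p. p * w"] by (simp only: mult.assoc t_def z_def)
    then have "ri 0 * (r 0 * (t * (r 0 * (z * w)))) = ri 0 * (z * (r 0 * (t * (r 0 * w))))" by (simp only:)
    then show ?thesis by (simp only: r_cancel)
  qed
  have br: "r 0 * (r 1 * (r 0 * w)) = r 1 * (r 0 * (r 1 * w))" for w
    using arg_cong[OF braid[of 0], of "\<lambda>p. p * w"] by (simp add: mult.assoc)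
  have b1: "r 0 * (r 1 * (ri 0 * w)) = ri 1 * (r 0 * (r 1 * w))" for w
  proof -
    have "r 1 * (r 0 * (r 1 * (ri 0 * w))) = r 0 * (r 1 * w)" by (simp only: br[symmetric] r_cancel)
    then have "ri 1 * (r 1 * (r 0 * (r 1 * (ri 0 * w)))) = ri 1 * (r 0 * (r 1 * w))" by (simp only:)
    then show ?thesis by (simp only: r_cancel)
  qed
  have b2: "r 0 * (ri 1 * (ri 0 * w)) = ri 1 * (ri 0 * (r 1 * w))" for w
  proof -
    have "r 0 * (r 1 * (r 0 * (ri 1 * (ri 0 * w)))) = r 1 * w" by (simp only: br r_cancel)
    then have "ri 1 * (ri 0 * (r 0 * (r 1 * (r 0 * (ri 1 * (ri 0 * w)))))) = ri 1 * (ri 0 * (r 1 * w))" by (simp only:)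
    then show ?thesis by (simp only: r_cancel)
  qed
  have L: "r 0 * (t * (r 0 * (t * (r 1 * (r 0 * (z * w))))))
      = ri 1 * (ri 0 * (z * (r 0 * (r 1 * (r 0 * (t * (r 0 * (t * (r 1 * (r 0 * w))))))))))" for w
  proof -
    have "r 0 * (t * (r 0 * (t * (r 1 * (r 0 * (z * w)))))) = r 0 * (t * (r 0 * (r 1 * (t * (r 0 * (z * w))))))"
      by (simp only: far(1))
    also have "\<dots> = r 0 * (t * (r 0 * (r 1 * (ri 0 * (z * (r 0 * (t * (r 0 * w))))))))" by (simp only: e)
    also have "\<dots> = r 0 * (t * (ri 1 * (r 0 * (r 1 * (z * (r 0 * (t * (r 0 * w))))))))" by (simp only: b1)
    also have "\<dots> = r 0 * (ri 1 * (t * (r 0 * (z * (r 1 * (r 0 * (t * (r 0 * w))))))))" by (simp only: far(2,3))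
    also have "\<dots> = r 0 * (ri 1 * (ri 0 * (z * (r 0 * (t * (r 0 * (r 1 * (r 0 * (t * (r 0 * w)))))))))) " by (simp only: e)
    also have "\<dots> = ri 1 * (ri 0 * (z * (r 1 * (r 0 * (t * (r 1 * (r 0 * (r 1 * (t * (r 0 * w))))))))))"
      by (simp only: b2 br far(3))
    also have "\<dots> = ri 1 * (ri 0 * (z * (r 1 * (r 0 * (r 1 * (t * (r 0 * (t * (r 1 * (r 0 * w))))))))))"
      by (simp only: far(1))
    finally show ?thesis by (simp only: br)
  qed
  have Rr: "t * (r 0 * (t * (r 0 * (r 1 * (r 0 * (z * w))))))
      = ri 1 * (ri 0 * (z * (r 0 * (r 1 * (t * (r 0 * (t * (r 0 * (r 1 * (r 0 * w))))))))))" for w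
  proof -
    have "t * (r 0 * (t * (r 0 * (r 1 * (r 0 * (z * w)))))) = t * (r 0 * (r 1 * (t * (r 0 * (z * (r 1 * w))))))"
      by (simp only: br far(1,3))
    also have "\<dots> = t * (r 0 * (r 1 * (ri 0 * (z * (r 0 * (t * (r 0 * (r 1 * w))))))))" by (simp only: e)
    also have "\<dots> = ri 1 * (t * (r 0 * (z * (r 1 * (r 0 * (t * (r 0 * (r 1 * w))))))))" by (simp only: b1 far(2,3))
    also have "\<dots> = ri 1 * (ri 0 * (z * (r 0 * (t * (r 0 * (r 1 * (r 0 * (t * (r 0 * (r 1 * w))))))))))" by (simp only: e)
    also have "\<dots> = ri 1 * (ri 0 * (z * (r 0 * (r 1 * (t * (r 0 * (t * (r 1 * (r 0 * (r 1 * w))))))))))"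
      by (simp only: br far(1))
    finally show ?thesis by (simp only: br)
  qed
  note L[of 1] Rr[of 1]
  then show ?thesis
    unfolding refl_defect_def t_def[symmetric] z_def[symmetric]
    by (simp only: left_diff_distrib right_diff_distrib mult.assoc mult_1_right)
qed

lemma locs_entries:
  assumes "locs P"
  obtains E where "\<And>f s. app P f s = (\<Sum>k\<in>UNIV. \<Sum>p\<in>UNIV. E (s 0) (s 1) k p * f (s(0 := k, 1 := p)))"
    "\<And>i j k c. ent2 P i j k c = E i j k c"
proof -
  obtain A where A: "P = opo 0 2 A" using assms unfolding locs_def by blast
  show ?thesis
  proof (rule that[of "\<lambda>i j k p. A [i, j] [k, p]"])
    show "app P f s = (\<Sum>k\<in>UNIV. \<Sum>p\<in>UNIV. A [s 0, s 1] [k, p] * f (s(0 := k, 1 := p)))" for f s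
      unfolding A app_opo sum_length_2 by (simp add: put_pair numeral_2_eq_2 seg_Suc)
  qed (simp add: A ent2_opo)
qed

lemma ent2_lmul:
  assumes P: "locs P" and 0: "P * lmul y = 0"
  shows "ent2 P i j k c * y = 0"
proof -
  obtain E where E: "\<And>f s. app P f s = (\<Sum>k\<in>UNIV. \<Sum>p\<in>UNIV. E (s 0) (s 1) k p * f (s(0 := k, 1 := p)))"
    "\<And>i j k c. ent2 P i j k c = E i j k c" by (rule locs_entries[OF P]) (rule that)
  have "app (P * lmul y) (\<lambda>s. if s 0 = k then if s 1 = c then 1 else 0 else 0) (\<lambda>n. if n = 0 then i else j) = 0"
    unfolding 0 by simp
  then show ?thesis by (simp add: E mult_if_delta sum_if_const)
qed

text \<open>The factors r_1 r_0 between \<open>P\<close> and \<open>V\<close> are removed by two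
  applications of \<open>solve_R\<close>.\<close>

lemma strip_copy:
  assumes P: "locs P" and \<kappa>P: "\<And>c. lmul (\<kappa> c) * P = P * lmul (\<kappa> c)"
    and 0: "P * (r 1 * (r 0 * op1 0 V)) = 0"
  shows "P * lmul (V a b) = 0"
proof -
  obtain E where E: "\<And>f s. app P f s = (\<Sum>k\<in>UNIV. \<Sum>p\<in>UNIV. E (s 0) (s 1) k p * f (s(0 := k, 1 := p)))"
    "\<And>i j k c. ent2 P i j k c = E i j k c" by (rule locs_entries[OF P]) (rule that)
  have \<kappa>E: "\<kappa> d * E i j k c = E i j k c * \<kappa> d" for d i j k c
  proof -
    have "app (lmul (\<kappa> d) * P) (\<lambda>s. if s 0 = k then if s 1 = c then 1 else 0 else 0) (\<lambda>n. if n = 0 then i else j)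
      = app (P * lmul (\<kappa> d)) (\<lambda>s. if s 0 = k then if s 1 = c then 1 else 0 else 0) (\<lambda>n. if n = 0 then i else j)"
      by (simp only: \<kappa>P)
    then show ?thesis by (simp add: E mult_if_delta sum_if_const)
  qed
  have \<kappa>E': "\<kappa> d * (E i j k c * y) = E i j k c * (\<kappa> d * y)" for d i j k c y
    by (simp only: mult.assoc[symmetric] \<kappa>E)
  have 1: "(\<Sum>k\<in>UNIV. \<Sum>p\<in>UNIV. E i j k p * (\<Sum>l\<in>UNIV. \<kappa> (R $ (p, x) $ (l, d)) *
      (\<Sum>a\<in>UNIV. \<kappa> (R $ (k, l) $ (a, c)) * V a b))) = 0" for i j x d c b
  proof -
    define f :: "(nat \<Rightarrow> 'n) \<Rightarrow> 'a" where
      "f = (\<lambda>s. if s 0 = b then if s (Suc 0) = c then if s (Suc (Suc 0)) = d then 1 else 0 else 0 else 0)"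
    define s where "s = (\<lambda>n::nat. if n = 0 then i else if n = Suc 0 then j else x)"
    have "app (P * (r 1 * (r 0 * op1 0 V))) f s = 0" unfolding 0 by simp
    then show ?thesis
      by (simp add: E r_def num2_def app_op1 app_op2 f_def s_def mult_if_delta sum_if_const)
  qed
  have 2: "(\<Sum>k\<in>UNIV. E i j k p * (\<Sum>a\<in>UNIV. \<kappa> (R $ (k, l) $ (a, c)) * V a b)) = 0" for i j p l c b
  proof -
    have "(\<Sum>p\<in>UNIV. \<Sum>l\<in>UNIV. \<kappa> (R $ (p, x) $ (l, d)) * (\<Sum>k\<in>UNIV. E i j k p * (\<Sum>a\<in>UNIV. \<kappa> (R $ (k, l) $ (a, c)) * V a b))) = 0" for x d
    proof -
      have "(\<Sum>p\<in>UNIV. \<Sum>l\<in>UNIV. \<kappa> (R $ (p, x) $ (l, d)) * (\<Sum>k\<in>UNIV. E i j k p * (\<Sum>a\<in>UNIV. \<kappa> (R $ (k, l) $ (a, c)) * V a b)))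
        = (\<Sum>p\<in>UNIV. \<Sum>l\<in>UNIV. \<Sum>k\<in>UNIV. E i j k p * (\<kappa> (R $ (p, x) $ (l, d)) * (\<Sum>a\<in>UNIV. \<kappa> (R $ (k, l) $ (a, c)) * V a b)))"
        by (simp only: sum_distrib_left[of "\<kappa> _"] \<kappa>E')
          (simp only: sum_distrib_left[of "\<kappa> _", symmetric])?
      also have "\<dots> = (\<Sum>p\<in>UNIV. \<Sum>k\<in>UNIV. \<Sum>l\<in>UNIV. E i j k p * (\<kappa> (R $ (p, x) $ (l, d)) * (\<Sum>a\<in>UNIV. \<kappa> (R $ (k, l) $ (a, c)) * V a b)))"
        by (rule sum.cong[OF refl], rule sum.swap)
      also have "\<dots> = (\<Sum>k\<in>UNIV. \<Sum>p\<in>UNIV. \<Sum>l\<in>UNIV. E i j k p * (\<kappa> (R $ (p, x) $ (l, d)) * (\<Sum>a\<in>UNIV. \<kappa> (R $ (k, l) $ (a, c)) * V a b)))"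
        by (rule sum.swap)
      also have "\<dots> = 0" using 1[of i j x d c b] by (simp only: sum_distrib_left[of "E _ _ _ _"])
      finally show ?thesis .
    qed
    from solve_R[OF this, of p l] show ?thesis by simp
  qed
  have 3: "E i j k p * V a b = 0" for i j k p a b
  proof -
    have "(\<Sum>k\<in>UNIV. \<Sum>a\<in>UNIV. \<kappa> (R $ (k, l) $ (a, c)) * (E i j k p * V a b)) = 0" for l c
      using 2[of i j p l c b] by (simp only: sum_distrib_left \<kappa>E')
    from solve_R[OF this, of k a] show ?thesis by simp
  qed
  show ?thesis
    by (rule op_eqI) (simp add: E mult.assoc[symmetric] 3)
qed

lemma lmul_r: assumes "\<And>c. \<kappa> c * y = y * \<kappa> c" shows "lmul y * r i = r i * lmul y" "lmul y * ri i = ri i * lmul y"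
  unfolding r_def ri_def num2_def op2_def by (rule lmul_opo_commute, simp add: assms)+

lemma \<kappa>_op1: "(\<And>c i j. \<kappa> c * Y i j = Y i j * \<kappa> c) \<Longrightarrow> lmul (\<kappa> d) * op1 p Y = op1 p Y * lmul (\<kappa> d)"
  unfolding op1_def by (rule lmul_opo_commute) simp

lemma lmul_refl_defect:
  assumes a: "lmul y * op1 0 Y = op1 0 Y * lmul y" and \<kappa>y: "\<And>c. \<kappa> c * y = y * \<kappa> c"
  shows "lmul y * refl_defect Y = refl_defect Y * lmul y"
proof -
  note b = lmul_r(1)[OF \<kappa>y, of 0]
  have a': "lmul y * (op1 0 Y * w) = op1 0 Y * (lmul y * w)" and b': "lmul y * (r 0 * w) = r 0 * (lmul y * w)" for w
    by (simp_all only: mult.assoc[symmetric] a b)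
  show ?thesis unfolding refl_defect_def
    by (simp only: left_diff_distrib right_diff_distrib mult.assoc a a' b b')
qed

text \<open>\<open>refl_defect_copy\<close> brings the defect next to \<open>y\<close>, which it
  annihilates, and \<open>strip_copy\<close> frees the single entries of \<open>Z\<close>. So
  annihilation propagates from the unit through all products.\<close>

lemma refl_defect_step:
  assumes ex: "exch Y Z" and \<kappa>Y: "\<And>c i j. \<kappa> c * Y i j = Y i j * \<kappa> c" and \<kappa>Z: "\<And>c i j. \<kappa> c * Z i j = Z i j * \<kappa> c"
    and \<kappa>y: "\<And>c. \<kappa> c * y = y * \<kappa> c" and 0: "refl_defect Y * lmul y = 0"
  shows "refl_defect Y * lmul (Z a b * y) = 0"
proof (rule strip_copy[where V = "\<lambda>a b. Z a b * y"])
  show "locs (refl_defect Y)" by (rule locs_refl_defect)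
  show "lmul (\<kappa> c) * refl_defect Y = refl_defect Y * lmul (\<kappa> c)" for c
    by (rule lmul_refl_defect) (simp_all add: \<kappa>_op1 \<kappa>Y \<kappa>_comm)
  have "op1 0 (\<lambda>a b. Z a b * y) = op1 0 Z * lmul y" by (rule op_eqI) (simp add: app_op1 mult.assoc)
  then have "refl_defect Y * (r 1 * (r 0 * op1 0 (\<lambda>a b. Z a b * y))) = refl_defect Y * (r 1 * (r 0 * op1 0 Z)) * lmul y"
    by (simp only: mult.assoc)
  also have "\<dots> = ri 1 * (ri 0 * (op1 0 Z * (r 0 * (r 1 * (refl_defect Y * (r 1 * (r 0 * lmul y)))))))"
    unfolding refl_defect_copy[OF ex \<kappa>Y \<kappa>Z] by (simp only: mult.assoc)
  also have "r 1 * (r 0 * lmul y) = lmul y * (r 1 * r 0)"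
    by (simp only: lmul_r(1)[OF \<kappa>y, symmetric] mult.assoc[symmetric])
  also have "refl_defect Y * (lmul y * (r 1 * r 0)) = 0" by (simp only: mult.assoc[symmetric] 0 mult_zero_left)
  finally show "refl_defect Y * (r 1 * (r 0 * op1 0 (\<lambda>a b. Z a b * y))) = 0" by simp
qed

text \<open>Where \<open>Y\<close> acts as a scalar multiple of the identity matrix, both terms of
  the defect reduce to the same multiple of r_0 r_0. This starts the propagation.\<close>

lemma refl_defect_scalar:
  assumes \<kappa>y: "\<And>c. \<kappa> c * y = y * \<kappa> c" and Yy: "\<And>i j. Y i j * y = (if i = j then \<kappa> d * y else 0)"
  shows "refl_defect Y * lmul y = 0"
proof -
  have t: "op1 0 Y * lmul y = lmul y * lmul (\<kappa> d)"
    by (rule op_eqI) (simp add: app_op1 mult.assoc[symmetric] Yy \<kappa>y mult_if_delta)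
  have t': "op1 0 Y * (lmul y * w) = lmul y * (lmul (\<kappa> d) * w)" for w
    by (simp only: t mult.assoc[symmetric])
  note b = lmul_r(1)[OF \<kappa>y, of 0, symmetric] lmul_r(1)[OF \<kappa>_comm, of _ 0, symmetric]
  have b': "r 0 * (lmul y * w) = lmul y * (r 0 * w)" "r 0 * (lmul (\<kappa> d) * w) = lmul (\<kappa> d) * (r 0 * w)" for w
    by (simp_all only: mult.assoc[symmetric] b)
  have "refl_defect Y * lmul y = 0"
    unfolding refl_defect_def by (simp add: left_diff_distrib mult.assoc t t' b b')
  then show ?thesis .
qed

end

context bda
begin

text \<open>The defect commutes up to braiding with the entries of \<open>M\<close> and \<open>Q\<close> and it annihilates the
  unit element.\<close>

lemma T_T: "exS T T"
proof -
  interpret g: GL \<kappa>S R q m by (rule GL_S)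
  \<comment> \<open>The propagation lemmas multiply by ring elements, not vectors. The unit is
    therefore represented by an operator whose image is the scalars; on it \<open>T\<close> acts as
    \<xi>, by \<open>T_1\<close>.\<close>
  define Pc where "Pc = Endo (\<lambda>y. fconst (\<epsilon> y) :: ('k, 'n) falg)"
  have Pc: "app Pc y = fconst (\<epsilon> y)" for y
    unfolding Pc_def by (subst app_Endo) (simp_all add: eps.ev_add fconst_simps)
  have \<kappa>Pc: "\<kappa>S c * Pc = Pc * \<kappa>S c" for c
    by (rule \<kappa>S_app) (simp add: Pc eps.ev_mult eps.ev_const fconst_simps)
  have TPc: "T i j * Pc = (if i = j then \<kappa>S \<xi> * Pc else 0)" for i j
    by (rule endo_eqI) (simp add: Pc T_1 app_\<kappa>S fconst_comm[of \<xi>])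
  have step: "g.refl_defect T * lmul y = 0 \<Longrightarrow> (\<And>c. \<kappa>S c * y = y * \<kappa>S c) \<Longrightarrow> g.refl_defect T * lmul (\<rho> x * y) = 0" for x y
  proof (induction x arbitrary: y rule: falg_induct)
    case (const c)
    have "g.refl_defect T * lmul (\<rho> (fconst c) * y) = g.refl_defect T * lmul y * lmul (\<kappa>S c)"
      by (simp only: rho.ev_const const(2) lmul_hom mult.assoc)
    then show ?case by (simp only: const mult_zero_left)
  next
    case (gen z)
    show ?case
    proof (cases z)
      case (MGen a b)
      show ?thesis unfolding MGen rho.ev_gen by (rule g.refl_defect_step[OF T_M \<kappa>S_T \<kappa>S_rep gen(2,1)])
    next
      case (QGen a b)
      show ?thesis unfolding QGen rho.ev_gen by (rule g.refl_defect_step[OF T_Q \<kappa>S_T \<kappa>S_rep gen(2,1)])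
    next
      case AInv
      have "rep (fgen AInv) * T i j = T i j * rep (fgen AInv)" for i j
        by (rule endo_eqI) (simp add: T_AInv)
      then have "lmul (rep (fgen AInv)) * op1 0 T = op1 0 T * lmul (rep (fgen AInv))"
        unfolding op1_def by (intro lmul_opo_commute) simp
      from g.lmul_refl_defect[OF this \<kappa>S_rep]
      have "g.refl_defect T * lmul (\<rho> (fgen z) * y) = lmul (rep (fgen AInv)) * (g.refl_defect T * lmul y)"
        by (simp only: AInv rho.ev_gen lmul_hom mult.assoc[symmetric])
      then show ?thesis by (simp only: gen mult_zero_right)
    qed
  next
    case (add x1 x2)
    then show ?case by (simp add: rho.ev_add distrib_right distrib_left lmul_hom)
  next
    case (mult x1 x2)
    have c: "\<kappa>S c * (\<rho> x2 * y) = \<rho> x2 * y * \<kappa>S c" for c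
    proof -
      have "\<kappa>S c * (\<rho> x2 * y) = \<rho> x2 * (\<kappa>S c * y)" by (simp only: mult.assoc[symmetric] rho.\<kappa>_e)
      then show ?thesis by (simp only: mult(4) mult.assoc)
    qed
    show ?case unfolding rho.ev_mult mult.assoc by (rule mult(1)[OF mult(2)[OF mult(3,4)] c])
  qed
  have zero: "g.refl_defect T * lmul (\<rho> x * Pc) = 0" for x
    by (rule step[OF g.refl_defect_scalar[OF \<kappa>Pc TPc] \<kappa>Pc])
  \<comment> \<open>Each y is \<open>app (\<rho> y) 1\<close> plus \<open>app Dm y\<close>. The
    second part lies in the ideal, where \<open>T\<close> vanishes, so the defect is treated there
    as the scalar case with value 0.\<close>
  define Dm where "Dm = Endo (\<lambda>y. y - app (\<rho> y) 1)"
  have Dm: "app Dm y = y - app (\<rho> y) 1" for y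
    unfolding Dm_def by (subst app_Endo) (simp_all add: rho.ev_add)
  have \<kappa>D: "\<kappa>S c * Dm = Dm * \<kappa>S c" for c
    by (rule \<kappa>S_app) (simp add: Dm rho.ev_mult rho.ev_const app_\<kappa>S right_diff_distrib)
  have "app (T i j) (app (\<rho> y) 1) = app (T i j) y" for i j y
    using rho_mod[of y 1] by (intro T_mod) simp
  then have "T i j * Dm = (if i = j then \<kappa>S 0 * Dm else 0)" for i j
    by (intro endo_eqI) (simp add: Dm app_diff app_\<kappa>S fconst_simps)
  then have D: "g.refl_defect T * lmul Dm = 0" by (rule g.refl_defect_scalar[OF \<kappa>D])
  have "g.ent2 (g.refl_defect T) i j k c = 0" for i j k c
  proof (rule endo_eqI)
    fix y
    let ?E = "g.ent2 (g.refl_defect T) i j k c"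
    have "app (?E * (\<rho> y * Pc)) 1 = 0" unfolding g.ent2_lmul[OF g.locs_refl_defect zero] by simp
    then have "app ?E (app (\<rho> y) 1) = 0" by (simp add: Pc eps.ev_1 fconst_simps)
    moreover have "app (?E * Dm) y = 0" unfolding g.ent2_lmul[OF g.locs_refl_defect D] by simp
    ultimately show "app ?E y = app 0 y" by (simp add: Dm app_diff)
  qed
  then have "g.refl_defect T = 0"
    by (intro g.locs_eqI) (simp_all add: g.locs_refl_defect g.locs_diff[OF g.locs_refl_defect g.locs_refl_defect, of T T, simplified] g.ent2_def)
  then show ?thesis by (simp add: g.exch_iff_refl_defect)
qed

primrec gT :: "'n gen \<Rightarrow> ('k, 'n) falg endo" where
  "gT (MGen i j) = rep (fgen (MGen i j))"
| "gT (QGen i j) = T i j"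
| "gT AInv = rep (fgen AInv)"

sublocale Th: falg_hom \<kappa>S gT
proof unfold_locales
  show "\<kappa>S c * gT z = gT z * \<kappa>S c" for c z by (cases z) (simp_all add: \<kappa>S_T \<kappa>S_rep)
qed

abbreviation \<Theta> where "\<Theta> \<equiv> ev \<kappa>S gT"

lemma Theta_GL_hom: "GL_hom \<kappa>S R q m gT"
  by (rule GL_hom.intro[OF GL_S Th.falg_hom_axioms])

text \<open>Both sides are the determinant of the images of M times the same constant, and M has the
  same images under \<Theta> and \<rho>.\<close>

lemma Theta_a: "\<Theta> (a_elem q m R) = \<rho> (a_elem q m R)"
proof -
  have "RE_hom \<kappa>S R q m gT u v"
    by (rule RE_hom.intro[OF Theta_GL_hom], rule RE_hom_axioms.intro[OF _ numuv]) (simp add: rho_relations(1))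
  from RE_hom.ev_a_elem[OF this] RE_hom.ev_a_elem[OF rho_RE_hom] show ?thesis by simp
qed

lemma Theta_kills: "x \<in> I \<Longrightarrow> \<Theta> x = 0"
proof (rule Th.kills_ideal)
  show "\<forall>y\<in>ad_relations q m R. \<Theta> y = 0"
    unfolding GL_hom.kills_relations_iff[OF Theta_GL_hom]
    by (simp add: rho_relations T_T T_M Theta_a)
qed

end


section \<open>Subalgebras and reordering\<close>

inductive_set subalg :: "'n gen set \<Rightarrow> ('k::field, 'n) falg set" for G where
  const: "fconst c \<in> subalg G"
| gen: "z \<in> G \<Longrightarrow> fgen z \<in> subalg G"
| add: "x \<in> subalg G \<Longrightarrow> y \<in> subalg G \<Longrightarrow> x + y \<in> subalg G"
| mult: "x \<in> subalg G \<Longrightarrow> y \<in> subalg G \<Longrightarrow> x * y \<in> subalg G"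

abbreviation Ms where "Ms \<equiv> subalg {z. \<exists>i j. z = MGen i j}"
abbreviation Qs where "Qs \<equiv> subalg {z. \<exists>i j. z = QGen i j}"

lemma subalg_1: "1 \<in> subalg G" and subalg_0: "0 \<in> subalg G"
  using subalg.const[of 1 G] subalg.const[of 0 G] by (simp_all add: fconst_simps)

lemma subalg_sum: "(\<And>i. i \<in> A \<Longrightarrow> f i \<in> subalg G) \<Longrightarrow> sum f A \<in> subalg G"
  by (induction A rule: infinite_finite_induct) (auto intro: subalg.add simp: subalg_0)

lemma subalg_minus: fixes x :: "('k::field, 'n) falg" assumes "x \<in> subalg G" shows "- x \<in> subalg G"
proof -
  have "fconst (- 1) + fconst 1 = (0 :: ('k, 'n) falg)"
    unfolding fconst_simps(1)[symmetric] by (simp add: fconst_simps(4))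
  then have "fconst (- 1) = (- 1 :: ('k, 'n) falg)" by (simp add: fconst_simps(3) eq_neg_iff_add_eq_0)
  then show ?thesis using subalg.mult[OF subalg.const[of "- 1" G] assms] by simp
qed

lemma fM_Ms: "fM i j \<in> Ms" and fQ_Qs: "fQ i j \<in> Qs"
  by (auto simp: fM_def fQ_def intro: subalg.gen)

inductive_set span_prod :: "('k::field, 'n) falg set \<Rightarrow> ('k, 'n) falg set \<Rightarrow> ('k, 'n) falg set \<Rightarrow> ('k, 'n) falg set"
  for S A N where
  rel: "x \<in> N \<Longrightarrow> x \<in> span_prod S A N"
| prod: "b \<in> S \<Longrightarrow> a \<in> A \<Longrightarrow> b * a \<in> span_prod S A N"
| add: "x \<in> span_prod S A N \<Longrightarrow> y \<in> span_prod S A N \<Longrightarrow> x + y \<in> span_prod S A N"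

inductive_set gen_ideal :: "('k::field, 'n) falg set \<Rightarrow> ('k, 'n) falg set \<Rightarrow> ('k, 'n) falg set" for A Z where
  gen: "b \<in> A \<Longrightarrow> b' \<in> A \<Longrightarrow> z \<in> Z \<Longrightarrow> b * z * b' \<in> gen_ideal A Z"
| add: "x \<in> gen_ideal A Z \<Longrightarrow> y \<in> gen_ideal A Z \<Longrightarrow> x + y \<in> gen_ideal A Z"

context bda
begin

lemma Theta_M: "b \<in> Ms \<Longrightarrow> \<Theta> b = \<rho> b"
  by (induction rule: subalg.induct) (auto simp: Th.ev_const rho.ev_const Th.ev_gen rho.ev_gen Th.ev_add rho.ev_add Th.ev_mult rho.ev_mult)

lemma Theta_Q: "a \<in> Qs \<Longrightarrow> app (\<Theta> a) (fconst c) = fconst (c * \<epsilon> a)"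
proof (induction arbitrary: c rule: subalg.induct)
  case (gen z)
  then show ?case by (auto simp: Th.ev_gen eps.ev_gen T_1 fconst_simps)
next
  case (mult x y)
  then show ?case by (simp add: Th.ev_mult eps.ev_mult ac_simps)
qed (simp_all add: Th.ev_const Th.ev_add eps.ev_const eps.ev_add app_\<kappa>S fconst_simps distrib_left mult.commute)

definition \<Lambda> where "\<Lambda> x = app (\<Theta> x) 1"

lemma Lambda_add: "\<Lambda> (x + y) = \<Lambda> x + \<Lambda> y" by (simp add: \<Lambda>_def Th.ev_add)

lemma Lambda_I: "x \<in> I \<Longrightarrow> \<Lambda> x = 0" by (simp add: \<Lambda>_def Theta_kills)

lemma Lambda_cong: "\<rho> x = \<rho> y \<Longrightarrow> \<Lambda> x = \<Lambda> y"
  using Lambda_I[of "x - y"] Lambda_add[of "x - y" y] by (simp add: rho_eq_iff)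

lemma rho_app: "\<rho> (app (\<rho> x) y) = \<rho> (x * y)"
  unfolding rho_eq_iff by (rule rho_mod)

text \<open>Applied to the unit, the Q-factor yields its character value, and the M-factor then
  multiplies from the left.\<close>

lemma Lambda_prod: "b \<in> Ms \<Longrightarrow> a \<in> Qs \<Longrightarrow> \<rho> (\<Lambda> (b * a)) = \<rho> (b * fconst (\<epsilon> a))"
  using Theta_Q[of a 1] by (simp add: \<Lambda>_def Th.ev_mult Theta_M fconst_simps rho_app)

text \<open>Left combinations of the entries of Q with coefficients from M(R): the normal form of an
  entry of Q times an element of M(R), linear in Q.\<close>

definition LQ :: "('k, 'n) falg endo \<Rightarrow> bool" where
  "LQ x \<longleftrightarrow> (\<exists>c. (\<forall>k l. c k l \<in> Ms) \<and> x = (\<Sum>k\<in>UNIV. \<Sum>l\<in>UNIV. \<rho> (c k l) * QS k l))"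

lemma LQ_0: "LQ 0"
  unfolding LQ_def by (rule exI[of _ "\<lambda>_ _. 0"]) (simp add: subalg_0 rho.ev_0)

lemma LQ_add: assumes "LQ x" "LQ y" shows "LQ (x + y)"
proof -
  obtain c d where "\<forall>k l. c k l \<in> Ms" "x = (\<Sum>k\<in>UNIV. \<Sum>l\<in>UNIV. \<rho> (c k l) * QS k l)"
    "\<forall>k l. d k l \<in> Ms" "y = (\<Sum>k\<in>UNIV. \<Sum>l\<in>UNIV. \<rho> (d k l) * QS k l)"
    using assms unfolding LQ_def by blast
  then show ?thesis unfolding LQ_def
    by (intro exI[of _ "\<lambda>k l. c k l + d k l"]) (simp add: subalg.add rho.ev_add distrib_right sum.distrib)
qed

lemma LQ_sum: "(\<And>i. i \<in> A \<Longrightarrow> LQ (f i)) \<Longrightarrow> LQ (sum f A)"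
  by (induction A rule: infinite_finite_induct) (auto intro: LQ_add simp: LQ_0)

lemma LQ_mult: assumes "b \<in> Ms" "LQ x" shows "LQ (\<rho> b * x)"
proof -
  obtain c where "\<forall>k l. c k l \<in> Ms" "x = (\<Sum>k\<in>UNIV. \<Sum>l\<in>UNIV. \<rho> (c k l) * QS k l)"
    using assms unfolding LQ_def by blast
  then show ?thesis unfolding LQ_def using assms(1)
    by (intro exI[of _ "\<lambda>k l. b * c k l"]) (simp add: subalg.mult rho.ev_mult sum_distrib_left mult.assoc)
qed

lemma LQ_\<kappa>: "LQ x \<Longrightarrow> LQ (\<kappa>S c * x)"
  using LQ_mult[OF subalg.const[of c]] by (simp add: rho.ev_const)

lemma LQ_M: "LQ x \<Longrightarrow> LQ (MS i j * x)"
  using LQ_mult[OF fM_Ms[of i j]] by (simp add: fM_def rho.ev_gen)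

lemma LQ_Q: "LQ (QS i j)"
  unfolding LQ_def
proof (intro exI conjI allI)
  show "(if k = i then if l = j then 1 else 0 else 0) \<in> Ms" for k l by (auto simp: subalg_0 subalg_1)
  show "QS i j = (\<Sum>k\<in>UNIV. \<Sum>l\<in>UNIV. \<rho> (if k = i then if l = j then 1 else 0 else 0) * QS k l)"
    by (simp add: if_distrib[of \<rho>] rho.ev_0 rho.ev_1 if_distrib[of "\<lambda>x. x * _"] sum_if_const cong: if_cong)
qed

lemma LQ_Q\<kappa>: "LQ (QS i j * \<kappa>S c)"
  unfolding \<kappa>S_rep[symmetric] by (intro LQ_\<kappa> LQ_Q)

lemma LQ_QM: "LQ (QS i x * MS y k)"
proof -
  interpret g: GL \<kappa>S R q m by (rule GL_S)
  show ?thesis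
    unfolding g.exch_solved[OF rho_relations(3) \<kappa>S_rep] g.swapped_def
    by (intro LQ_sum LQ_\<kappa> LQ_M LQ_Q\<kappa>)
qed

text \<open>Each passage of an entry of Q through a product leaves single entries of Q on the right,
  so the factors can be treated one by one.\<close>

lemma LQ_QMs: "b \<in> Ms \<Longrightarrow> LQ (QS i j * \<rho> b)"
proof (induction arbitrary: i j rule: subalg.induct)
  case (const c)
  show ?case by (simp only: rho.ev_const LQ_Q\<kappa>)
next
  case (gen z)
  then show ?case by (auto simp: rho.ev_gen LQ_QM)
next
  case (add x y)
  then show ?case by (simp add: rho.ev_add distrib_left LQ_add)
next
  case (mult x y)
  obtain c where c: "\<forall>k l. c k l \<in> Ms" "QS i j * \<rho> x = (\<Sum>k\<in>UNIV. \<Sum>l\<in>UNIV. \<rho> (c k l) * QS k l)"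
    using mult.IH(1)[of i j] unfolding LQ_def by blast
  have "QS i j * \<rho> (x * y) = (\<Sum>k\<in>UNIV. \<Sum>l\<in>UNIV. \<rho> (c k l) * (QS k l * \<rho> y))"
    by (simp only: rho.ev_mult mult.assoc[symmetric] c(2) sum_distrib_right)
  also have "LQ \<dots>" using c(1) mult.IH(2) by (intro LQ_sum LQ_mult) auto
  finally show ?case .
qed

abbreviation mq where "mq S \<equiv> span_prod S Qs I"

lemma mq_cong: assumes "\<rho> x = \<rho> y" "y \<in> mq S" shows "x \<in> mq S"
  using span_prod.add[OF span_prod.rel[of "x - y" I S Qs] assms(2)] assms(1) by (simp add: rho_eq_iff)

lemma mq_sum: "(\<And>i. i \<in> A \<Longrightarrow> f i \<in> mq S) \<Longrightarrow> sum f A \<in> mq S"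
  by (induction A rule: infinite_finite_induct) (auto intro: span_prod.add span_prod.rel ad_ideal_closed(1))

lemma mq_right: "x \<in> mq S \<Longrightarrow> a \<in> Qs \<Longrightarrow> x * a \<in> mq S"
proof (induction rule: span_prod.induct)
  case (rel x) then show ?case by (intro span_prod.rel ad_ideal_closed(4))
next
  case (prod b a') then show ?case using span_prod.prod[OF prod(1) subalg.mult[OF prod(2,3)]] by (simp add: mult.assoc)
next
  case (add x y) then show ?case by (simp add: distrib_right span_prod.add)
qed

lemma mq_left:
  assumes "x \<in> mq S" "\<And>b. b \<in> S \<Longrightarrow> a * b \<in> mq S'"
  shows "a * x \<in> mq S'"
  using assms(1)
proof (induction rule: span_prod.induct)
  case (rel x) then show ?case by (intro span_prod.rel ad_ideal_closed(3))
next
  case (prod b a') then show ?case unfolding mult.assoc[symmetric] by (intro mq_right assms(2))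
next
  case (add x y) then show ?case by (simp add: distrib_left span_prod.add)
qed

lemma reorder: "a \<in> Qs \<Longrightarrow> b \<in> Ms \<Longrightarrow> a * b \<in> mq Ms"
proof (induction arbitrary: b rule: subalg.induct)
  case (const c)
  then show ?case using span_prod.prod[OF subalg.mult[OF subalg.const[of c] const] subalg_1] by simp
next
  case (gen z)
  then obtain i j where z: "z = QGen i j" by auto
  obtain c where c: "\<forall>k l. c k l \<in> Ms" "QS i j * \<rho> b = (\<Sum>k\<in>UNIV. \<Sum>l\<in>UNIV. \<rho> (c k l) * QS k l)"
    using LQ_QMs[OF gen(2), of i j] unfolding LQ_def by blast
  have "\<rho> (fgen z * b) = \<rho> (\<Sum>k\<in>UNIV. \<Sum>l\<in>UNIV. c k l * fQ k l)"
    using c(2) by (simp add: z rho.ev_mult rho.ev_gen rho.ev_sum fQ_def)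
  then show ?case
    by (rule mq_cong) (intro mq_sum span_prod.prod fQ_Qs c(1)[rule_format])
next
  case (add x y)
  then show ?case by (simp add: distrib_right span_prod.add)
next
  case (mult x y)
  have "x * (y * b) \<in> mq Ms" by (rule mq_left[OF mult.IH(2)[OF mult.prems] mult.IH(1)])
  then show ?case by (simp only: mult.assoc)
qed

lemma mq_expand:
  assumes "x \<in> mq S"
  shows "\<exists>L. (\<forall>(b, a)\<in>set L. b \<in> S \<and> a \<in> Qs) \<and> \<rho> x = \<rho> (\<Sum>(b, a)\<leftarrow>L. b * a)"
  using assms
proof (induction rule: span_prod.induct)
  case (rel x)
  then show ?case by (intro exI[of _ "[]"]) (simp add: rho_0_iff rho.ev_0)
next
  case (prod b a)
  then show ?case by (intro exI[of _ "[(b, a)]"]) simp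
next
  case (add x y)
  then obtain L L' where "\<forall>(b, a)\<in>set L. b \<in> S \<and> a \<in> Qs" "\<rho> x = \<rho> (\<Sum>(b, a)\<leftarrow>L. b * a)"
    "\<forall>(b, a)\<in>set L'. b \<in> S \<and> a \<in> Qs" "\<rho> y = \<rho> (\<Sum>(b, a)\<leftarrow>L'. b * a)" by blast
  then show ?case by (intro exI[of _ "L @ L'"]) (auto simp: rho.ev_add)
qed

section \<open>The inverse of \<open>M\<close> and central elements\<close>

text \<open>It inverts a_m(M), a scalar multiple of the determinant, which commutes with M and Q by
  \<open>qdet_commutes\<close>.\<close>

lemma AInv_central: "rep (fgen AInv) * \<rho> x = \<rho> x * rep (fgen AInv)"
proof -
  interpret e: RE_hom \<kappa>S R q m "\<lambda>z. rep (fgen z)" u v by (rule rho_RE_hom)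
  let ?A = "rep (fgen AInv)" and ?a = "\<rho> (a_elem q m R)"
  have a: "y * ?a = ?a * y" if "y * e.qdet = e.qdet * y" "\<And>c. \<kappa>S c * y = y * \<kappa>S c" for y
    unfolding e.ev_a_elem by (simp only: mult.assoc[symmetric] that(1)) (simp only: mult.assoc that(2))
  have inv: "?A * y = y * ?A" if "y * ?a = ?a * y" for y
  proof -
    have "?A * y = ?A * (y * ?a) * ?A" by (simp only: mult.assoc rho_relations(4) mult_1_right)
    also have "\<dots> = y * ?A" by (simp only: that mult.assoc[symmetric] rho_relations(5) mult_1_left)
    finally show ?thesis .
  qed
  show ?thesis
  proof (induction x rule: falg_induct)
    case (const c) show ?case by (simp add: rho.ev_const \<kappa>S_rep)
  next
    case (gen z)
    show ?case
    proof (cases z)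
      case AInv then show ?thesis by (simp add: rho.ev_gen)
    next
      case (MGen i j)
      show ?thesis unfolding MGen rho.ev_gen by (rule inv[OF a[OF e.qdet_commutes[OF \<kappa>S_rep rho_relations(1)] \<kappa>S_rep]])
    next
      case (QGen i j)
      show ?thesis unfolding QGen rho.ev_gen by (rule inv[OF a[OF e.qdet_commutes[OF \<kappa>S_rep rho_relations(3)] \<kappa>S_rep]])
    qed
  next
    case (add x y) then show ?case by (simp add: rho.ev_add algebra_simps)
  next
    case (mult x y)
    have "?A * (\<rho> x * \<rho> y) = \<rho> x * (?A * \<rho> y)" using mult(1) by (simp only: mult.assoc[symmetric])
    then show ?case using mult(2) by (simp only: rho.ev_mult mult.assoc)
  qed
qed

lemma commutes_gens:
  assumes M: "\<And>i j. x * MS i j = MS i j * x" and Q: "\<And>i j. x * QS i j = QS i j * x" and x: "x = \<rho> x'"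
  shows "x * \<rho> y = \<rho> y * x"
proof (induction y rule: falg_induct)
  case (const c) show ?case by (simp add: rho.ev_const x rho.\<kappa>_e)
next
  case (gen z)
  show ?case
  proof (cases z)
    case AInv then show ?thesis by (simp add: rho.ev_gen x AInv_central)
  qed (simp_all add: rho.ev_gen M Q)
next
  case (add y z) then show ?case by (simp add: rho.ev_add distrib_left distrib_right)
next
  case (mult y z)
  have "x * (\<rho> y * \<rho> z) = \<rho> y * (x * \<rho> z)" using mult(1) by (simp only: mult.assoc[symmetric])
  then show ?case using mult(2) by (simp only: rho.ev_mult mult.assoc)
qed

lemma matrix_inverse_unique:
  fixes M W Z :: "'i::finite \<Rightarrow> 'i \<Rightarrow> 'b::ring_1"
  assumes WM: "\<And>i j. (\<Sum>a\<in>UNIV. W i a * M a j) = (if i = j then 1 else 0)"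
    and MZ: "\<And>i j. (\<Sum>a\<in>UNIV. M i a * Z a j) = (if i = j then 1 else 0)"
  shows "W i j = Z i j"
proof -
  have "W i j = (\<Sum>b\<in>UNIV. W i b * (\<Sum>a\<in>UNIV. M b a * Z a j))" unfolding MZ by (simp add: mult_if_delta)
  also have "\<dots> = (\<Sum>b\<in>UNIV. \<Sum>a\<in>UNIV. W i b * M b a * Z a j)" by (simp only: sum_distrib_left mult.assoc)
  also have "\<dots> = (\<Sum>a\<in>UNIV. \<Sum>b\<in>UNIV. W i b * M b a * Z a j)" by (rule sum.swap)
  also have "\<dots> = (\<Sum>a\<in>UNIV. (if i = a then 1 else 0) * Z a j)" unfolding WM[symmetric] by (simp only: sum_distrib_right)
  also have "\<dots> = Z i j" by (simp add: mult_if_delta)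
  finally show ?thesis .
qed

lemma M_inverse_exists:
  "\<exists>Z. (\<forall>i j. \<rho> (\<Sum>a\<in>UNIV. fM i a * Z a j) = (if i = j then 1 else 0)) \<and>
       (\<forall>i j. \<rho> (\<Sum>a\<in>UNIV. Z i a * fM a j) = (if i = j then 1 else 0))"
proof -
  interpret e: RE_hom \<kappa>S R q m "\<lambda>z. rep (fgen z)" u v by (rule rho_RE_hom)
  let ?A = "rep (fgen AInv)"
  have qA: "e.qdet * (\<kappa>S tc * ?A) = 1" "(\<kappa>S tc * ?A) * e.qdet = 1"
  proof -
    show "e.qdet * (\<kappa>S tc * ?A) = 1" using rho_relations(4) unfolding e.ev_a_elem by (simp only: mult.assoc)
    have "?A * (e.qdet * \<kappa>S tc) = 1" using rho_relations(5) unfolding e.ev_a_elem .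
    then show "(\<kappa>S tc * ?A) * e.qdet = 1" by (simp only: mult.assoc e.\<kappa>_qdet[symmetric] \<kappa>S_rep)
  qed
  obtain y where y: "\<And>i j. (\<Sum>K | length K = m - 1. u (i # K) * y j K) = (if i = j then 1 else 0)"
    using e.u_contract by blast
  let ?T = "tprod m (map (M_bar R m) [1..<Suc (m - 1)])"
  have T: "e.tail_copies (op1 0 MS) (m - 1) = opo 0 m (\<lambda>I J. \<rho> (?T I J))"
    using e.evo_M_tail[of "m - 1" m] e.m1 unfolding rho.evo_def by simp
  define Z where "Z = (\<lambda>a j. (\<Sum>K | length K = m - 1. \<Sum>L | length L = m. ?T (a # K) L * fconst (u L) * fconst (y j K))
      * (fconst tc * fgen AInv))"
  have MZ: "(\<Sum>a\<in>UNIV. MS i a * \<rho> (Z a j)) = (if i = j then 1 else 0)" for i j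
  proof -
    have "(\<Sum>a\<in>UNIV. MS i a * \<rho> (Z a j)) = (\<Sum>a\<in>UNIV. MS i a *
        (\<Sum>K | length K = m - 1. \<Sum>L | length L = m. \<rho> (?T (a # K) L) * \<kappa>S (u L) * \<kappa>S (y j K))) * (\<kappa>S tc * ?A)"
      unfolding Z_def rho.ev_mult rho.ev_sum rho.ev_const rho.ev_gen by (simp only: sum_distrib_right mult.assoc)
    also have "\<dots> = (if i = j then 1 else 0)" unfolding e.right_inverse[OF y T] using qA(1) by simp
    finally show ?thesis .
  qed
  obtain Z' c where Z': "c \<noteq> 0" "\<And>i j. (\<Sum>a\<in>UNIV. Z' i a * MS a j) = (if i = j then e.qdet * \<kappa>S c else 0)"
    using e.left_inverse by blast
  define W where "W = (\<lambda>i j. \<kappa>S (1 / c) * (\<kappa>S tc * ?A) * Z' i j)"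
  have WM: "(\<Sum>a\<in>UNIV. W i a * MS a j) = (if i = j then 1 else 0)" for i j
  proof -
    have "(\<Sum>a\<in>UNIV. W i a * MS a j) = \<kappa>S (1 / c) * (\<kappa>S tc * ?A) * (\<Sum>a\<in>UNIV. Z' i a * MS a j)"
      by (simp only: W_def mult.assoc sum_distrib_left)
    also have "\<dots> = (if i = j then \<kappa>S (1 / c) * ((\<kappa>S tc * ?A) * e.qdet) * \<kappa>S c else 0)"
      unfolding Z'(2) by (simp add: mult.assoc)
    also have "\<dots> = (if i = j then 1 else 0)"
      unfolding qA using Z'(1) by (simp add: S.\<kappa>_mult[symmetric] S.\<kappa>_1)
    finally show ?thesis .
  qed
  \<comment> \<open>The left inverse \<open>W\<close> is only a matrix of endomorphisms, whereas
    \<open>Z\<close> comes from the free algebra. Their equality makes \<open>Z\<close> a two-sided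
    inverse modulo the ideal.\<close>
  have "W i j = \<rho> (Z i j)" for i j by (rule matrix_inverse_unique[OF WM MZ])
  then have "(\<Sum>a\<in>UNIV. \<rho> (Z i a) * MS a j) = (if i = j then 1 else 0)" for i j using WM by simp
  then show ?thesis using MZ by (intro exI[of _ Z]) (simp add: rho.ev_sum rho.ev_mult fM_def rho.ev_gen)
qed

definition Zf where "Zf = (SOME Z. (\<forall>i j. \<rho> (\<Sum>a\<in>UNIV. fM i a * Z a j) = (if i = j then 1 else 0)) \<and>
       (\<forall>i j. \<rho> (\<Sum>a\<in>UNIV. Z i a * fM a j) = (if i = j then 1 else 0)))"

lemma Zf: "\<rho> (\<Sum>a\<in>UNIV. fM i a * Zf a j) = (if i = j then 1 else 0)"
  "\<rho> (\<Sum>a\<in>UNIV. Zf i a * fM a j) = (if i = j then 1 else 0)"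
  using someI_ex[OF M_inverse_exists, folded Zf_def] by blast+

definition fN where "fN i j = (\<Sum>a\<in>UNIV. Zf i a * fQ a j)"

primrec fpow :: "('n \<Rightarrow> 'n \<Rightarrow> ('k, 'n) falg) \<Rightarrow> nat \<Rightarrow> 'n \<Rightarrow> 'n \<Rightarrow> ('k, 'n) falg" where
  "fpow Z 0 = (\<lambda>i j. if i = j then 1 else 0)"
| "fpow Z (Suc k) = (\<lambda>i j. \<Sum>l\<in>UNIV. fpow Z k i l * Z l j)"

definition fTr :: "('n \<Rightarrow> 'n \<Rightarrow> ('k, 'n) falg) \<Rightarrow> ('k, 'n) falg" where
  "fTr Z = (\<Sum>i\<in>UNIV. \<Sum>j\<in>UNIV. fconst (C_mat R i j) * Z j i)"

text \<open>For M the two exchange relations suffice. The trace of a power of N commutes with M by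
  \<open>RTr_N_M\<close> and with N by the reflection equation of N, hence with Q = M N.\<close>

lemma central:
  "\<rho> (fTr (fpow fM k) * x) = \<rho> (x * fTr (fpow fM k))"
  "\<rho> (fTr (fpow fN k) * x) = \<rho> (x * fTr (fpow fN k))"
proof -
  interpret g: GL \<kappa>S R q m by (rule GL_S)
  have pow: "\<rho> (fpow Z k i j) = g.mpow (\<lambda>i j. \<rho> (Z i j)) k i j" for Z i j
    by (induction k arbitrary: i j) (simp_all add: rho.ev_sum rho.ev_mult rho.ev_0 rho.ev_1 if_distrib[of \<rho>])
  have tr: "\<rho> (fTr (fpow Z k)) = g.RTr (g.mpow (\<lambda>i j. \<rho> (Z i j)) k)" for Z
    by (simp add: fTr_def g.RTr_def rho.ev_sum rho.ev_mult rho.ev_const pow)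
  have M: "(\<lambda>i j. \<rho> (fM i j)) = MS" by (simp add: fM_def rho.ev_gen)
  have "g.RTr (g.mpow MS k) * \<rho> x = \<rho> x * g.RTr (g.mpow MS k)"
    by (rule commutes_gens[OF g.RTr_mpow_commutes[OF \<kappa>S_rep \<kappa>S_rep rho_relations(1)]
      g.RTr_mpow_commutes[OF \<kappa>S_rep \<kappa>S_rep rho_relations(3)] tr[of fM, unfolded M, symmetric]])
  then show "\<rho> (fTr (fpow fM k) * x) = \<rho> (x * fTr (fpow fM k))" by (simp only: rho.ev_mult tr M)
  define NS where "NS = (\<lambda>i j. \<rho> (fN i j))"
  define Mi where "Mi = (\<lambda>i j. \<rho> (Zf i j))"
  have \<kappa>N: "\<kappa>S c * NS i j = NS i j * \<kappa>S c" for c i j unfolding NS_def by (rule rho.\<kappa>_e)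
  have MiM: "(\<Sum>a\<in>UNIV. Mi i a * MS a j) = (if i = j then 1 else 0)" for i j
    using Zf(2)[of i j] by (simp add: Mi_def rho.ev_sum rho.ev_mult fM_def rho.ev_gen)
  have MMi: "(\<Sum>a\<in>UNIV. MS i a * Mi a j) = (if i = j then 1 else 0)" for i j
    using Zf(1)[of i j] by (simp add: Mi_def rho.ev_sum rho.ev_mult fM_def rho.ev_gen)
  have Q: "QS i j = (\<Sum>l\<in>UNIV. MS i l * NS l j)" for i j
  proof -
    have "(\<Sum>l\<in>UNIV. MS i l * NS l j) = (\<Sum>l\<in>UNIV. \<Sum>a\<in>UNIV. MS i l * Mi l a * QS a j)"
      by (simp add: NS_def Mi_def fN_def rho.ev_sum rho.ev_mult fQ_def rho.ev_gen sum_distrib_left mult.assoc)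
    also have "\<dots> = (\<Sum>a\<in>UNIV. \<Sum>l\<in>UNIV. MS i l * Mi l a * QS a j)" by (rule sum.swap)
    also have "\<dots> = (\<Sum>a\<in>UNIV. (if i = a then 1 else 0) * QS a j)" unfolding MMi[symmetric] by (simp only: sum_distrib_right)
    also have "\<dots> = QS i j" by (simp add: mult_if_delta)
    finally show ?thesis ..
  qed
  let ?c = "g.RTr (g.mpow NS k)"
  note ctx = rho_relations(1) rho_relations(3) rho_relations(2) MiM Q
  have cM: "?c * MS i j = MS i j * ?c" for i j by (rule g.RTr_N_M[OF ctx \<kappa>N \<kappa>S_rep])
  have cN: "?c * NS i j = NS i j * ?c" for i j by (rule g.RTr_mpow_commutes[OF \<kappa>N \<kappa>N g.N_N[OF ctx]])
  have "?c * (MS i l * NS l j) = (MS i l * NS l j) * ?c" for i j l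
  proof -
    have "?c * (MS i l * NS l j) = MS i l * (?c * NS l j)" by (simp only: mult.assoc[symmetric] cM)
    then show ?thesis by (simp only: cN mult.assoc)
  qed
  then have cQ: "?c * QS i j = QS i j * ?c" for i j unfolding Q by (simp only: sum_distrib_left sum_distrib_right)
  have "?c * \<rho> x = \<rho> x * ?c"
    by (rule commutes_gens[OF cM cQ tr[of fN, folded NS_def, symmetric]])
  then show "\<rho> (fTr (fpow fN k) * x) = \<rho> (x * fTr (fpow fN k))" by (simp only: rho.ev_mult tr NS_def[symmetric])
qed

section \<open>The orbit ideal\<close>

abbreviation orb :: "(nat \<Rightarrow> 'k) \<Rightarrow> ('k, 'n) falg set" where
  "orb c \<equiv> gen_ideal Ms {fTr (fpow fM k) - fconst (c k) | k. k \<in> {1..m}}"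

lemma fpow_Ms: "fpow fM k i j \<in> Ms"
  by (induction k arbitrary: i j) (auto simp: subalg_0 subalg_1 intro!: subalg_sum subalg.mult fM_Ms)

lemma fTr_Ms: "fTr (fpow fM k) \<in> Ms"
  unfolding fTr_def by (intro subalg_sum subalg.mult subalg.const fpow_Ms)

lemma central_gen: "\<rho> ((fTr (fpow fM k) - fconst d) * x) = \<rho> (x * (fTr (fpow fM k) - fconst d))"
  using central(1)[of k x] by (simp add: left_diff_distrib right_diff_distrib rho.ev_diff fconst_comm)

lemma orb_mult: "x \<in> orb c \<Longrightarrow> b \<in> Ms \<Longrightarrow> b * x \<in> orb c" "x \<in> orb c \<Longrightarrow> b \<in> Ms \<Longrightarrow> x * b \<in> orb c"
proof (induction rule: gen_ideal.induct)
  case (gen b1 b2 z)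
  { case 1 then show ?case using gen_ideal.gen[OF subalg.mult[OF 1 gen(1)] gen(2,3)] by (simp only: mult.assoc) }
  { case 2 then show ?case using gen_ideal.gen[OF gen(1) subalg.mult[OF gen(2) 2] gen(3)] by (simp only: mult.assoc) }
qed (simp_all add: distrib_left distrib_right gen_ideal.add)

lemma orbit_gen_Ms: "fTr (fpow fM k) - fconst d \<in> Ms"
  using subalg.add[OF fTr_Ms subalg_minus[OF subalg.const]] by simp

lemma orb_Ms: "x \<in> orb c \<Longrightarrow> x \<in> Ms"
proof (induction rule: gen_ideal.induct)
  case (gen b b' z)
  then have "z \<in> Ms" using orbit_gen_Ms by blast
  then show ?case using gen by (intro subalg.mult)
qed (rule subalg.add)

lemma orbit_gen: "k \<in> {1..m} \<Longrightarrow> fTr (fpow fM k) - fconst (c k) \<in> orb c"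
  using gen_ideal.gen[OF subalg_1 subalg_1, of "fTr (fpow fM k) - fconst (c k)" "{fTr (fpow fM k) - fconst (c k) | k. k \<in> {1..m}}"] by auto

lemma orb_0: "0 \<in> orb c"
  using orb_mult(1)[OF orbit_gen[of 1 c] subalg_0] GLt by (simp add: GL_type_def)

lemma orb_uminus: "x \<in> orb c \<Longrightarrow> - x \<in> orb c"
  using orb_mult(1)[OF _ subalg_minus[OF subalg_1], of x c] by simp

text \<open>The central generator z is first pulled in front of a b b'; only the rest is reordered,
  and every resulting z b'' stays in the ideal.\<close>

lemma orb_invariant: "x \<in> orb c \<Longrightarrow> a \<in> Qs \<Longrightarrow> a * x \<in> mq (orb c)"
proof (induction rule: gen_ideal.induct)
  case (gen b b' z)
  obtain k where k: "k \<in> {1..m}" "z = fTr (fpow fM k) - fconst (c k)" using gen(3) by blast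
  have "a * (b * b') \<in> mq Ms" using gen by (intro reorder subalg.mult)
  then have "z * (a * (b * b')) \<in> mq (orb c)"
  proof (rule mq_left)
    fix b'' :: "('k, 'n) falg" assume b'': "b'' \<in> Ms"
    have "z * b'' \<in> orb c" unfolding k by (rule orb_mult(2)[OF orbit_gen[OF k(1)] b''])
    then show "z * b'' \<in> mq (orb c)" using span_prod.prod[OF _ subalg_1, of "z * b''"] by simp
  qed
  moreover have "\<rho> (a * (b * z * b')) = \<rho> (z * (a * (b * b')))"
  proof -
    have "\<rho> (a * (b * z * b')) = \<rho> (a * b * z) * \<rho> b'" by (simp only: rho.ev_mult[symmetric] mult.assoc)
    also have "\<dots> = \<rho> (z * (a * b)) * \<rho> b'" unfolding k by (simp only: central_gen)
    finally show ?thesis by (simp only: rho.ev_mult[symmetric] mult.assoc)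
  qed
  ultimately show ?case by (rule mq_cong[rotated])
next
  case (add x y)
  then show ?case by (simp add: distrib_left span_prod.add)
qed

lemma Lambda_orb: "x \<in> mq (orb c) \<Longrightarrow> \<exists>y\<in>orb c. \<rho> (\<Lambda> x) = \<rho> y"
proof (induction rule: span_prod.induct)
  case (rel x)
  then show ?case using orb_0 by (auto simp: Lambda_I)
next
  case (prod b a)
  then show ?case using orb_mult(2)[OF prod(1) subalg.const[of "\<epsilon> a"]] Lambda_prod[OF orb_Ms prod(2)] by blast
next
  case (add x y)
  then obtain z z' where "z \<in> orb c" "\<rho> (\<Lambda> x) = \<rho> z" "z' \<in> orb c" "\<rho> (\<Lambda> y) = \<rho> z'" by blast
  then show ?case by (intro bexI[of _ "z + z'"] gen_ideal.add) (simp_all add: Lambda_add rho.ev_add)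
qed

end


section \<open>The quotient algebra\<close>

context bda
begin

abbreviation B where "B \<equiv> ad_alg q m R"
abbreviation cl where "cl \<equiv> ad_class q m R"

lemma cl_hom: "ring_hom_ring ring_of_type_algebra B cl"
  using ideal.rcos_ring_hom_ring[OF ad_ideal_ideal[of q m R]]
  unfolding ad_alg_def ad_class_def[abs_def] .

lemma B_ring: "ring B"
  using cl_hom by (simp add: ring_hom_ring_def)

lemma cl_eq: "cl x = cl y \<longleftrightarrow> \<rho> x = \<rho> y"
proof -
  have cl: "cl x = (\<lambda>h. h + x) ` I" for x
    by (auto simp: ad_class_def a_r_coset_def')
  show ?thesis unfolding rho_eq_iff
  proof
    assume "cl x = cl y"
    moreover have "x \<in> cl x" unfolding cl using ad_ideal_closed(1) by (intro image_eqI[of _ _ 0]) auto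
    ultimately show "x - y \<in> I" unfolding cl by auto
  next
    assume a: "x - y \<in> I"
    show "cl x = cl y" unfolding cl
    proof (intro equalityI image_subsetI)
      fix h assume h: "h \<in> I"
      show "h + x \<in> (\<lambda>h. h + y) ` I"
        using ad_ideal_closed(2)[OF h a] by (intro image_eqI[of _ _ "h + (x - y)"]) auto
      show "h + y \<in> (\<lambda>h. h + x) ` I"
        using ad_ideal_closed(6)[OF h a] by (intro image_eqI[of _ _ "h - (x - y)"]) auto
    qed
  qed
qed

lemma cl_closed [simp]: "cl x \<in> carrier B"
  and cl_add: "cl x \<oplus>\<^bsub>B\<^esub> cl y = cl (x + y)"
  and cl_mult: "cl x \<otimes>\<^bsub>B\<^esub> cl y = cl (x * y)"
  and cl_1: "\<one>\<^bsub>B\<^esub> = cl 1" and cl_0: "\<zero>\<^bsub>B\<^esub> = cl 0"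
proof -
  interpret h: ring_hom_ring ring_of_type_algebra B cl by (rule cl_hom)
  show "cl x \<in> carrier B" "cl x \<oplus>\<^bsub>B\<^esub> cl y = cl (x + y)" "cl x \<otimes>\<^bsub>B\<^esub> cl y = cl (x * y)"
    "\<one>\<^bsub>B\<^esub> = cl 1" "\<zero>\<^bsub>B\<^esub> = cl 0"
    using h.hom_closed[of x] h.hom_add[of x y] h.hom_mult[of x y] h.hom_one h.hom_zero by simp_all
qed

lemma cl_minus: "\<ominus>\<^bsub>B\<^esub> cl x = cl (- x)"
proof -
  interpret B: ring B by (rule B_ring)
  show ?thesis by (rule B.minus_equality) (simp_all add: cl_add cl_0)
qed

lemma cl_diff: "cl x \<ominus>\<^bsub>B\<^esub> cl y = cl (x - y)"
  by (simp add: a_minus_def cl_minus cl_add)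

lemma carrier_B: "z \<in> carrier B \<Longrightarrow> \<exists>x. z = cl x"
  by (auto simp: ad_alg_def ad_class_def FactRing_def A_RCOSETS_defs a_r_coset_def)

lemma cl_sum: "finite A \<Longrightarrow> (\<Oplus>\<^bsub>B\<^esub>i\<in>A. cl (f i)) = cl (sum f A)"
proof (induction A rule: finite_induct)
  interpret B: ring B by (rule B_ring)
  { case empty show ?case by (simp add: cl_0) }
  { case (insert x F) then show ?case by (simp add: B.finsum_insert cl_add) }
qed

lemma mat_carrier: "A \<in> carrier (mat_monoid B) \<Longrightarrow> \<exists>W. A = (\<lambda>i j. cl (W i j))"
proof -
  assume "A \<in> carrier (mat_monoid B)"
  then have "\<forall>i j. \<exists>x. A i j = cl x" by (auto simp: mat_monoid_def intro: carrier_B)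
  then have "\<exists>W. \<forall>i j. A i j = cl (W i j)" by metis
  then show ?thesis by (auto simp: fun_eq_iff)
qed

lemma mat_mult: "(\<lambda>i j. cl (W i j)) \<otimes>\<^bsub>mat_monoid B\<^esub> (\<lambda>i j. cl (Y i j)) = (\<lambda>i j. cl (\<Sum>a\<in>UNIV. W i a * Y a j))"
  by (simp add: mat_monoid_def cl_mult cl_sum)

lemma mat_one: "\<one>\<^bsub>mat_monoid B\<^esub> = (\<lambda>i j. cl (if i = j then 1 else 0))"
  by (auto simp: mat_monoid_def cl_1 cl_0 fun_eq_iff)

lemma mat_pow: "(\<lambda>i j. cl (W i j)) [^]\<^bsub>mat_monoid B\<^esub> (k::nat) = (\<lambda>i j. cl (fpow W k i j))"
proof (induction k)
  case 0 show ?case by (simp add: nat_pow_def mat_one)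
next
  case (Suc k)
  have "(\<lambda>i j. cl (W i j)) [^]\<^bsub>mat_monoid B\<^esub> Suc k
      = ((\<lambda>i j. cl (W i j)) [^]\<^bsub>mat_monoid B\<^esub> k) \<otimes>\<^bsub>mat_monoid B\<^esub> (\<lambda>i j. cl (W i j))"
    by (simp add: nat_pow_def)
  then show ?case unfolding Suc mat_mult by simp
qed

lemma ad_M: "ad_M q m R = (\<lambda>i j. cl (fM i j))" and ad_Q: "ad_Q q m R = (\<lambda>i j. cl (fQ i j))"
  by (simp_all add: ad_M_def ad_Q_def fun_eq_iff)

lemma mat_inv: "inv\<^bsub>mat_monoid B\<^esub> (ad_M q m R) = (\<lambda>i j. cl (Zf i j))"
  unfolding m_inv_def
proof (rule the_equality)
  have 1: "\<rho> (if i = j then 1 else 0) = (if i = j then 1 else 0)" for i j :: 'n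
    by (simp add: rho.ev_1 rho.ev_0)
  show "(\<lambda>i j. cl (Zf i j)) \<in> carrier (mat_monoid B) \<and>
      ad_M q m R \<otimes>\<^bsub>mat_monoid B\<^esub> (\<lambda>i j. cl (Zf i j)) = \<one>\<^bsub>mat_monoid B\<^esub> \<and>
      (\<lambda>i j. cl (Zf i j)) \<otimes>\<^bsub>mat_monoid B\<^esub> ad_M q m R = \<one>\<^bsub>mat_monoid B\<^esub>"
    unfolding ad_M mat_mult mat_one fun_eq_iff cl_eq 1 Zf by (simp add: mat_monoid_def)
  fix A assume A: "A \<in> carrier (mat_monoid B) \<and> ad_M q m R \<otimes>\<^bsub>mat_monoid B\<^esub> A = \<one>\<^bsub>mat_monoid B\<^esub> \<and>
      A \<otimes>\<^bsub>mat_monoid B\<^esub> ad_M q m R = \<one>\<^bsub>mat_monoid B\<^esub>"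
  then obtain W where W: "A = (\<lambda>i j. cl (W i j))" using mat_carrier by blast
  have XM: "(\<Sum>a\<in>UNIV. \<rho> (W i a) * \<rho> (fM a j)) = (if i = j then 1 else 0)" for i j
    using A unfolding W ad_M mat_mult mat_one fun_eq_iff cl_eq 1 by (simp add: rho.ev_sum rho.ev_mult)
  have MZ: "(\<Sum>a\<in>UNIV. \<rho> (fM i a) * \<rho> (Zf a j)) = (if i = j then 1 else 0)" for i j
    using Zf(1)[of i j] by (simp add: rho.ev_sum rho.ev_mult)
  have "\<rho> (W i j) = \<rho> (Zf i j)" for i j by (rule matrix_inverse_unique[OF XM MZ])
  then show "A = (\<lambda>i j. cl (Zf i j))" by (simp add: W fun_eq_iff cl_eq)
qed

lemma ad_N: "ad_N q m R = (\<lambda>i j. cl (fN i j))"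
  unfolding ad_N_def mat_inv ad_Q mat_mult fN_def ..

lemma R_trace: "R_trace q m R (\<lambda>i j. cl (W i j)) = cl (fTr W)"
  by (simp add: R_trace_def ad_const_def fTr_def cl_mult cl_sum)

lemma central_inI:
  assumes "\<And>y. \<rho> (x * y) = \<rho> (y * x)"
  shows "central_in B (cl x)"
  unfolding central_in_def
proof (intro conjI ballI)
  fix z assume "z \<in> carrier B"
  then obtain y where z: "z = cl y" using carrier_B by blast
  show "cl x \<otimes>\<^bsub>B\<^esub> z = z \<otimes>\<^bsub>B\<^esub> cl x" unfolding z cl_mult cl_eq by (rule assms)
qed simp

lemma traces_central:
  fixes k :: nat
  shows "central_in B (R_trace q m R (ad_M q m R [^]\<^bsub>mat_monoid B\<^esub> k))"
    and "central_in B (R_trace q m R (ad_N q m R [^]\<^bsub>mat_monoid B\<^esub> k))"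
  unfolding ad_M ad_N mat_pow R_trace by (auto intro!: central_inI central)

lemma generate_subalg:
  "generate_ring B (range (ad_const q m R) \<union> cl ` fgen ` G) = cl ` subalg G" (is "?L = _")
proof (intro equalityI subsetI)
  fix z assume "z \<in> ?L"
  then show "z \<in> cl ` subalg G"
  proof (induction rule: generate_ring.induct)
    case one show ?case unfolding cl_1 by (intro imageI subalg_1)
  next
    case (incl h) then show ?case by (auto simp: ad_const_def intro: subalg.intros)
  qed (auto simp: cl_minus cl_add cl_mult intro: subalg.intros subalg_minus)
next
  fix z assume "z \<in> cl ` subalg G"
  then obtain x where x: "z = cl x" "x \<in> subalg G" by blast
  from x(2) have "cl x \<in> ?L"
  proof (induction rule: subalg.induct)
    case (const c) show ?case by (rule generate_ring.incl) (auto simp: ad_const_def)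
  next
    case (gen z) then show ?case by (intro generate_ring.incl) auto
  qed (simp_all add: cl_add[symmetric] cl_mult[symmetric] generate_ring.eng_add generate_ring.eng_mult)
  then show "z \<in> ?L" using x by simp
qed

lemma M_alg: "M_alg q m R = cl ` Ms" and Q_alg: "Q_alg q m R = cl ` Qs"
proof -
  have "{ad_M q m R i j | i j. True} = cl ` fgen ` {z. \<exists>i j. z = MGen i j}"
    "{ad_Q q m R i j | i j. True} = cl ` fgen ` {z. \<exists>i j. z = QGen i j}"
    by (auto simp: ad_M ad_Q fM_def fQ_def)
  then show "M_alg q m R = cl ` Ms" "Q_alg q m R = cl ` Qs"
    unfolding M_alg_def Q_alg_def by (simp_all only: generate_subalg)
qed

text \<open>\<open>chi\<close> is an arbitrary choice. \<epsilon> vanishes on the ideal and so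
  induces a function on cosets that is admissible; on Q(R) every admissible choice is determined by
  the generators.\<close>

lemma chi_cl: assumes "a \<in> Qs" shows "chi q m R \<xi> (cl a) = \<epsilon> a"
proof -
  define f where "f = (\<lambda>A. \<epsilon> (SOME x. cl x = A))"
  have f: "f (cl x) = \<epsilon> x" for x
  proof -
    have "cl (SOME y. cl y = cl x) = cl x" by (rule someI) (rule refl)
    then have "(SOME y. cl y = cl x) - x \<in> I" by (simp add: cl_eq rho_eq_iff)
    from eps_kills[OF this] show ?thesis by (simp add: f_def eps.ev_diff)
  qed
  have "is_chi q m R \<xi> f"
    unfolding is_chi_def Q_alg
  proof (intro conjI allI ring_hom_memI)
    show "f \<one>\<^bsub>B\<lparr>carrier := cl ` Qs\<rparr>\<^esub> = \<one>\<^bsub>ring_of_type_algebra\<^esub>" by (simp add: cl_1 f eps.ev_1)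
  qed (auto simp: cl_mult cl_add f eps.ev_mult eps.ev_add ad_const_def eps.ev_const ad_Q fQ_def eps.ev_gen)
  then have chi: "is_chi q m R \<xi> (chi q m R \<xi>)" unfolding chi_def by (rule someI[of "is_chi q m R \<xi>"])
  then have h: "chi q m R \<xi> \<in> ring_hom (B\<lparr>carrier := cl ` Qs\<rparr>) ring_of_type_algebra"
    and c: "chi q m R \<xi> (cl (fconst c)) = c"
    and Q: "chi q m R \<xi> (cl (fQ i j)) = (if i = j then \<xi> else 0)" for c i j
    unfolding is_chi_def Q_alg ad_const_def ad_Q by blast+
  show ?thesis using assms
  proof (induction rule: subalg.induct)
    case (const c) show ?case by (simp add: c eps.ev_const)
  next
    case (gen z)
    then obtain i j where z: "z = QGen i j" by blast
    show ?case using Q[of i j] by (simp add: z fQ_def eps.ev_gen)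
  next
    case (add x y)
    then show ?case using ring_hom_add[OF h, of "cl x" "cl y"] by (simp add: cl_add eps.ev_add)
  next
    case (mult x y)
    then show ?case using ring_hom_mult[OF h, of "cl x" "cl y"] by (simp add: cl_mult eps.ev_mult)
  qed
qed

text \<open>\<open>\<Lambda>\<close> depends only on the coset of the product and sends each b_i a_i
  to b_i \<chi>(a_i) modulo the ideal. Hence every reordering gives the same result.\<close>

lemma reorders_to_imp:
  assumes "reorders_to q m R \<xi> (cl a) (cl b) c"
  shows "c = cl (\<Lambda> (a * b))"
proof -
  obtain N :: nat and bs as where bs: "\<And>i. i < N \<Longrightarrow> bs i \<in> cl ` Ms \<and> as i \<in> cl ` Qs"
    and ab: "cl (a * b) = (\<Oplus>\<^bsub>B\<^esub>i\<in>{..<N}. bs i \<otimes>\<^bsub>B\<^esub> as i)"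
    and c: "c = (\<Oplus>\<^bsub>B\<^esub>i\<in>{..<N}. bs i \<otimes>\<^bsub>B\<^esub> ad_const q m R (chi q m R \<xi> (as i)))"
    using assms unfolding reorders_to_def M_alg Q_alg cl_mult by blast
  interpret B: ring B by (rule B_ring)
  define b' where "b' i = (SOME x. x \<in> Ms \<and> bs i = cl x)" for i
  define a' where "a' i = (SOME y. y \<in> Qs \<and> as i = cl y)" for i
  have ba: "b' i \<in> Ms \<and> a' i \<in> Qs \<and> bs i = cl (b' i) \<and> as i = cl (a' i)" if "i < N" for i
  proof -
    have "\<exists>x. x \<in> Ms \<and> bs i = cl x" "\<exists>y. y \<in> Qs \<and> as i = cl y" using bs[OF that] by blast+
    from this[THEN someI_ex] show ?thesis unfolding b'_def a'_def by blast
  qed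
  have "cl (a * b) = (\<Oplus>\<^bsub>B\<^esub>i\<in>{..<N}. cl (b' i * a' i))"
    unfolding ab by (rule B.finsum_cong') (auto simp: ba cl_mult)
  then have "\<rho> (a * b) = \<rho> (\<Sum>i<N. b' i * a' i)" by (simp add: cl_sum cl_eq)
  then have "\<Lambda> (a * b) = \<Lambda> (\<Sum>i<N. b' i * a' i)" by (rule Lambda_cong)
  also have "\<dots> = (\<Sum>i<N. \<Lambda> (b' i * a' i))"
    by (induction N) (simp_all add: Lambda_add Lambda_I ad_ideal_closed)
  finally have "\<rho> (\<Lambda> (a * b)) = (\<Sum>i<N. \<rho> (b' i * fconst (\<epsilon> (a' i))))"
    using ba by (simp add: rho.ev_sum Lambda_prod)
  moreover have "c = (\<Oplus>\<^bsub>B\<^esub>i\<in>{..<N}. cl (b' i * fconst (\<epsilon> (a' i))))"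
    unfolding c by (rule B.finsum_cong') (auto simp: ba cl_mult ad_const_def chi_cl)
  ultimately show ?thesis by (simp add: cl_sum cl_eq rho.ev_sum)
qed

lemma reorders_to_exists:
  assumes "a \<in> Qs" "b \<in> Ms"
  shows "\<exists>c. reorders_to q m R \<xi> (cl a) (cl b) c"
proof -
  obtain L where L: "\<forall>(b, a)\<in>set L. b \<in> Ms \<and> a \<in> Qs" "\<rho> (a * b) = \<rho> (\<Sum>(b, a)\<leftarrow>L. b * a)"
    using mq_expand[OF reorder[OF assms]] by blast
  define bs as where "bs = (\<lambda>i. cl (fst (L ! i)))" and "as = (\<lambda>i. cl (snd (L ! i)))"
  have mem: "bs i \<in> cl ` Ms \<and> as i \<in> cl ` Qs" if "i < length L" for i
    using L(1) nth_mem[OF that] unfolding bs_def as_def by (cases "L ! i") auto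
  have "\<rho> (a * b) = \<rho> (\<Sum>i<length L. fst (L ! i) * snd (L ! i))"
    using L(2) by (simp add: sum_list_sum_nth case_prod_beta atLeast0LessThan)
  then have "cl a \<otimes>\<^bsub>B\<^esub> cl b = (\<Oplus>\<^bsub>B\<^esub>i\<in>{..<length L}. bs i \<otimes>\<^bsub>B\<^esub> as i)"
    by (simp add: bs_def as_def cl_mult cl_sum cl_eq)
  then show ?thesis unfolding reorders_to_def M_alg Q_alg using mem by blast
qed

lemma Q_act_cl:
  assumes "a \<in> Qs" "b \<in> Ms"
  shows "Q_act q m R \<xi> (cl a) (cl b) = cl (\<Lambda> (a * b))"
proof -
  obtain c where c: "reorders_to q m R \<xi> (cl a) (cl b) c" using reorders_to_exists[OF assms] by blast
  show ?thesis unfolding Q_act_def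
    by (rule the_equality) (use c reorders_to_imp in auto)
qed

lemma orbit_ideal_eq: "orbit_ideal q m R c = cl ` orb c"
proof -
  let ?B = "B\<lparr>carrier := cl ` Ms\<rparr>"
  let ?S = "{R_trace q m R (ad_M q m R [^]\<^bsub>mat_monoid B\<^esub> k) \<ominus>\<^bsub>B\<^esub> ad_const q m R (c k) | k. k \<in> {1..m}}"
  interpret B: ring B by (rule B_ring)
  have "range (ad_const q m R) \<union> {ad_M q m R i j | i j. True} \<subseteq> carrier B" by (auto simp: ad_const_def ad_M)
  from B.generate_ring_is_ring[OF this] have ring: "ring ?B" unfolding M_alg_def[symmetric] M_alg .
  interpret M: ring ?B by (rule ring)
  have S: "?S = {cl (fTr (fpow fM k) - fconst (c k)) | k. k \<in> {1..m}}"
    unfolding ad_M mat_pow R_trace ad_const_def cl_diff ..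
  have Sc: "?S \<subseteq> carrier ?B" unfolding S using orbit_gen_Ms by auto
  have inv: "inv\<^bsub>add_monoid ?B\<^esub> cl x = cl (- x)" if "x \<in> Ms" for x
  proof -
    have "\<ominus>\<^bsub>?B\<^esub> cl x = cl (- x)"
      by (rule M.minus_equality) (auto simp: cl_add cl_0 that subalg_minus)
    then show ?thesis by (simp only: a_inv_def)
  qed
  have "ideal (cl ` orb c) ?B"
  proof (rule idealI[OF ring])
    show "subgroup (cl ` orb c) (add_monoid ?B)"
    proof (rule group.subgroupI)
      show "Group.group (add_monoid ?B)" by (rule M.add.is_group)
      show "cl ` orb c \<subseteq> carrier (add_monoid ?B)" using orb_Ms by auto
      show "cl ` orb c \<noteq> {}" using orb_0 by blast
      show "inv\<^bsub>add_monoid ?B\<^esub> z \<in> cl ` orb c" if "z \<in> cl ` orb c" for z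
      proof -
        from that obtain x where x: "z = cl x" "x \<in> orb c" by blast
        show ?thesis unfolding x(1) inv[OF orb_Ms[OF x(2)]] by (intro imageI orb_uminus x(2))
      qed
      show "y \<otimes>\<^bsub>add_monoid ?B\<^esub> z \<in> cl ` orb c" if "y \<in> cl ` orb c" "z \<in> cl ` orb c" for y z
        using that by (auto simp: cl_add intro: gen_ideal.add)
    qed
  qed (auto simp: cl_mult simp del: atLeastAtMost_iff One_nat_def intro: orb_mult)
  moreover have "?S \<subseteq> cl ` orb c" unfolding S using orbit_gen by blast
  ultimately have "Idl\<^bsub>?B\<^esub> ?S \<subseteq> cl ` orb c" by (rule M.genideal_minimal)
  moreover have "cl x \<in> Idl\<^bsub>?B\<^esub> ?S" if "x \<in> orb c" for x
  proof -
    interpret J: ideal "Idl\<^bsub>?B\<^esub> ?S" ?B by (rule M.genideal_ideal[OF Sc])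
    show ?thesis using that
    proof (induction rule: gen_ideal.induct)
      case (gen b b' z)
      have "cl z \<in> Idl\<^bsub>?B\<^esub> ?S" using gen(3) M.genideal_self[OF Sc] unfolding S by blast
      from J.I_r_closed[OF J.I_l_closed[OF this, of "cl b"], of "cl b'"] gen(1,2)
      show ?case by (simp add: cl_mult)
    next
      case (add x y)
      from additive_subgroup.a_closed[OF J.additive_subgroup_axioms add(3,4)] show ?case by (simp add: cl_add)
    qed
  qed
  ultimately show ?thesis unfolding orbit_ideal_def M_alg by blast
qed

lemma orbit_preserved:
  assumes "A \<in> Q_alg q m R" "Y \<in> orbit_ideal q m R c"
  shows "Q_act q m R \<xi> A Y \<in> orbit_ideal q m R c"
proof -
  obtain a x where a: "A = cl a" "a \<in> Qs" and x: "Y = cl x" "x \<in> orb c"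
    using assms unfolding Q_alg orbit_ideal_eq by blast
  obtain y where "y \<in> orb c" "\<rho> (\<Lambda> (a * x)) = \<rho> y"
    using Lambda_orb[OF orb_invariant[OF x(2) a(2)]] by blast
  then show ?thesis
    unfolding orbit_ideal_eq a x Q_act_cl[OF a(2) orb_Ms[OF x(2)]] by (auto simp: cl_eq[symmetric])
qed

end

theorem mainTheorem5:
  fixes R :: "('k::real_normed_field, 'n::finite) mat2" and q \<eta> :: 'k and m :: nat
  assumes "GL_type q m R"
    and "flip_deformation q m R"
    and "\<eta> \<noteq> 0"
  shows "(\<forall>k::nat. k \<ge> 1 \<longrightarrow>
            central_in (ad_alg q m R)
              (R_trace q m R (ad_M q m R [^]\<^bsub>mat_monoid (ad_alg q m R)\<^esub> k)) \<and>
            central_in (ad_alg q m R)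
              (R_trace q m R (ad_N q m R [^]\<^bsub>mat_monoid (ad_alg q m R)\<^esub> k))) \<and>
         (\<forall>c. \<forall>a\<in>Q_alg q m R. \<forall>b\<in>orbit_ideal q m R c.
            Q_act q m R (inverse \<eta> * q ^ (2 * m)) a b \<in> orbit_ideal q m R c)"
proof -
  interpret bda R q "inverse \<eta> * q ^ (2 * m)" m
    by unfold_locales (rule assms(1))
  show ?thesis
    using traces_central orbit_preserved by blast
qed

end
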